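(* Let $f\in L^2(\mathbb{P}_\eta)$. Then $T_nf\in L^2(\lambda^n)$ for $n\in\mathbb{N}$, and $$f(\eta)=\sum_{n=0}^\infty\frac{1}{n!}I_n(T_nf),$$ where the series converges in $L^2(\mathbb{P})$. Moreover, if $g_n\in\mathbf{H}_n$, $n\in\mathbb{N}_0$, satisfy $f(\eta)=\sum_{n=0}^\infty\frac{1}{n!}I_n(g_n)$ with convergence in $L^2(\mathbb{P})$, then $g_0=\mathbb{E}f(\eta)$ and $g_n=T_nf$ $\lambda^n$-almost everywhere on $\mathbb{Y}^n$, for all $n\in\mathbb{N}$.
   Context: Let $(\mathbb{Y},\mathcal{Y})$ be an arbitrary measurable space and $\lambda$ an arbitrary $\sigma$-finite measure on it. Let $\mathbf{N}$ be the space of all $\sigma$-finite measures $\mu$ on $\mathbb{Y}$ with values in $\{0,1,2,\ldots\}\cup\{\infty\}$, equipped with the smallest $\sigma$-field making $\mu\mapsto\mu(B)$ measurable for every $B\in\mathcal{Y}$. On a probability space $(\Omega,\mathcal{F},\mathbb{P})$, $\eta$ is a Poisson process on $\mathbb{Y}$ with intensity measure $\lambda$: a random element of $\mathbf{N}$ such that $\eta(B)$ is Poisson distributed with parameter $\lambda(B)$ for each $B\in\mathcal{Y}$, and $\eta(B_1),\ldots,\eta(B_k)$ are independent for pairwise disjoint $B_1,\ldots,B_k\in\mathcal{Y}$. $\eta$ is taken in a version of the form $\eta=\sum_{i=1}^{\eta(\mathbb{Y})}\delta_{X_i}$ with random elements $X_i$ of $\mathbb{Y}$ (such a version always exists). $\mathbb{P}_\eta$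 is the distribution of $\eta$, and $L^2(\mathbb{P}_\eta)$ is the space of measurable $f:\mathbf{N}\to\mathbb{R}$ with $\mathbb{E}f(\eta)^2<\infty$. Difference operators: for measurable $f:\mathbf{N}\to\mathbb{R}$ and $y\in\mathbb{Y}$, $D_yf(\mu):=f(\mu+\delta_y)-f(\mu)$; $D^1:=D$, $D^0f:=f$, and $D^n_{y_1,\ldots,y_n}f:=D^1_{y_1}D^{n-1}_{y_2,\ldots,y_n}f$ for $n\ge2$. For $n\ge1$, $T_nf(y_1,\ldots,y_n):=\mathbb{E}D^n_{y_1,\ldots,y_n}f(\eta)$ and $T_0f:=\mathbb{E}f(\eta)$, whenever defined (for $f\in L^2(\mathbb{P}_\eta)$ this is the case $\lambda^n$-a.e.). For $n\ge1$, $\mathbf{H}_n$ is the space of symmetric functions in $L^2(\lambda^n)$ ($\lambda^n$ the $n$-fold product measure), with scalar product $\langle\cdot,\cdot\rangle_n$; $\mathbf{H}_0:=\mathbb{R}$. Multiple Wiener-Itô integral $I_n$: $I_0(c):=c$ for $c\in\mathbb{R}$. For $\mu=\sum_i\delta_{x_i}$ and $m\ge1$, $\mu^{(m)}$ is the measure on $\mathbb{Y}^m$ such that $\mu^{(m)}(B)$ is the number of $m$-tuples of pairwise distinct indices $(i_1,\ldots,i_m)$ with $(x_{i_1},\ldots,x_{i_m})\in B$; $\mu^{(m)}(h)$ denotes the integral of $h$ with respect to it. Let $\mathcal{Y}_0:=\{B\in\mathcal{Y}:\lambda(B)<\infty\}$. For $n\geq 1$, a function $g:\mathbb{Y}^n\to\mathbb{R}$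 is of product form if $g(y_1,\ldots,y_n)=\prod_{i=1}^ng_i(y_i)$ (written $g=\otimes_{i=1}^ng_i$) with each $g_i$ bounded, measurable and vanishing outside some $B\in\mathcal{Y}_0$; then $$I_n(g):=\sum_{J\subset\{1,\ldots,n\}}(-1)^{n-|J|}\,\eta^{(|J|)}(\otimes_{j\in J}g_j)\,\lambda^{n-|J|}(\otimes_{j'\in\{1,\ldots,n\}\setminus J}\,g_{j'}),$$ where the factors corresponding to an empty index set are $1$. $I_n$ is extended by linearity to finite sums of functions of product form (functions of sum-product form), and then, using the isometry $\mathbb{E}I_m(g)I_n(h)=\mathbf{1}\{m=n\}\,m!\,\langle\tilde g,\tilde h\rangle_n$ (where $\tilde g(y_1,\ldots,y_n)=\frac1{n!}\sum_\pi g(y_{\pi(1)},\ldots,y_{\pi(n)})$ is the symmetrization, the sum over all permutations of $\{1,\ldots,n\}$) and the density of functions of sum-product form, by continuity to a linear map $I_n:L^2(\lambda^n)\to L^2(\mathbb{P})$. *)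

theory Defs
  imports "HOL-Probability.Probability" "HOL-Combinatorics.Permutations"
begin

section \<open>Point measures and Poisson processes\<close>

text \<open>
  Throughout, \<open>L\<close> is the intensity measure; its carrier \<open>space L\<close> and \<open>\<sigma>\<close>-algebra \<open>sets L\<close> are the
  underlying measurable space.  \<open>M\<close> is the probability space.
\<close>

definition point_measures :: "'a measure \<Rightarrow> 'a measure set" where
  "point_measures L = {\<mu>. space \<mu> = space L \<and> sets \<mu> = sets L \<and> sigma_finite_measure \<mu> \<and>
     (\<forall>B\<in>sets L. emeasure \<mu> B \<in> range ennreal_of_enat)}"

text \<open>The smallest \<open>\<sigma>\<close>-algebra making all evaluations measurable, built as in \<open>subprob_algebra\<close>.\<close>

definition point_algebra :: "'a measure \<Rightarrow> 'a measure measure" where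
  "point_algebra L = (SUP B\<in>sets L. vimage_algebra (point_measures L) (\<lambda>\<mu>. emeasure \<mu> B) borel)"

text \<open>A Poisson variable with infinite parameter is almost surely infinite.  The constant
  \<open>poisson_pmf\<close> does not cover the parameters \<open>0\<close> and \<open>\<infinity>\<close>; note \<open>0 ^ 0 = 1\<close> below.\<close>

definition poisson_distributed :: "'w measure \<Rightarrow> ('w \<Rightarrow> ennreal) \<Rightarrow> ennreal \<Rightarrow> bool" where
  "poisson_distributed M Z c \<longleftrightarrow> Z \<in> borel_measurable M \<and>
     (if c = \<infinity> then AE \<omega> in M. Z \<omega> = \<infinity>
      else \<forall>k::nat. measure M {\<omega> \<in> space M. Z \<omega> = of_nat k}
             = exp (- enn2real c) * enn2real c ^ k / fact k)"

definition poisson_process :: "'w measure \<Rightarrow> 'a measure \<Rightarrow> ('w \<Rightarrow> 'a measure) \<Rightarrow> bool" where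
  "poisson_process M L \<eta> \<longleftrightarrow>
     \<eta> \<in> M \<rightarrow>\<^sub>M point_algebra L \<and>
     (\<forall>B\<in>sets L. poisson_distributed M (\<lambda>\<omega>. emeasure (\<eta> \<omega>) B) (emeasure L B)) \<and>
     (\<forall>(k::nat) B. (\<forall>i<k. B i \<in> sets L) \<and> disjoint_family_on B {..<k} \<longrightarrow>
        prob_space.indep_vars M (\<lambda>_. borel) (\<lambda>i \<omega>. emeasure (\<eta> \<omega>) (B i)) {..<k})"

text \<open>The measure \<open>\<Sum>i<\<kappa>. \<delta>(x i)\<close>, with \<open>\<kappa>\<close> a natural number or \<open>\<infinity>\<close>.\<close>

definition point_sum :: "'a measure \<Rightarrow> ennreal \<Rightarrow> (nat \<Rightarrow> 'a) \<Rightarrow> 'a measure" where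
  "point_sum L \<kappa> x = distr (count_space {i. of_nat i < \<kappa>}) L x"

section \<open>Square integrable functions\<close>

definition square_integrable :: "'b measure \<Rightarrow> ('b \<Rightarrow> real) \<Rightarrow> bool" where
  "square_integrable M u \<longleftrightarrow> u \<in> borel_measurable M \<and> integrable M (\<lambda>x. (u x)\<^sup>2)"

definition L2_tendsto :: "'b measure \<Rightarrow> (nat \<Rightarrow> 'b \<Rightarrow> real) \<Rightarrow> ('b \<Rightarrow> real) \<Rightarrow> bool" where
  "L2_tendsto M u v \<longleftrightarrow> (\<forall>k. square_integrable M (u k)) \<and> square_integrable M v \<and>
     (\<lambda>k. \<integral>x. (u k x - v x)\<^sup>2 \<partial>M) \<longlonglongrightarrow> 0"

text \<open>The \<open>n\<close>-fold product.  Coordinates are numbered from \<open>0\<close>.  For \<open>n = 0\<close> this is the unit mass on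
  the single point \<open>\<lambda>_. undefined\<close>, so that functions on it are real constants.\<close>

abbreviation power_measure :: "'a measure \<Rightarrow> nat \<Rightarrow> (nat \<Rightarrow> 'a) measure" where
  "power_measure L n \<equiv> Pi\<^sub>M {..<n} (\<lambda>_. L)"

text \<open>Elements of \<open>L\<^sup>2\<close> being identified up to null sets, symmetry is required almost everywhere.
  For \<open>n = 0\<close> every function qualifies, and the space is a copy of the real numbers.\<close>

definition sym_L2 :: "'a measure \<Rightarrow> nat \<Rightarrow> ((nat \<Rightarrow> 'a) \<Rightarrow> real) set" where
  "sym_L2 L n = {g. square_integrable (power_measure L n) g \<and>
     (\<forall>\<pi>. \<pi> permutes {..<n} \<longrightarrow> (AE y in power_measure L n. g (y \<circ> \<pi>) = g y))}"

section \<open>Difference operators\<close>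

definition add_point :: "'a measure \<Rightarrow> 'a \<Rightarrow> 'a measure" where
  "add_point \<mu> y = measure_of (space \<mu>) (sets \<mu>) (\<lambda>B. emeasure \<mu> B + indicator B y)"

definition diff_op :: "'a \<Rightarrow> ('a measure \<Rightarrow> real) \<Rightarrow> 'a measure \<Rightarrow> real" where
  "diff_op y f = (\<lambda>\<mu>. f (add_point \<mu> y) - f \<mu>)"

primrec diff_ops :: "'a list \<Rightarrow> ('a measure \<Rightarrow> real) \<Rightarrow> 'a measure \<Rightarrow> real" where
  "diff_ops [] f = f"
| "diff_ops (y # ys) f = diff_op y (diff_ops ys f)"

definition iter_diff :: "nat \<Rightarrow> ('a measure \<Rightarrow> real) \<Rightarrow> (nat \<Rightarrow> 'a) \<Rightarrow> 'a measure \<Rightarrow> real" where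
  "iter_diff n f y = diff_ops (map y [0..<n]) f"

text \<open>The operator \<open>T\<^sub>n\<close>.  Where the expectation is undefined the value is \<open>0\<close> by the convention for
  the Bochner integral; claims about \<open>T\<^sub>n\<close> have to state definedness separately.\<close>

definition mean_diff ::
  "'w measure \<Rightarrow> ('w \<Rightarrow> 'a measure) \<Rightarrow> nat \<Rightarrow> ('a measure \<Rightarrow> real) \<Rightarrow> (nat \<Rightarrow> 'a) \<Rightarrow> real" where
  "mean_diff M \<eta> n f y = (\<integral>\<omega>. iter_diff n f y (\<eta> \<omega>) \<partial>M)"

section \<open>Multiple Wiener-Ito integrals\<close>

text \<open>The factorial measure of \<open>point_sum L \<kappa> x\<close>: counting measure on the tuples of pairwise distinct
  indices, pushed forward.  Its coordinates are labelled by a finite set \<open>J\<close> instead of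
  \<open>1, \<dots>, card J\<close>, which avoids renumbering the factors of a tensor product over \<open>J\<close>.
  For \<open>J = {}\<close> it is the unit mass on the empty tuple.\<close>

definition factorial_measure ::
  "'a measure \<Rightarrow> ennreal \<Rightarrow> (nat \<Rightarrow> 'a) \<Rightarrow> nat set \<Rightarrow> (nat \<Rightarrow> 'a) measure" where
  "factorial_measure L \<kappa> x J =
     distr (count_space {i \<in> J \<rightarrow>\<^sub>E {k. of_nat k < \<kappa>}. inj_on i J})
       (Pi\<^sub>M J (\<lambda>_. L)) (\<lambda>i. \<lambda>j\<in>J. x (i j))"

definition tensor :: "nat set \<Rightarrow> (nat \<Rightarrow> 'a \<Rightarrow> real) \<Rightarrow> (nat \<Rightarrow> 'a) \<Rightarrow> real" where
  "tensor J g y = (\<Prod>j\<in>J. g j (y j))"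

definition admissible_factor :: "'a measure \<Rightarrow> ('a \<Rightarrow> real) \<Rightarrow> bool" where
  "admissible_factor L u \<longleftrightarrow> u \<in> borel_measurable L \<and> (\<exists>C. \<forall>y\<in>space L. \<bar>u y\<bar> \<le> C) \<and>
     (\<exists>B\<in>sets L. emeasure L B < \<infinity> \<and> (\<forall>y\<in>space L - B. u y = 0))"

definition product_integral ::
  "'a measure \<Rightarrow> ennreal \<Rightarrow> (nat \<Rightarrow> 'a) \<Rightarrow> nat \<Rightarrow> (nat \<Rightarrow> 'a \<Rightarrow> real) \<Rightarrow> real" where
  "product_integral L \<kappa> x n g =
     (\<Sum>J\<in>Pow {..<n}. (- 1) ^ (n - card J)
        * (\<integral>y. tensor J g y \<partial>factorial_measure L \<kappa> x J)
        * (\<integral>y. tensor ({..<n} - J) g y \<partial>Pi\<^sub>M ({..<n} - J) (\<lambda>_. L)))"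

text \<open>A function of sum-product form is represented by the list of its summands, each given by its
  family of factors.\<close>

definition sum_product_form :: "'a measure \<Rightarrow> nat \<Rightarrow> (nat \<Rightarrow> 'a \<Rightarrow> real) list \<Rightarrow> bool" where
  "sum_product_form L n gs \<longleftrightarrow> (\<forall>g\<in>set gs. \<forall>i<n. admissible_factor L (g i))"

definition sum_product :: "nat \<Rightarrow> (nat \<Rightarrow> 'a \<Rightarrow> real) list \<Rightarrow> (nat \<Rightarrow> 'a) \<Rightarrow> real" where
  "sum_product n gs y = (\<Sum>g\<leftarrow>gs. tensor {..<n} g y)"

definition sum_product_integral ::
  "'a measure \<Rightarrow> ('w \<Rightarrow> 'a measure) \<Rightarrow> (nat \<Rightarrow> 'w \<Rightarrow> 'a) \<Rightarrow> nat \<Rightarrow> (nat \<Rightarrow> 'a \<Rightarrow> real) list \<Rightarrow> 'w \<Rightarrow> real"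
  where
  "sum_product_integral L \<eta> X n gs \<omega> =
     (\<Sum>g\<leftarrow>gs. product_integral L (emeasure (\<eta> \<omega>) (space L)) (\<lambda>i. X i \<omega>) n g)"

text \<open>Extension by continuity: \<open>Z\<close> is a version of the integral of \<open>g\<close> if it is the \<open>L\<^sup>2\<close>-limit of the
  integrals of functions of sum-product form converging to \<open>g\<close> in \<open>L\<^sup>2\<close>.\<close>

definition wiener_ito_version ::
  "'w measure \<Rightarrow> 'a measure \<Rightarrow> ('w \<Rightarrow> 'a measure) \<Rightarrow> (nat \<Rightarrow> 'w \<Rightarrow> 'a) \<Rightarrow> nat \<Rightarrow>
     ((nat \<Rightarrow> 'a) \<Rightarrow> real) \<Rightarrow> ('w \<Rightarrow> real) \<Rightarrow> bool" where
  "wiener_ito_version M L \<eta> X n g Z \<longleftrightarrow>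
     (\<exists>h. (\<forall>k. sum_product_form L n (h k)) \<and>
          L2_tendsto (power_measure L n) (\<lambda>k. sum_product n (h k)) g \<and>
          L2_tendsto M (\<lambda>k. sum_product_integral L \<eta> X n (h k)) Z)"

text \<open>The integral \<open>I\<^sub>n\<close> takes values in \<open>L\<^sup>2\<close>, so a version is chosen; by the isometry property it is
  unique up to null sets.  For \<open>n = 0\<close> the constant represented by \<open>g\<close> is returned.\<close>

definition wiener_ito ::
  "'w measure \<Rightarrow> 'a measure \<Rightarrow> ('w \<Rightarrow> 'a measure) \<Rightarrow> (nat \<Rightarrow> 'w \<Rightarrow> 'a) \<Rightarrow> nat \<Rightarrow>
     ((nat \<Rightarrow> 'a) \<Rightarrow> real) \<Rightarrow> 'w \<Rightarrow> real" where
  "wiener_ito M L \<eta> X n g =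
     (if n = 0 then (\<lambda>_. g (\<lambda>_. undefined)) else (SOME Z. wiener_ito_version M L \<eta> X n g Z))"

text \<open>\<open>f(\<eta>) = \<Sum>n. I\<^sub>n(g\<^sub>n) / n!\<close> with convergence in \<open>L\<^sup>2\<close>.\<close>

definition has_chaos_expansion ::
  "'w measure \<Rightarrow> 'a measure \<Rightarrow> ('w \<Rightarrow> 'a measure) \<Rightarrow> (nat \<Rightarrow> 'w \<Rightarrow> 'a) \<Rightarrow>
     ('a measure \<Rightarrow> real) \<Rightarrow> (nat \<Rightarrow> (nat \<Rightarrow> 'a) \<Rightarrow> real) \<Rightarrow> bool" where
  "has_chaos_expansion M L \<eta> X f g \<longleftrightarrow>
     L2_tendsto M (\<lambda>N \<omega>. \<Sum>n<N. 1 / fact n * wiener_ito M L \<eta> X n (g n) \<omega>) (\<lambda>\<omega>. f (\<eta> \<omega>))"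

end

theory Submission
  imports Defs
begin

text \<open>
  By the Mecke equation, \<open>I\<^sub>n\<close> is adjoint to the iterated difference operator:
  \<open>E f(\<eta>) I\<^sub>n(g) = \<langle>T\<^sub>n f, g\<rangle>\<close> for \<open>f(\<eta>)\<close> with enough moments and \<open>g\<close> of
  product form. Taking \<open>f(\<eta>) = I\<^sub>m(h)\<close> gives the isometry, and
  truncation together with duality then gives \<open>T\<^sub>n f \<in> L\<^sup>2(\<lambda>\<^sup>n)\<close> for square
  integrable \<open>f\<close>. Hence the partial sum of the expansion below order \<open>N\<close> is the orthogonal projection
  of \<open>f(\<eta>)\<close> onto the integrals of order less than \<open>N\<close>. These are total, because the indicator of
  \<open>{\<eta>(B) = k}\<close> is the \<open>L\<^sup>2\<close>-limit of the polynomials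
  \<open>\<Sum>m\<in>{k..n}. (- 1)^(m - k) (m choose k) (\<eta>(B) choose m)\<close>, which are dominated by \<open>3\<close> to the power
  \<open>\<eta>(B)\<close>. Uniqueness follows by testing an expansion against integrals of functions of product form.
\<close>

section \<open>Square integrable functions\<close>

text \<open>Three obstacles shape the argument. \<open>D_y\<close> evaluates \<open>f\<close> at
  \<open>\<eta> + \<delta>_y\<close>, so an almost sure statement about \<open>f(\<eta>)\<close>
  reaches \<open>D_y f\<close> only through the Mecke equation, which converts an added point of
  \<open>B\<close> into a factor \<open>\<eta>(B)\<close>. Square integrability is therefore not
  inherited by differences, while finiteness of all moments weighted by powers of
  \<open>1 + \<eta>(B)\<close> is, for almost every added point of \<open>B\<close>. Next, the
  integrals are defined by sums over the labels \<open>X i\<close>, whereas the Mecke equation and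
  the difference operators speak of functions of a measure; a recursion expresses factorial
  integrals as polynomials in ordinary integrals, and both agree where \<open>\<eta>(B)\<close> is
  finite. Finally, testing \<open>T_n f\<close> against itself presupposes that it is square
  integrable. On a cube of finite measure this is clear for bounded \<open>f\<close>, and the
  resulting bound \<open>n! E f(\<eta>)^2\<close> depends neither on the bound of \<open>f\<close>
  nor on the cube, so it survives the removal of both restrictions. The majorant 3 to the power
  \<open>\<eta>(B)\<close> is admissible because a Poisson variable has all exponential
  moments.\<close>

lemma square_integrable_measurable [measurable_dest]:
  "square_integrable M u \<Longrightarrow> u \<in> borel_measurable M"
  by (simp add: square_integrable_def)

lemma square_integrable_integrable: "square_integrable M u \<Longrightarrow> integrable M (\<lambda>x. (u x)\<^sup>2)"
  by (simp add: square_integrable_def)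

lemma square_integrable_bound:
  assumes "square_integrable M w" "u \<in> borel_measurable M" "AE x in M. \<bar>u x\<bar> \<le> \<bar>w x\<bar>"
  shows "square_integrable M u"
proof -
  have "integrable M (\<lambda>x. (u x)\<^sup>2)"
  proof (rule Bochner_Integration.integrable_bound[of M "\<lambda>x. (w x)\<^sup>2"])
    show "integrable M (\<lambda>x. (w x)\<^sup>2)" using assms(1) by (simp add: square_integrable_def)
    show "(\<lambda>x. (u x)\<^sup>2) \<in> borel_measurable M" using assms(2) by simp
    show "AE x in M. norm ((u x)\<^sup>2) \<le> norm ((w x)\<^sup>2)"
      using assms(3) by eventually_elim (simp add: abs_le_square_iff)
  qed
  then show ?thesis using assms(2) by (simp add: square_integrable_def)
qed

lemma square_integrable_cong_AE:
  assumes "square_integrable M w" "u \<in> borel_measurable M" "AE x in M. u x = w x"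
  shows "square_integrable M u"
  using assms(3) by (intro square_integrable_bound[OF assms(1,2)]) auto

lemma integrable_mult_square:
  assumes "square_integrable M u" "square_integrable M v"
  shows "integrable M (\<lambda>x. u x * v x)"
proof (rule Bochner_Integration.integrable_bound[of M "\<lambda>x. (u x)\<^sup>2 + (v x)\<^sup>2"])
  show "integrable M (\<lambda>x. (u x)\<^sup>2 + (v x)\<^sup>2)"
    using assms by (simp add: square_integrable_def)
  show "(\<lambda>x. u x * v x) \<in> borel_measurable M"
    using assms by (auto simp: square_integrable_def)
  have "\<bar>a * b\<bar> \<le> a\<^sup>2 + b\<^sup>2" for a b :: real
  proof -
    have "0 \<le> (\<bar>a\<bar> - \<bar>b\<bar>)\<^sup>2" by simp
    then have "2 * (\<bar>a\<bar> * \<bar>b\<bar>) \<le> a\<^sup>2 + b\<^sup>2" by (simp add: power2_diff)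
    moreover have "0 \<le> \<bar>a\<bar> * \<bar>b\<bar>" by simp
    ultimately show ?thesis unfolding abs_mult by linarith
  qed
  then show "AE x in M. norm (u x * v x) \<le> norm ((u x)\<^sup>2 + (v x)\<^sup>2)"
    by (simp add: abs_mult)
qed

lemma square_integrable_scale [intro]:
  "square_integrable M u \<Longrightarrow> square_integrable M (\<lambda>x. c * u x)"
  by (auto simp: square_integrable_def power_mult_distrib)

lemma square_integrable_add [intro]:
  assumes "square_integrable M u" "square_integrable M v"
  shows "square_integrable M (\<lambda>x. u x + v x)"
proof -
  have "(\<lambda>x. (u x + v x)\<^sup>2) = (\<lambda>x. (u x)\<^sup>2 + (v x)\<^sup>2 + 2 * (u x * v x))"
    by (auto simp: power2_sum)
  then show ?thesis
    using assms integrable_mult_square[OF assms] by (auto simp: square_integrable_def)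
qed

lemma square_integrable_diff [intro]:
  assumes "square_integrable M u" "square_integrable M v"
  shows "square_integrable M (\<lambda>x. u x - v x)"
  using square_integrable_add[OF assms(1) square_integrable_scale[OF assms(2), of "-1"]] by simp

lemma square_integrable_zero [simp]: "square_integrable M (\<lambda>x. 0)"
  by (simp add: square_integrable_def)

lemma square_integrable_sum [intro]:
  "(\<And>i. i \<in> I \<Longrightarrow> square_integrable M (u i)) \<Longrightarrow> square_integrable M (\<lambda>x. \<Sum>i\<in>I. u i x)"
  by (induction I rule: infinite_finite_induct) auto

lemma (in finite_measure) square_integrable_const [simp]: "square_integrable M (\<lambda>x. c)"
  by (simp add: square_integrable_def)

lemma (in finite_measure) square_integrable_bounded:
  assumes "u \<in> borel_measurable M" "\<And>x. x \<in> space M \<Longrightarrow> \<bar>u x\<bar> \<le> c"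
  shows "square_integrable M u"
proof (rule square_integrable_bound[of M "\<lambda>_. c"])
  show "AE x in M. \<bar>u x\<bar> \<le> \<bar>c\<bar>" using assms(2) by fastforce
qed (use assms(1) in auto)

lemma square_integrable_distr:
  assumes "T \<in> M \<rightarrow>\<^sub>M N"
  shows "square_integrable (distr M N T) u \<longleftrightarrow> u \<in> borel_measurable N \<and> square_integrable M (\<lambda>x. u (T x))"
  using assms by (auto simp: square_integrable_def integrable_distr_eq)

section \<open>The \<open>L^2\<close> seminorm and convergence in it\<close>

definition L2_norm :: "'b measure \<Rightarrow> ('b \<Rightarrow> real) \<Rightarrow> real" where
  "L2_norm M u = sqrt (\<integral>x. (u x)\<^sup>2 \<partial>M)"

lemma L2_norm_nonneg [simp]: "0 \<le> L2_norm M u"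
  by (simp add: L2_norm_def)

lemma L2_norm_square: "(L2_norm M u)\<^sup>2 = (\<integral>x. (u x)\<^sup>2 \<partial>M)"
  by (simp add: L2_norm_def)

text \<open>The quadratic polynomial in \<open>t\<close> given by the integral of
  \<open>(t u + v)^2\<close> is nonnegative, so its discriminant is not positive. This avoids
  normalising \<open>u\<close>, whose norm may vanish.\<close>

lemma L2_Cauchy_Schwarz:
  assumes "square_integrable M u" "square_integrable M v"
  shows "\<bar>\<integral>x. u x * v x \<partial>M\<bar> \<le> L2_norm M u * L2_norm M v"
proof -
  let ?a = "\<integral>x. (u x)\<^sup>2 \<partial>M" and ?b = "\<integral>x. u x * v x \<partial>M" and ?c = "\<integral>x. (v x)\<^sup>2 \<partial>M"
  have q: "0 \<le> t\<^sup>2 * ?a + 2 * t * ?b + ?c" for t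
  proof -
    have "(\<integral>x. (t * u x + v x)\<^sup>2 \<partial>M) = (\<integral>x. t\<^sup>2 * (u x)\<^sup>2 + 2 * t * (u x * v x) + (v x)\<^sup>2 \<partial>M)"
      by (intro Bochner_Integration.integral_cong) (auto simp: power2_sum power_mult_distrib)
    also have "\<dots> = t\<^sup>2 * ?a + 2 * t * ?b + ?c"
      using assms integrable_mult_square[OF assms] by (simp add: square_integrable_def)
    finally show ?thesis using Bochner_Integration.integral_nonneg[of M "\<lambda>x. (t * u x + v x)\<^sup>2"] by simp
  qed
  have "?b\<^sup>2 \<le> ?a * ?c"
  proof (cases "?a = 0")
    case True
    \<comment> \<open>With leading coefficient 0 the polynomial is affine in \<open>t\<close>; if
      its slope were nonzero, the argument chosen below would give it the value -1.\<close>
    have "?b = 0"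
    proof (rule ccontr)
      assume "?b \<noteq> 0"
      then have "2 * (- (?c + 1) / (2 * ?b)) * ?b = - (?c + 1)" by simp
      with q[of "- (?c + 1) / (2 * ?b)"] True show False by simp
    qed
    with True show ?thesis by simp
  next
    case False
    then have a: "?a > 0" using Bochner_Integration.integral_nonneg[of M "\<lambda>x. (u x)\<^sup>2"] by (simp add: less_le)
    \<comment> \<open>\<open>- ?b / ?a\<close> is the minimiser of the polynomial.\<close>
    from q[of "- ?b / ?a"] have "0 \<le> ?b\<^sup>2 / ?a - 2 * ?b\<^sup>2 / ?a + ?c"
      using a by (simp add: power2_eq_square field_simps)
    then have "?b\<^sup>2 / ?a \<le> ?c" by simp
    with a show ?thesis by (simp add: field_simps)
  qed
  then have "sqrt (?b\<^sup>2) \<le> sqrt (?a * ?c)" by (rule real_sqrt_le_mono)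
  then show ?thesis by (simp add: L2_norm_def real_sqrt_mult)
qed

lemma L2_norm_triangle:
  assumes "square_integrable M u" "square_integrable M v"
  shows "L2_norm M (\<lambda>x. u x + v x) \<le> L2_norm M u + L2_norm M v"
proof (rule power2_le_imp_le)
  have "(L2_norm M (\<lambda>x. u x + v x))\<^sup>2 = (\<integral>x. (u x)\<^sup>2 + (v x)\<^sup>2 + 2 * (u x * v x) \<partial>M)"
    unfolding L2_norm_square by (intro Bochner_Integration.integral_cong) (auto simp: power2_sum)
  also have "\<dots> = (L2_norm M u)\<^sup>2 + (L2_norm M v)\<^sup>2 + 2 * (\<integral>x. u x * v x \<partial>M)"
    using assms integrable_mult_square[OF assms] by (simp add: square_integrable_def L2_norm_square)
  also have "\<dots> \<le> (L2_norm M u + L2_norm M v)\<^sup>2"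
    using L2_Cauchy_Schwarz[OF assms] by (simp add: power2_sum)
  finally show "(L2_norm M (\<lambda>x. u x + v x))\<^sup>2 \<le> (L2_norm M u + L2_norm M v)\<^sup>2" .
qed simp

lemma L2_norm_scale: "L2_norm M (\<lambda>x. c * u x) = \<bar>c\<bar> * L2_norm M u"
  by (simp add: L2_norm_def power_mult_distrib real_sqrt_mult)

lemma L2_norm_minus_commute: "L2_norm M (\<lambda>x. u x - v x) = L2_norm M (\<lambda>x. v x - u x)"
proof -
  have "(\<lambda>x. (u x - v x)\<^sup>2) = (\<lambda>x. (v x - u x)\<^sup>2)"
    by (rule ext) (rule power2_commute)
  then show ?thesis by (simp only: L2_norm_def)
qed

lemma L2_norm_triangle_diff:
  assumes "square_integrable M u" "square_integrable M v" "square_integrable M w"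
  shows "L2_norm M (\<lambda>x. u x - w x) \<le> L2_norm M (\<lambda>x. u x - v x) + L2_norm M (\<lambda>x. v x - w x)"
  using L2_norm_triangle[of M "\<lambda>x. u x - v x" "\<lambda>x. v x - w x"] assms by (simp add: square_integrable_diff)

lemma L2_norm_cong_AE:
  assumes "AE x in M. u x = v x" "u \<in> borel_measurable M" "v \<in> borel_measurable M"
  shows "L2_norm M u = L2_norm M v"
  unfolding L2_norm_def using assms by (intro arg_cong[where f=sqrt] integral_cong_AE) auto

lemma L2_norm_eq_0_AE:
  assumes "square_integrable M u" "L2_norm M u = 0"
  shows "AE x in M. u x = 0"
proof -
  have "(\<integral>x. (u x)\<^sup>2 \<partial>M) = 0" using assms(2) by (simp add: L2_norm_def)
  then have "AE x in M. (u x)\<^sup>2 = 0"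
    using integral_nonneg_eq_0_iff_AE[of M "\<lambda>x. (u x)\<^sup>2"] assms(1) by (simp add: square_integrable_def)
  then show ?thesis by simp
qed

lemma L2_tendsto_iff:
  "L2_tendsto M u v \<longleftrightarrow> (\<forall>k. square_integrable M (u k)) \<and> square_integrable M v \<and>
     (\<lambda>k. L2_norm M (\<lambda>x. u k x - v x)) \<longlonglongrightarrow> 0"
proof -
  have "(\<lambda>k. \<integral>x. (u k x - v x)\<^sup>2 \<partial>M) \<longlonglongrightarrow> 0 \<longleftrightarrow> (\<lambda>k. L2_norm M (\<lambda>x. u k x - v x)) \<longlonglongrightarrow> 0" (is "?A \<longleftrightarrow> ?B")
  proof
    assume ?A
    then have "(\<lambda>k. sqrt (\<integral>x. (u k x - v x)\<^sup>2 \<partial>M)) \<longlonglongrightarrow> sqrt 0" by (intro tendsto_intros)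
    then show ?B by (simp add: L2_norm_def)
  next
    assume ?B
    then have "(\<lambda>k. (L2_norm M (\<lambda>x. u k x - v x))\<^sup>2) \<longlonglongrightarrow> 0\<^sup>2" by (intro tendsto_intros)
    then show ?A by (simp add: L2_norm_square)
  qed
  then show ?thesis by (auto simp: L2_tendsto_def)
qed

lemma L2_tendsto_cong_AE:
  assumes "L2_tendsto M u v" "\<And>k. AE x in M. u' k x = u k x" "AE x in M. v' x = v x"
    "\<And>k. u' k \<in> borel_measurable M" "v' \<in> borel_measurable M"
  shows "L2_tendsto M u' v'"
proof -
  have si: "square_integrable M (u k)" "square_integrable M v" for k
    using assms(1) by (auto simp: L2_tendsto_def)
  have "(\<integral>x. (u' k x - v' x)\<^sup>2 \<partial>M) = (\<integral>x. (u k x - v x)\<^sup>2 \<partial>M)" for k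
  proof (rule integral_cong_AE)
    show "AE x in M. (u' k x - v' x)\<^sup>2 = (u k x - v x)\<^sup>2"
      using assms(2)[of k] assms(3) by eventually_elim simp
  qed (use assms si[THEN square_integrable_measurable] in auto)
  then show ?thesis
    using assms(1) square_integrable_cong_AE[OF si(1) assms(4,2)] square_integrable_cong_AE[OF si(2) assms(5,3)]
    by (simp add: L2_tendsto_def)
qed

lemma L2_tendsto_const: "square_integrable M u \<Longrightarrow> L2_tendsto M (\<lambda>k. u) u"
  by (simp add: L2_tendsto_def)

lemma L2_tendsto_inner:
  assumes "L2_tendsto M u v" "square_integrable M w"
  shows "(\<lambda>k. \<integral>x. u k x * w x \<partial>M) \<longlonglongrightarrow> (\<integral>x. v x * w x \<partial>M)"
proof -
  have si: "square_integrable M (u k)" "square_integrable M v" for k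
    using assms(1) by (auto simp: L2_tendsto_def)
  have "norm ((\<integral>x. u k x * w x \<partial>M) - (\<integral>x. v x * w x \<partial>M)) \<le> L2_norm M (\<lambda>x. u k x - v x) * L2_norm M w" for k
  proof -
    have "(\<integral>x. u k x * w x \<partial>M) - (\<integral>x. v x * w x \<partial>M) = (\<integral>x. (u k x - v x) * w x \<partial>M)"
      using integrable_mult_square[OF si(1)[of k] assms(2)] integrable_mult_square[OF si(2) assms(2)]
      by (simp add: left_diff_distrib)
    then show ?thesis
      using L2_Cauchy_Schwarz[OF square_integrable_diff[OF si(1)[of k] si(2)] assms(2)] by simp
  qed
  moreover have "(\<lambda>k. L2_norm M (\<lambda>x. u k x - v x) * L2_norm M w) \<longlonglongrightarrow> 0"
    using assms(1) by (intro tendsto_mult_left_zero) (simp add: L2_tendsto_iff)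
  ultimately have "(\<lambda>k. (\<integral>x. u k x * w x \<partial>M) - (\<integral>x. v x * w x \<partial>M)) \<longlonglongrightarrow> 0"
    by (rule Lim_null_comparison[OF always_eventually[OF allI]])
  then show ?thesis by (simp add: LIM_zero_iff)
qed

lemma L2_tendsto_norm:
  assumes "L2_tendsto M u v"
  shows "(\<lambda>k. L2_norm M (u k)) \<longlonglongrightarrow> L2_norm M v"
proof -
  have si: "square_integrable M (u k)" "square_integrable M v" for k
    using assms(1) by (auto simp: L2_tendsto_def)
  have "norm (L2_norm M (u k) - L2_norm M v) \<le> L2_norm M (\<lambda>x. u k x - v x)" for k
  proof -
    have "L2_norm M (u k) \<le> L2_norm M (\<lambda>x. u k x - v x) + L2_norm M v"
      using L2_norm_triangle[OF square_integrable_diff[OF si(1)[of k] si(2)] si(2)] by simp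
    moreover have "L2_norm M v \<le> L2_norm M (\<lambda>x. u k x - v x) + L2_norm M (u k)"
      using L2_norm_triangle[OF square_integrable_diff[OF si(2) si(1)[of k]] si(1)[of k]]
      unfolding L2_norm_minus_commute[of M v "u k"] by simp
    ultimately show ?thesis by (simp add: abs_le_iff)
  qed
  then have "(\<lambda>k. L2_norm M (u k) - L2_norm M v) \<longlonglongrightarrow> 0"
    by (rule Lim_null_comparison[OF always_eventually[OF allI]]) (use assms in \<open>simp add: L2_tendsto_iff\<close>)
  then show ?thesis by (simp add: LIM_zero_iff)
qed

lemma L2_tendsto_add:
  assumes "L2_tendsto M u v" "L2_tendsto M u' v'"
  shows "L2_tendsto M (\<lambda>k x. u k x + u' k x) (\<lambda>x. v x + v' x)"
proof -
  have si: "square_integrable M (u k)" "square_integrable M v"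
      "square_integrable M (u' k)" "square_integrable M v'" for k
    using assms by (auto simp: L2_tendsto_def)
  have "norm (L2_norm M (\<lambda>x. u k x + u' k x - (v x + v' x))) \<le>
      L2_norm M (\<lambda>x. u k x - v x) + L2_norm M (\<lambda>x. u' k x - v' x)" for k
    using L2_norm_triangle[OF square_integrable_diff[OF si(1)[of k] si(2)] square_integrable_diff[OF si(3)[of k] si(4)]]
    by (simp add: add_diff_add)
  moreover have "(\<lambda>k. L2_norm M (\<lambda>x. u k x - v x) + L2_norm M (\<lambda>x. u' k x - v' x)) \<longlonglongrightarrow> 0"
    using assms by (intro tendsto_add_zero) (simp_all add: L2_tendsto_iff)
  ultimately have "(\<lambda>k. L2_norm M (\<lambda>x. u k x + u' k x - (v x + v' x))) \<longlonglongrightarrow> 0"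
    by (rule Lim_null_comparison[OF always_eventually[OF allI]])
  then show ?thesis using si by (simp add: L2_tendsto_iff square_integrable_add)
qed

lemma L2_tendsto_scale:
  assumes "L2_tendsto M u v"
  shows "L2_tendsto M (\<lambda>k x. c * u k x) (\<lambda>x. c * v x)"
proof -
  have si: "square_integrable M (u k)" "square_integrable M v" for k
    using assms by (auto simp: L2_tendsto_def)
  have "L2_norm M (\<lambda>x. c * u k x - c * v x) = \<bar>c\<bar> * L2_norm M (\<lambda>x. u k x - v x)" for k
    using L2_norm_scale[of M c "\<lambda>x. u k x - v x"] by (simp add: right_diff_distrib)
  moreover have "(\<lambda>k. \<bar>c\<bar> * L2_norm M (\<lambda>x. u k x - v x)) \<longlonglongrightarrow> 0"
    using assms by (intro tendsto_mult_right_zero) (simp add: L2_tendsto_iff)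
  ultimately show ?thesis using si by (simp add: L2_tendsto_iff square_integrable_scale)
qed

text \<open>The limit inherits the majorant \<open>w\<close>, hence \<open>(u k - v)^2\<close> is at
  most \<open>4 w^2\<close> and dominated convergence applies.\<close>

lemma L2_tendsto_dominated:
  assumes "\<And>k. u k \<in> borel_measurable M" "v \<in> borel_measurable M" "square_integrable M w"
    "\<And>k. AE x in M. \<bar>u k x\<bar> \<le> w x" "AE x in M. (\<lambda>k. u k x) \<longlonglongrightarrow> v x"
  shows "L2_tendsto M u v"
proof -
  note [measurable] = assms(1,2)
  have AEall: "AE x in M. \<forall>k. \<bar>u k x\<bar> \<le> w x" using assms(4) by (subst AE_all_countable) blast
  have v: "AE x in M. \<bar>v x\<bar> \<le> w x"
    using AEall assms(5)
  proof eventually_elim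
    case (elim x)
    then have "(\<lambda>k. \<bar>u k x\<bar>) \<longlonglongrightarrow> \<bar>v x\<bar>" by (intro tendsto_intros) auto
    then show ?case using elim(1) by (intro LIMSEQ_le_const2) auto
  qed
  have si: "square_integrable M (u k)" "square_integrable M v" for k
    using assms(4)[of k] v by (auto intro!: square_integrable_bound[OF assms(3)])
  have "(\<lambda>k. \<integral>x. (u k x - v x)\<^sup>2 \<partial>M) \<longlonglongrightarrow> (\<integral>x. 0 \<partial>M)"
  proof (rule integral_dominated_convergence[where w="\<lambda>x. 4 * (w x)\<^sup>2"])
    show "integrable M (\<lambda>x. 4 * (w x)\<^sup>2)" using assms(3) by (simp add: square_integrable_def)
    show "AE x in M. (\<lambda>k. (u k x - v x)\<^sup>2) \<longlonglongrightarrow> 0"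
      using assms(5)
    proof eventually_elim
      case (elim x)
      then have "(\<lambda>k. (u k x - v x)\<^sup>2) \<longlonglongrightarrow> (v x - v x)\<^sup>2" by (intro tendsto_intros) auto
      then show ?case by simp
    qed
    show "AE x in M. norm ((u k x - v x)\<^sup>2) \<le> 4 * (w x)\<^sup>2" for k
      using assms(4)[of k] v
    proof eventually_elim
      case (elim x)
      then have "\<bar>u k x - v x\<bar> \<le> 2 * w x" by linarith
      then have "\<bar>u k x - v x\<bar>\<^sup>2 \<le> (2 * w x)\<^sup>2" by (intro power_mono) auto
      then show ?case by (simp add: power_mult_distrib)
    qed
  qed measurable
  then show ?thesis using si by (simp add: L2_tendsto_def)
qed

text \<open>Riesz-Fischer. A subsequence whose jumps decay geometrically converges almost
  everywhere, because the sum of its absolute jumps is bounded in \<open>L^2\<close>; Fatou's lemma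
  then bounds the distance of the whole sequence to this pointwise limit.\<close>

theorem L2_complete:
  fixes u :: "nat \<Rightarrow> 'b \<Rightarrow> real"
  assumes si: "\<And>k. square_integrable M (u k)"
    and Cauchy: "\<And>e. e > 0 \<Longrightarrow> \<exists>N. \<forall>m\<ge>N. \<forall>n\<ge>N. L2_norm M (\<lambda>x. u m x - u n x) < e"
  obtains v where "L2_tendsto M u v"
proof -
  note [measurable] = square_integrable_measurable[OF si]
  have "\<exists>r. strict_mono r \<and> (\<forall>k. \<forall>n\<ge>r k. L2_norm M (\<lambda>x. u n x - u (r k) x) < (1/2)^k)"
  proof -
    have "\<exists>N. \<forall>m\<ge>N. \<forall>n\<ge>N. L2_norm M (\<lambda>x. u m x - u n x) < (1/2)^k" for k :: nat
      by (rule Cauchy) simp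
    then obtain N where N: "\<And>k m n. m \<ge> N k \<Longrightarrow> n \<ge> N k \<Longrightarrow> L2_norm M (\<lambda>x. u m x - u n x) < (1/2)^k"
      by metis
    \<comment> \<open>Summing makes \<open>r\<close> strictly increasing and keeps
      \<open>r k\<close> at least \<open>N k\<close>.\<close>
    define r where "r k = (\<Sum>i\<le>k. Suc (N i))" for k
    have "strict_mono r" by (rule strict_monoI_Suc) (simp add: r_def)
    moreover have "N k \<le> r k" for k
      unfolding r_def by (rule order_trans[of _ "Suc (N k)"]) (auto intro: member_le_sum)
    ultimately show ?thesis using N by (meson order_trans)
  qed
  then obtain r where r: "strict_mono r"
    and rb: "\<And>k n. n \<ge> r k \<Longrightarrow> L2_norm M (\<lambda>x. u n x - u (r k) x) < (1/2)^k"
    by blast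
  define w where "w k x = \<bar>u (r (Suc k)) x - u (r k) x\<bar>" for k x
  define S where "S n x = (\<Sum>k<n. w k x)" for n x
  have w_si: "square_integrable M (w k)" for k
    unfolding w_def by (rule square_integrable_bound[OF square_integrable_diff[OF si si]]) auto
  have S_si: "square_integrable M (S n)" for n
    unfolding S_def using w_si by (intro square_integrable_sum)
  have w_norm: "L2_norm M (w k) \<le> (1/2)^k" for k
  proof -
    have "L2_norm M (w k) = L2_norm M (\<lambda>x. u (r (Suc k)) x - u (r k) x)"
      by (simp add: L2_norm_def w_def)
    also have "\<dots> \<le> (1/2)^k"
      using rb[of k "r (Suc k)"] strict_mono_less_eq[OF r, of k "Suc k"] by simp
    finally show ?thesis .
  qed
  \<comment> \<open>\<open>2 - 2 * (1/2)^n\<close> is the geometric sum of the bounds for the first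
    \<open>n\<close> jumps; squaring the limit 2 gives the bound 4 below.\<close>
  have S_norm: "L2_norm M (S n) \<le> 2 - 2 * (1/2)^n" for n
  proof (induction n)
    case 0
    show ?case by (simp add: S_def L2_norm_def)
  next
    case (Suc n)
    have "L2_norm M (S (Suc n)) \<le> L2_norm M (S n) + L2_norm M (w n)"
      using L2_norm_triangle[OF S_si[of n] w_si[of n]] by (simp add: S_def[abs_def])
    with Suc w_norm[of n] show ?case by simp
  qed
  have w0: "0 \<le> w k x" for k x by (simp add: w_def)
  have S_mono: "S n x \<le> S (Suc n) x" for n x using w0 by (simp add: S_def)
  have S0: "0 \<le> S n x" for n x using w0 by (simp add: S_def sum_nonneg)
  have "(\<integral>\<^sup>+x. (SUP n. ennreal ((S n x)\<^sup>2)) \<partial>M) = (SUP n. \<integral>\<^sup>+x. ennreal ((S n x)\<^sup>2) \<partial>M)"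
  proof (rule nn_integral_monotone_convergence_SUP)
    show "incseq (\<lambda>n x. ennreal ((S n x)\<^sup>2))"
      by (intro incseq_SucI le_funI ennreal_leI power_mono S_mono S0)
    show "(\<lambda>x. ennreal ((S n x)\<^sup>2)) \<in> borel_measurable M" for n
      using square_integrable_measurable[OF S_si[of n]] by measurable
  qed
  also have "\<dots> \<le> 4"
  proof (rule SUP_least)
    fix n
    have "(\<integral>\<^sup>+x. ennreal ((S n x)\<^sup>2) \<partial>M) = ennreal ((L2_norm M (S n))\<^sup>2)"
      unfolding L2_norm_square by (rule nn_integral_eq_integral) (use S_si in \<open>auto simp: square_integrable_def\<close>)
    also have "\<dots> \<le> ennreal (2\<^sup>2)"
      using S_norm[of n] zero_le_power[of "1/2::real" n] by (intro ennreal_leI power_mono) (auto intro: order_trans)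
    finally show "(\<integral>\<^sup>+x. ennreal ((S n x)\<^sup>2) \<partial>M) \<le> 4" by simp
  qed
  finally have "(\<integral>\<^sup>+x. (SUP n. ennreal ((S n x)\<^sup>2)) \<partial>M) \<noteq> \<infinity>"
    using ennreal_numeral_less_top top.extremum_strict by (auto simp: top_unique)
  moreover have "(\<lambda>x. SUP n. ennreal ((S n x)\<^sup>2)) \<in> borel_measurable M"
    using square_integrable_measurable[OF S_si] by measurable
  ultimately have fin: "AE x in M. (SUP n. ennreal ((S n x)\<^sup>2)) \<noteq> \<infinity>"
    by (intro nn_integral_noteq_infinite) auto
  define v where "v x = lim (\<lambda>k. u (r k) x)" for x
  have conv: "AE x in M. (\<lambda>k. u (r k) x) \<longlonglongrightarrow> v x"
    using fin
  proof eventually_elim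
    case (elim x)
    obtain c where c: "(SUP n. ennreal ((S n x)\<^sup>2)) = ennreal c" "c \<ge> 0"
      using elim by (cases "SUP n. ennreal ((S n x)\<^sup>2)") auto
    have "(S n x)\<^sup>2 \<le> c" for n
      using SUP_upper[of n UNIV "\<lambda>n. ennreal ((S n x)\<^sup>2)"] c by simp
    then have "S n x \<le> sqrt c" for n by (simp add: real_le_rsqrt)
    then have "summable (\<lambda>k. w k x)"
      using w0 by (intro summableI_nonneg_bounded[of _ "sqrt c"]) (auto simp: S_def)
    then have "summable (\<lambda>k. u (r (Suc k)) x - u (r k) x)"
      unfolding w_def by (rule summable_rabs_cancel)
    then have "convergent (\<lambda>n. \<Sum>k<n. u (r (Suc k)) x - u (r k) x)"
      by (simp add: summable_iff_convergent)
    moreover have "(\<Sum>k<n. u (r (Suc k)) x - u (r k) x) = u (r n) x - u (r 0) x" for n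
      by (rule sum_lessThan_telescope[of "\<lambda>k. u (r k) x"])
    ultimately have "convergent (\<lambda>n. (u (r n) x - u (r 0) x) + u (r 0) x)"
      by (intro convergent_add[OF _ convergent_const]) simp
    then show ?case by (simp add: v_def convergent_LIMSEQ_iff)
  qed
  have v_meas [measurable]: "v \<in> borel_measurable M"
    unfolding v_def by measurable
  \<comment> \<open>Fatou along \<open>r\<close>: beyond \<open>r k\<close>, both \<open>u n\<close>
    and \<open>u (r j)\<close> lie within \<open>(1/2)^k\<close> of \<open>u (r k)\<close>, so the
    square of their distance is at most 4 times the square of \<open>(1/2)^k\<close>.\<close>
  have bound: "(\<integral>\<^sup>+x. ennreal ((u n x - v x)\<^sup>2) \<partial>M) \<le> ennreal (((1/2)^k)\<^sup>2 * 4)" if n: "n \<ge> r k" for n k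
  proof -
    have "(\<integral>\<^sup>+x. ennreal ((u n x - v x)\<^sup>2) \<partial>M) = (\<integral>\<^sup>+x. liminf (\<lambda>j. ennreal ((u n x - u (r j) x)\<^sup>2)) \<partial>M)"
    proof (rule nn_integral_cong_AE, use conv in eventually_elim)
      case (elim x)
      have "(\<lambda>j. ennreal ((u n x - u (r j) x)\<^sup>2)) \<longlonglongrightarrow> ennreal ((u n x - v x)\<^sup>2)"
        by (intro tendsto_intros elim)
      from lim_imp_Liminf[OF sequentially_bot this] show ?case by (rule sym)
    qed
    also have "\<dots> \<le> liminf (\<lambda>j. \<integral>\<^sup>+x. ennreal ((u n x - u (r j) x)\<^sup>2) \<partial>M)"
      by (rule nn_integral_liminf) measurable
    also have "\<dots> \<le> ennreal (((1/2)^k)\<^sup>2 * 4)"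
    proof (rule Liminf_le)
      have "(\<integral>\<^sup>+x. ennreal ((u n x - u (r j) x)\<^sup>2) \<partial>M) \<le> ennreal (((1/2)^k)\<^sup>2 * 4)" if j: "j \<ge> k" for j
      proof -
        have rj: "r j \<ge> r k" using j strict_mono_less_eq[OF r] by simp
        have "L2_norm M (\<lambda>x. u n x - u (r j) x) \<le> L2_norm M (\<lambda>x. u n x - u (r k) x) + L2_norm M (\<lambda>x. u (r k) x - u (r j) x)"
          by (rule L2_norm_triangle_diff[OF si si si])
        also have "\<dots> \<le> 2 * (1/2)^k"
          using rb[OF n] rb[OF rj] L2_norm_minus_commute[of M "u (r k)" "u (r j)"] by simp
        finally have "(L2_norm M (\<lambda>x. u n x - u (r j) x))\<^sup>2 \<le> (2 * (1/2)^k)\<^sup>2"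
          by (intro power_mono) auto
        then show ?thesis
          using si[of n] si[of "r j"] unfolding L2_norm_square
          by (subst nn_integral_eq_integral)
             (auto simp: square_integrable_integrable square_integrable_diff power_mult_distrib intro!: ennreal_leI)
      qed
      then show "\<forall>\<^sub>F j in sequentially. (\<integral>\<^sup>+x. ennreal ((u n x - u (r j) x)\<^sup>2) \<partial>M) \<le> ennreal (((1/2)^k)\<^sup>2 * 4)"
        by (auto simp: eventually_sequentially)
    qed simp
    finally show ?thesis .
  qed
  have diff_si: "square_integrable M (\<lambda>x. u (r k) x - v x)" for k
  proof -
    have "(\<integral>\<^sup>+x. ennreal ((u (r k) x - v x)\<^sup>2) \<partial>M) < \<infinity>"
      using bound[of k "r k"] by (auto intro: le_less_trans)
    then show ?thesis
      by (auto simp: square_integrable_def intro!: integrableI_nonneg)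
  qed
  have v_si: "square_integrable M v"
    using square_integrable_diff[OF si[of "r 0"] diff_si[of 0]] by simp
  have small: "(\<integral>x. (u n x - v x)\<^sup>2 \<partial>M) \<le> 4 * (1/4)^k" if n: "n \<ge> r k" for n k
  proof -
    have "ennreal (\<integral>x. (u n x - v x)\<^sup>2 \<partial>M) = (\<integral>\<^sup>+x. ennreal ((u n x - v x)\<^sup>2) \<partial>M)"
      using square_integrable_diff[OF si[of n] v_si]
      by (intro nn_integral_eq_integral[symmetric]) (auto simp: square_integrable_def)
    also note bound[OF n]
    finally show ?thesis
      by (subst (asm) ennreal_le_iff) (simp_all add: power_mult_distrib power2_eq_square power_divide flip: power_mult_distrib)
  qed
  have "(\<lambda>n. \<integral>x. (u n x - v x)\<^sup>2 \<partial>M) \<longlonglongrightarrow> 0"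
  proof (rule LIMSEQ_I)
    fix e :: real assume e: "e > 0"
    have "(\<lambda>k. 4 * (1/4::real)^k) \<longlonglongrightarrow> 4 * 0" by (intro tendsto_intros LIMSEQ_power_zero) auto
    then obtain k where k: "4 * (1/4::real)^k < e"
      using LIMSEQ_D[of "\<lambda>k. 4 * (1/4::real)^k" 0 e] e by auto
    show "\<exists>no. \<forall>n\<ge>no. norm ((\<integral>x. (u n x - v x)\<^sup>2 \<partial>M) - 0) < e"
      using small k by (intro exI[of _ "r k"]) (auto intro: le_less_trans)
  qed
  then have "L2_tendsto M u v" using si v_si by (simp add: L2_tendsto_def)
  then show ?thesis by (rule that)
qed

section \<open>Sequential closures and an induction principle for \<open>L^2\<close>\<close>

definition L2_closure :: "'b measure \<Rightarrow> ('b \<Rightarrow> real) set \<Rightarrow> ('b \<Rightarrow> real) set" where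
  "L2_closure M V = {u. \<exists>h. (\<forall>k. h k \<in> V) \<and> L2_tendsto M h u}"

lemma L2_closure_square_integrable: "u \<in> L2_closure M V \<Longrightarrow> square_integrable M u"
  by (auto simp: L2_closure_def L2_tendsto_def)

lemma L2_closure_incl: "u \<in> V \<Longrightarrow> square_integrable M u \<Longrightarrow> u \<in> L2_closure M V"
  by (auto simp: L2_closure_def intro!: exI[of _ "\<lambda>_. u"] L2_tendsto_const)

lemma L2_closure_approx:
  assumes "u \<in> L2_closure M V" "e > 0"
  obtains v where "v \<in> V" "square_integrable M v" "L2_norm M (\<lambda>x. v x - u x) < e"
proof -
  obtain h where h: "\<And>k. h k \<in> V" "L2_tendsto M h u" using assms(1) by (auto simp: L2_closure_def)
  then have "(\<lambda>k. L2_norm M (\<lambda>x. h k x - u x)) \<longlonglongrightarrow> 0" by (simp add: L2_tendsto_iff)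
  from LIMSEQ_D[OF this assms(2)] obtain k where "L2_norm M (\<lambda>x. h k x - u x) < e" by auto
  then show ?thesis using that[of "h k"] h by (auto simp: L2_tendsto_def)
qed

text \<open>Taking closures twice gives nothing new: approximate the \<open>k\<close>-th element of
  the closure within \<open>1/(k+1)\<close> by an element of \<open>V\<close>.\<close>

lemma L2_closure_lim:
  assumes "\<And>k. u k \<in> L2_closure M V" "L2_tendsto M u v"
  shows "v \<in> L2_closure M V"
proof -
  have si: "square_integrable M (u k)" "square_integrable M v" for k
    using assms(2) by (auto simp: L2_tendsto_def)
  have "\<exists>h. h \<in> V \<and> square_integrable M h \<and> L2_norm M (\<lambda>x. h x - u k x) < inverse (real (Suc k))" for k
    by (rule L2_closure_approx[OF assms(1)[of k], of "inverse (real (Suc k))"]) auto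
  then obtain h where h: "\<And>k. h k \<in> V" "\<And>k. square_integrable M (h k)"
      "\<And>k. L2_norm M (\<lambda>x. h k x - u k x) < inverse (real (Suc k))"
    by metis
  have "(\<lambda>k. L2_norm M (\<lambda>x. h k x - v x)) \<longlonglongrightarrow> 0"
  proof (rule Lim_null_comparison[OF always_eventually[OF allI]])
    show "norm (L2_norm M (\<lambda>x. h k x - v x)) \<le> inverse (real (Suc k)) + L2_norm M (\<lambda>x. u k x - v x)" for k
      using L2_norm_triangle_diff[OF h(2)[of k] si(1)[of k] si(2)] h(3)[of k] by simp
    show "(\<lambda>k. inverse (real (Suc k)) + L2_norm M (\<lambda>x. u k x - v x)) \<longlonglongrightarrow> 0"
      using assms(2) by (intro tendsto_add_zero LIMSEQ_inverse_real_of_nat) (simp add: L2_tendsto_iff)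
  qed
  then show ?thesis using h si by (auto simp: L2_closure_def L2_tendsto_iff)
qed

lemma L2_closure_add:
  assumes "\<And>u v. u \<in> V \<Longrightarrow> v \<in> V \<Longrightarrow> (\<lambda>x. u x + v x) \<in> V" "u \<in> L2_closure M V" "v \<in> L2_closure M V"
  shows "(\<lambda>x. u x + v x) \<in> L2_closure M V"
proof -
  from assms(2,3) obtain h h' where "\<And>k. h k \<in> V" "L2_tendsto M h u" "\<And>k. h' k \<in> V" "L2_tendsto M h' v"
    unfolding L2_closure_def by blast
  then show ?thesis
    using L2_tendsto_add[of M h u h' v] assms(1) unfolding L2_closure_def
    by (intro CollectI exI[of _ "\<lambda>k x. h k x + h' k x"]) auto
qed

lemma L2_closure_scale:
  assumes "\<And>u. u \<in> V \<Longrightarrow> (\<lambda>x. c * u x) \<in> V" "u \<in> L2_closure M V"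
  shows "(\<lambda>x. c * u x) \<in> L2_closure M V"
proof -
  from assms(2) obtain h where "\<And>k. h k \<in> V" "L2_tendsto M h u"
    unfolding L2_closure_def by blast
  then show ?thesis
    using L2_tendsto_scale[of M h u c] assms(1) unfolding L2_closure_def
    by (intro CollectI exI[of _ "\<lambda>k x. c * h k x"]) auto
qed

text \<open>A monotone class argument. Complements and disjoint unions carry \<open>P\<close> from
  the generator to all measurable sets (Dynkin), linear combinations carry it to simple functions,
  and dominated limits to \<open>L^2\<close>. The separate hypothesis on the whole space is what
  makes complements possible, since \<open>G\<close> is not assumed to contain it.\<close>

lemma (in finite_measure) L2_induct_generator:
  assumes G: "Int_stable G" "G \<subseteq> Pow (space M)" "sets M = sigma_sets (space M) G"
    and G_P: "\<And>A. A \<in> G \<Longrightarrow> P (indicator A)"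
    and space_P: "P (indicator (space M))"
    and add: "\<And>u v. P u \<Longrightarrow> P v \<Longrightarrow> P (\<lambda>x. u x + v x)"
    and scale: "\<And>u c. P u \<Longrightarrow> P (\<lambda>x. c * u x)"
    and lim: "\<And>u v. (\<And>k. P (u k)) \<Longrightarrow> L2_tendsto M u v \<Longrightarrow> P v"
    and u: "square_integrable M u"
  shows "P (u :: 'a \<Rightarrow> real)"
proof -
  have zero: "P (\<lambda>x. 0)" using scale[OF space_P, of 0] by simp
  have sum: "P (\<lambda>x. \<Sum>i\<in>I. h i x)" if "\<And>i. i \<in> I \<Longrightarrow> P (h i)" for I :: "'i set" and h
    using that by (induction I rule: infinite_finite_induct) (auto intro: zero add)
  have sets_P: "P (indicator A)" if "A \<in> sets M" for A
  proof -
    have "A \<in> sigma_sets (space M) G" using that G(3) by simp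
    with G(1,2) show ?thesis
    proof (induction rule: sigma_sets_induct_disjoint)
      case (basic A)
      then show ?case by (rule G_P)
    next
      case empty
      then show ?case using zero by simp
    next
      case (compl A)
      then have "A \<subseteq> space M" using G(3) sets.sets_into_space by auto
      then have "indicator (space M - A) = (\<lambda>x. indicator (space M) x + (-1) * indicator A x :: real)"
        by (auto simp: indicator_def fun_eq_iff)
      then show ?case using add[OF space_P scale[OF compl(2), of "-1"]] by simp
    next
      case (union A)
      have A: "A i \<in> sets M" for i using union(2) G(3) by auto
      \<comment> \<open>Disjointness turns the partial sums into indicators of partial unions; the
        constant majorant 1 is square integrable because the measure is finite.\<close>
      have "L2_tendsto M (\<lambda>n x. \<Sum>i<n. indicator (A i) x) (indicator (\<Union>i. A i))"
      proof (rule L2_tendsto_dominated[where w="\<lambda>_. 1"])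
        have eq: "(\<Sum>i<n. indicator (A i) x) = (indicator (\<Union>i<n. A i) x :: real)" for n x
          using union(1) by (subst indicator_UN_disjoint) (auto simp: disjoint_family_on_def)
        show "AE x in M. \<bar>\<Sum>i<n. indicator (A i) x\<bar> \<le> (1::real)" for n
          unfolding eq by (auto simp: indicator_def)
        show "AE x in M. (\<lambda>n. \<Sum>i<n. indicator (A i) x :: real) \<longlonglongrightarrow> indicator (\<Union>i. A i) x"
          unfolding eq by (intro AE_I2 LIMSEQ_indicator_UN)
      qed (use A in auto)
      then show ?case by (rule lim[rotated]) (intro sum union(3))
    qed
  qed
  obtain s where s: "\<And>i. simple_function M (s i)" "\<And>x. x \<in> space M \<Longrightarrow> (\<lambda>i. s i x) \<longlonglongrightarrow> u x"
      "\<And>i x. x \<in> space M \<Longrightarrow> dist (s i x) 0 \<le> 2 * dist (u x) 0"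
    using borel_measurable_implies_sequence_metric[OF square_integrable_measurable[OF u], of 0] by blast
  \<comment> \<open>\<open>P\<close> is a predicate on functions, not on classes. As
    \<open>s i\<close> may be arbitrary outside the space, it is replaced by the linear combination
    of indicators with which it agrees on the space.\<close>
  define t where "t i x = (\<Sum>c\<in>s i ` space M. c * indicator (s i -` {c} \<inter> space M) x)" for i x
  have t: "t i x = s i x" if "x \<in> space M" for i x
    using simple_functionD(1)[OF s(1)] that
    by (simp add: t_def indicator_def sum.If_cases if_distrib cong: if_cong)
  have "P (t i)" for i
    unfolding t_def using simple_functionD[OF s(1)[of i]] by (intro sum scale sets_P) auto
  moreover have "L2_tendsto M t u"
  proof (rule L2_tendsto_dominated[where w="\<lambda>x. 2 * \<bar>u x\<bar>"])
    show "t i \<in> borel_measurable M" for i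
      using borel_measurable_simple_function[OF s(1)[of i]] t by (simp cong: measurable_cong)
    show "square_integrable M (\<lambda>x. 2 * \<bar>u x\<bar>)"
      using u by (auto simp: square_integrable_def power_mult_distrib)
    show "AE x in M. \<bar>t i x\<bar> \<le> 2 * \<bar>u x\<bar>" for i
      using s(3) t by (auto simp: dist_real_def)
    show "AE x in M. (\<lambda>i. t i x) \<longlonglongrightarrow> u x"
      using s(2) t by auto
  qed (use u in auto)
  ultimately show ?thesis by (rule lim)
qed

section \<open>The space of point measures\<close>

lemma range_ennreal_of_enat: "x \<in> range ennreal_of_enat \<longleftrightarrow> x = \<infinity> \<or> (\<exists>k::nat. x = of_nat k)"
proof
  assume "x \<in> range ennreal_of_enat"
  then obtain e where "x = ennreal_of_enat e" by blast
  then show "x = \<infinity> \<or> (\<exists>k::nat. x = of_nat k)" by (cases e) auto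
next
  assume "x = \<infinity> \<or> (\<exists>k::nat. x = of_nat k)"
  then show "x \<in> range ennreal_of_enat"
    by (metis ennreal_of_enat_enat ennreal_of_enat_infty infinity_ennreal_def rangeI)
qed

lemma point_measuresD:
  assumes "\<mu> \<in> point_measures L"
  shows "space \<mu> = space L" "sets \<mu> = sets L" "sigma_finite_measure \<mu>"
    "B \<in> sets L \<Longrightarrow> emeasure \<mu> B = \<infinity> \<or> (\<exists>k::nat. emeasure \<mu> B = of_nat k)"
  using assms unfolding point_measures_def range_ennreal_of_enat by auto

lemma space_point_algebra [simp]: "space (point_algebra L) = point_measures L"
  unfolding point_algebra_def by (auto simp: space_Sup_eq_UN)

lemma measurable_emeasure_point_algebra:
  "B \<in> sets L \<Longrightarrow> (\<lambda>\<mu>. emeasure \<mu> B) \<in> borel_measurable (point_algebra L)"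
  unfolding point_algebra_def by (auto intro!: measurable_Sup1 measurable_vimage_algebra1)

lemma measurable_emeasure_point_algebra2 [measurable (raw)]:
  "f \<in> N \<rightarrow>\<^sub>M point_algebra L \<Longrightarrow> B \<in> sets L \<Longrightarrow> (\<lambda>x. emeasure (f x) B) \<in> borel_measurable N"
  using measurable_compose[OF _ measurable_emeasure_point_algebra] by blast

lemma measurable_point_algebra:
  assumes "\<And>x. x \<in> space N \<Longrightarrow> f x \<in> point_measures L"
    "\<And>B. B \<in> sets L \<Longrightarrow> (\<lambda>x. emeasure (f x) B) \<in> borel_measurable N"
  shows "f \<in> N \<rightarrow>\<^sub>M point_algebra L"
  unfolding point_algebra_def using assms
  by (auto intro!: measurable_Sup2 measurable_vimage_algebra2)

section \<open>Sets of finite intensity and a generator for the space of point measures\<close>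

definition finite_sets :: "'a measure \<Rightarrow> 'a set set" where
  "finite_sets L = {B \<in> sets L. emeasure L B < \<infinity>}"

lemma finite_setsD: "B \<in> finite_sets L \<Longrightarrow> B \<in> sets L" "B \<in> finite_sets L \<Longrightarrow> emeasure L B < \<infinity>"
  by (auto simp: finite_sets_def)

lemma finite_sets_Un: "B \<in> finite_sets L \<Longrightarrow> C \<in> finite_sets L \<Longrightarrow> B \<union> C \<in> finite_sets L"
  using emeasure_subadditive[of B L C] by (auto simp: finite_sets_def intro: le_less_trans)

lemma finite_sets_UN:
  "finite I \<Longrightarrow> (\<And>i. i \<in> I \<Longrightarrow> B i \<in> finite_sets L) \<Longrightarrow> (\<Union>i\<in>I. B i) \<in> finite_sets L"
proof (induction I rule: finite_induct)
  case empty
  show ?case by (simp add: finite_sets_def)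
next
  case (insert x I)
  then show ?case using finite_sets_Un[of "B x" L "\<Union>i\<in>I. B i"] by simp
qed

lemma finite_sets_subset: "B \<in> finite_sets L \<Longrightarrow> C \<in> sets L \<Longrightarrow> C \<subseteq> B \<Longrightarrow> C \<in> finite_sets L"
  using emeasure_mono[of C B L] by (auto simp: finite_sets_def intro: le_less_trans)

text \<open>Events prescribing finite values of finitely many counts. Pooling the prescriptions of
  two events prescribes their intersection, and the empty prescription gives the whole space. Only
  sets of finite intensity occur, so the counts involved are almost surely finite and the Mecke
  equation can be computed on these events.\<close>

definition point_generator :: "'a measure \<Rightarrow> 'a measure set set" where
  "point_generator L = {{\<mu> \<in> point_measures L. \<forall>(B, k)\<in>S. emeasure \<mu> B = of_nat k} | S :: ('a set \<times> nat) set.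
     finite S \<and> fst ` S \<subseteq> finite_sets L}"

lemma point_generatorI:
  fixes S :: "('a set \<times> nat) set"
  shows "finite S \<Longrightarrow> fst ` S \<subseteq> finite_sets L \<Longrightarrow>
    {\<mu> \<in> point_measures L. \<forall>(B, k)\<in>S. emeasure \<mu> B = of_nat k} \<in> point_generator L"
  unfolding point_generator_def by blast

lemma point_generator_Pow: "point_generator L \<subseteq> Pow (point_measures L)"
  by (auto simp: point_generator_def)

lemma point_measures_in_generator: "point_measures L \<in> point_generator L"
  using point_generatorI[of "{}" L] by simp

lemma Int_stable_point_generator: "Int_stable (point_generator L)"
proof (rule Int_stableI)
  fix a b assume "a \<in> point_generator L" "b \<in> point_generator L"
  then obtain S T :: "('a set \<times> nat) set" where
    "a = {\<mu> \<in> point_measures L. \<forall>(B, k)\<in>S. emeasure \<mu> B = of_nat k}" "finite S" "fst ` S \<subseteq> finite_sets L"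
    "b = {\<mu> \<in> point_measures L. \<forall>(B, k)\<in>T. emeasure \<mu> B = of_nat k}" "finite T" "fst ` T \<subseteq> finite_sets L"
    unfolding point_generator_def by blast
  then show "a \<inter> b \<in> point_generator L"
    using point_generatorI[of "S \<union> T" L] by (simp add: ball_Un image_Un Collect_conj_eq[symmetric] conj_ac Int_def)
qed

text \<open>Infinite counts are recovered from the finite values: a count that equals no natural
  number is infinite, and the count of a set of infinite intensity is a supremum of counts of sets
  of finite intensity, by \<open>\<sigma>\<close>-finiteness.\<close>

lemma (in sigma_finite_measure) sets_point_algebra:
  "sets (point_algebra M) = sigma_sets (point_measures M) (point_generator M)"
proof
  let ?S = "sigma (point_measures M) (point_generator M)"
  have sp: "space ?S = point_measures M"
    by (simp add: space_measure_of_conv)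
  have setsS: "sets ?S = sigma_sets (point_measures M) (point_generator M)"
    by (rule sets_measure_of) (rule point_generator_Pow)
  have fin: "(\<lambda>\<mu>. emeasure \<mu> B) \<in> borel_measurable ?S" if B: "B \<in> finite_sets M" for B
  proof (rule measurableI)
    fix A :: "ennreal set"
    define E where "E k = {\<mu> \<in> point_measures M. emeasure \<mu> B = of_nat k}" for k :: nat
    have E: "E k \<in> sets ?S" for k
      using point_generatorI[of "{(B, k)}" M] B unfolding setsS E_def by (intro sigma_sets.Basic) simp
    \<comment> \<open>A count takes countably many values, and the value infinity is the complement
      of all the finite ones.\<close>
    have "(\<lambda>\<mu>. emeasure \<mu> B) -` A \<inter> point_measures M =
        (\<Union>k\<in>{k. of_nat k \<in> A}. E k) \<union> (if \<infinity> \<in> A then space ?S - (\<Union>k. E k) else {})"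
    proof (rule set_eqI)
      fix \<mu>
      show "\<mu> \<in> (\<lambda>\<mu>. emeasure \<mu> B) -` A \<inter> point_measures M \<longleftrightarrow>
        \<mu> \<in> (\<Union>k\<in>{k. of_nat k \<in> A}. E k) \<union> (if \<infinity> \<in> A then space ?S - (\<Union>k. E k) else {})"
      proof (cases "\<mu> \<in> point_measures M")
        case True
        then consider "emeasure \<mu> B = \<infinity>" | k :: nat where "emeasure \<mu> B = of_nat k"
          using point_measuresD(4)[OF _ finite_setsD(1)[OF B]] by blast
        then show ?thesis using True by cases (auto simp: E_def sp)
      qed (simp add: E_def sp)
    qed
    also have "\<dots> \<in> sets ?S" using E by auto
    finally show "(\<lambda>\<mu>. emeasure \<mu> B) -` A \<inter> space ?S \<in> sets ?S" by (simp only: sp)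
  qed simp
  obtain C where C: "range C \<subseteq> sets M" "(\<Union>i. C i) = space M" "\<And>i. emeasure M (C i) \<noteq> \<infinity>" "incseq C"
    using sigma_finite_incseq by metis
  have id: "(\<lambda>\<mu>. \<mu>) \<in> ?S \<rightarrow>\<^sub>M point_algebra M"
  proof (rule measurable_point_algebra)
    fix B assume B: "B \<in> sets M"
    have "emeasure \<mu> B = (SUP i. emeasure \<mu> (B \<inter> C i))" if "\<mu> \<in> point_measures M" for \<mu>
    proof -
      have "B = (\<Union>i. B \<inter> C i)" using C(2) sets.sets_into_space[OF B] by auto
      moreover have "(SUP i. emeasure \<mu> (B \<inter> C i)) = emeasure \<mu> (\<Union>i. B \<inter> C i)"
      proof (rule SUP_emeasure_incseq)
        show "range (\<lambda>i. B \<inter> C i) \<subseteq> sets \<mu>"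
          using C(1) B by (auto simp: point_measuresD(2)[OF that])
        show "incseq (\<lambda>i. B \<inter> C i)"
          using C(4) by (auto simp: incseq_def)
      qed
      ultimately show ?thesis by simp
    qed
    moreover have "(\<lambda>\<mu>. SUP i. emeasure \<mu> (B \<inter> C i)) \<in> borel_measurable ?S"
    proof (rule borel_measurable_SUP, simp, rule fin)
      show "B \<inter> C i \<in> finite_sets M" for i
        by (rule finite_sets_subset[of "C i"]) (use C B in \<open>auto simp: finite_sets_def top.not_eq_extremum\<close>)
    qed
    ultimately show "(\<lambda>\<mu>. emeasure \<mu> B) \<in> borel_measurable ?S"
      by (subst measurable_cong[where g="\<lambda>\<mu>. SUP i. emeasure \<mu> (B \<inter> C i)"]) (auto simp: sp)
  qed (simp add: sp)
  show "sets (point_algebra M) \<subseteq> sigma_sets (point_measures M) (point_generator M)"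
  proof
    fix A assume A: "A \<in> sets (point_algebra M)"
    then have "(\<lambda>\<mu>. \<mu>) -` A \<inter> space ?S \<in> sets ?S" by (rule measurable_sets[OF id])
    moreover have "A \<subseteq> point_measures M" using sets.sets_into_space[OF A] by simp
    then have "(\<lambda>\<mu>. \<mu>) -` A \<inter> space ?S = A" by (auto simp: sp)
    ultimately show "A \<in> sigma_sets (point_measures M) (point_generator M)" by (simp add: setsS)
  qed
  have "point_generator M \<subseteq> sets (point_algebra M)"
  proof
    fix a assume "a \<in> point_generator M"
    then obtain S :: "('a set \<times> nat) set" where S:
      "a = {\<mu> \<in> point_measures M. \<forall>(B, k)\<in>S. emeasure \<mu> B = of_nat k}" "finite S" "fst ` S \<subseteq> finite_sets M"
      unfolding point_generator_def by blast
    have "{\<mu> \<in> space (point_algebra M). \<forall>p\<in>S. emeasure \<mu> (fst p) = of_nat (snd p)} \<in> sets (point_algebra M)"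
    proof (rule sets.sets_Collect_finite_All[OF _ S(2)])
      fix p assume "p \<in> S"
      then have [measurable]: "(\<lambda>\<mu>. emeasure \<mu> (fst p)) \<in> borel_measurable (point_algebra M)"
        using S(3) finite_setsD by (intro measurable_emeasure_point_algebra) auto
      show "{\<mu> \<in> space (point_algebra M). emeasure \<mu> (fst p) = of_nat (snd p)} \<in> sets (point_algebra M)"
        by measurable
    qed
    then show "a \<in> sets (point_algebra M)" by (simp add: S(1) case_prod_beta)
  qed
  then show "sigma_sets (point_measures M) (point_generator M) \<subseteq> sets (point_algebra M)"
    using sets.sigma_sets_subset[of "point_generator M" "point_algebra M"] by simp
qed

subsection \<open>Adding a point\<close>

lemma space_add_point [simp]: "space (add_point \<mu> y) = space \<mu>"
  and sets_add_point [simp]: "sets (add_point \<mu> y) = sets \<mu>"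
  by (simp_all add: add_point_def)

lemma emeasure_add_point:
  assumes "B \<in> sets \<mu>"
  shows "emeasure (add_point \<mu> y) B = emeasure \<mu> B + indicator B y"
  unfolding add_point_def
proof (rule emeasure_measure_of_sigma)
  show "sigma_algebra (space \<mu>) (sets \<mu>)" ..
  show "positive (sets \<mu>) (\<lambda>B. emeasure \<mu> B + indicator B y)" by (simp add: positive_def)
  show "countably_additive (sets \<mu>) (\<lambda>B. emeasure \<mu> B + indicator B y)"
  proof (rule countably_additiveI)
    fix A :: "nat \<Rightarrow> 'a set" assume A: "range A \<subseteq> sets \<mu>" "disjoint_family A" "\<Union> (range A) \<in> sets \<mu>"
    have "(\<Sum>i. emeasure \<mu> (A i) + indicator (A i) y) = (\<Sum>i. emeasure \<mu> (A i)) + (\<Sum>i. indicator (A i) y)"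
      by (rule suminf_add[symmetric]) auto
    also have "\<dots> = emeasure \<mu> (\<Union>i. A i) + indicator (\<Union>i. A i) y"
      using A by (simp add: suminf_emeasure suminf_indicator)
    finally show "(\<Sum>i. emeasure \<mu> (A i) + indicator (A i) y) = emeasure \<mu> (\<Union> (range A)) + indicator (\<Union> (range A)) y" .
  qed
qed fact

lemma add_point_commute: "add_point (add_point \<mu> x) y = add_point (add_point \<mu> y) x"
  by (rule measure_eqI) (simp_all add: emeasure_add_point ac_simps)

lemma add_point_in_point_measures:
  assumes "\<mu> \<in> point_measures L"
  shows "add_point \<mu> y \<in> point_measures L"
proof -
  interpret sigma_finite_measure \<mu> using assms by (rule point_measuresD)
  have "sigma_finite_measure (add_point \<mu> y)"
  proof
    obtain A where A: "countable A" "A \<subseteq> sets \<mu>" "\<Union> A = space \<mu>" "\<And>a. a \<in> A \<Longrightarrow> emeasure \<mu> a \<noteq> \<infinity>"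
      using sigma_finite_countable by blast
    show "\<exists>A. countable A \<and> A \<subseteq> sets (add_point \<mu> y) \<and> \<Union> A = space (add_point \<mu> y) \<and>
        (\<forall>a\<in>A. emeasure (add_point \<mu> y) a \<noteq> \<infinity>)"
      using A by (intro exI[of _ A]) (auto simp: emeasure_add_point subset_iff indicator_def)
  qed
  moreover have "emeasure (add_point \<mu> y) B = \<infinity> \<or> (\<exists>k::nat. emeasure (add_point \<mu> y) B = of_nat k)" if B: "B \<in> sets L" for B
  proof -
    have eq: "emeasure (add_point \<mu> y) B = emeasure \<mu> B + indicator B y"
      using B point_measuresD(2)[OF assms] by (simp add: emeasure_add_point)
    consider "emeasure \<mu> B = \<infinity>" | k :: nat where "emeasure \<mu> B = of_nat k"
      using point_measuresD(4)[OF assms B] by blast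
    then show ?thesis
    proof cases
      case 2
      then have "emeasure (add_point \<mu> y) B = of_nat (k + (if y \<in> B then 1 else 0))"
        by (simp add: eq indicator_def)
      then show ?thesis by blast
    qed (simp add: eq)
  qed
  ultimately show ?thesis
    using point_measuresD(1,2)[OF assms] by (auto simp: point_measures_def range_ennreal_of_enat)
qed

lemma measurable_add_point [measurable (raw)]:
  assumes f: "f \<in> N \<rightarrow>\<^sub>M point_algebra L" and g: "g \<in> N \<rightarrow>\<^sub>M L"
  shows "(\<lambda>x. add_point (f x) (g x)) \<in> N \<rightarrow>\<^sub>M point_algebra L"
proof (rule measurable_point_algebra)
  have fs: "f x \<in> point_measures L" if "x \<in> space N" for x
    using measurable_space[OF f that] by simp
  then show "add_point (f x) (g x) \<in> point_measures L" if "x \<in> space N" for x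
    using that by (intro add_point_in_point_measures)
  fix B assume B: "B \<in> sets L"
  have "emeasure (add_point (f x) (g x)) B = emeasure (f x) B + indicator B (g x)" if "x \<in> space N" for x
    using B point_measuresD(2)[OF fs[OF that]] by (simp add: emeasure_add_point)
  moreover have "(\<lambda>x. emeasure (f x) B + indicator B (g x)) \<in> borel_measurable N"
    using f g B by measurable
  ultimately show "(\<lambda>x. emeasure (add_point (f x) (g x)) B) \<in> borel_measurable N"
    by (simp cong: measurable_cong)
qed

lemma nn_integral_add_point:
  assumes h: "h \<in> borel_measurable \<mu>" and y: "y \<in> space \<mu>"
  shows "(\<integral>\<^sup>+x. h x \<partial>add_point \<mu> y) = (\<integral>\<^sup>+x. h x \<partial>\<mu>) + h y"
  using h
proof (induction rule: borel_measurable_induct)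
  case (cong f g)
  then show ?case using y by (simp cong: nn_integral_cong_simp)
next
  case (set A)
  then show ?case by (simp add: emeasure_add_point)
next
  case (mult u c)
  then have [measurable]: "u \<in> borel_measurable (add_point \<mu> y)"
    by (simp cong: measurable_cong_sets)
  show ?case using mult by (simp add: nn_integral_cmult distrib_left)
next
  case (add u v)
  have [measurable]: "u \<in> borel_measurable (add_point \<mu> y)" "v \<in> borel_measurable (add_point \<mu> y)"
    using add by (simp_all cong: measurable_cong_sets)
  show ?case using add by (simp add: nn_integral_add ac_simps)
next
  case (seq U)
  have m: "U i \<in> borel_measurable (add_point \<mu> y)" for i
    using seq by (simp cong: measurable_cong_sets)
  have "(\<integral>\<^sup>+x. (SUP i. U i x) \<partial>add_point \<mu> y) = (SUP i. \<integral>\<^sup>+x. U i x \<partial>add_point \<mu> y)"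
    using seq m by (intro nn_integral_monotone_convergence_SUP) auto
  also have "\<dots> = (SUP i. (\<integral>\<^sup>+x. U i x \<partial>\<mu>) + U i y)"
    by (simp add: seq)
  also have "\<dots> = (SUP i. \<integral>\<^sup>+x. U i x \<partial>\<mu>) + (SUP i. U i y)"
    using seq by (intro ennreal_SUP_add) (auto simp: incseq_def le_fun_def intro!: nn_integral_mono)
  also have "(SUP i. \<integral>\<^sup>+x. U i x \<partial>\<mu>) = (\<integral>\<^sup>+x. (SUP i. U i x) \<partial>\<mu>)"
    using seq by (intro nn_integral_monotone_convergence_SUP[symmetric]) auto
  finally show ?case by (simp add: image_comp)
qed

text \<open>Integrability is essential: otherwise both integrals are 0 by convention, while
  \<open>h y\<close> may be different from 0.\<close>

lemma integral_add_point:
  fixes h :: "'a \<Rightarrow> real"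
  assumes h: "integrable \<mu> h" and y: "y \<in> space \<mu>"
  shows "integrable (add_point \<mu> y) h" "(\<integral>x. h x \<partial>add_point \<mu> y) = (\<integral>x. h x \<partial>\<mu>) + h y"
proof -
  have [measurable]: "h \<in> borel_measurable \<mu>" using h by auto
  have m: "h \<in> borel_measurable (add_point \<mu> y)" by (simp cong: measurable_cong_sets)
  have fin: "(\<integral>\<^sup>+x. ennreal (h x) \<partial>\<mu>) < \<infinity>" "(\<integral>\<^sup>+x. ennreal (- h x) \<partial>\<mu>) < \<infinity>"
    using h by (auto simp: real_integrable_def top.not_eq_extremum)
  have norm: "(\<integral>\<^sup>+x. ennreal (norm (h x)) \<partial>\<mu>) < \<infinity>"
    using h by (simp add: integrable_iff_bounded)
  show i: "integrable (add_point \<mu> y) h"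
    using norm m y by (auto simp: integrable_iff_bounded nn_integral_add_point)
  show "(\<integral>x. h x \<partial>add_point \<mu> y) = (\<integral>x. h x \<partial>\<mu>) + h y"
    unfolding real_lebesgue_integral_def[OF h] real_lebesgue_integral_def[OF i]
    using fin y by (cases "h y \<ge> 0") (simp_all add: nn_integral_add_point enn2real_plus ennreal_neg)
qed

subsection \<open>Difference operators\<close>

lemma diff_op_commute: "diff_op x (diff_op y f) = diff_op y (diff_op x f)"
  by (rule ext) (simp add: diff_op_def add_point_commute[of _ x y])

lemma diff_ops_append: "diff_ops (xs @ ys) f = diff_ops xs (diff_ops ys f)"
  by (induction xs) auto

lemma diff_ops_Cons_swap: "diff_op y (diff_ops xs f) = diff_ops xs (diff_op y f)"
  by (induction xs) (auto simp: diff_op_commute)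

text \<open>Differences commute because adding points does. Only the multiset of added points
  matters, which makes \<open>iter_diff\<close> symmetric everywhere and not just almost
  everywhere.\<close>

lemma diff_ops_mset_eq: "mset xs = mset ys \<Longrightarrow> diff_ops xs f = diff_ops ys f"
proof (induction xs arbitrary: ys)
  case Nil
  then show ?case by simp
next
  case (Cons x xs)
  then have "x \<in> set ys" by (metis list.set_intros(1) set_mset_mset)
  then obtain us vs where ys: "ys = us @ x # vs" by (auto simp: in_set_conv_decomp)
  then have "mset xs = mset (us @ vs)" using Cons.prems by simp
  then have "diff_ops xs f = diff_ops (us @ vs) f" by (rule Cons.IH)
  then have "diff_ops (x # xs) f = diff_op x (diff_ops (us @ vs) f)" by (simp only: diff_ops.simps)
  also have "\<dots> = diff_ops ys f" unfolding ys by (simp add: diff_ops_append diff_ops_Cons_swap)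
  finally show ?case .
qed

lemma iter_diff_0 [simp]: "iter_diff 0 f y = f"
  by (simp add: iter_diff_def)

text \<open>The list is split at its end, so \<open>y n\<close> is the point applied to
  \<open>f\<close> first. Inductions on \<open>n\<close> therefore pass from \<open>f\<close> to
  \<open>diff_op (y n) f\<close> and have to keep \<open>f\<close> general.\<close>

lemma iter_diff_Suc: "iter_diff (Suc n) f y = iter_diff n (diff_op (y n) f) y"
  by (simp add: iter_diff_def diff_ops_append)

lemma iter_diff_fun_upd [simp]: "n \<le> m \<Longrightarrow> iter_diff n f (y(m := z)) = iter_diff n f y"
  by (auto simp: iter_diff_def intro!: arg_cong2[where f=diff_ops])

lemma iter_diff_permutes:
  assumes "\<pi> permutes {..<n}"
  shows "iter_diff n f (y \<circ> \<pi>) = iter_diff n f y"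
proof -
  have "mset (map \<pi> [0..<n]) = mset [0..<n]"
    using permutes_imp_bij[OF assms] permutes_inj_on[OF assms]
    by (intro set_eq_iff_mset_eq_distinct[THEN iffD1])
       (auto simp: distinct_map bij_betw_def atLeast0LessThan)
  then have "mset (map y (map \<pi> [0..<n])) = mset (map y [0..<n])"
    by (simp only: mset_map)
  then show ?thesis unfolding iter_diff_def by (intro diff_ops_mset_eq) (simp add: comp_def)
qed

text \<open>The function may depend on the same parameter \<open>x\<close> that selects the added
  point; in this form the statement can be iterated along a list.\<close>

lemma measurable_diff_op:
  assumes F: "(\<lambda>(x, \<mu>). F x \<mu>) \<in> borel_measurable (N \<Otimes>\<^sub>M point_algebra L)" and Y: "Y \<in> N \<rightarrow>\<^sub>M L"
  shows "(\<lambda>(x, \<mu>). diff_op (Y x) (F x) \<mu>) \<in> borel_measurable (N \<Otimes>\<^sub>M point_algebra L)"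
proof -
  note [measurable] = Y
  have [measurable]: "(\<lambda>p. F (fst p) (snd p)) \<in> borel_measurable (N \<Otimes>\<^sub>M point_algebra L)"
    using F by (simp add: case_prod_beta)
  have "(\<lambda>p. (fst p, add_point (snd p) (Y (fst p)))) \<in> N \<Otimes>\<^sub>M point_algebra L \<rightarrow>\<^sub>M N \<Otimes>\<^sub>M point_algebra L"
    by measurable
  from measurable_compose[OF this F]
  have "(\<lambda>p. F (fst p) (add_point (snd p) (Y (fst p)))) \<in> borel_measurable (N \<Otimes>\<^sub>M point_algebra L)"
    by simp
  then show ?thesis unfolding diff_op_def case_prod_beta by measurable
qed

lemma measurable_diff_ops:
  assumes "(\<lambda>(x, \<mu>). F x \<mu>) \<in> borel_measurable (N \<Otimes>\<^sub>M point_algebra L)" "\<And>j. j \<in> set js \<Longrightarrow> Y j \<in> N \<rightarrow>\<^sub>M L"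
  shows "(\<lambda>(x, \<mu>). diff_ops (map (\<lambda>j. Y j x) js) (F x) \<mu>) \<in> borel_measurable (N \<Otimes>\<^sub>M point_algebra L)"
  using assms(2) by (induction js) (auto intro: assms(1) measurable_diff_op)

lemma measurable_iter_diff:
  assumes f: "f \<in> borel_measurable (point_algebra L)"
  shows "(\<lambda>(y, \<mu>). iter_diff n f y \<mu>) \<in> borel_measurable (power_measure L n \<Otimes>\<^sub>M point_algebra L)"
  unfolding iter_diff_def
  using measurable_diff_ops[of "\<lambda>_. f" "power_measure L n" L "[0..<n]" "\<lambda>j y. y j"] f by simp

section \<open>Poisson variables\<close>

definition poisson_weight :: "real \<Rightarrow> nat \<Rightarrow> real" where
  "poisson_weight a k = exp (- a) * a ^ k / fact k"

lemma poisson_weight_nonneg [simp]: "0 \<le> a \<Longrightarrow> 0 \<le> poisson_weight a k"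
  by (simp add: poisson_weight_def)

lemma poisson_weight_Suc: "real (Suc k) * poisson_weight a (Suc k) = a * poisson_weight a k"
  unfolding poisson_weight_def fact_Suc power_Suc by (simp add: field_simps del: of_nat_Suc)

text \<open>The probability generating function at \<open>r\<close>: the value \<open>r = 1\<close>
  gives total mass 1, other values give the exponential moments.\<close>

lemma poisson_weight_sums: "(\<lambda>k. r ^ k * poisson_weight a k) sums exp ((r - 1) * a)"
proof -
  have "(\<lambda>k. exp (- a) * ((r * a) ^ k /\<^sub>R fact k)) sums (exp (- a) * exp (r * a))"
    by (intro sums_mult exp_converges)
  moreover have "exp (- a) * ((r * a) ^ k /\<^sub>R fact k) = r ^ k * poisson_weight a k" for k
    by (simp add: poisson_weight_def power_mult_distrib divide_inverse)
  moreover have "exp (- a) * exp (r * a) = exp ((r - 1) * a)"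
    by (simp add: exp_add[symmetric] algebra_simps)
  ultimately show ?thesis by simp
qed

context prob_space
begin

context
  fixes Z :: "'a \<Rightarrow> ennreal" and c :: ennreal
  assumes Z: "poisson_distributed M Z c" and c: "c < \<infinity>"
begin

lemma poisson_measurable: "Z \<in> borel_measurable M"
  using Z by (simp add: poisson_distributed_def)

lemma poisson_prob: "prob {\<omega> \<in> space M. Z \<omega> = of_nat k} = poisson_weight (enn2real c) k"
  using Z c by (simp add: poisson_distributed_def poisson_weight_def)

text \<open>Only the probabilities of natural values are given; they add up to 1, which leaves no
  mass for anything else.\<close>

lemma poisson_AE: "AE \<omega> in M. \<exists>k::nat. Z \<omega> = of_nat k"
proof -
  note [measurable] = poisson_measurable
  have "(\<lambda>k::nat. prob {\<omega> \<in> space M. Z \<omega> = of_nat k}) sums prob (\<Union>k::nat. {\<omega> \<in> space M. Z \<omega> = of_nat k})"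
    by (rule finite_measure_UNION) (auto simp: disjoint_family_on_def)
  moreover have "(\<lambda>k::nat. prob {\<omega> \<in> space M. Z \<omega> = of_nat k}) sums 1"
    using poisson_weight_sums[of 1 "enn2real c"] by (simp add: poisson_prob)
  ultimately have "prob (\<Union>k::nat. {\<omega> \<in> space M. Z \<omega> = of_nat k}) = 1"
    by (rule sums_unique2)
  from AE_prob_1[OF this] show ?thesis by eventually_elim auto
qed

lemma nn_integral_poisson:
  "(\<integral>\<^sup>+\<omega>. h (Z \<omega>) \<partial>M) = (\<Sum>k. h (of_nat k) * ennreal (poisson_weight (enn2real c) k))"
proof -
  note [measurable] = poisson_measurable
  have "(\<integral>\<^sup>+\<omega>. h (Z \<omega>) \<partial>M) = (\<integral>\<^sup>+\<omega>. (\<Sum>k. h (of_nat k) * indicator {\<omega> \<in> space M. Z \<omega> = of_nat k} \<omega>) \<partial>M)"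
  proof (rule nn_integral_cong_AE, use poisson_AE AE_space in eventually_elim)
    case (elim \<omega>)
    then obtain k :: nat where k: "Z \<omega> = of_nat k" by blast
    have "(\<Sum>j. h (of_nat j) * indicator {\<omega> \<in> space M. Z \<omega> = of_nat j} \<omega>) =
        (\<Sum>j\<in>{k}. h (of_nat j) * indicator {\<omega> \<in> space M. Z \<omega> = of_nat j} \<omega>)"
      by (rule suminf_finite) (auto simp: k)
    then show ?case using k elim by simp
  qed
  also have "\<dots> = (\<Sum>k. \<integral>\<^sup>+\<omega>. h (of_nat k) * indicator {\<omega> \<in> space M. Z \<omega> = of_nat k} \<omega> \<partial>M)"
    by (rule nn_integral_suminf) measurable
  also have "\<dots> = (\<Sum>k. h (of_nat k) * ennreal (poisson_weight (enn2real c) k))"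
    by (intro suminf_cong, subst nn_integral_cmult_indicator) (simp_all add: emeasure_eq_measure poisson_prob)
  finally show ?thesis .
qed

text \<open>The Mecke equation for a single count. It is the recursion
  \<open>(k + 1) p (k + 1) = c p k\<close> of the Poisson weights in integrated form.\<close>

lemma nn_integral_poisson_mult:
  "(\<integral>\<^sup>+\<omega>. Z \<omega> * h (Z \<omega>) \<partial>M) = c * (\<integral>\<^sup>+\<omega>. h (Z \<omega> + 1) \<partial>M)"
proof -
  let ?p = "\<lambda>k. ennreal (poisson_weight (enn2real c) k)"
  have p: "of_nat (Suc k) * ?p (Suc k) = c * ?p k" for k
  proof -
    have "of_nat (Suc k) * ?p (Suc k) = ennreal (real (Suc k) * poisson_weight (enn2real c) (Suc k))"
      unfolding ennreal_of_nat_eq_real_of_nat by (rule ennreal_mult'[symmetric]) simp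
    also have "\<dots> = ennreal (enn2real c) * ?p k"
      by (simp only: poisson_weight_Suc) (rule ennreal_mult', simp)
    finally show ?thesis using c by simp
  qed
  have "(\<integral>\<^sup>+\<omega>. Z \<omega> * h (Z \<omega>) \<partial>M) = (\<Sum>k. of_nat k * h (of_nat k) * ?p k)"
    by (rule nn_integral_poisson)
  \<comment> \<open>The term with \<open>k = 0\<close> vanishes because of its factor
    \<open>k\<close>, so the sum may start at 1.\<close>
  also have "\<dots> = (\<Sum>k. of_nat (Suc k) * h (of_nat (Suc k)) * ?p (Suc k))"
  proof -
    have "(\<lambda>k. of_nat (Suc k) * h (of_nat (Suc k)) * ?p (Suc k)) sums (\<Sum>k. of_nat (Suc k) * h (of_nat (Suc k)) * ?p (Suc k))"
      by (rule summable_sums) simp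
    from sums_Suc[OF this] show ?thesis by (simp add: sums_iff)
  qed
  also have "\<dots> = (\<Sum>k. c * (h (of_nat k + 1) * ?p k))"
  proof (rule suminf_cong)
    fix k
    have "of_nat (Suc k) * h (of_nat (Suc k)) * ?p (Suc k) = h (of_nat k + 1) * (of_nat (Suc k) * ?p (Suc k))"
      by (simp add: ac_simps)
    also have "\<dots> = c * (h (of_nat k + 1) * ?p k)" unfolding p by (simp add: ac_simps)
    finally show "of_nat (Suc k) * h (of_nat (Suc k)) * ?p (Suc k) = c * (h (of_nat k + 1) * ?p k)" .
  qed
  also have "\<dots> = c * (\<integral>\<^sup>+\<omega>. h (Z \<omega> + 1) \<partial>M)"
    by (simp add: nn_integral_poisson[of "\<lambda>z. h (z + 1)"])
  finally show ?thesis .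
qed

lemma nn_integral_poisson_powr:
  assumes "r > 0"
  shows "(\<integral>\<^sup>+\<omega>. ennreal (r powr enn2real (Z \<omega>)) \<partial>M) < \<infinity>"
proof -
  have "(\<integral>\<^sup>+\<omega>. ennreal (r powr enn2real (Z \<omega>)) \<partial>M) = (\<Sum>k. ennreal (r ^ k * poisson_weight (enn2real c) k))"
    using assms by (simp add: nn_integral_poisson[of "\<lambda>z. ennreal (r powr enn2real z)"] powr_realpow ennreal_mult'')
  also have "\<dots> = ennreal (exp ((r - 1) * enn2real c))"
    using assms by (intro suminf_ennreal_eq poisson_weight_sums) simp
  finally show ?thesis by simp
qed

end

end

section \<open>The Mecke equation\<close>

locale poisson_points = prob_space M + L: sigma_finite_measure L
  for M :: "'w measure" and L :: "'a measure" +
  fixes \<eta> :: "'w \<Rightarrow> 'a measure" and X :: "nat \<Rightarrow> 'w \<Rightarrow> 'a"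
  assumes process: "poisson_process M L \<eta>"
    and X_measurable [measurable]: "\<And>i. X i \<in> M \<rightarrow>\<^sub>M L"
    and representation: "\<And>\<omega>. \<omega> \<in> space M \<Longrightarrow> \<eta> \<omega> = point_sum L (emeasure (\<eta> \<omega>) (space L)) (\<lambda>i. X i \<omega>)"
begin

lemma eta_measurable [measurable]: "\<eta> \<in> M \<rightarrow>\<^sub>M point_algebra L"
  using process by (simp add: poisson_process_def)

lemma eta_point_measure: "\<omega> \<in> space M \<Longrightarrow> \<eta> \<omega> \<in> point_measures L"
  using measurable_space[OF eta_measurable] by simp

lemma eta_sets: "\<omega> \<in> space M \<Longrightarrow> sets (\<eta> \<omega>) = sets L"
  and eta_space: "\<omega> \<in> space M \<Longrightarrow> space (\<eta> \<omega>) = space L"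
  by (rule point_measuresD[OF eta_point_measure], assumption)+

lemma eta_poisson: "B \<in> sets L \<Longrightarrow> poisson_distributed M (\<lambda>\<omega>. emeasure (\<eta> \<omega>) B) (emeasure L B)"
  using process by (simp add: poisson_process_def)

lemma eta_indep:
  assumes "\<And>i. i < n \<Longrightarrow> B i \<in> sets L" "disjoint_family_on B {..<n::nat}"
  shows "indep_vars (\<lambda>_. borel) (\<lambda>i \<omega>. emeasure (\<eta> \<omega>) (B i)) {..<n}"
  using process assms by (simp add: poisson_process_def)

text \<open>Independence makes the law of the vector of counts a product measure; integrating over
  coordinate \<open>m\<close> with the others fixed reduces the claim to the Mecke equation for one
  Poisson variable.\<close>

lemma nn_integral_eta_disjoint:
  fixes A :: "nat \<Rightarrow> 'a set" and n :: nat
  defines "N \<equiv> \<lambda>\<omega>. \<lambda>i\<in>{..<n}. emeasure (\<eta> \<omega>) (A i)"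
  assumes A: "\<And>i. A i \<in> sets L" and disj: "disjoint_family_on A {..<n}"
    and m: "m < n" and fin: "emeasure L (A m) < \<infinity>"
    and h [measurable]: "h \<in> borel_measurable (Pi\<^sub>M {..<n} (\<lambda>_. borel))"
  shows "(\<integral>\<^sup>+\<omega>. N \<omega> m * h (N \<omega>) \<partial>M) = emeasure L (A m) * (\<integral>\<^sup>+\<omega>. h ((N \<omega>)(m := N \<omega> m + 1)) \<partial>M)"
proof -
  define D where "D i = distr M borel (\<lambda>\<omega>. emeasure (\<eta> \<omega>) (A i))" for i
  note [measurable] = A
  interpret D: prob_space "D i" for i
    unfolding D_def by (rule prob_space_distr) measurable
  interpret D: product_sigma_finite D by standard
  have setsD: "sets (D i) = sets borel" for i by (simp add: D_def)
  have N [measurable]: "N \<in> M \<rightarrow>\<^sub>M Pi\<^sub>M {..<n} (\<lambda>_. borel)" unfolding N_def by measurable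
  have setsPi: "sets (Pi\<^sub>M I D) = sets (Pi\<^sub>M I (\<lambda>_. borel :: ennreal measure))" for I
    by (intro sets_PiM_cong refl setsD)
  \<comment> \<open>Independence in the form of a product law; \<open>m < n\<close> supplies the
    nonempty index set that this characterisation requires.\<close>
  have dN: "distr M (Pi\<^sub>M {..<n} (\<lambda>_. borel)) N = Pi\<^sub>M {..<n} D"
    using eta_indep[of n A] A disj unfolding N_def D_def
    by (subst (asm) indep_vars_iff_distr_eq_PiM') (use m in auto)
  let ?J = "{..<n} - {m}"
  have ins: "insert m ?J = {..<n}" using m by auto
  have fold: "(\<integral>\<^sup>+x. g x \<partial>Pi\<^sub>M {..<n} D) = (\<integral>\<^sup>+x. \<integral>\<^sup>+y. g (x(m := y)) \<partial>D m \<partial>Pi\<^sub>M ?J D)"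
    if "g \<in> borel_measurable (Pi\<^sub>M {..<n} (\<lambda>_. borel))" for g
    using D.product_nn_integral_insert[of ?J m g] that unfolding ins
    by (simp add: measurable_cong_sets[OF setsPi refl])
  have upd [measurable]: "(\<lambda>x. x(m := x m + 1)) \<in> Pi\<^sub>M {..<n} (\<lambda>_. borel) \<rightarrow>\<^sub>M Pi\<^sub>M {..<n} (\<lambda>_. borel :: ennreal measure)"
    using m by (intro measurable_fun_upd[where J="{..<n}"]) (auto simp: insert_absorb)
  have inner: "(\<integral>\<^sup>+y. y * h (x(m := y)) \<partial>D m) = emeasure L (A m) * (\<integral>\<^sup>+y. h (x(m := y + 1)) \<partial>D m)"
    if x: "x \<in> space (Pi\<^sub>M ?J D)" for x
  proof -
    have [measurable]: "(\<lambda>y. x(m := y)) \<in> borel \<rightarrow>\<^sub>M Pi\<^sub>M {..<n} (\<lambda>_. borel :: ennreal measure)"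
      by (rule measurable_fun_upd[where J="?J"]) (use m x in \<open>auto simp: space_PiM D_def\<close>)
    have "(\<integral>\<^sup>+y. y * h (x(m := y)) \<partial>D m) = (\<integral>\<^sup>+\<omega>. emeasure (\<eta> \<omega>) (A m) * h (x(m := emeasure (\<eta> \<omega>) (A m))) \<partial>M)"
      unfolding D_def by (subst nn_integral_distr) auto
    also have "\<dots> = emeasure L (A m) * (\<integral>\<^sup>+\<omega>. h (x(m := emeasure (\<eta> \<omega>) (A m) + 1)) \<partial>M)"
      using nn_integral_poisson_mult[OF eta_poisson[OF A[of m]] fin, of "\<lambda>y. h (x(m := y))"] by simp
    also have "(\<integral>\<^sup>+\<omega>. h (x(m := emeasure (\<eta> \<omega>) (A m) + 1)) \<partial>M) = (\<integral>\<^sup>+y. h (x(m := y + 1)) \<partial>D m)"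
      unfolding D_def by (subst nn_integral_distr) auto
    finally show ?thesis .
  qed
  have "(\<integral>\<^sup>+\<omega>. N \<omega> m * h (N \<omega>) \<partial>M) = (\<integral>\<^sup>+x. x m * h x \<partial>Pi\<^sub>M {..<n} D)"
    unfolding dN[symmetric] using m by (subst nn_integral_distr) auto
  also have "\<dots> = (\<integral>\<^sup>+x. \<integral>\<^sup>+y. (x(m := y)) m * h (x(m := y)) \<partial>D m \<partial>Pi\<^sub>M ?J D)"
    using m by (intro fold) simp
  also have "\<dots> = (\<integral>\<^sup>+x. emeasure L (A m) * (\<integral>\<^sup>+y. h (x(m := y + 1)) \<partial>D m) \<partial>Pi\<^sub>M ?J D)"
    by (intro nn_integral_cong) (simp add: inner)
  also have "\<dots> = emeasure L (A m) * (\<integral>\<^sup>+x. (\<integral>\<^sup>+y. h ((x(m := y))(m := (x(m := y)) m + 1)) \<partial>D m) \<partial>Pi\<^sub>M ?J D)"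
  proof (subst nn_integral_cmult)
    have "(\<lambda>(x, y). x(m := y)) \<in> Pi\<^sub>M ?J D \<Otimes>\<^sub>M D m \<rightarrow>\<^sub>M Pi\<^sub>M (insert m ?J) D"
      by (rule measurable_add_dim)
    then have [measurable]: "(\<lambda>p. (fst p)(m := snd p)) \<in> Pi\<^sub>M ?J D \<Otimes>\<^sub>M D m \<rightarrow>\<^sub>M Pi\<^sub>M {..<n} (\<lambda>_. borel)"
      unfolding ins by (simp add: case_prod_beta measurable_cong_sets[OF refl setsPi])
    have "(\<lambda>p. h (((fst p)(m := snd p))(m := ((fst p)(m := snd p)) m + 1))) \<in> borel_measurable (Pi\<^sub>M ?J D \<Otimes>\<^sub>M D m)"
      by (rule measurable_compose[OF _ h], rule measurable_compose[OF _ upd]) measurable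
    then show "(\<lambda>x. \<integral>\<^sup>+y. h (x(m := y + 1)) \<partial>D m) \<in> borel_measurable (Pi\<^sub>M ?J D)"
      by (intro D.borel_measurable_nn_integral) (simp add: case_prod_beta)
  qed simp
  also have "(\<integral>\<^sup>+x. (\<integral>\<^sup>+y. h ((x(m := y))(m := (x(m := y)) m + 1)) \<partial>D m) \<partial>Pi\<^sub>M ?J D) = (\<integral>\<^sup>+x. h (x(m := x m + 1)) \<partial>Pi\<^sub>M {..<n} D)"
    by (rule fold[symmetric]) (rule measurable_compose[OF upd h])
  also have "\<dots> = (\<integral>\<^sup>+\<omega>. h ((N \<omega>)(m := N \<omega> m + 1)) \<partial>M)"
    unfolding dN[symmetric] by (subst nn_integral_distr) auto
  finally show ?thesis .
qed

text \<open>The sets prescribed by \<open>a\<close>, together with \<open>B\<close>, may overlap, so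
  their counts need not be independent. But they are unions of finitely many disjoint atoms of the
  set algebra they generate. On the atoms the statement for independent counts applies, and summing
  over the atoms inside \<open>B\<close> gives the claim.\<close>

lemma mecke_generator:
  assumes a: "a \<in> point_generator L" and B: "B \<in> finite_sets L"
  shows "(\<integral>\<^sup>+\<omega>. emeasure (\<eta> \<omega>) B * indicator a (\<eta> \<omega>) \<partial>M) =
    (\<integral>\<^sup>+y. (\<integral>\<^sup>+\<omega>. indicator a (add_point (\<eta> \<omega>) y) \<partial>M) * indicator B y \<partial>L)"
proof -
  obtain S :: "('a set \<times> nat) set" where S:
    "a = {\<mu> \<in> point_measures L. \<forall>(C, k)\<in>S. emeasure \<mu> C = of_nat k}" "finite S" "fst ` S \<subseteq> finite_sets L"
    using a unfolding point_generator_def by blast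
  define F where "F = insert B (fst ` S)"
  have F: "finite F" "F \<subseteq> finite_sets L" using S B by (auto simp: F_def)
  then have F_sets: "C \<in> F \<Longrightarrow> C \<in> sets L" for C using finite_setsD by auto
  obtain e where e: "bij_betw e {0..<card (Pow F - {{}})} (Pow F - {{}})"
    using ex_bij_betw_nat_finite F(1) by (metis finite_Diff finite_Pow_iff)
  define n where "n = card (Pow F - {{}})"
  \<comment> \<open>\<open>A i\<close> collects the points whose pattern of membership in the sets
    of \<open>F\<close> is \<open>e i\<close>. The empty pattern is left out: its atom is the
    complement of all these sets and may have infinite intensity.\<close>
  define A where "A i = {y \<in> space L. {C \<in> F. y \<in> C} = e i}" for i
  have e_bij: "bij_betw e {..<n} (Pow F - {{}})"
    using e by (simp add: n_def atLeast0LessThan)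
  have A_sets: "A i \<in> sets L" for i
  proof (cases "e i \<subseteq> F")
    case True
    then have "A i = {y \<in> space L. \<forall>C\<in>F. y \<in> (if C \<in> e i then C else space L - C)}"
      unfolding A_def by (auto split: if_splits)
    also have "\<dots> \<in> sets L"
    proof (rule sets.sets_Collect_finite_All[OF _ F(1)])
      fix C assume "C \<in> F"
      then have [measurable]: "(if C \<in> e i then C else space L - C) \<in> sets L" using F_sets by auto
      show "{y \<in> space L. y \<in> (if C \<in> e i then C else space L - C)} \<in> sets L" by measurable
    qed
    finally show ?thesis .
  next
    case False
    then have "A i = {}" unfolding A_def by auto
    then show ?thesis by simp
  qed
  have A_disj: "disjoint_family_on A {..<n}"
    using e_bij by (auto simp: disjoint_family_on_def A_def bij_betw_def inj_on_def)
  have A_unique: "\<exists>i<n. y \<in> A i" if "C \<in> F" "y \<in> C" for C y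
  proof -
    have "y \<in> space L" using F_sets[OF that(1)] sets.sets_into_space that(2) by blast
    moreover have "{C \<in> F. y \<in> C} \<in> Pow F - {{}}" using that by auto
    then have "{C \<in> F. y \<in> C} \<in> e ` {..<n}"
      using bij_betw_imp_surj_on[OF e_bij] by simp
    then obtain i where "{C \<in> F. y \<in> C} = e i" "i \<in> {..<n}" by (rule imageE)
    ultimately show ?thesis by (auto simp: A_def)
  qed
  define I where "I C = {i\<in>{..<n}. C \<in> e i}" for C
  have C_eq: "C = (\<Union>i\<in>I C. A i)" if C: "C \<in> F" for C
  proof (rule set_eqI)
    fix y
    show "y \<in> C \<longleftrightarrow> y \<in> (\<Union>i\<in>I C. A i)"
    proof
      assume y: "y \<in> C"
      then obtain i where i: "i < n" "y \<in> A i" using A_unique[OF C] by blast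
      then have "C \<in> e i" using y C by (auto simp: A_def)
      then show "y \<in> (\<Union>i\<in>I C. A i)" using i by (auto simp: I_def)
    next
      assume "y \<in> (\<Union>i\<in>I C. A i)"
      then obtain i where "C \<in> e i" "y \<in> A i" by (auto simp: I_def)
      then show "y \<in> C" by (auto simp: A_def)
    qed
  qed
  have A_fin: "emeasure L (A i) < \<infinity>" if "i < n" for i
  proof -
    have "e i \<in> Pow F - {{}}" using e_bij that by (auto simp: bij_betw_def)
    then obtain C where C: "C \<in> e i" "C \<in> F" by blast
    then have "A i \<subseteq> C" by (auto simp: A_def)
    then have "emeasure L (A i) \<le> emeasure L C" using C F_sets by (intro emeasure_mono) auto
    also have "\<dots> < \<infinity>" by (rule finite_setsD(2)[OF subsetD[OF F(2) C(2)]])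
    finally show ?thesis .
  qed
  have sum_C: "emeasure \<mu> C = (\<Sum>i\<in>I C. emeasure \<mu> (A i))" if "C \<in> F" "sets \<mu> = sets L" for C and \<mu> :: "'a measure"
    using C_eq[OF that(1)] A_sets A_disj that(2)
    by (subst C_eq[OF that(1)], intro sum_emeasure[symmetric])
       (auto simp: I_def disjoint_family_on_def)
  define N where "N \<omega> = (\<lambda>i\<in>{..<n}. emeasure (\<eta> \<omega>) (A i))" for \<omega>
  \<comment> \<open>The event \<open>a\<close>, expressed through the counts of the atoms
    alone.\<close>
  define h :: "(nat \<Rightarrow> ennreal) \<Rightarrow> ennreal" where
    "h x = indicator {x. \<forall>p\<in>S. (\<Sum>i\<in>I (fst p). x i) = of_nat (snd p)} x" for x
  have h [measurable]: "h \<in> borel_measurable (Pi\<^sub>M {..<n} (\<lambda>_. borel))"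
  proof -
    have "{x \<in> space (Pi\<^sub>M {..<n} (\<lambda>_. borel)). \<forall>p\<in>S. (\<Sum>i\<in>I (fst p). x i) = (of_nat (snd p) :: ennreal)} \<in> sets (Pi\<^sub>M {..<n} (\<lambda>_. borel))"
    proof (rule sets.sets_Collect_finite_All[OF _ S(2)])
      fix p :: "'a set \<times> nat"
      have [measurable]: "(\<lambda>x. \<Sum>i\<in>I (fst p). x i) \<in> borel_measurable (Pi\<^sub>M {..<n} (\<lambda>_. borel :: ennreal measure))"
        by (intro borel_measurable_sum measurable_component_singleton) (auto simp: I_def)
      show "{x \<in> space (Pi\<^sub>M {..<n} (\<lambda>_. borel)). (\<Sum>i\<in>I (fst p). x i) = (of_nat (snd p) :: ennreal)} \<in> sets (Pi\<^sub>M {..<n} (\<lambda>_. borel))"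
        by measurable
    qed
    then show ?thesis unfolding h_def by (simp add: borel_measurable_indicator_iff Int_def conj_commute)
  qed
  have a_h: "indicator a \<mu> = h (\<lambda>i\<in>{..<n}. emeasure \<mu> (A i))" if "\<mu> \<in> point_measures L" for \<mu>
  proof -
    have "emeasure \<mu> (fst p) = (\<Sum>i\<in>I (fst p). (\<lambda>i\<in>{..<n}. emeasure \<mu> (A i)) i)" if "p \<in> S" for p
      using sum_C[of "fst p" \<mu>] that \<open>\<mu> \<in> point_measures L\<close>
      by (auto simp: F_def point_measuresD I_def intro!: sum.cong)
    then have "(\<forall>(C, k)\<in>S. emeasure \<mu> C = of_nat k) \<longleftrightarrow>
        (\<forall>p\<in>S. (\<Sum>i\<in>I (fst p). (\<lambda>i\<in>{..<n}. emeasure \<mu> (A i)) i) = of_nat (snd p))"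
      unfolding case_prod_beta by (intro ball_cong refl) (simp only:)
    with that show ?thesis unfolding h_def S(1) indicator_def mem_Collect_eq by simp
  qed
  \<comment> \<open>The atoms are disjoint, so a point added in \<open>A m\<close> raises exactly
    the count with index \<open>m\<close>.\<close>
  have shift: "indicator a (add_point (\<eta> \<omega>) y) = h ((N \<omega>)(m := N \<omega> m + 1))" if "m < n" "y \<in> A m" "\<omega> \<in> space M" for m y \<omega>
  proof -
    have "(\<lambda>i\<in>{..<n}. emeasure (add_point (\<eta> \<omega>) y) (A i)) = (N \<omega>)(m := N \<omega> m + 1)"
    proof
      fix i
      have "y \<notin> A i" if "i < n" "i \<noteq> m" using A_disj that \<open>m < n\<close> \<open>y \<in> A m\<close>
        by (auto simp: disjoint_family_on_def)
      then show "(\<lambda>i\<in>{..<n}. emeasure (add_point (\<eta> \<omega>) y) (A i)) i = ((N \<omega>)(m := N \<omega> m + 1)) i"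
        using that A_sets by (auto simp: N_def emeasure_add_point eta_sets)
    qed
    with a_h[OF add_point_in_point_measures[OF eta_point_measure[OF that(3)]]] show ?thesis by simp
  qed
  have B: "B \<in> F" by (simp add: F_def)
  have "(\<integral>\<^sup>+\<omega>. emeasure (\<eta> \<omega>) B * indicator a (\<eta> \<omega>) \<partial>M) = (\<integral>\<^sup>+\<omega>. (\<Sum>m\<in>I B. N \<omega> m * h (N \<omega>)) \<partial>M)"
    using sum_C[OF B] a_h[OF eta_point_measure]
    by (intro nn_integral_cong) (auto simp: eta_sets N_def I_def sum_distrib_right intro!: sum.cong)
  also have "\<dots> = (\<Sum>m\<in>I B. \<integral>\<^sup>+\<omega>. N \<omega> m * h (N \<omega>) \<partial>M)"
  proof (rule nn_integral_sum)
    have N [measurable]: "N \<in> M \<rightarrow>\<^sub>M Pi\<^sub>M {..<n} (\<lambda>_. borel)" unfolding N_def using A_sets by measurable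
    show "(\<lambda>\<omega>. N \<omega> m * h (N \<omega>)) \<in> borel_measurable M" if "m \<in> I B" for m
    proof -
      have [measurable]: "(\<lambda>\<omega>. N \<omega> m) \<in> borel_measurable M"
        using measurable_compose[OF N measurable_component_singleton[of m "{..<n}"]] that by (simp add: I_def)
      show ?thesis by measurable
    qed
  qed
  also have "\<dots> = (\<Sum>m\<in>I B. emeasure L (A m) * (\<integral>\<^sup>+\<omega>. h ((N \<omega>)(m := N \<omega> m + 1)) \<partial>M))"
    unfolding N_def
    by (intro sum.cong refl nn_integral_eta_disjoint A_sets A_disj A_fin h) (auto simp: I_def)
  also have "\<dots> = (\<Sum>m\<in>I B. \<integral>\<^sup>+y. (\<integral>\<^sup>+\<omega>. indicator a (add_point (\<eta> \<omega>) y) \<partial>M) * indicator (A m) y \<partial>L)"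
  proof (rule sum.cong[OF refl])
    fix m assume m: "m \<in> I B"
    have "(\<integral>\<^sup>+y. (\<integral>\<^sup>+\<omega>. indicator a (add_point (\<eta> \<omega>) y) \<partial>M) * indicator (A m) y \<partial>L) =
      (\<integral>\<^sup>+y. (\<integral>\<^sup>+\<omega>. h ((N \<omega>)(m := N \<omega> m + 1)) \<partial>M) * indicator (A m) y \<partial>L)"
      using m shift by (intro nn_integral_cong) (auto simp: I_def indicator_def intro!: nn_integral_cong)
    also have "\<dots> = emeasure L (A m) * (\<integral>\<^sup>+\<omega>. h ((N \<omega>)(m := N \<omega> m + 1)) \<partial>M)"
      using A_sets by (subst nn_integral_cmult_indicator) (simp_all add: mult.commute)
    finally show "emeasure L (A m) * (\<integral>\<^sup>+\<omega>. h ((N \<omega>)(m := N \<omega> m + 1)) \<partial>M) =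
      (\<integral>\<^sup>+y. (\<integral>\<^sup>+\<omega>. indicator a (add_point (\<eta> \<omega>) y) \<partial>M) * indicator (A m) y \<partial>L)" by simp
  qed
  also have "\<dots> = (\<integral>\<^sup>+y. (\<Sum>m\<in>I B. (\<integral>\<^sup>+\<omega>. indicator a (add_point (\<eta> \<omega>) y) \<partial>M) * indicator (A m) y) \<partial>L)"
  proof (rule nn_integral_sum[symmetric])
    have "a \<in> sets (point_algebra L)" using a by (simp add: L.sets_point_algebra)
    then have "(\<lambda>p. indicator a (add_point (\<eta> (snd p)) (fst p)) :: ennreal) \<in> borel_measurable (L \<Otimes>\<^sub>M M)"
      by measurable
    then have [measurable]: "(\<lambda>y. \<integral>\<^sup>+\<omega>. indicator a (add_point (\<eta> \<omega>) y) \<partial>M) \<in> borel_measurable L"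
      by (intro borel_measurable_nn_integral) (simp add: case_prod_beta)
    show "(\<lambda>y. (\<integral>\<^sup>+\<omega>. indicator a (add_point (\<eta> \<omega>) y) \<partial>M) * indicator (A m) y) \<in> borel_measurable L" for m
      using A_sets[of m] by measurable
  qed
  also have "\<dots> = (\<integral>\<^sup>+y. (\<integral>\<^sup>+\<omega>. indicator a (add_point (\<eta> \<omega>) y) \<partial>M) * indicator B y \<partial>L)"
  proof (rule nn_integral_cong)
    fix y
    have "(\<Sum>m\<in>I B. indicator (A m) y) = (indicator (\<Union>m\<in>I B. A m) y :: ennreal)"
      using A_disj by (intro indicator_UN_disjoint[symmetric]) (auto simp: I_def disjoint_family_on_def)
    then show "(\<Sum>m\<in>I B. (\<integral>\<^sup>+\<omega>. indicator a (add_point (\<eta> \<omega>) y) \<partial>M) * indicator (A m) y) =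
        (\<integral>\<^sup>+\<omega>. indicator a (add_point (\<eta> \<omega>) y) \<partial>M) * indicator B y"
      unfolding sum_distrib_left[symmetric] C_eq[OF B, symmetric] by simp
  qed
  finally show ?thesis .
qed

text \<open>For fixed \<open>B\<close> both sides are measures in \<open>a\<close>: the law of
  \<open>\<eta>\<close> weighted by \<open>\<eta>(B)\<close>, and the law of
  \<open>\<eta> + \<delta>_y\<close> with \<open>y\<close> distributed according to \<open>L\<close>
  on \<open>B\<close>. They agree on the generator, and their total mass \<open>L(B)\<close> is
  finite, so they coincide.\<close>

lemma mecke_sets:
  assumes a: "a \<in> sets (point_algebra L)" and B: "B \<in> finite_sets L"
  shows "(\<integral>\<^sup>+\<omega>. emeasure (\<eta> \<omega>) B * indicator a (\<eta> \<omega>) \<partial>M) =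
    (\<integral>\<^sup>+y. (\<integral>\<^sup>+\<omega>. indicator a (add_point (\<eta> \<omega>) y) \<partial>M) * indicator B y \<partial>L)"
proof -
  interpret LM: pair_sigma_finite L M ..
  note [measurable] = finite_setsD(1)[OF B]
  define P where "P = distr (density M (\<lambda>\<omega>. emeasure (\<eta> \<omega>) B)) (point_algebra L) \<eta>"
  define Q where "Q = distr (density (L \<Otimes>\<^sub>M M) (\<lambda>(y, \<omega>). indicator B y)) (point_algebra L) (\<lambda>(y, \<omega>). add_point (\<eta> \<omega>) y)"
  have P: "emeasure P a = (\<integral>\<^sup>+\<omega>. emeasure (\<eta> \<omega>) B * indicator a (\<eta> \<omega>) \<partial>M)" if [measurable]: "a \<in> sets (point_algebra L)" for a
  proof -
    have "emeasure P a = (\<integral>\<^sup>+\<mu>. indicator a \<mu> \<partial>P)" by (simp add: P_def)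
    also have "\<dots> = (\<integral>\<^sup>+\<omega>. emeasure (\<eta> \<omega>) B * indicator a (\<eta> \<omega>) \<partial>M)"
      unfolding P_def by (subst nn_integral_distr, measurable, subst nn_integral_density) auto
    finally show ?thesis .
  qed
  have Q: "emeasure Q a = (\<integral>\<^sup>+y. (\<integral>\<^sup>+\<omega>. indicator a (add_point (\<eta> \<omega>) y) \<partial>M) * indicator B y \<partial>L)" if [measurable]: "a \<in> sets (point_algebra L)" for a
  proof -
    have [measurable]: "(\<lambda>(y, \<omega>). indicator B y :: ennreal) \<in> borel_measurable (L \<Otimes>\<^sub>M M)"
      unfolding case_prod_beta by measurable
    have "emeasure Q a = (\<integral>\<^sup>+\<mu>. indicator a \<mu> \<partial>Q)" by (simp add: Q_def)
    also have "\<dots> = (\<integral>\<^sup>+p. indicator B (fst p) * indicator a (add_point (\<eta> (snd p)) (fst p)) \<partial>(L \<Otimes>\<^sub>M M))"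
      unfolding Q_def by (subst nn_integral_distr, measurable, subst nn_integral_density) (auto simp: case_prod_beta)
    also have "\<dots> = (\<integral>\<^sup>+y. \<integral>\<^sup>+\<omega>. indicator B y * indicator a (add_point (\<eta> \<omega>) y) \<partial>M \<partial>L)"
      by (subst nn_integral_fst[symmetric]) auto
    also have "\<dots> = (\<integral>\<^sup>+y. (\<integral>\<^sup>+\<omega>. indicator a (add_point (\<eta> \<omega>) y) \<partial>M) * indicator B y \<partial>L)"
      by (intro nn_integral_cong) (auto simp: indicator_def)
    finally show ?thesis .
  qed
  have "P = Q"
  proof (rule measure_eqI_generator_eq[OF Int_stable_point_generator point_generator_Pow])
    show "sets P = sigma_sets (point_measures L) (point_generator L)"
      "sets Q = sigma_sets (point_measures L) (point_generator L)"
      by (simp_all add: P_def Q_def L.sets_point_algebra)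
    show "emeasure P a = emeasure Q a" if "a \<in> point_generator L" for a
    proof -
      have "a \<in> sets (point_algebra L)" using that by (simp add: L.sets_point_algebra)
      then show ?thesis using mecke_generator[OF that B] by (simp add: P Q)
    qed
    show "range (\<lambda>_::nat. point_measures L) \<subseteq> point_generator L" by (simp add: point_measures_in_generator)
    show "emeasure P (point_measures L) \<noteq> \<infinity>"
    proof -
      have "point_measures L \<in> sets (point_algebra L)"
        using point_measures_in_generator[of L] by (simp add: L.sets_point_algebra)
      moreover have "(\<integral>\<^sup>+y. (\<integral>\<^sup>+\<omega>. indicator (point_measures L) (add_point (\<eta> \<omega>) y) \<partial>M) * indicator B y \<partial>L) =
          (\<integral>\<^sup>+y. indicator B y \<partial>L)"
        by (intro nn_integral_cong)
           (simp add: indicator_def add_point_in_point_measures eta_point_measure emeasure_space_1 cong: nn_integral_cong_simp)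
      ultimately show ?thesis
        using mecke_generator[OF point_measures_in_generator B] finite_setsD[OF B] by (simp add: P)
    qed
  qed auto
  then show ?thesis using P[OF a] Q[OF a] by simp
qed

text \<open>The random number of points is moved into an indicator over the fixed index set
  \<open>UNIV\<close>. This turns integrals against the random measure
  \<open>\<eta> \<omega>\<close> into integrals over a fixed product space.\<close>

lemma nn_integral_eta:
  assumes "\<omega> \<in> space M" and h: "h \<in> borel_measurable L"
  shows "(\<integral>\<^sup>+y. h y \<partial>\<eta> \<omega>) =
    (\<integral>\<^sup>+k. indicator {k. of_nat k < emeasure (\<eta> \<omega>) (space L)} k * h (X k \<omega>) \<partial>count_space UNIV)"
proof -
  let ?K = "{k::nat. of_nat k < emeasure (\<eta> \<omega>) (space L)}"
  have "(\<integral>\<^sup>+y. h y \<partial>\<eta> \<omega>) = (\<integral>\<^sup>+y. h y \<partial>distr (count_space ?K) L (\<lambda>k. X k \<omega>))"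
    by (subst representation[OF assms(1)]) (simp add: point_sum_def)
  also have "\<dots> = (\<integral>\<^sup>+k. h (X k \<omega>) \<partial>count_space ?K)"
    using measurable_space[OF X_measurable assms(1)] h by (subst nn_integral_distr) auto
  also have "\<dots> = (\<integral>\<^sup>+k. indicator ?K k * h (X k \<omega>) \<partial>count_space UNIV)"
    by (subst nn_integral_count_space_indicator) (auto simp: mult.commute)
  finally show ?thesis .
qed

lemma integral_eta:
  fixes h :: "'a \<Rightarrow> real"
  assumes "\<omega> \<in> space M" and h: "h \<in> borel_measurable L"
  shows "(\<integral>y. h y \<partial>\<eta> \<omega>) =
    (\<integral>k. indicator {k. of_nat k < emeasure (\<eta> \<omega>) (space L)} k * h (X k \<omega>) \<partial>count_space UNIV)"
proof -
  let ?K = "{k::nat. of_nat k < emeasure (\<eta> \<omega>) (space L)}"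
  have "(\<integral>y. h y \<partial>\<eta> \<omega>) = (\<integral>y. h y \<partial>distr (count_space ?K) L (\<lambda>k. X k \<omega>))"
    by (subst representation[OF assms(1)]) (simp add: point_sum_def)
  also have "\<dots> = (\<integral>k. h (X k \<omega>) \<partial>count_space ?K)"
    using measurable_space[OF X_measurable assms(1)] h by (subst integral_distr) auto
  also have "\<dots> = (\<integral>k. h (X k \<omega>) \<partial>restrict_space (count_space UNIV) ?K)"
    by (simp add: restrict_count_space)
  also have "\<dots> = (\<integral>k. indicator ?K k * h (X k \<omega>) \<partial>count_space UNIV)"
    by (subst integral_restrict_space) auto
  finally show ?thesis .
qed

section \<open>Campbell measures and the Mecke equation for functions of a configuration and a
  point\<close>

definition label_set :: "('w \<times> nat) set" where
  "label_set = {p \<in> space (M \<Otimes>\<^sub>M count_space UNIV). of_nat (snd p) < emeasure (\<eta> (fst p)) (space L)}"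

text \<open>The measure of pairs of a configuration and one of its points. It is built from the
  labels, as an image of \<open>M\<close> times counting measure, rather than by integrating the
  measures \<open>\<eta> \<omega>\<close>; the Fubini theorems for \<open>\<sigma>\<close>-finite
  products then apply, also to functions of varying sign.\<close>

definition campbell :: "('a measure \<times> 'a) measure" where
  "campbell = distr (restrict_space (M \<Otimes>\<^sub>M count_space UNIV) label_set) (point_algebra L \<Otimes>\<^sub>M L)
     (\<lambda>(\<omega>, k). (\<eta> \<omega>, X k \<omega>))"

definition shifted_campbell :: "('a measure \<times> 'a) measure" where
  "shifted_campbell = distr (L \<Otimes>\<^sub>M M) (point_algebra L \<Otimes>\<^sub>M L) (\<lambda>(y, \<omega>). (add_point (\<eta> \<omega>) y, y))"

lemma label_set [measurable]: "label_set \<in> sets (M \<Otimes>\<^sub>M count_space UNIV)"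
  unfolding label_set_def by measurable

lemma eta_X_measurable [measurable]:
  "(\<lambda>(\<omega>, k). (\<eta> \<omega>, X k \<omega>)) \<in> M \<Otimes>\<^sub>M count_space UNIV \<rightarrow>\<^sub>M point_algebra L \<Otimes>\<^sub>M L"
proof -
  have "(\<lambda>p. X (snd p) (fst p)) \<in> M \<Otimes>\<^sub>M count_space UNIV \<rightarrow>\<^sub>M L"
    by (rule measurable_compose_countable[where g=snd]) measurable
  then show ?thesis unfolding case_prod_beta by measurable
qed

lemma eta_X_restrict_measurable:
  "(\<lambda>(\<omega>, k). (\<eta> \<omega>, X k \<omega>)) \<in> restrict_space (M \<Otimes>\<^sub>M count_space UNIV) label_set \<rightarrow>\<^sub>M point_algebra L \<Otimes>\<^sub>M L"
  by (intro measurable_restrict_space1 eta_X_measurable)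

lemma nn_integral_campbell:
  assumes F [measurable]: "F \<in> borel_measurable (point_algebra L \<Otimes>\<^sub>M L)"
  shows "(\<integral>\<^sup>+p. F p \<partial>campbell) = (\<integral>\<^sup>+\<omega>. \<integral>\<^sup>+y. F (\<eta> \<omega>, y) \<partial>\<eta> \<omega> \<partial>M)"
proof -
  interpret C: sigma_finite_measure "count_space UNIV :: nat measure"
    by (rule sigma_finite_measure_count_space)
  have [measurable]: "(\<lambda>p. F (\<eta> (fst p), X (snd p) (fst p))) \<in> borel_measurable (M \<Otimes>\<^sub>M count_space UNIV)"
    using measurable_compose[OF eta_X_measurable F] by (simp add: case_prod_beta)
  have "(\<integral>\<^sup>+p. F p \<partial>campbell) = (\<integral>\<^sup>+p. F (\<eta> (fst p), X (snd p) (fst p)) \<partial>restrict_space (M \<Otimes>\<^sub>M count_space UNIV) label_set)"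
    unfolding campbell_def by (subst nn_integral_distr[OF eta_X_restrict_measurable]) (simp_all add: case_prod_beta)
  also have "\<dots> = (\<integral>\<^sup>+p. F (\<eta> (fst p), X (snd p) (fst p)) * indicator label_set p \<partial>(M \<Otimes>\<^sub>M count_space UNIV))"
    by (rule nn_integral_restrict_space) simp
  also have "\<dots> = (\<integral>\<^sup>+\<omega>. \<integral>\<^sup>+k. F (\<eta> \<omega>, X k \<omega>) * indicator label_set (\<omega>, k) \<partial>count_space UNIV \<partial>M)"
    by (subst C.nn_integral_fst[symmetric]) auto
  also have "\<dots> = (\<integral>\<^sup>+\<omega>. \<integral>\<^sup>+y. F (\<eta> \<omega>, y) \<partial>\<eta> \<omega> \<partial>M)"
  proof (rule nn_integral_cong)
    fix \<omega> assume w: "\<omega> \<in> space M"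
    have "(\<lambda>y. F (\<eta> \<omega>, y)) \<in> borel_measurable L"
      by (rule measurable_compose[OF measurable_Pair1' F]) (simp add: eta_point_measure[OF w])
    from nn_integral_eta[OF w this]
    show "(\<integral>\<^sup>+k. F (\<eta> \<omega>, X k \<omega>) * indicator label_set (\<omega>, k) \<partial>count_space UNIV) = (\<integral>\<^sup>+y. F (\<eta> \<omega>, y) \<partial>\<eta> \<omega>)"
      using w by (simp add: label_set_def indicator_def space_pair_measure mult.commute)
  qed
  finally show ?thesis .
qed

lemma nn_integral_shifted_campbell:
  assumes F [measurable]: "F \<in> borel_measurable (point_algebra L \<Otimes>\<^sub>M L)"
  shows "(\<integral>\<^sup>+p. F p \<partial>shifted_campbell) = (\<integral>\<^sup>+y. \<integral>\<^sup>+\<omega>. F (add_point (\<eta> \<omega>) y, y) \<partial>M \<partial>L)"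
proof -
  have m: "(\<lambda>(y, \<omega>). (add_point (\<eta> \<omega>) y, y)) \<in> L \<Otimes>\<^sub>M M \<rightarrow>\<^sub>M point_algebra L \<Otimes>\<^sub>M L"
    unfolding case_prod_beta by measurable
  have [measurable]: "(\<lambda>p. F (add_point (\<eta> (snd p)) (fst p), fst p)) \<in> borel_measurable (L \<Otimes>\<^sub>M M)"
    using measurable_compose[OF m F] by (simp add: case_prod_beta)
  have "(\<integral>\<^sup>+p. F p \<partial>shifted_campbell) = (\<integral>\<^sup>+p. F (add_point (\<eta> (snd p)) (fst p), fst p) \<partial>(L \<Otimes>\<^sub>M M))"
    unfolding shifted_campbell_def by (subst nn_integral_distr[OF m]) (simp_all add: case_prod_beta)
  also have "\<dots> = (\<integral>\<^sup>+y. \<integral>\<^sup>+\<omega>. F (add_point (\<eta> \<omega>) y, y) \<partial>M \<partial>L)"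
    by (subst nn_integral_fst[symmetric]) auto
  finally show ?thesis .
qed

text \<open>On rectangles whose second side has finite intensity this is \<open>mecke_sets\<close>;
  all other rectangles are increasing unions of such. The exhaustion required for uniqueness exists
  because the rectangle over \<open>D i\<close> has mass \<open>L (D i)\<close>.\<close>

lemma campbell_eq: "campbell = shifted_campbell"
proof -
  have sets: "sets campbell = sets (point_algebra L \<Otimes>\<^sub>M L)" "sets shifted_campbell = sets (point_algebra L \<Otimes>\<^sub>M L)"
    by (simp_all add: campbell_def shifted_campbell_def)
  have C: "emeasure campbell (a \<times> B) = (\<integral>\<^sup>+\<omega>. emeasure (\<eta> \<omega>) B * indicator a (\<eta> \<omega>) \<partial>M)"
    if [measurable]: "a \<in> sets (point_algebra L)" "B \<in> sets L" for a B
  proof -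
    have "emeasure campbell (a \<times> B) = (\<integral>\<^sup>+p. indicator (a \<times> B) p \<partial>campbell)" by (simp add: sets)
    also have "\<dots> = (\<integral>\<^sup>+\<omega>. \<integral>\<^sup>+y. indicator (a \<times> B) (\<eta> \<omega>, y) \<partial>\<eta> \<omega> \<partial>M)"
      by (rule nn_integral_campbell) measurable
    also have "\<dots> = (\<integral>\<^sup>+\<omega>. emeasure (\<eta> \<omega>) B * indicator a (\<eta> \<omega>) \<partial>M)"
    proof (rule nn_integral_cong)
      fix \<omega> assume "\<omega> \<in> space M"
      then show "(\<integral>\<^sup>+y. indicator (a \<times> B) (\<eta> \<omega>, y) \<partial>\<eta> \<omega>) = emeasure (\<eta> \<omega>) B * indicator a (\<eta> \<omega>)"
        using that by (cases "\<eta> \<omega> \<in> a") (simp_all add: indicator_times eta_sets)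
    qed
    finally show ?thesis .
  qed
  have S: "emeasure shifted_campbell (a \<times> B) = (\<integral>\<^sup>+y. (\<integral>\<^sup>+\<omega>. indicator a (add_point (\<eta> \<omega>) y) \<partial>M) * indicator B y \<partial>L)"
    if [measurable]: "a \<in> sets (point_algebra L)" "B \<in> sets L" for a B
  proof -
    have "emeasure shifted_campbell (a \<times> B) = (\<integral>\<^sup>+p. indicator (a \<times> B) p \<partial>shifted_campbell)" by (simp add: sets)
    also have "\<dots> = (\<integral>\<^sup>+y. \<integral>\<^sup>+\<omega>. indicator (a \<times> B) (add_point (\<eta> \<omega>) y, y) \<partial>M \<partial>L)"
      by (rule nn_integral_shifted_campbell) measurable
    also have "\<dots> = (\<integral>\<^sup>+y. (\<integral>\<^sup>+\<omega>. indicator a (add_point (\<eta> \<omega>) y) \<partial>M) * indicator B y \<partial>L)"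
      by (intro nn_integral_cong) (auto simp: indicator_def)
    finally show ?thesis .
  qed
  obtain D where D: "range D \<subseteq> sets L" "(\<Union>i. D i) = space L" "\<And>i. emeasure L (D i) \<noteq> \<infinity>" "incseq D"
    using L.sigma_finite_incseq by metis
  have D_fin: "B \<inter> D i \<in> finite_sets L" if "B \<in> sets L" for B i
    by (rule finite_sets_subset[of "D i"]) (use D that in \<open>auto simp: finite_sets_def top.not_eq_extremum\<close>)
  let ?E = "{a \<times> B |a B. a \<in> sets (point_algebra L) \<and> B \<in> sets L}"
  show ?thesis
  proof (rule measure_eqI_generator_eq[where E="?E" and \<Omega>="point_measures L \<times> space L" and A="\<lambda>i. point_measures L \<times> D i"])
    show "Int_stable ?E" by (rule Int_stable_pair_measure_generator)
    show "?E \<subseteq> Pow (point_measures L \<times> space L)"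
      using sets.sets_into_space[of _ "point_algebra L"] sets.sets_into_space[of _ L] by auto
    show "sets campbell = sigma_sets (point_measures L \<times> space L) ?E" "sets shifted_campbell = sigma_sets (point_measures L \<times> space L) ?E"
      by (simp_all add: sets sets_pair_measure)
    show "emeasure campbell Y = emeasure shifted_campbell Y" if Y_E: "Y \<in> ?E" for Y
    proof -
      obtain a B where Y: "Y = a \<times> B" and aB: "a \<in> sets (point_algebra L)" "B \<in> sets L" using Y_E by blast
      have Y_eq: "Y = (\<Union>i. a \<times> (B \<inter> D i))" using D(2) sets.sets_into_space[OF aB(2)] by (auto simp: Y)
      have inc: "incseq (\<lambda>i. a \<times> (B \<inter> D i))" using D(4) by (fastforce simp: incseq_def)
      have ms: "range (\<lambda>i. a \<times> (B \<inter> D i)) \<subseteq> sets (point_algebra L \<Otimes>\<^sub>M L)"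
        using aB D(1) by auto
      have "emeasure campbell Y = (SUP i. emeasure campbell (a \<times> (B \<inter> D i)))"
        unfolding Y_eq using ms by (intro SUP_emeasure_incseq[symmetric] inc) (simp add: sets)
      also have "\<dots> = (SUP i. emeasure shifted_campbell (a \<times> (B \<inter> D i)))"
        using mecke_sets[OF aB(1) D_fin[OF aB(2)]] C[OF aB(1)] S[OF aB(1)] finite_setsD(1)[OF D_fin[OF aB(2)]] by simp
      also have "\<dots> = emeasure shifted_campbell Y"
        unfolding Y_eq using ms by (intro SUP_emeasure_incseq inc) (simp add: sets)
      finally show ?thesis .
    qed
    have top: "point_measures L \<in> sets (point_algebra L)" using sets.top[of "point_algebra L"] by simp
    show "range (\<lambda>i. point_measures L \<times> D i) \<subseteq> ?E" using D(1) top by auto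
    show "(\<Union>i. point_measures L \<times> D i) = point_measures L \<times> space L" using D(2) by auto
    show "emeasure campbell (point_measures L \<times> D i) \<noteq> \<infinity>" for i
    proof -
      have "D i \<in> sets L" using D(1) by auto
      then have "emeasure campbell (point_measures L \<times> D i) = (\<integral>\<^sup>+\<omega>. emeasure (\<eta> \<omega>) (D i) * 1 \<partial>M)"
        using C[OF top, of "D i"] eta_point_measure by (auto simp: indicator_def intro!: nn_integral_cong)
      also have "\<dots> = emeasure L (D i)"
        using nn_integral_poisson_mult[OF eta_poisson[of "D i"], of "\<lambda>_. 1"] D \<open>D i \<in> sets L\<close>
        by (simp add: emeasure_space_1 top.not_eq_extremum)
      finally show ?thesis using D(3) by simp
    qed
  qed
qed

theorem mecke_nn_integral:
  assumes "F \<in> borel_measurable (point_algebra L \<Otimes>\<^sub>M L)"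
  shows "(\<integral>\<^sup>+\<omega>. \<integral>\<^sup>+y. F (\<eta> \<omega>, y) \<partial>\<eta> \<omega> \<partial>M) = (\<integral>\<^sup>+y. \<integral>\<^sup>+\<omega>. F (add_point (\<eta> \<omega>) y, y) \<partial>M \<partial>L)"
  using nn_integral_campbell[OF assms] nn_integral_shifted_campbell[OF assms] by (simp add: campbell_eq)

text \<open>The right side stays an integral over the product space, so that it can be compared with
  other joint integrands before an order of integration is chosen. Integrability is assumed on the
  left; equality of the two Campbell measures carries it over.\<close>

theorem mecke_integral:
  fixes F :: "'a measure \<times> 'a \<Rightarrow> real"
  assumes F [measurable]: "F \<in> borel_measurable (point_algebra L \<Otimes>\<^sub>M L)"
    and fin: "(\<integral>\<^sup>+\<omega>. \<integral>\<^sup>+y. ennreal \<bar>F (\<eta> \<omega>, y)\<bar> \<partial>\<eta> \<omega> \<partial>M) < \<infinity>"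
  shows "integrable (L \<Otimes>\<^sub>M M) (\<lambda>p. F (add_point (\<eta> (snd p)) (fst p), fst p))"
    "(\<integral>\<omega>. \<integral>y. F (\<eta> \<omega>, y) \<partial>\<eta> \<omega> \<partial>M) = (\<integral>p. F (add_point (\<eta> (snd p)) (fst p), fst p) \<partial>(L \<Otimes>\<^sub>M M))"
proof -
  interpret C: sigma_finite_measure "count_space UNIV :: nat measure"
    by (rule sigma_finite_measure_count_space)
  interpret MC: pair_sigma_finite M "count_space UNIV :: nat measure" ..
  have int: "integrable campbell F"
    unfolding integrable_iff_bounded
    using fin by (auto simp: nn_integral_campbell) (auto simp: campbell_def)
  have m: "(\<lambda>(y, \<omega>). (add_point (\<eta> \<omega>) y, y)) \<in> L \<Otimes>\<^sub>M M \<rightarrow>\<^sub>M point_algebra L \<Otimes>\<^sub>M L"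
    unfolding case_prod_beta by measurable
  show "integrable (L \<Otimes>\<^sub>M M) (\<lambda>p. F (add_point (\<eta> (snd p)) (fst p), fst p))"
    using int unfolding campbell_eq shifted_campbell_def
    by (subst (asm) integrable_distr_eq[OF m]) (auto simp: case_prod_beta)
  have int2: "integrable (M \<Otimes>\<^sub>M count_space UNIV) (\<lambda>p. indicator label_set p * F (\<eta> (fst p), X (snd p) (fst p)))"
    using int unfolding campbell_def
    by (subst (asm) integrable_distr_eq[OF eta_X_restrict_measurable])
       (auto simp: case_prod_beta integrable_restrict_space)
  have "(\<integral>p. F p \<partial>campbell) = (\<integral>p. F (\<eta> (fst p), X (snd p) (fst p)) \<partial>restrict_space (M \<Otimes>\<^sub>M count_space UNIV) label_set)"
    unfolding campbell_def by (subst integral_distr[OF eta_X_restrict_measurable]) (auto simp: case_prod_beta)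
  also have "\<dots> = (\<integral>p. indicator label_set p * F (\<eta> (fst p), X (snd p) (fst p)) \<partial>(M \<Otimes>\<^sub>M count_space UNIV))"
    by (subst integral_restrict_space) auto
  also have "\<dots> = (\<integral>\<omega>. \<integral>k. indicator label_set (\<omega>, k) * F (\<eta> \<omega>, X k \<omega>) \<partial>count_space UNIV \<partial>M)"
    using MC.integral_fst'[OF int2] by simp
  also have "\<dots> = (\<integral>\<omega>. \<integral>y. F (\<eta> \<omega>, y) \<partial>\<eta> \<omega> \<partial>M)"
  proof (rule Bochner_Integration.integral_cong[OF refl])
    fix \<omega> assume w: "\<omega> \<in> space M"
    have "(\<lambda>y. F (\<eta> \<omega>, y)) \<in> borel_measurable L"
      by (rule measurable_compose[OF measurable_Pair1' F]) (simp add: eta_point_measure[OF w])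
    from integral_eta[OF w this]
    show "(\<integral>k. indicator label_set (\<omega>, k) * F (\<eta> \<omega>, X k \<omega>) \<partial>count_space UNIV) = (\<integral>y. F (\<eta> \<omega>, y) \<partial>\<eta> \<omega>)"
      using w by (simp add: label_set_def indicator_def space_pair_measure)
  qed
  finally have "(\<integral>p. F p \<partial>campbell) = (\<integral>\<omega>. \<integral>y. F (\<eta> \<omega>, y) \<partial>\<eta> \<omega> \<partial>M)" .
  moreover have "(\<integral>p. F p \<partial>campbell) = (\<integral>p. F (add_point (\<eta> (snd p)) (fst p), fst p) \<partial>(L \<Otimes>\<^sub>M M))"
    unfolding campbell_eq shifted_campbell_def by (subst integral_distr[OF m]) (auto simp: case_prod_beta)
  ultimately show "(\<integral>\<omega>. \<integral>y. F (\<eta> \<omega>, y) \<partial>\<eta> \<omega> \<partial>M) = (\<integral>p. F (add_point (\<eta> (snd p)) (fst p), fst p) \<partial>(L \<Otimes>\<^sub>M M))"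
    by simp
qed

end

section \<open>Sums over injections\<close>

text \<open>For finitely many points \<open>x k\<close> and \<open>a j k = g j (x k)\<close> this is
  their factorial measure applied to a tensor product; with all entries equal to 1 it counts the
  injections from \<open>J\<close> into \<open>K\<close>.\<close>

definition injsum :: "'k set \<Rightarrow> (nat \<Rightarrow> 'k \<Rightarrow> real) \<Rightarrow> nat set \<Rightarrow> real" where
  "injsum K a J = (\<Sum>i\<in>{i \<in> J \<rightarrow>\<^sub>E K. inj_on i J}. \<Prod>j\<in>J. a j (i j))"

lemma injsum_empty [simp]: "injsum K a {} = 1"
proof -
  have "{i \<in> {} \<rightarrow>\<^sub>E K. inj_on i {}} = {\<lambda>_. undefined}" by auto
  then show ?thesis by (simp add: injsum_def)
qed

lemma injsum_cong: "(\<And>j k. j \<in> J \<Longrightarrow> k \<in> K \<Longrightarrow> a j k = b j k) \<Longrightarrow> injsum K a J = injsum K b J"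
  unfolding injsum_def by (intro sum.cong prod.cong refl) auto

text \<open>Splits by the label that \<open>j\<close> receives; the remaining indices have to avoid
  it.\<close>

lemma injsum_insert_index:
  assumes K: "finite K" and J: "finite J" "j \<notin> J"
  shows "injsum K a (insert j J) = (\<Sum>k\<in>K. a j k * injsum (K - {k}) a J)"
proof -
  let ?S = "\<lambda>k. {i \<in> J \<rightarrow>\<^sub>E (K - {k}). inj_on i J}"
  have fin: "finite (?S k)" for k using finite_PiE[OF J(1), of "\<lambda>_. K - {k}"] K by auto
  have "(\<Sum>k\<in>K. a j k * injsum (K - {k}) a J) = (\<Sum>k\<in>K. \<Sum>i\<in>?S k. a j k * (\<Prod>j\<in>J. a j (i j)))"
    by (simp add: injsum_def sum_distrib_left)
  also have "\<dots> = (\<Sum>(k, i)\<in>Sigma K ?S. a j k * (\<Prod>j\<in>J. a j (i j)))"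
    using K fin by (intro sum.Sigma) auto
  also have "\<dots> = injsum K a (insert j J)"
    unfolding injsum_def
  \<comment> \<open>Removing \<open>j\<close> resets the map to \<open>undefined\<close> there,
    which keeps it in the extensional function space over \<open>J\<close>.\<close>
  proof (rule sum.reindex_bij_witness[where i="\<lambda>i. (i j, i(j := undefined))" and j="\<lambda>(k, i). i(j := k)"], goal_cases)
    case (1 p)
    then show ?case using J by (auto simp: PiE_def extensional_def fun_eq_iff)
  next
    case (2 p)
    then obtain k i where p: "p = (k, i)" "k \<in> K" "i \<in> J \<rightarrow>\<^sub>E (K - {k})" "inj_on i J" by auto
    have "inj_on (i(j := k)) J" using p(4) J(2) by (simp add: inj_on_def)
    moreover have "k \<notin> i(j := k) ` J" using p(3) J(2) by (auto simp: PiE_def Pi_def)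
    ultimately show ?case using p J by (auto simp: PiE_def Pi_def extensional_def)
  next
    case (3 i)
    then show ?case by simp
  next
    case (4 i)
    then have i: "i \<in> insert j J \<rightarrow>\<^sub>E K" "inj_on i (insert j J)" by auto
    have "inj_on (i(j := undefined)) J" using i(2) J(2) by (auto simp: inj_on_def)
    moreover have "i x \<noteq> i j" if "x \<in> J" for x using i(2) that J(2) by (metis inj_onD insertCI)
    ultimately show ?case using i J by (auto simp: PiE_def Pi_def extensional_def)
  next
    case (5 p)
    then show ?case using J by (auto intro!: prod.cong)
  qed
  finally show ?thesis by simp
qed

text \<open>The new label is taken by no index or by exactly one. For factorial integrals this is
  the effect of adding one point.\<close>

lemma injsum_insert_label:
  assumes "finite J" "finite K" "k \<notin> K"
  shows "injsum (insert k K) a J = injsum K a J + (\<Sum>j\<in>J. a j k * injsum K a (J - {j}))"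
  using assms
proof (induction J arbitrary: K rule: finite_induct)
  case empty
  show ?case by simp
next
  case (insert j J)
  have IH: "injsum (insert k K - {k'}) a J =
      injsum (K - {k'}) a J + (\<Sum>i\<in>J. a i k * injsum (K - {k'}) a (J - {i}))" if "k' \<in> K" for k'
    using insert.IH[of "K - {k'}"] insert.prems that by (auto simp: insert_Diff_if)
  have "injsum (insert k K) a (insert j J) =
      a j k * injsum K a J + (\<Sum>k'\<in>K. a j k' * injsum (insert k K - {k'}) a J)"
    using insert.prems insert.hyps by (simp add: injsum_insert_index)
  also have "(\<Sum>k'\<in>K. a j k' * injsum (insert k K - {k'}) a J) =
      (\<Sum>k'\<in>K. a j k' * injsum (K - {k'}) a J) + (\<Sum>k'\<in>K. \<Sum>i\<in>J. a i k * (a j k' * injsum (K - {k'}) a (J - {i})))"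
    by (simp add: IH sum.distrib distrib_left sum_distrib_left mult.left_commute)
  also have "(\<Sum>k'\<in>K. a j k' * injsum (K - {k'}) a J) = injsum K a (insert j J)"
    using insert by (simp add: injsum_insert_index)
  also have "(\<Sum>k'\<in>K. \<Sum>i\<in>J. a i k * (a j k' * injsum (K - {k'}) a (J - {i}))) =
      (\<Sum>i\<in>J. a i k * (\<Sum>k'\<in>K. a j k' * injsum (K - {k'}) a (J - {i})))"
    by (subst sum.swap) (simp add: sum_distrib_left)
  also have "\<dots> = (\<Sum>i\<in>J. a i k * injsum K a (insert j J - {i}))"
  proof (rule sum.cong[OF refl])
    fix i assume "i \<in> J"
    then have "insert j J - {i} = insert j (J - {i})" using insert.hyps by auto
    then show "a i k * (\<Sum>k'\<in>K. a j k' * injsum (K - {k'}) a (J - {i})) = a i k * injsum K a (insert j J - {i})"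
      using insert by (simp add: injsum_insert_index)
  qed
  finally show ?case using insert.hyps by simp
qed

text \<open>Let \<open>j\<close> choose its label freely and subtract the collisions: when
  \<open>j\<close> meets \<open>i\<close>, the two indices merge into one with factor
  \<open>a j * a i\<close>. Unlike the splitting by labels this never removes a label from
  \<open>K\<close>, so it can be read as an identity between integrals with respect to one
  measure.\<close>

lemma injsum_recursion:
  assumes K: "finite K" and J: "finite J" "j \<notin> J"
  shows "injsum K a (insert j J) =
    (\<Sum>k\<in>K. a j k) * injsum K a J - (\<Sum>i\<in>J. injsum K (a(i := \<lambda>k. a j k * a i k)) J)"
proof -
  have *: "injsum K a J = injsum (K - {k}) a J + (\<Sum>i\<in>J. a i k * injsum (K - {k}) a (J - {i}))" if "k \<in> K" for k
    using injsum_insert_label[OF J(1), of "K - {k}" k a] K that by (simp add: insert_absorb)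
  have "(\<Sum>i\<in>J. injsum K (a(i := \<lambda>k. a j k * a i k)) J) =
      (\<Sum>i\<in>J. \<Sum>k\<in>K. a j k * (a i k * injsum (K - {k}) a (J - {i})))"
  proof (rule sum.cong[OF refl])
    fix i assume i: "i \<in> J"
    have "injsum K (a(i := \<lambda>k. a j k * a i k)) (insert i (J - {i})) =
        (\<Sum>k\<in>K. a j k * a i k * injsum (K - {k}) (a(i := \<lambda>k. a j k * a i k)) (J - {i}))"
      using K J by (subst injsum_insert_index) auto
    also have "\<dots> = (\<Sum>k\<in>K. a j k * (a i k * injsum (K - {k}) a (J - {i})))"
    proof (rule sum.cong[OF refl])
      fix k
      have "injsum (K - {k}) (a(i := \<lambda>k. a j k * a i k)) (J - {i}) = injsum (K - {k}) a (J - {i})"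
        by (rule injsum_cong) simp
      then show "a j k * a i k * injsum (K - {k}) (a(i := \<lambda>k. a j k * a i k)) (J - {i}) =
          a j k * (a i k * injsum (K - {k}) a (J - {i}))" by (simp only: mult.assoc)
    qed
    finally show "injsum K (a(i := \<lambda>k. a j k * a i k)) J = (\<Sum>k\<in>K. a j k * (a i k * injsum (K - {k}) a (J - {i})))"
      using i by (simp add: insert_absorb)
  qed
  also have "\<dots> = (\<Sum>k\<in>K. a j k * (\<Sum>i\<in>J. a i k * injsum (K - {k}) a (J - {i})))"
    by (subst sum.swap) (simp add: sum_distrib_left)
  also have "\<dots> = (\<Sum>k\<in>K. a j k * (injsum K a J - injsum (K - {k}) a J))"
    by (intro sum.cong refl) (simp add: *)
  also have "\<dots> = (\<Sum>k\<in>K. a j k) * injsum K a J - injsum K a (insert j J)"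
    using K J by (simp add: right_diff_distrib sum_subtractf sum_distrib_right injsum_insert_index)
  finally show ?thesis by simp
qed

lemma injsum_reindex:
  assumes "finite J" "finite K" "inj_on e J"
  shows "injsum K a (e ` J) = injsum K (\<lambda>j. a (e j)) J"
  using assms
proof (induction J arbitrary: K rule: finite_induct)
  case empty
  show ?case by simp
next
  case (insert j J)
  then show ?case by (simp add: injsum_insert_index)
qed

text \<open>With as many labels as indices the sum is the permanent of the matrix
  \<open>a\<close>.\<close>

lemma injsum_permutes:
  "injsum {..<n} a {..<n} = (\<Sum>\<pi> | \<pi> permutes {..<n}. \<Prod>j<n. a j (\<pi> j))"
  unfolding injsum_def
proof (rule sum.reindex_bij_witness[where i="\<lambda>\<pi>. restrict \<pi> {..<n}" and j="\<lambda>i j. if j < n then i j else j"], goal_cases)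
  case (1 i)
  then show ?case by (auto simp: PiE_def extensional_def fun_eq_iff)
next
  case (2 i)
  then have i: "i \<in> {..<n} \<rightarrow>\<^sub>E {..<n}" "inj_on i {..<n}" by auto
  have "inj_on (\<lambda>j. if j < n then i j else j) {..<n}" using i(2) by (simp add: inj_on_def)
  moreover have "(\<lambda>j. if j < n then i j else j) ` {..<n} \<subseteq> {..<n}" using i(1) by auto
  ultimately have "bij_betw (\<lambda>j. if j < n then i j else j) {..<n} {..<n}"
    unfolding bij_betw_def using endo_inj_surj[of "{..<n}"] by blast
  then have "(\<lambda>j. if j < n then i j else j) permutes {..<n}" by (rule bij_imp_permutes) simp
  then show ?case by simp
next
  case (3 \<pi>)
  then show ?case by (auto simp: fun_eq_iff permutes_def)
next
  case (4 \<pi>)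
  then have "\<pi> permutes {..<n}" by simp
  then have "\<pi> ` {..<n} = {..<n}" "inj_on \<pi> {..<n}"
    by (rule permutes_image, rule permutes_inj_on)
  then show ?case by (auto simp: inj_on_def)
next
  case (5 i)
  then show ?case by (intro prod.cong) auto
qed

section \<open>Factorial integrals\<close>

text \<open>The support set is a parameter and not existentially quantified: all factors of an
  argument share one \<open>B\<close>, and a single almost sure event, finiteness of
  \<open>\<eta>(B)\<close>, serves them all.\<close>

definition factor_on :: "'a measure \<Rightarrow> 'a set \<Rightarrow> ('a \<Rightarrow> real) \<Rightarrow> bool" where
  "factor_on L B u \<longleftrightarrow> u \<in> borel_measurable L \<and> (\<exists>C. \<forall>y\<in>space L. \<bar>u y\<bar> \<le> C) \<and> (\<forall>y\<in>space L - B. u y = 0)"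

lemma admissible_factor_iff: "admissible_factor L u \<longleftrightarrow> (\<exists>B\<in>finite_sets L. factor_on L B u)"
  by (auto simp: admissible_factor_def factor_on_def finite_sets_def)

lemma factor_on_mono: "factor_on L B u \<Longrightarrow> B \<subseteq> C \<Longrightarrow> factor_on L C u"
  by (auto simp: factor_on_def)

lemma factor_on_measurable: "factor_on L B u \<Longrightarrow> u \<in> borel_measurable L"
  by (simp add: factor_on_def)

lemma factor_on_bound:
  assumes "factor_on L B u"
  shows "\<exists>C\<ge>0. \<forall>y\<in>space L. \<bar>u y\<bar> \<le> C * indicator B y"
proof -
  obtain C where "\<And>y. y \<in> space L \<Longrightarrow> \<bar>u y\<bar> \<le> C" using assms by (auto simp: factor_on_def)
  then have "\<bar>u y\<bar> \<le> \<bar>C\<bar> * indicator B y" if "y \<in> space L" for y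
    using that assms by (cases "y \<in> B") (force simp: factor_on_def)+
  then show ?thesis by (intro exI[of _ "\<bar>C\<bar>"]) simp
qed

lemma factor_on_mult:
  assumes "factor_on L B u" "factor_on L B v"
  shows "factor_on L B (\<lambda>y. u y * v y)"
proof -
  obtain C where C: "\<And>y. y \<in> space L \<Longrightarrow> \<bar>u y\<bar> \<le> C" using assms(1) by (auto simp: factor_on_def)
  obtain D where D: "\<And>y. y \<in> space L \<Longrightarrow> \<bar>v y\<bar> \<le> D" using assms(2) by (auto simp: factor_on_def)
  have "\<bar>u y * v y\<bar> \<le> C * D" if "y \<in> space L" for y
    using C[OF that] D[OF that] by (simp add: abs_mult mult_mono')
  then show ?thesis using assms by (auto simp: factor_on_def)
qed

lemma factor_on_scale: "factor_on L B u \<Longrightarrow> factor_on L B (\<lambda>y. c * u y)"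
proof -
  assume u: "factor_on L B u"
  then obtain C where C: "\<And>y. y \<in> space L \<Longrightarrow> \<bar>u y\<bar> \<le> C" by (auto simp: factor_on_def)
  then have "\<bar>c * u y\<bar> \<le> \<bar>c\<bar> * C" if "y \<in> space L" for y
    using that by (simp add: abs_mult mult_left_mono)
  then show ?thesis using u by (auto simp: factor_on_def)
qed

lemma factor_on_indicator: "B \<in> sets L \<Longrightarrow> C \<subseteq> B \<Longrightarrow> C \<in> sets L \<Longrightarrow> factor_on L B (indicator C)"
  by (auto simp: factor_on_def indicator_def intro!: exI[of _ 1])

lemma factor_on_integrable:
  assumes u: "factor_on L B u" and \<mu>: "sets \<mu> = sets L" "B \<in> sets L" "emeasure \<mu> B < \<infinity>"
  shows "integrable \<mu> u" "\<exists>C\<ge>0. \<bar>\<integral>y. u y \<partial>\<mu>\<bar> \<le> C * measure \<mu> B"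
proof -
  obtain C where C: "C \<ge> 0" "\<And>y. y \<in> space L \<Longrightarrow> \<bar>u y\<bar> \<le> C * indicator B y"
    using factor_on_bound[OF u] by blast
  have sp: "space \<mu> = space L" using \<mu>(1) by (rule sets_eq_imp_space_eq)
  have ind: "integrable \<mu> (\<lambda>y. C * indicator B y)" using \<mu> by simp
  show int: "integrable \<mu> u"
    by (rule Bochner_Integration.integrable_bound[OF ind])
       (use factor_on_measurable[OF u] C sp in \<open>auto simp: measurable_cong_sets[OF \<mu>(1) refl]\<close>)
  have "\<bar>\<integral>y. u y \<partial>\<mu>\<bar> \<le> (\<integral>y. \<bar>u y\<bar> \<partial>\<mu>)" by (rule integral_abs_bound)
  also have "\<dots> \<le> (\<integral>y. C * indicator B y \<partial>\<mu>)"
    using int ind C sp by (intro integral_mono) auto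
  also have "\<dots> = C * measure \<mu> B" using \<mu> by simp
  finally show "\<exists>C\<ge>0. \<bar>\<integral>y. u y \<partial>\<mu>\<bar> \<le> C * measure \<mu> B" using C(1) by blast
qed

text \<open>A measure in the first argument need not be a sum of point masses; the recursion writes the
  factorial integral as a polynomial in integrals, which makes sense and is measurable on the whole
  space of point measures.\<close>

primrec factorial_poly :: "nat list \<Rightarrow> (nat \<Rightarrow> 'a \<Rightarrow> real) \<Rightarrow> 'a measure \<Rightarrow> real" where
  "factorial_poly [] g \<mu> = 1"
| "factorial_poly (j # js) g \<mu> = (\<integral>y. g j y \<partial>\<mu>) * factorial_poly js g \<mu>
     - (\<Sum>i\<in>set js. factorial_poly js (g(i := \<lambda>y. g j y * g i y)) \<mu>)"

text \<open>The recursion consumes a list, so an order has to be fixed; on labelled measures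
  \<open>factorial_poly_labelled\<close> shows that the value does not depend on it.\<close>

definition factorial_integral :: "nat set \<Rightarrow> (nat \<Rightarrow> 'a \<Rightarrow> real) \<Rightarrow> 'a measure \<Rightarrow> real" where
  "factorial_integral J g \<mu> = factorial_poly (sorted_list_of_set J) g \<mu>"

text \<open>On \<open>B\<close>, the measure \<open>\<mu>\<close> is the finite sum of the point masses at \<open>x k\<close>, \<open>k \<in> K\<close>.\<close>

definition labelled :: "'a measure \<Rightarrow> 'a set \<Rightarrow> 'a measure \<Rightarrow> nat set \<Rightarrow> (nat \<Rightarrow> 'a) \<Rightarrow> bool" where
  "labelled L B \<mu> K x \<longleftrightarrow> finite K \<and> sets \<mu> = sets L \<and>
     (\<forall>h. factor_on L B h \<longrightarrow> integrable \<mu> h \<and> (\<integral>y. h y \<partial>\<mu>) = (\<Sum>k\<in>K. h (x k)))"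

lemma labelled_add_point:
  assumes \<mu>: "labelled L B \<mu> K x" and y: "y \<in> space L" and k: "k \<notin> K"
  shows "labelled L B (add_point \<mu> y) (insert k K) (x(k := y))"
proof -
  have "y \<in> space \<mu>" using \<mu> y sets_eq_imp_space_eq[of \<mu> L] by (simp add: labelled_def)
  moreover have "(\<Sum>i\<in>K. h ((x(k := y)) i)) = (\<Sum>i\<in>K. h (x i))" for h :: "'a \<Rightarrow> real"
    using k by (intro sum.cong) auto
  ultimately show ?thesis
    using \<mu> k unfolding labelled_def by (simp add: integral_add_point)
qed

text \<open>The recursion of \<open>factorial_poly\<close> is \<open>injsum_recursion\<close> with
  sums over labels replaced by integrals. The induction has to vary \<open>g\<close>, because
  merging changes a factor.\<close>

lemma factorial_poly_labelled:
  assumes "labelled L B \<mu> K x" "distinct js" "\<And>j. j \<in> set js \<Longrightarrow> factor_on L B (g j)"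
  shows "factorial_poly js g \<mu> = injsum K (\<lambda>j k. g j (x k)) (set js)"
  using assms(2,3)
proof (induction js arbitrary: g)
  case Nil
  show ?case by simp
next
  case (Cons j js)
  have K: "finite K" using assms(1) by (simp add: labelled_def)
  have upd: "factorial_poly js (g(i := \<lambda>y. g j y * g i y)) \<mu> =
      injsum K ((\<lambda>j k. g j (x k))(i := \<lambda>k. g j (x k) * g i (x k))) (set js)" if "i \<in> set js" for i
  proof -
    have "factorial_poly js (g(i := \<lambda>y. g j y * g i y)) \<mu> =
        injsum K (\<lambda>l k. (g(i := \<lambda>y. g j y * g i y)) l (x k)) (set js)"
      using Cons.prems that by (intro Cons.IH) (auto intro: factor_on_mult)
    also have "(\<lambda>l k. (g(i := \<lambda>y. g j y * g i y)) l (x k)) = (\<lambda>j k. g j (x k))(i := \<lambda>k. g j (x k) * g i (x k))"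
      by auto
    finally show ?thesis .
  qed
  have "(\<integral>y. g j y \<partial>\<mu>) = (\<Sum>k\<in>K. g j (x k))"
    using assms(1) Cons.prems by (simp add: labelled_def)
  with Cons show ?case by (simp add: upd injsum_recursion[OF K])
qed

lemma factorial_integral_labelled:
  assumes "labelled L B \<mu> K x" "finite J" "\<And>j. j \<in> J \<Longrightarrow> factor_on L B (g j)"
  shows "factorial_integral J g \<mu> = injsum K (\<lambda>j k. g j (x k)) J"
  using factorial_poly_labelled[OF assms(1), of "sorted_list_of_set J" g] assms(2,3)
  by (simp add: factorial_integral_def)

lemma factorial_integral_empty [simp]: "factorial_integral {} g \<mu> = 1"
  by (simp add: factorial_integral_def)

lemma factorial_integral_insert:
  assumes \<mu>: "labelled L B \<mu> K x" and J: "finite J" "j \<notin> J" "\<And>i. i \<in> insert j J \<Longrightarrow> factor_on L B (g i)"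
  shows "factorial_integral (insert j J) g \<mu> = (\<integral>y. g j y \<partial>\<mu>) * factorial_integral J g \<mu>
    - (\<Sum>i\<in>J. factorial_integral J (g(i := \<lambda>y. g j y * g i y)) \<mu>)"
proof -
  have K: "finite K" using \<mu> by (simp add: labelled_def)
  have "factorial_integral J (g(i := \<lambda>y. g j y * g i y)) \<mu> =
      injsum K ((\<lambda>j k. g j (x k))(i := \<lambda>k. g j (x k) * g i (x k))) J" if "i \<in> J" for i
  proof -
    have "factorial_integral J (g(i := \<lambda>y. g j y * g i y)) \<mu> =
        injsum K (\<lambda>l k. (g(i := \<lambda>y. g j y * g i y)) l (x k)) J"
      using J that by (intro factorial_integral_labelled[OF \<mu>]) (auto intro: factor_on_mult)
    also have "(\<lambda>l k. (g(i := \<lambda>y. g j y * g i y)) l (x k)) = (\<lambda>j k. g j (x k))(i := \<lambda>k. g j (x k) * g i (x k))"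
      by auto
    finally show ?thesis .
  qed
  moreover have "(\<integral>y. g j y \<partial>\<mu>) = (\<Sum>k\<in>K. g j (x k))"
    using \<mu> J by (simp add: labelled_def)
  moreover have "factorial_integral J g \<mu> = injsum K (\<lambda>j k. g j (x k)) J"
      "factorial_integral (insert j J) g \<mu> = injsum K (\<lambda>j k. g j (x k)) (insert j J)"
    using J by (intro factorial_integral_labelled[OF \<mu>]; auto)+
  ultimately show ?thesis
    using J by (simp add: injsum_recursion[OF K])
qed

text \<open>The new point is used by no factor or by exactly one, as in
  \<open>injsum_insert_label\<close>. This is why a difference operator lowers the order of a
  factorial integral by one.\<close>

lemma factorial_integral_add_point:
  assumes \<mu>: "labelled L B \<mu> K x" and y: "y \<in> space L" and J: "finite J" "\<And>i. i \<in> J \<Longrightarrow> factor_on L B (g i)"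
  shows "factorial_integral J g (add_point \<mu> y) =
    factorial_integral J g \<mu> + (\<Sum>j\<in>J. g j y * factorial_integral (J - {j}) g \<mu>)"
proof -
  have K: "finite K" using \<mu> by (simp add: labelled_def)
  then obtain k where k: "k \<notin> K" using ex_new_if_finite infinite_UNIV_nat by blast
  have eq: "injsum K (\<lambda>j l. g j ((x(k := y)) l)) I = injsum K (\<lambda>j l. g j (x l)) I" for I
    using k by (intro injsum_cong) auto
  have sub: "factorial_integral I g \<mu> = injsum K (\<lambda>j l. g j (x l)) I" if "I \<subseteq> J" for I
    using J that by (intro factorial_integral_labelled[OF \<mu>]) (auto intro: finite_subset)
  have "factorial_integral J g (add_point \<mu> y) = injsum (insert k K) (\<lambda>j l. g j ((x(k := y)) l)) J"
    using J by (intro factorial_integral_labelled[OF labelled_add_point[OF \<mu> y k]]) auto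
  also have "\<dots> = injsum K (\<lambda>j l. g j (x l)) J + (\<Sum>j\<in>J. g j y * injsum K (\<lambda>j l. g j (x l)) (J - {j}))"
    unfolding injsum_insert_label[OF J(1) K k] eq by simp
  also have "\<dots> = factorial_integral J g \<mu> + (\<Sum>j\<in>J. g j y * factorial_integral (J - {j}) g \<mu>)"
    using sub by simp
  finally show ?thesis .
qed

lemma factorial_integral_reindex:
  assumes "labelled L B \<mu> K x" "finite J" "inj_on e J" "\<And>j. j \<in> J \<Longrightarrow> factor_on L B (g (e j))"
  shows "factorial_integral (e ` J) g \<mu> = factorial_integral J (\<lambda>j. g (e j)) \<mu>"
proof -
  have K: "finite K" using assms(1) by (simp add: labelled_def)
  have "factorial_integral (e ` J) g \<mu> = injsum K (\<lambda>j k. g j (x k)) (e ` J)"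
    using assms by (intro factorial_integral_labelled[OF assms(1)]) auto
  also have "\<dots> = injsum K (\<lambda>j k. g (e j) (x k)) J" by (rule injsum_reindex[OF assms(2) K assms(3)])
  also have "\<dots> = factorial_integral J (\<lambda>j. g (e j)) \<mu>"
    using assms by (intro factorial_integral_labelled[OF assms(1), symmetric]) auto
  finally show ?thesis .
qed

text \<open>The value is a polynomial in integrals each of which is at most a multiple of
  \<open>\<mu>(B)\<close>. The base \<open>1 + \<mu>(B)\<close> is at least 1, so the exponents
  arising from the summands can be raised to a common one.\<close>

lemma factorial_poly_bound:
  assumes B: "B \<in> sets L" and "\<And>j. j \<in> set js \<Longrightarrow> factor_on L B (g j)"
  shows "\<exists>C m. C \<ge> 0 \<and> (\<forall>\<mu>. sets \<mu> = sets L \<longrightarrow> emeasure \<mu> B < \<infinity> \<longrightarrow>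
    \<bar>factorial_poly js g \<mu>\<bar> \<le> C * (1 + measure \<mu> B) ^ m)"
  using assms(2)
proof (induction js arbitrary: g)
  case Nil
  show ?case by (intro exI[of _ 1] exI[of _ 0]) simp
next
  case (Cons j js)
  obtain D where D: "D \<ge> 0" "\<And>y. y \<in> space L \<Longrightarrow> \<bar>g j y\<bar> \<le> D * indicator B y"
    using factor_on_bound[of L B "g j"] Cons.prems by auto
  have "\<exists>C m. C \<ge> 0 \<and> (\<forall>\<mu>. sets \<mu> = sets L \<longrightarrow> emeasure \<mu> B < \<infinity> \<longrightarrow>
    \<bar>factorial_poly js g \<mu>\<bar> \<le> C * (1 + measure \<mu> B) ^ m)"
    using Cons.prems by (intro Cons.IH) auto
  then obtain C m where Cm: "C \<ge> 0" "\<And>\<mu>. sets \<mu> = sets L \<Longrightarrow> emeasure \<mu> B < \<infinity> \<Longrightarrow>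
    \<bar>factorial_poly js g \<mu>\<bar> \<le> C * (1 + measure \<mu> B) ^ m" by blast
  have "\<exists>C m. C \<ge> 0 \<and> (\<forall>\<mu>. sets \<mu> = sets L \<longrightarrow> emeasure \<mu> B < \<infinity> \<longrightarrow>
    \<bar>factorial_poly js (g(i := \<lambda>y. g j y * g i y)) \<mu>\<bar> \<le> C * (1 + measure \<mu> B) ^ m)" if "i \<in> set js" for i
    using Cons.prems that by (intro Cons.IH) (auto intro: factor_on_mult)
  then obtain C' m' where Cm': "\<And>i. i \<in> set js \<Longrightarrow> C' i \<ge> 0" "\<And>i \<mu>. i \<in> set js \<Longrightarrow> sets \<mu> = sets L \<Longrightarrow> emeasure \<mu> B < \<infinity> \<Longrightarrow>
    \<bar>factorial_poly js (g(i := \<lambda>y. g j y * g i y)) \<mu>\<bar> \<le> C' i * (1 + measure \<mu> B) ^ m' i" by metis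
  \<comment> \<open>At least \<open>m + 1\<close>, one more than \<open>m\<close> for the additional
    integral, and at least every \<open>m' i\<close>.\<close>
  define m0 where "m0 = Suc m + (\<Sum>i\<in>set js. m' i)"
  show ?case
  proof (intro exI[of _ "D * C + (\<Sum>i\<in>set js. C' i)"] exI[of _ m0] conjI allI impI)
    show "0 \<le> D * C + (\<Sum>i\<in>set js. C' i)" using D Cm Cm' by (intro add_nonneg_nonneg sum_nonneg) auto
    fix \<mu> :: "'a measure" assume \<mu>: "sets \<mu> = sets L" "emeasure \<mu> B < \<infinity>"
    let ?t = "1 + measure \<mu> B"
    have t: "?t \<ge> 1" by simp
    have sp: "space \<mu> = space L" using \<mu>(1) by (rule sets_eq_imp_space_eq)
    have ind: "integrable \<mu> (\<lambda>y. D * indicator B y)" using \<mu> B by simp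
    have gj: "integrable \<mu> (g j)" using Cons.prems \<mu> B by (intro factor_on_integrable[of L B]) auto
    have "\<bar>\<integral>y. g j y \<partial>\<mu>\<bar> \<le> (\<integral>y. \<bar>g j y\<bar> \<partial>\<mu>)" by (rule integral_abs_bound)
    also have "\<dots> \<le> (\<integral>y. D * indicator B y \<partial>\<mu>)"
      using gj ind D sp by (intro integral_mono) auto
    also have "\<dots> = D * measure \<mu> B" using \<mu> B by simp
    also have "\<dots> \<le> D * ?t" using D by (intro mult_left_mono) auto
    finally have "\<bar>\<integral>y. g j y \<partial>\<mu>\<bar> \<le> D * ?t" .
    then have "\<bar>(\<integral>y. g j y \<partial>\<mu>) * factorial_poly js g \<mu>\<bar> \<le> (D * ?t) * (C * ?t ^ m)"
      unfolding abs_mult using Cm(2)[OF \<mu>] by (intro mult_mono') auto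
    also have "\<dots> = D * C * ?t ^ Suc m" by simp
    also have "\<dots> \<le> D * C * ?t ^ m0"
      using D Cm t by (intro mult_left_mono power_increasing) (auto simp: m0_def)
    finally have 1: "\<bar>(\<integral>y. g j y \<partial>\<mu>) * factorial_poly js g \<mu>\<bar> \<le> D * C * ?t ^ m0" .
    have "\<bar>\<Sum>i\<in>set js. factorial_poly js (g(i := \<lambda>y. g j y * g i y)) \<mu>\<bar> \<le> (\<Sum>i\<in>set js. C' i * ?t ^ m0)"
    proof (rule order_trans[OF sum_abs], rule sum_mono)
      fix i assume i: "i \<in> set js"
      have "m' i \<le> (\<Sum>i\<in>set js. m' i)" using i by (intro member_le_sum) auto
      then have "m' i \<le> m0" by (simp add: m0_def)
      then have "C' i * ?t ^ m' i \<le> C' i * ?t ^ m0"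
        using Cm'(1)[OF i] t by (intro mult_left_mono power_increasing) auto
      then show "\<bar>factorial_poly js (g(i := \<lambda>y. g j y * g i y)) \<mu>\<bar> \<le> C' i * ?t ^ m0"
        using Cm'(2)[OF i \<mu>] by linarith
    qed
    with 1 show "\<bar>factorial_poly (j # js) g \<mu>\<bar> \<le> (D * C + (\<Sum>i\<in>set js. C' i)) * ?t ^ m0"
      by (simp add: distrib_right sum_distrib_right)
  qed
qed

section \<open>Measurability of integrals as functions of the measure\<close>

lemma measurable_point_algebra_cong:
  "(\<And>\<mu>. \<mu> \<in> point_measures L \<Longrightarrow> f \<mu> = g \<mu>) \<Longrightarrow> g \<in> point_algebra L \<rightarrow>\<^sub>M N \<Longrightarrow> f \<in> point_algebra L \<rightarrow>\<^sub>M N"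
  using measurable_cong[of "point_algebra L" f g N] by simp

lemma measurable_point_measure:
  "\<mu> \<in> point_measures L \<Longrightarrow> h \<in> L \<rightarrow>\<^sub>M N \<Longrightarrow> h \<in> \<mu> \<rightarrow>\<^sub>M N"
  by (subst measurable_cong_sets[OF point_measuresD(2) refl])

lemma nn_integral_measurable_point_algebra:
  assumes h: "h \<in> borel_measurable L"
  shows "(\<lambda>\<mu>. \<integral>\<^sup>+y. h y \<partial>\<mu>) \<in> borel_measurable (point_algebra L)"
  using h
proof (induction rule: borel_measurable_induct)
  case (cong f g)
  show ?case
  proof (rule measurable_point_algebra_cong[OF _ cong(4)])
    fix \<mu> assume "\<mu> \<in> point_measures L"
    then show "(\<integral>\<^sup>+y. f y \<partial>\<mu>) = (\<integral>\<^sup>+y. g y \<partial>\<mu>)"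
      using cong(3) by (intro nn_integral_cong) (simp add: point_measuresD(1))
  qed
next
  case (set A)
  show ?case
  proof (rule measurable_point_algebra_cong[OF _ measurable_emeasure_point_algebra[OF set]])
    fix \<mu> assume "\<mu> \<in> point_measures L"
    then show "(\<integral>\<^sup>+y. indicator A y \<partial>\<mu>) = emeasure \<mu> A"
      using set by (simp add: point_measuresD(2))
  qed
next
  case (mult u c)
  show ?case
  proof (rule measurable_point_algebra_cong)
    fix \<mu> assume "\<mu> \<in> point_measures L"
    then show "(\<integral>\<^sup>+y. c * u y \<partial>\<mu>) = c * (\<integral>\<^sup>+y. u y \<partial>\<mu>)"
      by (intro nn_integral_cmult measurable_point_measure[OF _ mult(2)])
  qed (use mult(4) in measurable)
next
  case (add u v)
  show ?case
  proof (rule measurable_point_algebra_cong)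
    fix \<mu> assume "\<mu> \<in> point_measures L"
    then show "(\<integral>\<^sup>+y. v y + u y \<partial>\<mu>) = (\<integral>\<^sup>+y. v y \<partial>\<mu>) + (\<integral>\<^sup>+y. u y \<partial>\<mu>)"
      by (intro nn_integral_add measurable_point_measure[OF _ add(1)] measurable_point_measure[OF _ add(3)])
  qed (use add.IH in measurable)
next
  case (seq U)
  show ?case
  proof (rule measurable_point_algebra_cong)
    fix \<mu> assume "\<mu> \<in> point_measures L"
    then have "(\<integral>\<^sup>+y. (SUP i. U i y) \<partial>\<mu>) = (SUP i. \<integral>\<^sup>+y. U i y \<partial>\<mu>)"
      by (intro nn_integral_monotone_convergence_SUP seq(3) measurable_point_measure[OF _ seq(1)])
    then show "(\<integral>\<^sup>+y. (SUP i. U i) y \<partial>\<mu>) = (SUP i. \<integral>\<^sup>+y. U i y \<partial>\<mu>)"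
      by (simp add: image_comp)
  qed (intro borel_measurable_SUP seq; simp)
qed

text \<open>Where \<open>h\<close> is not integrable the integral is 0 by convention, which the
  difference of the two one-sided integrals does not reproduce in general; hence the case
  distinction on a measurable condition.\<close>

lemma integral_measurable_point_algebra:
  fixes h :: "'a \<Rightarrow> real"
  assumes h [measurable]: "h \<in> borel_measurable L"
  shows "(\<lambda>\<mu>. \<integral>y. h y \<partial>\<mu>) \<in> borel_measurable (point_algebra L)"
proof -
  have [measurable]: "(\<lambda>\<mu>. \<integral>\<^sup>+y. ennreal (h y) \<partial>\<mu>) \<in> borel_measurable (point_algebra L)"
    "(\<lambda>\<mu>. \<integral>\<^sup>+y. ennreal (- h y) \<partial>\<mu>) \<in> borel_measurable (point_algebra L)"
    "(\<lambda>\<mu>. \<integral>\<^sup>+y. ennreal \<bar>h y\<bar> \<partial>\<mu>) \<in> borel_measurable (point_algebra L)"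
    by (rule nn_integral_measurable_point_algebra; measurable)+
  have "(\<integral>y. h y \<partial>\<mu>) = (if (\<integral>\<^sup>+y. ennreal \<bar>h y\<bar> \<partial>\<mu>) < \<infinity> then
      enn2real (\<integral>\<^sup>+y. ennreal (h y) \<partial>\<mu>) - enn2real (\<integral>\<^sup>+y. ennreal (- h y) \<partial>\<mu>) else 0)" if "\<mu> \<in> point_measures L" for \<mu>
  proof -
    have iff: "integrable \<mu> h \<longleftrightarrow> (\<integral>\<^sup>+y. ennreal \<bar>h y\<bar> \<partial>\<mu>) < \<infinity>"
      using measurable_point_measure[OF that h] by (simp add: integrable_iff_bounded)
    show ?thesis
    proof (cases "integrable \<mu> h")
      case True
      then show ?thesis unfolding iff[symmetric] using real_lebesgue_integral_def[OF True] by simp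
    next
      case False
      then show ?thesis unfolding iff[symmetric] by (simp add: not_integrable_integral_eq)
    qed
  qed
  moreover have "(\<lambda>\<mu>. if (\<integral>\<^sup>+y. ennreal \<bar>h y\<bar> \<partial>\<mu>) < \<infinity> then
      enn2real (\<integral>\<^sup>+y. ennreal (h y) \<partial>\<mu>) - enn2real (\<integral>\<^sup>+y. ennreal (- h y) \<partial>\<mu>) else 0) \<in> borel_measurable (point_algebra L)"
    by measurable
  ultimately show ?thesis by (rule measurable_point_algebra_cong)
qed

lemma factorial_poly_measurable:
  assumes "\<And>j. j \<in> set js \<Longrightarrow> g j \<in> borel_measurable L"
  shows "factorial_poly js g \<in> borel_measurable (point_algebra L)"
  using assms
proof (induction js arbitrary: g)
  case Nil
  have "factorial_poly [] g = (\<lambda>_. 1)" by auto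
  then show ?case by simp
next
  case (Cons j js)
  have eq: "factorial_poly (j # js) g = (\<lambda>\<mu>. (\<integral>y. g j y \<partial>\<mu>) * factorial_poly js g \<mu>
     - (\<Sum>i\<in>set js. factorial_poly js (g(i := \<lambda>y. g j y * g i y)) \<mu>))" by auto
  show ?case unfolding eq
    using Cons.prems
    by (intro borel_measurable_diff borel_measurable_times borel_measurable_sum Cons.IH integral_measurable_point_algebra) auto
qed

lemma factorial_integral_measurable:
  "finite J \<Longrightarrow> (\<And>j. j \<in> J \<Longrightarrow> g j \<in> borel_measurable L) \<Longrightarrow> factorial_integral J g \<in> borel_measurable (point_algebra L)"
  using factorial_poly_measurable[of "sorted_list_of_set J" g L] by (simp add: factorial_integral_def[abs_def])

lemma factorial_poly_cong:
  "(\<And>j. j \<in> set js \<Longrightarrow> g j = h j) \<Longrightarrow> factorial_poly js g \<mu> = factorial_poly js h \<mu>"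
proof (induction js arbitrary: g h)
  case (Cons j js)
  have "factorial_poly js (g(i := \<lambda>y. g j y * g i y)) \<mu> = factorial_poly js (h(i := \<lambda>y. h j y * h i y)) \<mu>" if "i \<in> set js" for i
    using Cons.prems that by (intro Cons.IH) auto
  moreover have "factorial_poly js g \<mu> = factorial_poly js h \<mu>" using Cons.prems by (intro Cons.IH) auto
  ultimately show ?case using Cons.prems by simp
qed simp

lemma factorial_integral_cong:
  "finite J \<Longrightarrow> (\<And>j. j \<in> J \<Longrightarrow> g j = h j) \<Longrightarrow> factorial_integral J g \<mu> = factorial_integral J h \<mu>"
  unfolding factorial_integral_def by (intro factorial_poly_cong) simp

lemma Pow_insert_sum:
  assumes "finite J" "j \<notin> J"
  shows "(\<Sum>I\<in>Pow (insert j J). h I) = (\<Sum>I\<in>Pow J. h (insert j I) + (h I :: real))"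
proof -
  have "(\<Sum>I\<in>Pow (insert j J). h I) = (\<Sum>I\<in>Pow J. h I) + (\<Sum>I\<in>insert j ` Pow J. h I)"
    unfolding Pow_insert using assms by (intro sum.union_disjoint) auto
  also have "(\<Sum>I\<in>insert j ` Pow J. h I) = (\<Sum>I\<in>Pow J. h (insert j I))"
    using assms(2) by (subst sum.reindex) (auto simp: inj_on_def)
  finally show ?thesis by (simp add: sum.distrib)
qed

section \<open>Compensated factorial integrals\<close>

text \<open>The multiple integral of a product form as a functional of the configuration: formally,
  integration against powers of \<open>\<mu> - L\<close> off the diagonals. General index sets
  \<open>J\<close> are allowed so that single indices can be removed.\<close>

definition compensated_integral :: "'a measure \<Rightarrow> nat set \<Rightarrow> (nat \<Rightarrow> 'a \<Rightarrow> real) \<Rightarrow> 'a measure \<Rightarrow> real" where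
  "compensated_integral L J g \<mu> = (\<Sum>I\<in>Pow J. (- 1) ^ card (J - I) * factorial_integral I g \<mu>
     * (\<Prod>j\<in>J - I. \<integral>y. g j y \<partial>L))"

lemma compensated_integral_empty [simp]: "compensated_integral L {} g \<mu> = 1"
  by (simp add: compensated_integral_def)

text \<open>Pairing each subset with and without \<open>j\<close> isolates the compensation of the
  factor \<open>j\<close>; in this form the Mecke equation can be applied to that factor
  alone.\<close>

lemma compensated_integral_insert:
  assumes "finite J" "j \<notin> J"
  shows "compensated_integral L (insert j J) g \<mu> = (\<Sum>I\<in>Pow J. (- 1) ^ card (J - I) *
    (factorial_integral (insert j I) g \<mu> - (\<integral>y. g j y \<partial>L) * factorial_integral I g \<mu>) * (\<Prod>j\<in>J - I. \<integral>y. g j y \<partial>L))"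
  unfolding compensated_integral_def Pow_insert_sum[OF assms]
proof (rule sum.cong[OF refl])
  fix I assume I: "I \<in> Pow J"
  then have "insert j J - I = insert j (J - I)" "insert j J - insert j I = J - I" "j \<notin> J - I" "finite (J - I)"
    using assms by auto
  then show "(- 1) ^ card (insert j J - insert j I) * factorial_integral (insert j I) g \<mu> * (\<Prod>j\<in>insert j J - insert j I. \<integral>y. g j y \<partial>L) +
      (- 1) ^ card (insert j J - I) * factorial_integral I g \<mu> * (\<Prod>j\<in>insert j J - I. \<integral>y. g j y \<partial>L) =
      (- 1) ^ card (J - I) * (factorial_integral (insert j I) g \<mu> - (\<integral>y. g j y \<partial>L) * factorial_integral I g \<mu>) * (\<Prod>j\<in>J - I. \<integral>y. g j y \<partial>L)"
    by (simp add: algebra_simps)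
qed

text \<open>Only the factorial integrals see the added point. Collect the terms by the factor
  \<open>j\<close> that absorbs it: the subsets \<open>I\<close> containing \<open>j\<close>
  correspond to the subsets \<open>I - {j}\<close> of \<open>J - {j}\<close>, with the same signs
  and compensating integrals.\<close>

lemma compensated_integral_add_point:
  assumes \<mu>: "labelled L B \<mu> K x" and y: "y \<in> space L" and J: "finite J" "\<And>i. i \<in> J \<Longrightarrow> factor_on L B (g i)"
  shows "compensated_integral L J g (add_point \<mu> y) =
    compensated_integral L J g \<mu> + (\<Sum>j\<in>J. g j y * compensated_integral L (J - {j}) g \<mu>)"
proof -
  let ?P = "\<lambda>I. \<Prod>j\<in>I. \<integral>y. g j y \<partial>L" and ?s = "\<lambda>I. (- 1 :: real) ^ card (J - I)"
  have FI: "factorial_integral I g (add_point \<mu> y) =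
      factorial_integral I g \<mu> + (\<Sum>j\<in>I. g j y * factorial_integral (I - {j}) g \<mu>)" if "I \<in> Pow J" for I
    using J that by (intro factorial_integral_add_point[OF \<mu> y]) (auto intro: finite_subset)
  have "compensated_integral L J g (add_point \<mu> y) = compensated_integral L J g \<mu> +
      (\<Sum>I\<in>Pow J. \<Sum>j | j \<in> J \<and> j \<in> I. ?s I * (g j y * factorial_integral (I - {j}) g \<mu>) * ?P (J - I))"
  proof -
    have "{j \<in> J. j \<in> I} = I" if "I \<in> Pow J" for I using that by auto
    then show ?thesis
      unfolding compensated_integral_def sum.distrib[symmetric]
      by (intro sum.cong refl) (simp add: FI distrib_left distrib_right sum_distrib_left sum_distrib_right)
  qed
  also have "(\<Sum>I\<in>Pow J. \<Sum>j | j \<in> J \<and> j \<in> I. ?s I * (g j y * factorial_integral (I - {j}) g \<mu>) * ?P (J - I)) =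
      (\<Sum>j\<in>J. \<Sum>I | I \<in> Pow J \<and> j \<in> I. ?s I * (g j y * factorial_integral (I - {j}) g \<mu>) * ?P (J - I))"
    using J by (intro sum.swap_restrict) auto
  also have "\<dots> = (\<Sum>j\<in>J. g j y * compensated_integral L (J - {j}) g \<mu>)"
  proof (rule sum.cong[OF refl])
    fix j assume j: "j \<in> J"
    show "(\<Sum>I | I \<in> Pow J \<and> j \<in> I. ?s I * (g j y * factorial_integral (I - {j}) g \<mu>) * ?P (J - I)) =
        g j y * compensated_integral L (J - {j}) g \<mu>"
      unfolding compensated_integral_def sum_distrib_left
    proof (rule sum.reindex_bij_witness[where i="insert j" and j="\<lambda>I. I - {j}"], goal_cases)
      case (5 I)
      then have "J - {j} - (I - {j}) = J - I" by auto
      then show ?case by simp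
    qed (use j in auto)
  qed
  finally show ?thesis .
qed

lemma compensated_integral_measurable:
  assumes "finite J" "\<And>j. j \<in> J \<Longrightarrow> g j \<in> borel_measurable L"
  shows "compensated_integral L J g \<in> borel_measurable (point_algebra L)"
proof -
  have "(\<lambda>\<mu>. \<Sum>I\<in>Pow J. (- 1) ^ card (J - I) * factorial_integral I g \<mu> * (\<Prod>j\<in>J - I. \<integral>y. g j y \<partial>L))
      \<in> borel_measurable (point_algebra L)"
    using assms by (intro borel_measurable_sum borel_measurable_times borel_measurable_const factorial_integral_measurable)
      (auto intro: finite_subset)
  then show ?thesis by (simp add: compensated_integral_def[abs_def])
qed

text \<open>Polynomial growth in the number of points in \<open>B\<close> suffices for integrability
  against a function all of whose weighted moments are finite. Measures with infinite mass on
  \<open>B\<close> are excluded, because there \<open>measure\<close> takes the value 0 by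
  convention.\<close>

definition poly_bounded :: "'a measure \<Rightarrow> 'a set \<Rightarrow> ('a measure \<Rightarrow> real) \<Rightarrow> bool" where
  "poly_bounded L B F \<longleftrightarrow> (\<exists>C m. C \<ge> 0 \<and> (\<forall>\<mu>. sets \<mu> = sets L \<longrightarrow> emeasure \<mu> B < \<infinity> \<longrightarrow>
    \<bar>F \<mu>\<bar> \<le> C * (1 + measure \<mu> B) ^ m))"

lemma poly_bounded_const: "poly_bounded L B (\<lambda>\<mu>. c)"
  unfolding poly_bounded_def by (intro exI[of _ "\<bar>c\<bar>"] exI[of _ 0]) simp

lemma poly_bounded_scale:
  assumes "poly_bounded L B F"
  shows "poly_bounded L B (\<lambda>\<mu>. c * F \<mu>)"
proof -
  obtain C m where "C \<ge> 0" and C: "\<And>\<mu>. sets \<mu> = sets L \<Longrightarrow> emeasure \<mu> B < \<infinity> \<Longrightarrow> \<bar>F \<mu>\<bar> \<le> C * (1 + measure \<mu> B) ^ m"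
    using assms unfolding poly_bounded_def by blast
  then have "\<bar>c * F \<mu>\<bar> \<le> \<bar>c\<bar> * C * (1 + measure \<mu> B) ^ m" if "sets \<mu> = sets L" "emeasure \<mu> B < \<infinity>" for \<mu>
    using C[OF that] by (simp add: abs_mult mult.assoc mult_left_mono)
  then show ?thesis using \<open>C \<ge> 0\<close> unfolding poly_bounded_def
    by (intro exI[of _ "\<bar>c\<bar> * C"] exI[of _ m]) auto
qed

lemma poly_bounded_add:
  assumes "poly_bounded L B F" "poly_bounded L B G"
  shows "poly_bounded L B (\<lambda>\<mu>. F \<mu> + G \<mu>)"
proof -
  obtain C m where C: "C \<ge> 0" "\<And>\<mu>. sets \<mu> = sets L \<Longrightarrow> emeasure \<mu> B < \<infinity> \<Longrightarrow> \<bar>F \<mu>\<bar> \<le> C * (1 + measure \<mu> B) ^ m"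
    using assms(1) unfolding poly_bounded_def by blast
  obtain D n where D: "D \<ge> 0" "\<And>\<mu>. sets \<mu> = sets L \<Longrightarrow> emeasure \<mu> B < \<infinity> \<Longrightarrow> \<bar>G \<mu>\<bar> \<le> D * (1 + measure \<mu> B) ^ n"
    using assms(2) unfolding poly_bounded_def by blast
  have "\<bar>F \<mu> + G \<mu>\<bar> \<le> (C + D) * (1 + measure \<mu> B) ^ (m + n)" if \<mu>: "sets \<mu> = sets L" "emeasure \<mu> B < \<infinity>" for \<mu>
  proof -
    have "C * (1 + measure \<mu> B) ^ m \<le> C * (1 + measure \<mu> B) ^ (m + n)"
      "D * (1 + measure \<mu> B) ^ n \<le> D * (1 + measure \<mu> B) ^ (m + n)"
      using C(1) D(1) by (auto intro!: mult_left_mono power_increasing)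
    with C(2)[OF \<mu>] D(2)[OF \<mu>] show ?thesis by (simp add: distrib_right)
  qed
  then show ?thesis using C(1) D(1) unfolding poly_bounded_def
    by (intro exI[of _ "C + D"] exI[of _ "m + n"]) auto
qed

lemma poly_bounded_sum:
  "(\<And>i. i \<in> I \<Longrightarrow> poly_bounded L B (F i)) \<Longrightarrow> poly_bounded L B (\<lambda>\<mu>. \<Sum>i\<in>I. F i \<mu>)"
  by (induction I rule: infinite_finite_induct) (auto intro: poly_bounded_add poly_bounded_const)

lemma poly_bounded_factorial_integral:
  "B \<in> sets L \<Longrightarrow> finite J \<Longrightarrow> (\<And>j. j \<in> J \<Longrightarrow> factor_on L B (g j)) \<Longrightarrow> poly_bounded L B (factorial_integral J g)"
  using factorial_poly_bound[of B L "sorted_list_of_set J" g]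
  by (simp add: poly_bounded_def factorial_integral_def)

lemma poly_bounded_compensated_integral:
  assumes "B \<in> sets L" "finite J" "\<And>j. j \<in> J \<Longrightarrow> factor_on L B (g j)"
  shows "poly_bounded L B (compensated_integral L J g)"
proof -
  have "poly_bounded L B (\<lambda>\<mu>. \<Sum>I\<in>Pow J. ((- 1) ^ card (J - I) * (\<Prod>j\<in>J - I. \<integral>y. g j y \<partial>L)) * factorial_integral I g \<mu>)"
    using assms by (intro poly_bounded_sum poly_bounded_scale poly_bounded_factorial_integral) (auto intro: finite_subset)
  then show ?thesis by (simp add: compensated_integral_def[abs_def] ac_simps)
qed

lemma tensor_measurable:
  assumes "finite J" "\<And>j. j \<in> J \<Longrightarrow> g j \<in> borel_measurable L"
  shows "tensor J g \<in> borel_measurable (Pi\<^sub>M J (\<lambda>_. L))"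
proof -
  have "(\<lambda>y. \<Prod>j\<in>J. g j (y j)) \<in> borel_measurable (Pi\<^sub>M J (\<lambda>_. L))"
    using assms by (intro borel_measurable_prod) (auto intro: measurable_compose[OF measurable_component_singleton])
  then show ?thesis by (simp add: tensor_def[abs_def])
qed

lemma (in product_sigma_finite) PiM_insert_eq_distr:
  assumes "finite I" "i \<notin> I"
  shows "Pi\<^sub>M (insert i I) M = distr (M i \<Otimes>\<^sub>M Pi\<^sub>M I M) (Pi\<^sub>M (insert i I) M) (\<lambda>p. (snd p)(i := fst p))"
proof (rule measure_eqI)
  interpret I: sigma_finite_measure "Pi\<^sub>M I M" by (rule sigma_finite) fact
  have m: "(\<lambda>p. (snd p)(i := fst p)) \<in> M i \<Otimes>\<^sub>M Pi\<^sub>M I M \<rightarrow>\<^sub>M Pi\<^sub>M (insert i I) M"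
    by (rule measurable_fun_upd[where J=I]) auto
  fix A assume A: "A \<in> sets (Pi\<^sub>M (insert i I) M)"
  have "emeasure (Pi\<^sub>M (insert i I) M) A = (\<integral>\<^sup>+y. \<integral>\<^sup>+x. indicator A (x(i := y)) \<partial>Pi\<^sub>M I M \<partial>M i)"
    using A assms by (subst product_nn_integral_insert_rev[symmetric]) auto
  also have "\<dots> = (\<integral>\<^sup>+p. indicator A ((snd p)(i := fst p)) \<partial>(M i \<Otimes>\<^sub>M Pi\<^sub>M I M))"
    using measurable_compose[OF m borel_measurable_indicator[OF A]]
    by (subst I.nn_integral_fst[symmetric]) auto
  also have "\<dots> = emeasure (distr (M i \<Otimes>\<^sub>M Pi\<^sub>M I M) (Pi\<^sub>M (insert i I) M) (\<lambda>p. (snd p)(i := fst p))) A"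
    using A by (subst nn_integral_distr[OF m, symmetric]) auto
  finally show "emeasure (Pi\<^sub>M (insert i I) M) A = \<dots>" .
qed simp

text \<open>The new coordinate is integrated in the outermost integral. This matches
  \<open>iter_diff\<close>, where the last coordinate modifies \<open>f\<close> itself and has to be
  fixed before the others.\<close>

lemma (in product_sigma_finite) product_integral_insert_rev:
  fixes f :: "_ \<Rightarrow> real"
  assumes I: "finite I" "i \<notin> I" and f: "integrable (Pi\<^sub>M (insert i I) M) f"
  shows "(\<integral>x. f x \<partial>Pi\<^sub>M (insert i I) M) = (\<integral>y. \<integral>x. f (x(i := y)) \<partial>Pi\<^sub>M I M \<partial>M i)"
proof -
  interpret I: sigma_finite_measure "Pi\<^sub>M I M" by (rule sigma_finite) fact
  interpret P: pair_sigma_finite "M i" "Pi\<^sub>M I M" ..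
  have m: "(\<lambda>p. (snd p)(i := fst p)) \<in> M i \<Otimes>\<^sub>M Pi\<^sub>M I M \<rightarrow>\<^sub>M Pi\<^sub>M (insert i I) M"
    by (rule measurable_fun_upd[where J=I]) auto
  have "integrable (M i \<Otimes>\<^sub>M Pi\<^sub>M I M) (\<lambda>p. f ((snd p)(i := fst p)))"
    using f by (subst (asm) PiM_insert_eq_distr[OF I], subst (asm) integrable_distr_eq[OF m]) auto
  note P.integral_fst'[OF this]
  moreover have "(\<integral>x. f x \<partial>Pi\<^sub>M (insert i I) M) = (\<integral>p. f ((snd p)(i := fst p)) \<partial>(M i \<Otimes>\<^sub>M Pi\<^sub>M I M))"
    using f by (subst PiM_insert_eq_distr[OF I], subst integral_distr[OF m]) auto
  ultimately show ?thesis by simp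
qed

context poisson_points
begin

sublocale LM: pair_sigma_finite L M ..

sublocale LP: product_sigma_finite "\<lambda>_. L" ..

lemma AE_eta_finite:
  assumes "B \<in> finite_sets L"
  shows "AE \<omega> in M. emeasure (\<eta> \<omega>) B < \<infinity>"
proof -
  have "AE \<omega> in M. \<exists>k::nat. emeasure (\<eta> \<omega>) B = of_nat k"
    by (rule poisson_AE[OF eta_poisson[OF finite_setsD(1)[OF assms]] finite_setsD(2)[OF assms]])
  then show ?thesis by eventually_elim (auto simp: of_nat_less_top)
qed

text \<open>\<open>\<eta>(B)\<close> is the number of labels with \<open>X k \<omega>\<close> in
  \<open>B\<close>, so finite mass means a finite set of labels; functions supported in
  \<open>B\<close> see no others.\<close>

lemma eta_labelled:
  assumes w: "\<omega> \<in> space M" and B: "B \<in> sets L" and fin: "emeasure (\<eta> \<omega>) B < \<infinity>"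
  shows "labelled L B (\<eta> \<omega>) {k. of_nat k < emeasure (\<eta> \<omega>) (space L) \<and> X k \<omega> \<in> B} (\<lambda>k. X k \<omega>)"
proof -
  let ?K = "{k. of_nat k < emeasure (\<eta> \<omega>) (space L)}"
  let ?KB = "{k. of_nat k < emeasure (\<eta> \<omega>) (space L) \<and> X k \<omega> \<in> B}"
  have "emeasure (\<eta> \<omega>) B = (\<integral>\<^sup>+y. indicator B y \<partial>\<eta> \<omega>)" using B w by (simp add: eta_sets)
  also have "\<dots> = (\<integral>\<^sup>+k. indicator ?KB k \<partial>count_space UNIV)"
    unfolding nn_integral_eta[OF w borel_measurable_indicator[OF B]]
    by (intro nn_integral_cong) (simp add: indicator_def)
  also have "\<dots> = emeasure (count_space UNIV) ?KB" by simp
  finally have K: "finite ?KB" using fin by (auto simp: emeasure_count_space split: if_splits)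
  have "(\<integral>y. h y \<partial>\<eta> \<omega>) = (\<Sum>k\<in>?KB. h (X k \<omega>))" if h: "factor_on L B h" for h
  proof -
    have zero: "h (X k \<omega>) = 0" if "X k \<omega> \<notin> B" for k
      using h that measurable_space[OF X_measurable w] by (auto simp: factor_on_def)
    let ?S = "{k \<in> UNIV. indicator ?K k * h (X k \<omega>) \<noteq> 0}"
    have sub: "?S \<subseteq> ?KB" using zero by (auto simp: indicator_def)
    have "(\<integral>y. h y \<partial>\<eta> \<omega>) = (\<Sum>k | k \<in> UNIV \<and> indicator ?K k * h (X k \<omega>) \<noteq> 0. indicator ?K k * h (X k \<omega>))"
      unfolding integral_eta[OF w factor_on_measurable[OF h]]
      by (rule lebesgue_integral_count_space_finite_support) (rule finite_subset[OF sub K])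
    also have "\<dots> = (\<Sum>k\<in>?KB. indicator ?K k * h (X k \<omega>))"
      using K sub by (intro sum.mono_neutral_left) auto
    finally show ?thesis by simp
  qed
  then show ?thesis
    using K w factor_on_integrable(1)[OF _ eta_sets[OF w] B fin] by (auto simp: labelled_def eta_sets)
qed

subsection \<open>Moments\<close>

lemma measure_eta_measurable [measurable]: "B \<in> sets L \<Longrightarrow> (\<lambda>\<omega>. measure (\<eta> \<omega>) B) \<in> borel_measurable M"
  unfolding measure_def by measurable

lemma square_integrable_powr:
  assumes B: "B \<in> finite_sets L" and r: "r > 0"
  shows "square_integrable M (\<lambda>\<omega>. r powr measure (\<eta> \<omega>) B)"
proof -
  note [measurable] = finite_setsD(1)[OF B]
  have "(\<integral>\<^sup>+\<omega>. ennreal ((r powr measure (\<eta> \<omega>) B)\<^sup>2) \<partial>M) < \<infinity>"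
    using nn_integral_poisson_powr[OF eta_poisson finite_setsD(2)[OF B], of "r\<^sup>2"] r
    by (simp add: measure_def powr_power power2_eq_square powr_mult)
  then show ?thesis by (simp add: square_integrable_def integrableI_nonneg)
qed

text \<open>By \<open>1 + t \<le> exp t\<close> the polynomial weight is dominated by an exponential
  one.\<close>

lemma square_integrable_weight:
  assumes B: "B \<in> finite_sets L"
  shows "square_integrable M (\<lambda>\<omega>. (1 + measure (\<eta> \<omega>) B) ^ m)"
proof (rule square_integrable_bound[OF square_integrable_powr[OF B, of "exp (real m)"]])
  note [measurable] = finite_setsD(1)[OF B]
  show "(\<lambda>\<omega>. (1 + measure (\<eta> \<omega>) B) ^ m) \<in> borel_measurable M" by measurable
  have "(1 + t) ^ m \<le> exp (real m) powr t" if "t \<ge> 0" for t :: real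
  proof -
    have "(1 + t) ^ m \<le> exp t ^ m" using that by (intro power_mono) auto
    also have "\<dots> = exp (real m) powr t" by (simp add: powr_def exp_of_nat_mult[symmetric] mult.commute)
    finally show ?thesis .
  qed
  then show "AE \<omega> in M. \<bar>(1 + measure (\<eta> \<omega>) B) ^ m\<bar> \<le> \<bar>exp (real m) powr measure (\<eta> \<omega>) B\<bar>"
    by simp
qed simp

text \<open>These weights are forced by the Mecke equation: moving a point of \<open>B\<close> into
  the configuration costs one factor \<open>\<eta>(B)\<close>, that is, one step in
  \<open>m\<close>.\<close>

definition weighted_norm :: "'a set \<Rightarrow> nat \<Rightarrow> ('a measure \<Rightarrow> real) \<Rightarrow> ennreal" where
  "weighted_norm B m f = (\<integral>\<^sup>+\<omega>. ennreal (\<bar>f (\<eta> \<omega>)\<bar> * (1 + measure (\<eta> \<omega>) B) ^ m) \<partial>M)"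

text \<open>Square integrability of \<open>f(\<eta>)\<close> implies this property, which, unlike
  square integrability, passes to \<open>diff_op y f\<close> for almost every \<open>y\<close> in
  \<open>B\<close>.\<close>

definition moments_finite :: "'a set \<Rightarrow> ('a measure \<Rightarrow> real) \<Rightarrow> bool" where
  "moments_finite B f \<longleftrightarrow> f \<in> borel_measurable (point_algebra L) \<and> (\<forall>m. weighted_norm B m f < \<infinity>)"

text \<open>Cauchy-Schwarz, since every polynomial weight is itself square integrable.\<close>

lemma moments_finite_square_integrable:
  assumes B: "B \<in> finite_sets L" and f: "f \<in> borel_measurable (point_algebra L)" "square_integrable M (\<lambda>\<omega>. f (\<eta> \<omega>))"
  shows "moments_finite B f"
proof -
  have "integrable M (\<lambda>\<omega>. f (\<eta> \<omega>) * (1 + measure (\<eta> \<omega>) B) ^ m)" for m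
    by (rule integrable_mult_square[OF f(2) square_integrable_weight[OF B]])
  then have "weighted_norm B m f < \<infinity>" for m
    unfolding weighted_norm_def integrable_iff_bounded by (simp add: abs_mult)
  then show ?thesis using f by (simp add: moments_finite_def)
qed

lemma poly_bounded_square_integrable:
  assumes B: "B \<in> finite_sets L" and F: "poly_bounded L B F" "F \<in> borel_measurable (point_algebra L)"
  shows "square_integrable M (\<lambda>\<omega>. F (\<eta> \<omega>))"
proof -
  obtain C m where C: "C \<ge> 0" "\<And>\<mu>. sets \<mu> = sets L \<Longrightarrow> emeasure \<mu> B < \<infinity> \<Longrightarrow> \<bar>F \<mu>\<bar> \<le> C * (1 + measure \<mu> B) ^ m"
    using F(1) unfolding poly_bounded_def by blast
  show ?thesis
  proof (rule square_integrable_bound[OF square_integrable_scale[OF square_integrable_weight[OF B], of C m]])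
    show "(\<lambda>\<omega>. F (\<eta> \<omega>)) \<in> borel_measurable M" using F(2) by measurable
    show "AE \<omega> in M. \<bar>F (\<eta> \<omega>)\<bar> \<le> \<bar>C * (1 + measure (\<eta> \<omega>) B) ^ m\<bar>"
      using AE_eta_finite[OF B] AE_space
    proof eventually_elim
      case (elim \<omega>)
      have "\<bar>F (\<eta> \<omega>)\<bar> \<le> C * (1 + measure (\<eta> \<omega>) B) ^ m"
        using C(2)[OF eta_sets[OF elim(2)] elim(1)] .
      then show ?case by linarith
    qed
  qed
qed

lemma weighted_norm_measurable:
  assumes F: "(\<lambda>(y, \<mu>). F y \<mu>) \<in> borel_measurable (N \<Otimes>\<^sub>M point_algebra L)" and B [measurable]: "B \<in> sets L"
  shows "(\<lambda>y. weighted_norm B m (F y)) \<in> borel_measurable N"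
proof -
  have "(\<lambda>p. (fst p, \<eta> (snd p))) \<in> N \<Otimes>\<^sub>M M \<rightarrow>\<^sub>M N \<Otimes>\<^sub>M point_algebra L" by measurable
  from measurable_compose[OF this F]
  have [measurable]: "(\<lambda>p. F (fst p) (\<eta> (snd p))) \<in> borel_measurable (N \<Otimes>\<^sub>M M)" by simp
  have "(\<lambda>p. ennreal (\<bar>F (fst p) (\<eta> (snd p))\<bar> * (1 + measure (\<eta> (snd p)) B) ^ m)) \<in> borel_measurable (N \<Otimes>\<^sub>M M)"
    by measurable
  then show ?thesis unfolding weighted_norm_def
    by (intro borel_measurable_nn_integral) (simp add: case_prod_beta)
qed

text \<open>The weight is first enlarged to that of the configuration with the added point. The
  integrand then depends on the pair of shifted configuration and point, the Mecke equation turns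
  the integral over \<open>B\<close> into a factor \<open>\<eta>(B)\<close>, and the exponent
  \<open>m + 1\<close> absorbs it.\<close>

lemma weighted_norm_shift:
  assumes B: "B \<in> finite_sets L" and f [measurable]: "f \<in> borel_measurable (point_algebra L)"
  shows "(\<integral>\<^sup>+y. weighted_norm B m (\<lambda>\<mu>. f (add_point \<mu> y)) * indicator B y \<partial>L) \<le> weighted_norm B (Suc m) f"
proof -
  note [measurable] = finite_setsD(1)[OF B]
  let ?F = "\<lambda>p. ennreal (\<bar>f (fst p)\<bar> * (1 + measure (fst p) B) ^ m) * indicator B (snd p)"
  have mB [measurable]: "(\<lambda>p. measure (fst p) B) \<in> borel_measurable (point_algebra L \<Otimes>\<^sub>M L)"
    unfolding measure_def by measurable
  have "(\<integral>\<^sup>+y. weighted_norm B m (\<lambda>\<mu>. f (add_point \<mu> y)) * indicator B y \<partial>L) =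
      (\<integral>\<^sup>+y. (\<integral>\<^sup>+\<omega>. ennreal (\<bar>f (add_point (\<eta> \<omega>) y)\<bar> * (1 + measure (\<eta> \<omega>) B) ^ m) * indicator B y \<partial>M) \<partial>L)"
    unfolding weighted_norm_def by (intro nn_integral_cong) (auto simp: indicator_def)
  also have "\<dots> \<le> (\<integral>\<^sup>+y. \<integral>\<^sup>+\<omega>. ?F (add_point (\<eta> \<omega>) y, y) \<partial>M \<partial>L)"
  proof (rule nn_integral_mono, rule nn_integral_mono_AE, use AE_eta_finite[OF B] AE_space in eventually_elim)
    case (elim y \<omega>)
    have "measure (\<eta> \<omega>) B \<le> measure (add_point (\<eta> \<omega>) y) B"
      unfolding measure_def using elim finite_setsD(1)[OF B]
      by (intro enn2real_mono) (auto simp: emeasure_add_point eta_sets indicator_def)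
    then show ?case by (auto intro!: mult_right_mono ennreal_leI mult_left_mono power_mono)
  qed
  also have "\<dots> = (\<integral>\<^sup>+\<omega>. \<integral>\<^sup>+y. ?F (\<eta> \<omega>, y) \<partial>\<eta> \<omega> \<partial>M)"
    by (rule mecke_nn_integral[symmetric]) measurable
  also have "\<dots> \<le> weighted_norm B (Suc m) f"
    unfolding weighted_norm_def
  proof (rule nn_integral_mono_AE, use AE_eta_finite[OF B] AE_space in eventually_elim)
    case (elim \<omega>)
    have "(\<integral>\<^sup>+y. ?F (\<eta> \<omega>, y) \<partial>\<eta> \<omega>) = ennreal (\<bar>f (\<eta> \<omega>)\<bar> * (1 + measure (\<eta> \<omega>) B) ^ m) * emeasure (\<eta> \<omega>) B"
      using finite_setsD(1)[OF B] elim by (simp add: nn_integral_cmult_indicator eta_sets)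
    also have "emeasure (\<eta> \<omega>) B = ennreal (measure (\<eta> \<omega>) B)"
      using elim by (simp add: emeasure_eq_ennreal_measure top.not_eq_extremum)
    also have "ennreal (\<bar>f (\<eta> \<omega>)\<bar> * (1 + measure (\<eta> \<omega>) B) ^ m) * ennreal (measure (\<eta> \<omega>) B) =
        ennreal (\<bar>f (\<eta> \<omega>)\<bar> * (1 + measure (\<eta> \<omega>) B) ^ m * measure (\<eta> \<omega>) B)"
      by (rule ennreal_mult[symmetric]) auto
    also have "\<dots> \<le> ennreal (\<bar>f (\<eta> \<omega>)\<bar> * (1 + measure (\<eta> \<omega>) B) ^ m * (1 + measure (\<eta> \<omega>) B))"
      by (intro ennreal_leI mult_left_mono) auto
    also have "\<dots> = ennreal (\<bar>f (\<eta> \<omega>)\<bar> * (1 + measure (\<eta> \<omega>) B) ^ Suc m)"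
      by (simp add: ac_simps)
    finally show ?case .
  qed
  finally show ?thesis .
qed

text \<open>In the constant, 1 belongs to the shifted configuration and \<open>emeasure L B\<close>
  to the unshifted one, whose weighted norm does not depend on \<open>y\<close>.\<close>

lemma weighted_norm_diff_op:
  assumes B: "B \<in> finite_sets L" and f [measurable]: "f \<in> borel_measurable (point_algebra L)"
  shows "(\<integral>\<^sup>+y. weighted_norm B m (diff_op y f) * indicator B y \<partial>L) \<le> (1 + emeasure L B) * weighted_norm B (Suc m) f"
proof -
  note [measurable] = finite_setsD(1)[OF B]
  have [measurable]: "(\<lambda>y. weighted_norm B m (\<lambda>\<mu>. f (add_point \<mu> y))) \<in> borel_measurable L"
  proof (rule weighted_norm_measurable)
    show "(\<lambda>(y, \<mu>). f (add_point \<mu> y)) \<in> borel_measurable (L \<Otimes>\<^sub>M point_algebra L)"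
      unfolding case_prod_beta by measurable
  qed measurable
  have "weighted_norm B m (diff_op y f) \<le> weighted_norm B m (\<lambda>\<mu>. f (add_point \<mu> y)) + weighted_norm B m f" if "y \<in> space L" for y
  proof -
    have "weighted_norm B m (diff_op y f) \<le> (\<integral>\<^sup>+\<omega>. ennreal (\<bar>f (add_point (\<eta> \<omega>) y)\<bar> * (1 + measure (\<eta> \<omega>) B) ^ m) +
        ennreal (\<bar>f (\<eta> \<omega>)\<bar> * (1 + measure (\<eta> \<omega>) B) ^ m) \<partial>M)"
      unfolding weighted_norm_def diff_op_def
      by (intro nn_integral_mono) (auto simp: ennreal_plus[symmetric] distrib_right[symmetric]
        simp del: ennreal_plus intro!: ennreal_leI mult_right_mono)
    also have "\<dots> = weighted_norm B m (\<lambda>\<mu>. f (add_point \<mu> y)) + weighted_norm B m f"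
      unfolding weighted_norm_def using that by (intro nn_integral_add) measurable
    finally show ?thesis .
  qed
  then have "(\<integral>\<^sup>+y. weighted_norm B m (diff_op y f) * indicator B y \<partial>L) \<le>
      (\<integral>\<^sup>+y. weighted_norm B m (\<lambda>\<mu>. f (add_point \<mu> y)) * indicator B y + weighted_norm B m f * indicator B y \<partial>L)"
    by (intro nn_integral_mono) (auto simp: distrib_right[symmetric] intro!: mult_right_mono)
  also have "\<dots> = (\<integral>\<^sup>+y. weighted_norm B m (\<lambda>\<mu>. f (add_point \<mu> y)) * indicator B y \<partial>L) + weighted_norm B m f * emeasure L B"
    by (subst nn_integral_add) (auto simp: nn_integral_cmult_indicator)
  also have "\<dots> \<le> weighted_norm B (Suc m) f + weighted_norm B (Suc m) f * emeasure L B"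
  proof (intro add_mono weighted_norm_shift B f mult_right_mono)
    show "weighted_norm B m f \<le> weighted_norm B (Suc m) f"
      unfolding weighted_norm_def
      by (intro nn_integral_mono ennreal_leI mult_left_mono power_increasing) auto
  qed auto
  also have "\<dots> = (1 + emeasure L B) * weighted_norm B (Suc m) f"
    by (simp add: distrib_right mult.commute)
  finally show ?thesis .
qed

lemma diff_op_measurable:
  "f \<in> borel_measurable (point_algebra L) \<Longrightarrow> y \<in> space L \<Longrightarrow> diff_op y f \<in> borel_measurable (point_algebra L)"
  using measurable_compose[OF measurable_add_point[OF measurable_ident_sets[OF refl] measurable_const]]
  unfolding diff_op_def by (intro borel_measurable_diff) auto

lemma diff_op_joint_measurable:
  "f \<in> borel_measurable (point_algebra L) \<Longrightarrow> (\<lambda>(y, \<mu>). diff_op y f \<mu>) \<in> borel_measurable (L \<Otimes>\<^sub>M point_algebra L)"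
  using measurable_diff_op[of "\<lambda>_. f" L L "\<lambda>y. y"] by simp

text \<open>There are countably many exponents \<open>m\<close>, so one null set serves all the
  weights.\<close>

lemma AE_moments_finite_diff_op:
  assumes B: "B \<in> finite_sets L" and f: "moments_finite B f"
  shows "AE y in L. y \<in> B \<longrightarrow> moments_finite B (diff_op y f)"
proof -
  note [measurable] = finite_setsD(1)[OF B]
  have fm [measurable]: "f \<in> borel_measurable (point_algebra L)" using f by (simp add: moments_finite_def)
  have "AE y in L. weighted_norm B m (diff_op y f) * indicator B y \<noteq> \<infinity>" for m
  proof (rule nn_integral_noteq_infinite)
    have [measurable]: "(\<lambda>y. weighted_norm B m (diff_op y f)) \<in> borel_measurable L"
      by (rule weighted_norm_measurable[OF diff_op_joint_measurable]) measurable
    show "(\<lambda>y. weighted_norm B m (diff_op y f) * indicator B y) \<in> borel_measurable L" by measurable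
    have "(1 + emeasure L B) * weighted_norm B (Suc m) f < \<infinity>"
      using f finite_setsD(2)[OF B] by (simp add: moments_finite_def ennreal_mult_less_top)
    with weighted_norm_diff_op[OF B fm, of m]
    show "(\<integral>\<^sup>+y. weighted_norm B m (diff_op y f) * indicator B y \<partial>L) \<noteq> \<infinity>" by auto
  qed
  then have "AE y in L. \<forall>m. weighted_norm B m (diff_op y f) * indicator B y \<noteq> \<infinity>"
    by (subst AE_all_countable) blast
  then show ?thesis using AE_space
  proof eventually_elim
    case (elim y)
    then show ?case using diff_op_measurable[OF fm]
      by (auto simp: moments_finite_def top.not_eq_extremum)
  qed
qed

text \<open>Each of the \<open>n\<close> differences costs one power of the weight and one factor
  \<open>1 + emeasure L B\<close>. The outermost variable is the point applied to \<open>f\<close>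
  first, so the induction hypothesis is used for \<open>diff_op z f\<close>.\<close>

lemma weighted_norm_iter_diff:
  assumes B: "B \<in> finite_sets L" and f: "f \<in> borel_measurable (point_algebra L)"
  shows "(\<integral>\<^sup>+y. weighted_norm B m (iter_diff n f y) * (\<Prod>i<n. indicator B (y i)) \<partial>power_measure L n)
    \<le> (1 + emeasure L B) ^ n * weighted_norm B (m + n) f"
  using f
proof (induction n arbitrary: f)
  case 0
  interpret P0: prob_space "Pi\<^sub>M {} (\<lambda>_. L)" by (intro prob_space_PiM) auto
  show ?case by (simp add: iter_diff_def lessThan_0 P0.emeasure_space_1)
next
  case (Suc n)
  note [measurable] = finite_setsD(1)[OF B]
  have m: "(\<lambda>y. weighted_norm B m (iter_diff (Suc n) f y) * (\<Prod>i<Suc n. indicator B (y i))) \<in> borel_measurable (power_measure L (Suc n))"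
    using weighted_norm_measurable[OF measurable_iter_diff[OF Suc.prems, of "Suc n"] finite_setsD(1)[OF B], of m]
    by measurable
  have "(\<integral>\<^sup>+y. weighted_norm B m (iter_diff (Suc n) f y) * (\<Prod>i<Suc n. indicator B (y i)) \<partial>power_measure L (Suc n)) =
      (\<integral>\<^sup>+z. \<integral>\<^sup>+y. weighted_norm B m (iter_diff (Suc n) f (y(n := z))) * (\<Prod>i<Suc n. indicator B ((y(n := z)) i)) \<partial>power_measure L n \<partial>L)"
    using LP.product_nn_integral_insert_rev[of "{..<n}" n "\<lambda>y. weighted_norm B m (iter_diff (Suc n) f y) * (\<Prod>i<Suc n. indicator B (y i))"] m
    by (simp add: lessThan_Suc del: fun_upd_apply)
  also have "\<dots> = (\<integral>\<^sup>+z. (\<integral>\<^sup>+y. weighted_norm B m (iter_diff n (diff_op z f) y) * (\<Prod>i<n. indicator B (y i)) \<partial>power_measure L n) * indicator B z \<partial>L)"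
  proof (rule nn_integral_cong)
    fix z assume z: "z \<in> space L"
    have "(\<lambda>y. weighted_norm B m (iter_diff n (diff_op z f) y) * (\<Prod>i<n. indicator B (y i))) \<in> borel_measurable (power_measure L n)"
      using weighted_norm_measurable[OF measurable_iter_diff[OF diff_op_measurable[OF Suc.prems z], of n] finite_setsD(1)[OF B], of m]
      by measurable
    then have "(\<integral>\<^sup>+y. weighted_norm B m (iter_diff n (diff_op z f) y) * (\<Prod>i<n. indicator B (y i)) \<partial>power_measure L n) * indicator B z =
        (\<integral>\<^sup>+y. weighted_norm B m (iter_diff n (diff_op z f) y) * (\<Prod>i<n. indicator B (y i)) * indicator B z \<partial>power_measure L n)"
      by (rule nn_integral_multc[symmetric])
    also have "\<dots> = (\<integral>\<^sup>+y. weighted_norm B m (iter_diff (Suc n) f (y(n := z))) * (\<Prod>i<Suc n. indicator B ((y(n := z)) i)) \<partial>power_measure L n)"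
    proof (rule nn_integral_cong)
      fix y
      have "(\<Prod>i<n. indicator B ((y(n := z)) i)) = (\<Prod>i<n. indicator B (y i) :: ennreal)"
        by (intro prod.cong) auto
      then show "weighted_norm B m (iter_diff n (diff_op z f) y) * (\<Prod>i<n. indicator B (y i)) * indicator B z =
          weighted_norm B m (iter_diff (Suc n) f (y(n := z))) * (\<Prod>i<Suc n. indicator B ((y(n := z)) i))"
        by (simp add: iter_diff_Suc mult.assoc)
    qed
    finally show "(\<integral>\<^sup>+y. weighted_norm B m (iter_diff (Suc n) f (y(n := z))) * (\<Prod>i<Suc n. indicator B ((y(n := z)) i)) \<partial>power_measure L n) =
        (\<integral>\<^sup>+y. weighted_norm B m (iter_diff n (diff_op z f) y) * (\<Prod>i<n. indicator B (y i)) \<partial>power_measure L n) * indicator B z"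
      by simp
  qed
  also have "\<dots> \<le> (\<integral>\<^sup>+z. (1 + emeasure L B) ^ n * (weighted_norm B (m + n) (diff_op z f) * indicator B z) \<partial>L)"
    using Suc.IH[OF diff_op_measurable[OF Suc.prems]]
    by (intro nn_integral_mono) (auto simp: mult.assoc[symmetric] intro!: mult_right_mono)
  also have "\<dots> = (1 + emeasure L B) ^ n * (\<integral>\<^sup>+z. weighted_norm B (m + n) (diff_op z f) * indicator B z \<partial>L)"
  proof (rule nn_integral_cmult)
    have [measurable]: "(\<lambda>z. weighted_norm B (m + n) (diff_op z f)) \<in> borel_measurable L"
      by (rule weighted_norm_measurable[OF diff_op_joint_measurable[OF Suc.prems] finite_setsD(1)[OF B]])
    show "(\<lambda>z. weighted_norm B (m + n) (diff_op z f) * indicator B z) \<in> borel_measurable L" by measurable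
  qed
  also have "\<dots> \<le> (1 + emeasure L B) ^ n * ((1 + emeasure L B) * weighted_norm B (Suc (m + n)) f)"
    by (intro mult_left_mono weighted_norm_diff_op B Suc.prems) auto
  finally show ?case by (simp add: ac_simps)
qed

end

context poisson_points
begin

subsection \<open>The compensated integral as an adjoint of the difference operator\<close>

lemma integrable_shift_product:
  assumes B: "B \<in> finite_sets L" and f: "moments_finite B f"
    and F: "poly_bounded L B F" "F \<in> borel_measurable (point_algebra L)" and u: "factor_on L B u"
  shows "integrable (L \<Otimes>\<^sub>M M) (\<lambda>p. u (fst p) * (f (add_point (\<eta> (snd p)) (fst p)) * F (\<eta> (snd p))))" (is ?A)
    and "integrable (L \<Otimes>\<^sub>M M) (\<lambda>p. u (fst p) * (f (\<eta> (snd p)) * F (\<eta> (snd p))))" (is ?B)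
proof -
  note [measurable] = finite_setsD(1)[OF B] F(2) factor_on_measurable[OF u]
  have fm [measurable]: "f \<in> borel_measurable (point_algebra L)" using f by (simp add: moments_finite_def)
  obtain C m where C: "C \<ge> 0" "\<And>\<mu>. sets \<mu> = sets L \<Longrightarrow> emeasure \<mu> B < \<infinity> \<Longrightarrow> \<bar>F \<mu>\<bar> \<le> C * (1 + measure \<mu> B) ^ m"
    using F(1) unfolding poly_bounded_def by blast
  obtain D where D: "D \<ge> 0" "\<And>y. y \<in> space L \<Longrightarrow> \<bar>u y\<bar> \<le> D * indicator B y"
    using factor_on_bound[OF u] by blast
  \<comment> \<open>A general \<open>h y\<close> serves both claims: it is later \<open>f\<close>
    shifted by \<open>y\<close>, and \<open>f\<close> itself.\<close>
  have key: "(\<integral>\<^sup>+y. \<integral>\<^sup>+\<omega>. ennreal \<bar>u y * (h y (\<eta> \<omega>) * F (\<eta> \<omega>))\<bar> \<partial>M \<partial>L) \<le>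
      ennreal (D * C) * (\<integral>\<^sup>+y. weighted_norm B m (h y) * indicator B y \<partial>L)"
    if h: "(\<lambda>(y, \<mu>). h y \<mu>) \<in> borel_measurable (L \<Otimes>\<^sub>M point_algebra L)" for h
  proof -
    have [measurable]: "(\<lambda>y. weighted_norm B m (h y)) \<in> borel_measurable L"
      by (rule weighted_norm_measurable[OF h]) measurable
    have "(\<integral>\<^sup>+\<omega>. ennreal \<bar>u y * (h y (\<eta> \<omega>) * F (\<eta> \<omega>))\<bar> \<partial>M) \<le> ennreal (D * C) * (weighted_norm B m (h y) * indicator B y)"
      if y: "y \<in> space L" for y
    proof -
      have [measurable]: "h y \<in> borel_measurable (point_algebra L)"
        using measurable_compose[OF measurable_Pair1'[OF y] h] by simp
      have "(\<integral>\<^sup>+\<omega>. ennreal \<bar>u y * (h y (\<eta> \<omega>) * F (\<eta> \<omega>))\<bar> \<partial>M) \<le>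
          (\<integral>\<^sup>+\<omega>. ennreal (D * C * indicator B y) * ennreal (\<bar>h y (\<eta> \<omega>)\<bar> * (1 + measure (\<eta> \<omega>) B) ^ m) \<partial>M)"
      proof (rule nn_integral_mono_AE, use AE_eta_finite[OF B] AE_space in eventually_elim)
        case (elim \<omega>)
        have "\<bar>u y * (h y (\<eta> \<omega>) * F (\<eta> \<omega>))\<bar> \<le> (D * indicator B y) * (\<bar>h y (\<eta> \<omega>)\<bar> * (C * (1 + measure (\<eta> \<omega>) B) ^ m))"
          unfolding abs_mult using D(2)[OF y] C(2)[OF eta_sets[OF elim(2)] elim(1)] D(1)
          by (intro mult_mono mult_left_mono) auto
        then have "\<bar>u y * (h y (\<eta> \<omega>) * F (\<eta> \<omega>))\<bar> \<le> (D * C * indicator B y) * (\<bar>h y (\<eta> \<omega>)\<bar> * (1 + measure (\<eta> \<omega>) B) ^ m)"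
          by (simp add: ac_simps)
        then show ?case using C(1) D(1) by (subst ennreal_mult[symmetric]) (auto intro!: ennreal_leI)
      qed
      also have "\<dots> = ennreal (D * C * indicator B y) * weighted_norm B m (h y)"
        unfolding weighted_norm_def by (rule nn_integral_cmult) measurable
      also have "\<dots> = ennreal (D * C) * (weighted_norm B m (h y) * indicator B y)"
        by (auto simp: indicator_def)
      finally show ?thesis .
    qed
    then have "(\<integral>\<^sup>+y. \<integral>\<^sup>+\<omega>. ennreal \<bar>u y * (h y (\<eta> \<omega>) * F (\<eta> \<omega>))\<bar> \<partial>M \<partial>L) \<le>
        (\<integral>\<^sup>+y. ennreal (D * C) * (weighted_norm B m (h y) * indicator B y) \<partial>L)"
      by (intro nn_integral_mono) auto
    also have "\<dots> = ennreal (D * C) * (\<integral>\<^sup>+y. weighted_norm B m (h y) * indicator B y \<partial>L)"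
      by (rule nn_integral_cmult) measurable
    finally show ?thesis .
  qed
  have wf: "weighted_norm B k f < \<infinity>" for k using f by (simp add: moments_finite_def)
  have "(\<integral>\<^sup>+p. ennreal \<bar>u (fst p) * (f (add_point (\<eta> (snd p)) (fst p)) * F (\<eta> (snd p)))\<bar> \<partial>(L \<Otimes>\<^sub>M M)) =
      (\<integral>\<^sup>+y. \<integral>\<^sup>+\<omega>. ennreal \<bar>u y * (f (add_point (\<eta> \<omega>) y) * F (\<eta> \<omega>))\<bar> \<partial>M \<partial>L)"
    by (subst nn_integral_fst[symmetric]) auto
  also have "\<dots> \<le> ennreal (D * C) * (\<integral>\<^sup>+y. weighted_norm B m (\<lambda>\<mu>. f (add_point \<mu> y)) * indicator B y \<partial>L)"
  proof (rule key)
    show "(\<lambda>(y, \<mu>). f (add_point \<mu> y)) \<in> borel_measurable (L \<Otimes>\<^sub>M point_algebra L)"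
      unfolding case_prod_beta by measurable
  qed
  also have "\<dots> \<le> ennreal (D * C) * weighted_norm B (Suc m) f"
    by (intro mult_left_mono weighted_norm_shift B fm) auto
  also have "\<dots> < \<infinity>" using wf by (simp add: ennreal_mult_less_top)
  finally show ?A unfolding integrable_iff_bounded by simp
  have "(\<integral>\<^sup>+p. ennreal \<bar>u (fst p) * (f (\<eta> (snd p)) * F (\<eta> (snd p)))\<bar> \<partial>(L \<Otimes>\<^sub>M M)) =
      (\<integral>\<^sup>+y. \<integral>\<^sup>+\<omega>. ennreal \<bar>u y * (f (\<eta> \<omega>) * F (\<eta> \<omega>))\<bar> \<partial>M \<partial>L)"
    by (subst nn_integral_fst[symmetric]) auto
  also have "\<dots> \<le> ennreal (D * C) * (\<integral>\<^sup>+y. weighted_norm B m f * indicator B y \<partial>L)"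
  proof (rule key)
    show "(\<lambda>(y, \<mu>). f \<mu>) \<in> borel_measurable (L \<Otimes>\<^sub>M point_algebra L)"
      unfolding case_prod_beta by measurable
  qed
  also have "\<dots> = ennreal (D * C) * (weighted_norm B m f * emeasure L B)"
    by (simp add: nn_integral_cmult_indicator)
  also have "\<dots> < \<infinity>" using wf finite_setsD(2)[OF B] by (simp add: ennreal_mult_less_top)
  finally show ?B unfolding integrable_iff_bounded by simp
qed

lemma integrable_product:
  assumes B: "B \<in> finite_sets L" and f: "moments_finite B f"
    and F: "poly_bounded L B F" "F \<in> borel_measurable (point_algebra L)"
  shows "integrable M (\<lambda>\<omega>. f (\<eta> \<omega>) * F (\<eta> \<omega>))"
proof -
  note [measurable] = F(2)
  have fm [measurable]: "f \<in> borel_measurable (point_algebra L)" using f by (simp add: moments_finite_def)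
  obtain C m where C: "C \<ge> 0" "\<And>\<mu>. sets \<mu> = sets L \<Longrightarrow> emeasure \<mu> B < \<infinity> \<Longrightarrow> \<bar>F \<mu>\<bar> \<le> C * (1 + measure \<mu> B) ^ m"
    using F(1) unfolding poly_bounded_def by blast
  have i: "integrable M (\<lambda>\<omega>. f (\<eta> \<omega>) * (1 + measure (\<eta> \<omega>) B) ^ m)"
    using f finite_setsD(1)[OF B] unfolding integrable_iff_bounded
    by (auto simp: moments_finite_def weighted_norm_def abs_mult)
  show ?thesis
  proof (rule Bochner_Integration.integrable_bound[OF integrable_mult_right[OF i, of C]])
    show "AE \<omega> in M. norm (f (\<eta> \<omega>) * F (\<eta> \<omega>)) \<le> norm (C * (f (\<eta> \<omega>) * (1 + measure (\<eta> \<omega>) B) ^ m))"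
      using AE_eta_finite[OF B] AE_space
    proof eventually_elim
      case (elim \<omega>)
      have "\<bar>f (\<eta> \<omega>)\<bar> * \<bar>F (\<eta> \<omega>)\<bar> \<le> \<bar>f (\<eta> \<omega>)\<bar> * (C * (1 + measure (\<eta> \<omega>) B) ^ m)"
        using C(2)[OF eta_sets[OF elim(2)] elim(1)] by (intro mult_left_mono) auto
      then show ?case using C(1) by (simp add: abs_mult ac_simps)
    qed
  qed measurable
qed

lemma mecke_factor:
  assumes B: "B \<in> finite_sets L" and f: "moments_finite B f"
    and F: "poly_bounded L B F" "F \<in> borel_measurable (point_algebra L)" and u: "factor_on L B u"
  shows "(\<integral>\<omega>. f (\<eta> \<omega>) * F (\<eta> \<omega>) * (\<integral>y. u y \<partial>\<eta> \<omega>) \<partial>M) =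
    (\<integral>p. u (fst p) * (f (add_point (\<eta> (snd p)) (fst p)) * F (add_point (\<eta> (snd p)) (fst p))) \<partial>(L \<Otimes>\<^sub>M M))"
proof -
  note [measurable] = finite_setsD(1)[OF B] F(2) factor_on_measurable[OF u]
  have fm [measurable]: "f \<in> borel_measurable (point_algebra L)" using f by (simp add: moments_finite_def)
  obtain C m where C: "C \<ge> 0" "\<And>\<mu>. sets \<mu> = sets L \<Longrightarrow> emeasure \<mu> B < \<infinity> \<Longrightarrow> \<bar>F \<mu>\<bar> \<le> C * (1 + measure \<mu> B) ^ m"
    using F(1) unfolding poly_bounded_def by blast
  obtain D where D: "D \<ge> 0" "\<And>y. y \<in> space L \<Longrightarrow> \<bar>u y\<bar> \<le> D * indicator B y"
    using factor_on_bound[OF u] by blast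
  let ?F = "\<lambda>p. f (fst p) * F (fst p) * u (snd p)"
  have meas: "?F \<in> borel_measurable (point_algebra L \<Otimes>\<^sub>M L)" by measurable
  have "(\<integral>\<^sup>+\<omega>. \<integral>\<^sup>+y. ennreal \<bar>?F (\<eta> \<omega>, y)\<bar> \<partial>\<eta> \<omega> \<partial>M) \<le>
      (\<integral>\<^sup>+\<omega>. ennreal (D * C) * ennreal (\<bar>f (\<eta> \<omega>)\<bar> * (1 + measure (\<eta> \<omega>) B) ^ Suc m) \<partial>M)"
  proof (rule nn_integral_mono_AE, use AE_eta_finite[OF B] AE_space in eventually_elim)
    case (elim \<omega>)
    let ?t = "measure (\<eta> \<omega>) B"
    have em: "emeasure (\<eta> \<omega>) B = ennreal ?t"
      using elim by (simp add: emeasure_eq_ennreal_measure top.not_eq_extremum)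
    have "(\<integral>\<^sup>+y. ennreal \<bar>?F (\<eta> \<omega>, y)\<bar> \<partial>\<eta> \<omega>) \<le> (\<integral>\<^sup>+y. ennreal (\<bar>f (\<eta> \<omega>)\<bar> * (C * (1 + ?t) ^ m) * D) * indicator B y \<partial>\<eta> \<omega>)"
    proof (rule nn_integral_mono)
      fix y assume "y \<in> space (\<eta> \<omega>)"
      then have y: "y \<in> space L" using elim by (simp add: eta_space)
      have "\<bar>?F (\<eta> \<omega>, y)\<bar> \<le> \<bar>f (\<eta> \<omega>)\<bar> * (C * (1 + ?t) ^ m) * (D * indicator B y)"
        using D(2)[OF y] C(2)[OF eta_sets[OF elim(2)] elim(1)] C(1)
        by (simp only: abs_mult fst_conv snd_conv) (intro mult_mono mult_left_mono; simp)
      then have "ennreal \<bar>?F (\<eta> \<omega>, y)\<bar> \<le> ennreal (\<bar>f (\<eta> \<omega>)\<bar> * (C * (1 + ?t) ^ m) * (D * indicator B y))"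
        by (rule ennreal_leI)
      then show "ennreal \<bar>?F (\<eta> \<omega>, y)\<bar> \<le> ennreal (\<bar>f (\<eta> \<omega>)\<bar> * (C * (1 + ?t) ^ m) * D) * indicator B y"
        by (auto simp: indicator_def split: if_splits)
    qed
    also have "\<dots> = ennreal (\<bar>f (\<eta> \<omega>)\<bar> * (C * (1 + ?t) ^ m) * D) * ennreal ?t"
      using elim by (simp add: nn_integral_cmult_indicator eta_sets em)
    also have "\<dots> = ennreal (\<bar>f (\<eta> \<omega>)\<bar> * (C * (1 + ?t) ^ m) * D * ?t)"
      using C(1) D(1) by (intro ennreal_mult[symmetric]) auto
    also have "\<dots> \<le> ennreal (\<bar>f (\<eta> \<omega>)\<bar> * (C * (1 + ?t) ^ m) * D * (1 + ?t))"
      using C(1) D(1) by (intro ennreal_leI mult_left_mono) auto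
    also have "\<dots> = ennreal ((D * C) * (\<bar>f (\<eta> \<omega>)\<bar> * (1 + ?t) ^ Suc m))" by (simp add: ac_simps)
    also have "\<dots> = ennreal (D * C) * ennreal (\<bar>f (\<eta> \<omega>)\<bar> * (1 + ?t) ^ Suc m)"
      using C(1) D(1) by (intro ennreal_mult) auto
    finally show ?case .
  qed
  also have "\<dots> = ennreal (D * C) * weighted_norm B (Suc m) f"
    unfolding weighted_norm_def by (rule nn_integral_cmult) measurable
  also have "\<dots> < \<infinity>" using f by (simp add: moments_finite_def ennreal_mult_less_top)
  finally have fin: "(\<integral>\<^sup>+\<omega>. \<integral>\<^sup>+y. ennreal \<bar>?F (\<eta> \<omega>, y)\<bar> \<partial>\<eta> \<omega> \<partial>M) < \<infinity>" .
  show ?thesis using mecke_integral(2)[OF meas fin] by (simp add: ac_simps)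
qed

text \<open>The Mecke equation with the added point left out of the factorial integral. Expand the
  left side with \<open>factorial_integral_insert\<close>. The plain Mecke equation for the factor
  \<open>j\<close> produces the other factors at the shifted configuration, and the terms in which
  one of them absorbs the new point are exactly the collision terms being subtracted. These have one
  index fewer and are known by induction.\<close>

lemma factorial_integral_adjoint:
  assumes B: "B \<in> finite_sets L" and f: "moments_finite B f" and J: "finite J" "j \<notin> J"
    and g: "\<And>i. i \<in> insert j J \<Longrightarrow> factor_on L B (g i)"
  shows "(\<integral>\<omega>. f (\<eta> \<omega>) * factorial_integral (insert j J) g (\<eta> \<omega>) \<partial>M) =
    (\<integral>p. g j (fst p) * (f (add_point (\<eta> (snd p)) (fst p)) * factorial_integral J g (\<eta> (snd p))) \<partial>(L \<Otimes>\<^sub>M M))"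
  using J g
proof (induction J arbitrary: j g rule: finite_psubset_induct)
  case (psubset J)
  have BL: "B \<in> sets L" using B by (rule finite_setsD)
  have fm [measurable]: "f \<in> borel_measurable (point_algebra L)" using f by (simp add: moments_finite_def)
  let ?g = "\<lambda>i. g(i := \<lambda>y. g j y * g i y)"
  have gi: "factor_on L B (?g i l)" if "i \<in> J" "l \<in> J" for i l
    using psubset.prems that by (auto intro: factor_on_mult)
  have pb: "poly_bounded L B (factorial_integral I h)" "factorial_integral I h \<in> borel_measurable (point_algebra L)"
    if "I \<subseteq> insert j J" "\<And>i. i \<in> I \<Longrightarrow> factor_on L B (h i)" for I h
    using that psubset.hyps finite_subset[OF that(1)]
    by (auto intro!: poly_bounded_factorial_integral[OF BL] factorial_integral_measurable factor_on_measurable[of L B])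
  have gJ: "\<And>i. i \<in> J \<Longrightarrow> factor_on L B (g i)" and gj: "factor_on L B (g j)" using psubset.prems by auto
  have prod: "factor_on L B (\<lambda>y. g j y * g i y)" if "i \<in> J" for i using gJ gj that by (intro factor_on_mult)
  \<comment> \<open>The collision of \<open>j\<close> with \<open>i\<close>: the induction
    hypothesis pulls out the index \<open>i\<close>, which carries the merged factor. The factors of
    \<open>J - {i}\<close> are untouched by the merge, so \<open>g\<close> may be written there
    again.\<close>
  have step: "(\<integral>\<omega>. f (\<eta> \<omega>) * factorial_integral J (?g i) (\<eta> \<omega>) \<partial>M) =
      (\<integral>p. (g j (fst p) * g i (fst p)) * (f (add_point (\<eta> (snd p)) (fst p)) * factorial_integral (J - {i}) g (\<eta> (snd p))) \<partial>(L \<Otimes>\<^sub>M M))"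
    if i: "i \<in> J" for i
  proof -
    have ins: "insert i (J - {i}) = J" using i by auto
    have c: "factorial_integral (J - {i}) (?g i) \<mu> = factorial_integral (J - {i}) g \<mu>" for \<mu>
      using psubset.hyps by (intro factorial_integral_cong) auto
    have "(\<integral>\<omega>. f (\<eta> \<omega>) * factorial_integral (insert i (J - {i})) (?g i) (\<eta> \<omega>) \<partial>M) =
      (\<integral>p. ?g i i (fst p) * (f (add_point (\<eta> (snd p)) (fst p)) * factorial_integral (J - {i}) (?g i) (\<eta> (snd p))) \<partial>(L \<Otimes>\<^sub>M M))"
      by (rule psubset.IH) (use i gJ prod in auto)
    then show ?thesis unfolding ins c fun_upd_same .
  qed
  have "(\<integral>\<omega>. f (\<eta> \<omega>) * factorial_integral (insert j J) g (\<eta> \<omega>) \<partial>M) =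
      (\<integral>\<omega>. f (\<eta> \<omega>) * factorial_integral J g (\<eta> \<omega>) * (\<integral>y. g j y \<partial>\<eta> \<omega>) -
        (\<Sum>i\<in>J. f (\<eta> \<omega>) * factorial_integral J (?g i) (\<eta> \<omega>)) \<partial>M)"
  proof (rule integral_cong_AE)
    have [measurable]: "factorial_integral (insert j J) g \<in> borel_measurable (point_algebra L)"
      "factorial_integral J g \<in> borel_measurable (point_algebra L)"
      using psubset.prems by (auto intro: pb)
    have [measurable]: "i \<in> J \<Longrightarrow> factorial_integral J (?g i) \<in> borel_measurable (point_algebra L)" for i
      using gi by (intro pb) auto
    have [measurable]: "(\<lambda>\<omega>. \<integral>y. g j y \<partial>\<eta> \<omega>) \<in> borel_measurable M"
      using measurable_compose[OF eta_measurable integral_measurable_point_algebra[OF factor_on_measurable[OF gj]]] .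
    show "(\<lambda>\<omega>. f (\<eta> \<omega>) * factorial_integral (insert j J) g (\<eta> \<omega>)) \<in> borel_measurable M"
      by measurable
    show "(\<lambda>\<omega>. f (\<eta> \<omega>) * factorial_integral J g (\<eta> \<omega>) * (\<integral>y. g j y \<partial>\<eta> \<omega>) -
        (\<Sum>i\<in>J. f (\<eta> \<omega>) * factorial_integral J (?g i) (\<eta> \<omega>))) \<in> borel_measurable M"
      by measurable
    show "AE \<omega> in M. f (\<eta> \<omega>) * factorial_integral (insert j J) g (\<eta> \<omega>) =
      f (\<eta> \<omega>) * factorial_integral J g (\<eta> \<omega>) * (\<integral>y. g j y \<partial>\<eta> \<omega>) -
        (\<Sum>i\<in>J. f (\<eta> \<omega>) * factorial_integral J (?g i) (\<eta> \<omega>))"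
      using AE_eta_finite[OF B] AE_space
    proof eventually_elim
      case (elim \<omega>)
      show ?case
        using factorial_integral_insert[OF eta_labelled[OF elim(2) BL elim(1)] psubset.hyps psubset.prems]
        by (simp add: right_diff_distrib sum_distrib_left ac_simps)
    qed
  qed
  also have "\<dots> = (\<integral>\<omega>. f (\<eta> \<omega>) * factorial_integral J g (\<eta> \<omega>) * (\<integral>y. g j y \<partial>\<eta> \<omega>) \<partial>M) -
        (\<Sum>i\<in>J. \<integral>\<omega>. f (\<eta> \<omega>) * factorial_integral J (?g i) (\<eta> \<omega>) \<partial>M)"
  proof -
    have "integrable M (\<lambda>\<omega>. f (\<eta> \<omega>) * (\<lambda>\<mu>. factorial_integral J g \<mu> * (\<integral>y. g j y \<partial>\<mu>)) (\<eta> \<omega>))"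
    proof (rule integrable_product[OF B f])
      obtain C m where C: "C \<ge> 0" "\<And>\<mu>. sets \<mu> = sets L \<Longrightarrow> emeasure \<mu> B < \<infinity> \<Longrightarrow> \<bar>factorial_integral J g \<mu>\<bar> \<le> C * (1 + measure \<mu> B) ^ m"
        using pb(1)[of J g] gJ unfolding poly_bounded_def by blast
      obtain D k where D: "D \<ge> 0" "\<And>\<mu>. sets \<mu> = sets L \<Longrightarrow> emeasure \<mu> B < \<infinity> \<Longrightarrow> \<bar>\<integral>y. g j y \<partial>\<mu>\<bar> \<le> D * (1 + measure \<mu> B) ^ k"
        using factorial_poly_bound[OF BL, of "[j]" g] gj by auto
      have "\<bar>factorial_integral J g \<mu> * (\<integral>y. g j y \<partial>\<mu>)\<bar> \<le> (C * D) * (1 + measure \<mu> B) ^ (m + k)"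
        if "sets \<mu> = sets L" "emeasure \<mu> B < \<infinity>" for \<mu>
      proof -
        have "\<bar>factorial_integral J g \<mu> * (\<integral>y. g j y \<partial>\<mu>)\<bar> \<le> (C * (1 + measure \<mu> B) ^ m) * (D * (1 + measure \<mu> B) ^ k)"
          unfolding abs_mult using C(2)[OF that] D(2)[OF that] by (intro mult_mono') auto
        then show ?thesis by (simp add: power_add ac_simps)
      qed
      then show "poly_bounded L B (\<lambda>\<mu>. factorial_integral J g \<mu> * (\<integral>y. g j y \<partial>\<mu>))"
        unfolding poly_bounded_def using C(1) D(1) by (intro exI[of _ "C * D"] exI[of _ "m + k"]) auto
      show "(\<lambda>\<mu>. factorial_integral J g \<mu> * (\<integral>y. g j y \<partial>\<mu>)) \<in> borel_measurable (point_algebra L)"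
        using pb(2)[of J g] gJ gj by (intro borel_measurable_times integral_measurable_point_algebra factor_on_measurable[of L B]) auto
    qed
    moreover have "integrable M (\<lambda>\<omega>. f (\<eta> \<omega>) * factorial_integral J (?g i) (\<eta> \<omega>))" if "i \<in> J" for i
      using gi that by (intro integrable_product[OF B f] pb) auto
    ultimately show ?thesis by (simp add: mult.assoc)
  qed
  also have "(\<integral>\<omega>. f (\<eta> \<omega>) * factorial_integral J g (\<eta> \<omega>) * (\<integral>y. g j y \<partial>\<eta> \<omega>) \<partial>M) =
      (\<integral>p. g j (fst p) * (f (add_point (\<eta> (snd p)) (fst p)) * factorial_integral J g (add_point (\<eta> (snd p)) (fst p))) \<partial>(L \<Otimes>\<^sub>M M))"
    using gJ by (intro mecke_factor[OF B f _ _ gj] pb) auto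
  also have "\<dots> = (\<integral>p. g j (fst p) * (f (add_point (\<eta> (snd p)) (fst p)) * factorial_integral J g (\<eta> (snd p))) +
      (\<Sum>i\<in>J. (g j (fst p) * g i (fst p)) * (f (add_point (\<eta> (snd p)) (fst p)) * factorial_integral (J - {i}) g (\<eta> (snd p)))) \<partial>(L \<Otimes>\<^sub>M M))"
  proof (rule integral_cong_AE)
    have [measurable]: "factorial_integral J g \<in> borel_measurable (point_algebra L)"
      using gJ by (intro pb) auto
    have [measurable]: "factorial_integral (J - {i}) g \<in> borel_measurable (point_algebra L)" for i
      using gJ by (intro pb) auto
    have [measurable]: "g j \<in> borel_measurable L" "i \<in> J \<Longrightarrow> g i \<in> borel_measurable L" for i
      using gJ gj by (auto intro: factor_on_measurable)
    show "(\<lambda>p. g j (fst p) * (f (add_point (\<eta> (snd p)) (fst p)) * factorial_integral J g (add_point (\<eta> (snd p)) (fst p)))) \<in> borel_measurable (L \<Otimes>\<^sub>M M)"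
      by measurable
    show "(\<lambda>p. g j (fst p) * (f (add_point (\<eta> (snd p)) (fst p)) * factorial_integral J g (\<eta> (snd p))) +
      (\<Sum>i\<in>J. (g j (fst p) * g i (fst p)) * (f (add_point (\<eta> (snd p)) (fst p)) * factorial_integral (J - {i}) g (\<eta> (snd p))))) \<in> borel_measurable (L \<Otimes>\<^sub>M M)"
      by measurable
    \<comment> \<open>The exceptional event concerns \<open>\<eta>\<close> only and is null for
      every fixed point, hence null in the product.\<close>
    have "AE p in L \<Otimes>\<^sub>M M. emeasure (\<eta> (snd p)) B < \<infinity>"
    proof (rule LM.AE_pair_measure)
      show "{p \<in> space (L \<Otimes>\<^sub>M M). emeasure (\<eta> (snd p)) B < \<infinity>} \<in> sets (L \<Otimes>\<^sub>M M)"
        using BL by measurable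
      show "AE y in L. AE \<omega> in M. emeasure (\<eta> (snd (y, \<omega>))) B < \<infinity>"
        unfolding snd_conv by (rule AE_I2) (rule AE_eta_finite[OF B])
    qed
    then show "AE p in L \<Otimes>\<^sub>M M. g j (fst p) * (f (add_point (\<eta> (snd p)) (fst p)) * factorial_integral J g (add_point (\<eta> (snd p)) (fst p))) =
      g j (fst p) * (f (add_point (\<eta> (snd p)) (fst p)) * factorial_integral J g (\<eta> (snd p))) +
      (\<Sum>i\<in>J. (g j (fst p) * g i (fst p)) * (f (add_point (\<eta> (snd p)) (fst p)) * factorial_integral (J - {i}) g (\<eta> (snd p))))"
      using AE_space
    proof eventually_elim
      case (elim p)
      then have p: "fst p \<in> space L" "snd p \<in> space M" by (auto simp: space_pair_measure)
      show ?case
        using factorial_integral_add_point[OF eta_labelled[OF p(2) BL elim(1)] p(1) psubset.hyps gJ]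
        by (simp add: distrib_left sum_distrib_left ac_simps)
    qed
  qed
  also have "\<dots> = (\<integral>p. g j (fst p) * (f (add_point (\<eta> (snd p)) (fst p)) * factorial_integral J g (\<eta> (snd p))) \<partial>(L \<Otimes>\<^sub>M M)) +
      (\<Sum>i\<in>J. \<integral>p. (g j (fst p) * g i (fst p)) * (f (add_point (\<eta> (snd p)) (fst p)) * factorial_integral (J - {i}) g (\<eta> (snd p))) \<partial>(L \<Otimes>\<^sub>M M))"
  proof -
    have "integrable (L \<Otimes>\<^sub>M M) (\<lambda>p. g j (fst p) * (f (add_point (\<eta> (snd p)) (fst p)) * factorial_integral J g (\<eta> (snd p))))"
      using gJ by (intro integrable_shift_product(1)[OF B f _ _ gj] pb) auto
    moreover have "integrable (L \<Otimes>\<^sub>M M) (\<lambda>p. (\<lambda>y. g j y * g i y) (fst p) * (f (add_point (\<eta> (snd p)) (fst p)) * factorial_integral (J - {i}) g (\<eta> (snd p))))"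
      if "i \<in> J" for i
      using gJ by (intro integrable_shift_product(1)[OF B f _ _ prod[OF that]] pb) auto
    ultimately show ?thesis by simp
  qed
  moreover have "(\<Sum>i\<in>J. \<integral>\<omega>. f (\<eta> \<omega>) * factorial_integral J (?g i) (\<eta> \<omega>) \<partial>M) =
      (\<Sum>i\<in>J. \<integral>p. (g j (fst p) * g i (fst p)) * (f (add_point (\<eta> (snd p)) (fst p)) * factorial_integral (J - {i}) g (\<eta> (snd p))) \<partial>(L \<Otimes>\<^sub>M M))"
    by (intro sum.cong refl step)
  ultimately show ?case by (simp only: add_diff_cancel_right')
qed

text \<open>Compensation subtracts the unshifted value: \<open>f\<close> at
  \<open>\<eta> + \<delta>_y\<close> minus \<open>f\<close> at \<open>\<eta>\<close> is the
  difference operator. The identity is obtained for every subset \<open>I\<close> separately and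
  then summed.\<close>

lemma compensated_integral_adjoint:
  assumes B: "B \<in> finite_sets L" and f: "moments_finite B f" and J: "finite J" "j \<notin> J"
    and g: "\<And>i. i \<in> insert j J \<Longrightarrow> factor_on L B (g i)"
  shows "(\<integral>\<omega>. f (\<eta> \<omega>) * compensated_integral L (insert j J) g (\<eta> \<omega>) \<partial>M) =
    (\<integral>p. g j (fst p) * (diff_op (fst p) f (\<eta> (snd p)) * compensated_integral L J g (\<eta> (snd p))) \<partial>(L \<Otimes>\<^sub>M M))"
    "integrable (L \<Otimes>\<^sub>M M) (\<lambda>p. g j (fst p) * (diff_op (fst p) f (\<eta> (snd p)) * compensated_integral L J g (\<eta> (snd p))))"
proof -
  have BL: "B \<in> sets L" using B by (rule finite_setsD)
  have gj: "factor_on L B (g j)" using g by auto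
  let ?s = "\<lambda>I. (- 1 :: real) ^ card (J - I) * (\<Prod>j\<in>J - I. \<integral>y. g j y \<partial>L)"
  let ?c = "\<integral>y. g j y \<partial>L"
  let ?F = "\<lambda>I. factorial_integral I g"
  have pb: "poly_bounded L B (?F I)" "?F I \<in> borel_measurable (point_algebra L)"
    if "I \<subseteq> insert j J" for I
    using subsetD[OF that] g J finite_subset[OF that]
    by (auto intro!: poly_bounded_factorial_integral[OF BL] factorial_integral_measurable factor_on_measurable[of L B])
  have i1: "integrable (L \<Otimes>\<^sub>M M) (\<lambda>p. g j (fst p) * (f (add_point (\<eta> (snd p)) (fst p)) * ?F I (\<eta> (snd p))))"
    and i2: "integrable (L \<Otimes>\<^sub>M M) (\<lambda>p. g j (fst p) * (f (\<eta> (snd p)) * ?F I (\<eta> (snd p))))" if "I \<in> Pow J" for I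
    using that by (auto intro!: integrable_shift_product[OF B f _ _ gj] pb)
  have im: "integrable M (\<lambda>\<omega>. f (\<eta> \<omega>) * ?F I (\<eta> \<omega>))" if "I \<subseteq> insert j J" for I
    using that by (intro integrable_product[OF B f] pb)
  have termwise: "(\<integral>\<omega>. f (\<eta> \<omega>) * ?F (insert j I) (\<eta> \<omega>) \<partial>M) - ?c * (\<integral>\<omega>. f (\<eta> \<omega>) * ?F I (\<eta> \<omega>) \<partial>M) =
      (\<integral>p. g j (fst p) * (diff_op (fst p) f (\<eta> (snd p)) * ?F I (\<eta> (snd p))) \<partial>(L \<Otimes>\<^sub>M M))" if I: "I \<in> Pow J" for I
  proof -
    have "(\<integral>\<omega>. f (\<eta> \<omega>) * ?F (insert j I) (\<eta> \<omega>) \<partial>M) =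
        (\<integral>p. g j (fst p) * (f (add_point (\<eta> (snd p)) (fst p)) * ?F I (\<eta> (snd p))) \<partial>(L \<Otimes>\<^sub>M M))"
      using I J g by (intro factorial_integral_adjoint[OF B f]) (auto intro: finite_subset)
    moreover have "?c * (\<integral>\<omega>. f (\<eta> \<omega>) * ?F I (\<eta> \<omega>) \<partial>M) = (\<integral>p. g j (fst p) * (f (\<eta> (snd p)) * ?F I (\<eta> (snd p))) \<partial>(L \<Otimes>\<^sub>M M))"
      using LM.integral_fst'[OF i2[OF I]] by simp
    ultimately show ?thesis
      using i1[OF I] i2[OF I] by (simp add: diff_op_def left_diff_distrib right_diff_distrib)
  qed
  have eq: "g j (fst p) * (diff_op (fst p) f (\<eta> (snd p)) * compensated_integral L J g (\<eta> (snd p))) =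
      (\<Sum>I\<in>Pow J. ?s I * (g j (fst p) * (diff_op (fst p) f (\<eta> (snd p)) * ?F I (\<eta> (snd p)))))" for p
    by (simp add: compensated_integral_def sum_distrib_left ac_simps)
  have id: "integrable (L \<Otimes>\<^sub>M M) (\<lambda>p. g j (fst p) * (diff_op (fst p) f (\<eta> (snd p)) * ?F I (\<eta> (snd p))))" if "I \<in> Pow J" for I
    using Bochner_Integration.integrable_diff[OF i1[OF that] i2[OF that]]
    by (simp add: diff_op_def left_diff_distrib right_diff_distrib)
  show "integrable (L \<Otimes>\<^sub>M M) (\<lambda>p. g j (fst p) * (diff_op (fst p) f (\<eta> (snd p)) * compensated_integral L J g (\<eta> (snd p))))"
    unfolding eq by (intro Bochner_Integration.integrable_sum integrable_mult_right id)
  have "(\<integral>\<omega>. f (\<eta> \<omega>) * compensated_integral L (insert j J) g (\<eta> \<omega>) \<partial>M) =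
      (\<integral>\<omega>. (\<Sum>I\<in>Pow J. ?s I * (f (\<eta> \<omega>) * ?F (insert j I) (\<eta> \<omega>) - ?c * (f (\<eta> \<omega>) * ?F I (\<eta> \<omega>)))) \<partial>M)"
    unfolding compensated_integral_insert[OF J] sum_distrib_left
    by (intro Bochner_Integration.integral_cong sum.cong refl) (simp add: algebra_simps)
  also have "\<dots> = (\<Sum>I\<in>Pow J. ?s I * ((\<integral>\<omega>. f (\<eta> \<omega>) * ?F (insert j I) (\<eta> \<omega>) \<partial>M) - ?c * (\<integral>\<omega>. f (\<eta> \<omega>) * ?F I (\<eta> \<omega>) \<partial>M)))"
  proof -
    have *: "integrable M (\<lambda>\<omega>. f (\<eta> \<omega>) * ?F (insert j I) (\<eta> \<omega>))" "integrable M (\<lambda>\<omega>. f (\<eta> \<omega>) * ?F I (\<eta> \<omega>))" if "I \<in> Pow J" for I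
      using that by (intro im; auto)+
    show ?thesis
      by (subst Bochner_Integration.integral_sum)
         (auto intro!: integrable_mult_right Bochner_Integration.integrable_diff * sum.cong simp: *)
  qed
  also have "\<dots> = (\<Sum>I\<in>Pow J. ?s I * (\<integral>p. g j (fst p) * (diff_op (fst p) f (\<eta> (snd p)) * ?F I (\<eta> (snd p))) \<partial>(L \<Otimes>\<^sub>M M)))"
    by (intro sum.cong refl) (simp add: termwise)
  also have "\<dots> = (\<integral>p. g j (fst p) * (diff_op (fst p) f (\<eta> (snd p)) * compensated_integral L J g (\<eta> (snd p))) \<partial>(L \<Otimes>\<^sub>M M))"
    unfolding eq using id by (subst Bochner_Integration.integral_sum) (auto intro!: integrable_mult_right)
  finally show "(\<integral>\<omega>. f (\<eta> \<omega>) * compensated_integral L (insert j J) g (\<eta> \<omega>) \<partial>M) =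
    (\<integral>p. g j (fst p) * (diff_op (fst p) f (\<eta> (snd p)) * compensated_integral L J g (\<eta> (snd p))) \<partial>(L \<Otimes>\<^sub>M M))" .
qed

end

lemma prod_fun_upd_cong: "(\<And>i. i \<in> I \<Longrightarrow> i \<noteq> n) \<Longrightarrow> (\<Prod>i\<in>I. h i ((y(n := z)) i)) = (\<Prod>i\<in>I. h i (y i))"
  by (intro prod.cong) auto

context poisson_points
begin

section \<open>Expected differences and their duality with product forms\<close>

lemma mean_diff_measurable:
  assumes "f \<in> borel_measurable (point_algebra L)"
  shows "mean_diff M \<eta> n f \<in> borel_measurable (power_measure L n)"
proof -
  have "(\<lambda>p. (fst p, \<eta> (snd p))) \<in> power_measure L n \<Otimes>\<^sub>M M \<rightarrow>\<^sub>M power_measure L n \<Otimes>\<^sub>M point_algebra L" by measurable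
  from measurable_compose[OF this measurable_iter_diff[OF assms]]
  have "(\<lambda>(y, \<omega>). iter_diff n f y (\<eta> \<omega>)) \<in> borel_measurable (power_measure L n \<Otimes>\<^sub>M M)"
    by (simp add: case_prod_beta)
  from borel_measurable_lebesgue_integral[OF this] show ?thesis
    by (simp add: mean_diff_def[abs_def])
qed

lemma weighted_norm_0: "weighted_norm B 0 f = (\<integral>\<^sup>+\<omega>. ennreal \<bar>f (\<eta> \<omega>)\<bar> \<partial>M)"
  by (simp add: weighted_norm_def)

lemma iter_diff_measurable:
  assumes "f \<in> borel_measurable (point_algebra L)" "y \<in> space (power_measure L n)"
  shows "iter_diff n f y \<in> borel_measurable (point_algebra L)"
  using measurable_compose[OF measurable_Pair1'[OF assms(2)] measurable_iter_diff[OF assms(1)]] by simp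

lemma weighted_norm_iter_diff_finite:
  assumes B: "B \<in> finite_sets L" and f: "moments_finite B f"
  shows "(\<integral>\<^sup>+y. weighted_norm B m (iter_diff n f y) * (\<Prod>i<n. indicator B (y i)) \<partial>power_measure L n) < \<infinity>"
proof -
  have "(1 + emeasure L B) ^ n * weighted_norm B (m + n) f < \<infinity>"
    using f finite_setsD(2)[OF B] by (simp add: moments_finite_def ennreal_mult_less_top power_less_top_ennreal)
  then show ?thesis
    using weighted_norm_iter_diff[OF B, where m=m and n=n and f=f] f by (auto simp: moments_finite_def intro: le_less_trans)
qed

text \<open>The weighted norm with exponent 0 is the first absolute moment, and its integral over
  the points in \<open>B\<close> is finite. So \<open>T_n f\<close> is a genuine expectation almost
  everywhere there.\<close>

lemma AE_integrable_iter_diff: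
  assumes B: "B \<in> finite_sets L" and f: "moments_finite B f"
  shows "AE y in power_measure L n. (\<forall>i<n. y i \<in> B) \<longrightarrow> integrable M (\<lambda>\<omega>. iter_diff n f y (\<eta> \<omega>))"
proof -
  note [measurable] = finite_setsD(1)[OF B]
  have fm: "f \<in> borel_measurable (point_algebra L)" using f by (simp add: moments_finite_def)
  have [measurable]: "(\<lambda>y. weighted_norm B 0 (iter_diff n f y)) \<in> borel_measurable (power_measure L n)"
    by (rule weighted_norm_measurable[OF measurable_iter_diff[OF fm]]) measurable
  have "AE y in power_measure L n. weighted_norm B 0 (iter_diff n f y) * (\<Prod>i<n. indicator B (y i)) \<noteq> \<infinity>"
    using weighted_norm_iter_diff_finite[OF B f, where m=0 and n=n]
    by (intro nn_integral_noteq_infinite) auto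
  then show ?thesis using AE_space
  proof eventually_elim
    case (elim y)
    have m: "(\<lambda>\<omega>. iter_diff n f y (\<eta> \<omega>)) \<in> borel_measurable M"
      using measurable_compose[OF eta_measurable iter_diff_measurable[OF fm elim(2)]] .
    show ?case
    proof
      assume "\<forall>i<n. y i \<in> B"
      then have "(\<Prod>i<n. indicator B (y i)) = (1::ennreal)" by (intro prod.neutral) auto
      with elim(1) m show "integrable M (\<lambda>\<omega>. iter_diff n f y (\<eta> \<omega>))"
        by (simp add: integrable_iff_bounded weighted_norm_0 top.not_eq_extremum)
    qed
  qed
qed

lemma tensor_bound:
  assumes "\<And>i. i < n \<Longrightarrow> factor_on L B (g i)"
  shows "\<exists>C\<ge>0. \<forall>y\<in>space (power_measure L n). \<bar>tensor {..<n} g y\<bar> \<le> C * (\<Prod>i<n. indicator B (y i))"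
proof -
  have "\<exists>C. \<forall>i<n. C i \<ge> 0 \<and> (\<forall>y\<in>space L. \<bar>g i y\<bar> \<le> C i * indicator B y)"
    using factor_on_bound[OF assms] by metis
  then obtain C where C: "\<And>i. i < n \<Longrightarrow> C i \<ge> 0" "\<And>i y. i < n \<Longrightarrow> y \<in> space L \<Longrightarrow> \<bar>g i y\<bar> \<le> C i * indicator B y"
    by blast
  have "\<bar>tensor {..<n} g y\<bar> \<le> (\<Prod>i<n. C i) * (\<Prod>i<n. indicator B (y i))" if "y \<in> space (power_measure L n)" for y
    unfolding tensor_def abs_prod prod.distrib[symmetric]
    using C that by (intro prod_mono) (auto simp: space_PiM)
  moreover have "(\<Prod>i<n. C i) \<ge> 0" using C by (intro prod_nonneg) auto
  ultimately show ?thesis by blast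
qed

lemma tensor_mean_diff_integrable:
  assumes B: "B \<in> finite_sets L" and f: "moments_finite B f" and g: "\<And>i. i < n \<Longrightarrow> factor_on L B (g i)"
  shows "integrable (power_measure L n) (\<lambda>y. tensor {..<n} g y * mean_diff M \<eta> n f y)"
proof -
  note [measurable] = finite_setsD(1)[OF B]
  have fm: "f \<in> borel_measurable (point_algebra L)" using f by (simp add: moments_finite_def)
  have [measurable]: "tensor {..<n} g \<in> borel_measurable (power_measure L n)"
    using g by (intro tensor_measurable factor_on_measurable) auto
  note [measurable] = mean_diff_measurable[OF fm]
  have [measurable]: "(\<lambda>y. weighted_norm B 0 (iter_diff n f y)) \<in> borel_measurable (power_measure L n)"
    by (rule weighted_norm_measurable[OF measurable_iter_diff[OF fm]]) measurable
  obtain C where C: "C \<ge> 0" "\<And>y. y \<in> space (power_measure L n) \<Longrightarrow> \<bar>tensor {..<n} g y\<bar> \<le> C * (\<Prod>i<n. indicator B (y i))"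
    using tensor_bound[of n B g] g by blast
  have "(\<integral>\<^sup>+y. ennreal \<bar>tensor {..<n} g y * mean_diff M \<eta> n f y\<bar> \<partial>power_measure L n) \<le>
      (\<integral>\<^sup>+y. ennreal C * (weighted_norm B 0 (iter_diff n f y) * (\<Prod>i<n. indicator B (y i))) \<partial>power_measure L n)"
  proof (rule nn_integral_mono)
    fix y assume y: "y \<in> space (power_measure L n)"
    \<comment> \<open>If the expectation is undefined, \<open>mean_diff\<close> is 0 by convention
      and the bound is trivial.\<close>
    have T: "ennreal \<bar>mean_diff M \<eta> n f y\<bar> \<le> weighted_norm B 0 (iter_diff n f y)"
    proof (cases "integrable M (\<lambda>\<omega>. iter_diff n f y (\<eta> \<omega>))")
      case True
      from integral_norm_bound_ennreal[OF this] show ?thesis by (simp add: mean_diff_def weighted_norm_0)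
    qed (simp add: mean_diff_def not_integrable_integral_eq)
    have ind: "ennreal (\<Prod>i<n. indicator B (y i)) = (\<Prod>i<n. indicator B (y i))"
      by (subst prod_ennreal[symmetric]) (auto intro!: prod.cong simp: ennreal_indicator)
    have "ennreal \<bar>tensor {..<n} g y * mean_diff M \<eta> n f y\<bar> = ennreal \<bar>tensor {..<n} g y\<bar> * ennreal \<bar>mean_diff M \<eta> n f y\<bar>"
      by (simp add: abs_mult ennreal_mult)
    also have "\<dots> \<le> ennreal (C * (\<Prod>i<n. indicator B (y i))) * weighted_norm B 0 (iter_diff n f y)"
      using C(2)[OF y] T by (intro mult_mono ennreal_leI) auto
    also have "\<dots> = ennreal C * (weighted_norm B 0 (iter_diff n f y) * (\<Prod>i<n. indicator B (y i)))"
      using C(1) by (simp add: ennreal_mult prod_nonneg ind ac_simps)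
    finally show "ennreal \<bar>tensor {..<n} g y * mean_diff M \<eta> n f y\<bar> \<le> ennreal C * (weighted_norm B 0 (iter_diff n f y) * (\<Prod>i<n. indicator B (y i)))" .
  qed
  also have "\<dots> = ennreal C * (\<integral>\<^sup>+y. weighted_norm B 0 (iter_diff n f y) * (\<Prod>i<n. indicator B (y i)) \<partial>power_measure L n)"
    by (rule nn_integral_cmult) measurable
  also have "\<dots> < \<infinity>"
    using weighted_norm_iter_diff_finite[OF B f, where m=0 and n=n] by (simp add: ennreal_mult_less_top)
  finally show ?thesis unfolding integrable_iff_bounded by simp
qed

text \<open>Pull out the index \<open>n\<close> by \<open>compensated_integral_adjoint\<close> and
  apply the induction hypothesis to \<open>diff_op z f\<close>. Its moments are known to be finite
  only for almost every \<open>z\<close> in \<open>B\<close>; outside \<open>B\<close> the factor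
  \<open>g n\<close> vanishes and both sides are 0.\<close>

theorem compensated_integral_mean_diff:
  assumes B: "B \<in> finite_sets L" and f: "moments_finite B f" and g: "\<And>i. i < n \<Longrightarrow> factor_on L B (g i)"
  shows "(\<integral>\<omega>. f (\<eta> \<omega>) * compensated_integral L {..<n} g (\<eta> \<omega>) \<partial>M) =
    (\<integral>y. tensor {..<n} g y * mean_diff M \<eta> n f y \<partial>power_measure L n)"
  using f g
proof (induction n arbitrary: f)
  case 0
  interpret P0: prob_space "Pi\<^sub>M {} (\<lambda>_. L)" by (intro prob_space_PiM) auto
  show ?case by (simp add: tensor_def mean_diff_def lessThan_0 P0.prob_space)
next
  case (Suc n)
  have g': "\<And>i. i \<in> insert n {..<n} \<Longrightarrow> factor_on L B (g i)" using Suc.prems by auto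
  have fm: "f \<in> borel_measurable (point_algebra L)" using Suc.prems by (simp add: moments_finite_def)
  let ?W = "compensated_integral L {..<n} g"
  have [measurable]: "?W \<in> borel_measurable (point_algebra L)"
    using g' by (intro compensated_integral_measurable factor_on_measurable) auto
  have [measurable]: "g n \<in> borel_measurable L" using g' by (intro factor_on_measurable) auto
  have ins: "insert n {..<n} = {..<Suc n}" by auto
  have adj: "(\<integral>\<omega>. f (\<eta> \<omega>) * compensated_integral L (insert n {..<n}) g (\<eta> \<omega>) \<partial>M) =
    (\<integral>p. g n (fst p) * (diff_op (fst p) f (\<eta> (snd p)) * ?W (\<eta> (snd p))) \<partial>(L \<Otimes>\<^sub>M M))"
    "integrable (L \<Otimes>\<^sub>M M) (\<lambda>p. g n (fst p) * (diff_op (fst p) f (\<eta> (snd p)) * ?W (\<eta> (snd p))))"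
    by (rule compensated_integral_adjoint[OF B Suc.prems(1)]; use g' in auto)+
  have "(\<integral>\<omega>. f (\<eta> \<omega>) * compensated_integral L {..<Suc n} g (\<eta> \<omega>) \<partial>M) =
    (\<integral>p. g n (fst p) * (diff_op (fst p) f (\<eta> (snd p)) * ?W (\<eta> (snd p))) \<partial>(L \<Otimes>\<^sub>M M))"
    using adj(1) by (simp add: ins)
  also have "\<dots> = (\<integral>z. \<integral>\<omega>. g n z * (diff_op z f (\<eta> \<omega>) * ?W (\<eta> \<omega>)) \<partial>M \<partial>L)"
    using LM.integral_fst'[of "\<lambda>p. g n (fst p) * (diff_op (fst p) f (\<eta> (snd p)) * ?W (\<eta> (snd p)))"] adj(2)
    by simp
  also have "\<dots> = (\<integral>z. \<integral>y. tensor {..<Suc n} g (y(n := z)) * mean_diff M \<eta> (Suc n) f (y(n := z)) \<partial>power_measure L n \<partial>L)"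
  proof (rule integral_cong_AE)
    show "(\<lambda>z. \<integral>\<omega>. g n z * (diff_op z f (\<eta> \<omega>) * ?W (\<eta> \<omega>)) \<partial>M) \<in> borel_measurable L"
    proof -
      have "(\<lambda>p. (fst p, \<eta> (snd p))) \<in> L \<Otimes>\<^sub>M M \<rightarrow>\<^sub>M L \<Otimes>\<^sub>M point_algebra L" by measurable
      from measurable_compose[OF this diff_op_joint_measurable[OF fm]]
      have [measurable]: "(\<lambda>p. diff_op (fst p) f (\<eta> (snd p))) \<in> borel_measurable (L \<Otimes>\<^sub>M M)" by simp
      show ?thesis by (rule borel_measurable_lebesgue_integral) (simp add: case_prod_beta)
    qed
    show "(\<lambda>z. \<integral>y. tensor {..<Suc n} g (y(n := z)) * mean_diff M \<eta> (Suc n) f (y(n := z)) \<partial>power_measure L n) \<in> borel_measurable L"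
    proof -
      interpret I: sigma_finite_measure "power_measure L n" by (rule LP.sigma_finite) simp
      have m: "(\<lambda>p. (snd p)(n := fst p)) \<in> L \<Otimes>\<^sub>M power_measure L n \<rightarrow>\<^sub>M power_measure L (Suc n)"
        by (rule measurable_fun_upd[where J="{..<n}"]) auto
      have [measurable]: "tensor {..<Suc n} g \<in> borel_measurable (power_measure L (Suc n))"
        using Suc.prems(2) by (intro tensor_measurable factor_on_measurable[of L B]) auto
      note [measurable] = mean_diff_measurable[OF fm]
      have "(\<lambda>y. tensor {..<Suc n} g y * mean_diff M \<eta> (Suc n) f y) \<in> borel_measurable (power_measure L (Suc n))"
        by measurable
      from measurable_compose[OF m this] show ?thesis
        by (intro I.borel_measurable_lebesgue_integral) (simp add: case_prod_beta)
    qed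
    show "AE z in L. (\<integral>\<omega>. g n z * (diff_op z f (\<eta> \<omega>) * ?W (\<eta> \<omega>)) \<partial>M) =
      (\<integral>y. tensor {..<Suc n} g (y(n := z)) * mean_diff M \<eta> (Suc n) f (y(n := z)) \<partial>power_measure L n)"
      using AE_moments_finite_diff_op[OF B Suc.prems(1)] AE_space
    proof eventually_elim
      case (elim z)
      have t: "tensor {..<Suc n} g (y(n := z)) = g n z * tensor {..<n} g y" for y
        using prod_fun_upd_cong[of "{..<n}" n g y z] by (simp add: tensor_def lessThan_Suc del: fun_upd_apply) simp
      have T: "mean_diff M \<eta> (Suc n) f (y(n := z)) = mean_diff M \<eta> n (diff_op z f) y" for y
        by (simp add: mean_diff_def iter_diff_Suc)
      show ?case
      proof (cases "z \<in> B")
        case True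
        then show ?thesis using elim Suc.IH[of "diff_op z f"] Suc.prems by (simp add: t T mult.assoc)
      next
        case False
        then have "g n z = 0" using g' elim by (auto simp: factor_on_def)
        then show ?thesis by (simp add: t)
      qed
    qed
  qed
  also have "\<dots> = (\<integral>y. tensor {..<Suc n} g y * mean_diff M \<eta> (Suc n) f y \<partial>power_measure L (Suc n))"
    using LP.product_integral_insert_rev[of "{..<n}" n] tensor_mean_diff_integrable[OF B Suc.prems]
    by (simp add: ins)
  finally show ?case .
qed

subsection \<open>Integrals of functions of product form\<close>

text \<open>A tuple containing a label outside \<open>B\<close> contributes a vanishing factor, so
  the possibly infinite set of injections reduces to the finite one summed by
  \<open>injsum\<close>.\<close>

lemma integral_factorial_measure:
  assumes w: "\<omega> \<in> space M" and B: "B \<in> sets L" and fin: "emeasure (\<eta> \<omega>) B < \<infinity>"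
    and J: "finite J" and g: "\<And>j. j \<in> J \<Longrightarrow> factor_on L B (g j)"
  shows "(\<integral>y. tensor J g y \<partial>factorial_measure L (emeasure (\<eta> \<omega>) (space L)) (\<lambda>i. X i \<omega>) J) = factorial_integral J g (\<eta> \<omega>)"
proof -
  let ?K = "{k. of_nat k < emeasure (\<eta> \<omega>) (space L)}" and ?KB = "{k. of_nat k < emeasure (\<eta> \<omega>) (space L) \<and> X k \<omega> \<in> B}"
  let ?S = "{i \<in> J \<rightarrow>\<^sub>E ?K. inj_on i J}" and ?SB = "{i \<in> J \<rightarrow>\<^sub>E ?KB. inj_on i J}"
  let ?\<phi> = "\<lambda>i. \<lambda>j\<in>J. X (i j) \<omega>"
  have lab: "labelled L B (\<eta> \<omega>) ?KB (\<lambda>k. X k \<omega>)" by (rule eta_labelled[OF w B fin])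
  then have KB: "finite ?KB" by (simp add: labelled_def)
  have SB: "finite ?SB" using finite_PiE[OF J, of "\<lambda>_. ?KB"] KB by auto
  have \<phi>: "?\<phi> \<in> count_space ?S \<rightarrow>\<^sub>M Pi\<^sub>M J (\<lambda>_. L)"
    using measurable_space[OF X_measurable w] by (auto simp: space_PiM)
  have tm: "tensor J g \<in> borel_measurable (Pi\<^sub>M J (\<lambda>_. L))"
    using J g by (intro tensor_measurable factor_on_measurable)
  have t: "tensor J g (?\<phi> i) = (\<Prod>j\<in>J. g j (X (i j) \<omega>))" for i
    unfolding tensor_def by (intro prod.cong) auto
  have zero: "g j (X k \<omega>) = 0" if "X k \<omega> \<notin> B" "j \<in> J" for j k
    using g[OF that(2)] that measurable_space[OF X_measurable w] by (auto simp: factor_on_def)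
  have "X (i j) \<omega> \<in> B" if "tensor J g (?\<phi> i) \<noteq> 0" "j \<in> J" for i j
    using that J zero unfolding t by (auto simp: prod_zero_iff)
  then have sub: "{i \<in> ?S. tensor J g (?\<phi> i) \<noteq> 0} \<subseteq> ?SB" by (auto simp: PiE_def Pi_def)
  have "(\<integral>y. tensor J g y \<partial>factorial_measure L (emeasure (\<eta> \<omega>) (space L)) (\<lambda>i. X i \<omega>) J) = (\<integral>i. tensor J g (?\<phi> i) \<partial>count_space ?S)"
    unfolding factorial_measure_def by (rule integral_distr[OF \<phi> tm])
  also have "\<dots> = (\<Sum>i | i \<in> ?S \<and> tensor J g (?\<phi> i) \<noteq> 0. tensor J g (?\<phi> i))"
    by (rule lebesgue_integral_count_space_finite_support) (rule finite_subset[OF sub SB])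
  also have "\<dots> = (\<Sum>i\<in>?SB. tensor J g (?\<phi> i))"
    using SB sub by (intro sum.mono_neutral_left) auto
  also have "\<dots> = injsum ?KB (\<lambda>j k. g j (X k \<omega>)) J"
    unfolding injsum_def t ..
  also have "\<dots> = factorial_integral J g (\<eta> \<omega>)"
    by (rule factorial_integral_labelled[OF lab J g, symmetric])
  finally show ?thesis .
qed

lemma product_integral_eq:
  assumes w: "\<omega> \<in> space M" and B: "B \<in> finite_sets L" and fin: "emeasure (\<eta> \<omega>) B < \<infinity>"
    and g: "\<And>i. i < n \<Longrightarrow> factor_on L B (g i)"
  shows "product_integral L (emeasure (\<eta> \<omega>) (space L)) (\<lambda>i. X i \<omega>) n g = compensated_integral L {..<n} g (\<eta> \<omega>)"
  unfolding product_integral_def compensated_integral_def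
proof (rule sum.cong[OF refl])
  fix J assume J: "J \<in> Pow {..<n}"
  then have fJ: "finite J" by (auto intro: finite_subset)
  have "(\<integral>y. tensor J g y \<partial>factorial_measure L (emeasure (\<eta> \<omega>) (space L)) (\<lambda>i. X i \<omega>) J) = factorial_integral J g (\<eta> \<omega>)"
    using J g by (intro integral_factorial_measure[OF w finite_setsD(1)[OF B] fin fJ]) auto
  moreover have "(\<integral>y. tensor ({..<n} - J) g y \<partial>Pi\<^sub>M ({..<n} - J) (\<lambda>_. L)) = (\<Prod>j\<in>{..<n} - J. \<integral>y. g j y \<partial>L)"
    unfolding tensor_def using g finite_setsD[OF B]
    by (intro LP.product_integral_prod factor_on_integrable(1)) auto
  moreover have "n - card J = card ({..<n} - J)" using J fJ by (subst card_Diff_subset) auto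
  ultimately show "(- 1) ^ (n - card J) * (\<integral>y. tensor J g y \<partial>factorial_measure L (emeasure (\<eta> \<omega>) (space L)) (\<lambda>i. X i \<omega>) J) *
      (\<integral>y. tensor ({..<n} - J) g y \<partial>Pi\<^sub>M ({..<n} - J) (\<lambda>_. L)) =
      (- 1) ^ card ({..<n} - J) * factorial_integral J g (\<eta> \<omega>) * (\<Prod>j\<in>{..<n} - J. \<integral>y. g j y \<partial>L)"
    by simp
qed

text \<open>These integrals agree with functionals of \<open>\<eta>\<close> only almost surely, and
  measurability does not pass through such an identity, since \<open>M\<close> need not be complete.
  It is shown directly: the index tuples form a countable set, so one tuple can be considered at a
  time.\<close>

lemma factorial_measure_integral_measurable:
  assumes J: "finite J" and g: "\<And>j. j \<in> J \<Longrightarrow> g j \<in> borel_measurable L"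
  shows "(\<lambda>\<omega>. \<integral>y. tensor J g y \<partial>factorial_measure L (emeasure (\<eta> \<omega>) (space L)) (\<lambda>i. X i \<omega>) J) \<in> borel_measurable M"
proof -
  let ?U = "J \<rightarrow>\<^sub>E (UNIV :: nat set)"
  let ?S = "\<lambda>\<omega>. {i \<in> J \<rightarrow>\<^sub>E {k. of_nat k < emeasure (\<eta> \<omega>) (space L)}. inj_on i J}"
  have U: "countable ?U" using J by (intro countable_PiE) auto
  interpret U: sigma_finite_measure "count_space ?U"
    by (rule sigma_finite_measure_count_space_countable[OF U])
  have eq: "(\<integral>y. tensor J g y \<partial>factorial_measure L (emeasure (\<eta> \<omega>) (space L)) (\<lambda>i. X i \<omega>) J) =
      (\<integral>i. indicator (?S \<omega>) i * (\<Prod>j\<in>J. g j (X (i j) \<omega>)) \<partial>count_space ?U)" if w: "\<omega> \<in> space M" for \<omega>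
  proof -
    have \<phi>: "(\<lambda>i. \<lambda>j\<in>J. X (i j) \<omega>) \<in> count_space (?S \<omega>) \<rightarrow>\<^sub>M Pi\<^sub>M J (\<lambda>_. L)"
      using measurable_space[OF X_measurable w] by (auto simp: space_PiM)
    have "(\<integral>y. tensor J g y \<partial>factorial_measure L (emeasure (\<eta> \<omega>) (space L)) (\<lambda>i. X i \<omega>) J) =
        (\<integral>i. tensor J g (\<lambda>j\<in>J. X (i j) \<omega>) \<partial>count_space (?S \<omega>))"
      unfolding factorial_measure_def by (rule integral_distr[OF \<phi> tensor_measurable[OF J g]])
    also have "\<dots> = (\<integral>i. (\<Prod>j\<in>J. g j (X (i j) \<omega>)) \<partial>count_space (?S \<omega>))"
      unfolding tensor_def by (intro Bochner_Integration.integral_cong prod.cong refl) auto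
    also have "count_space (?S \<omega>) = restrict_space (count_space ?U) (?S \<omega>)"
      unfolding restrict_count_space by (rule arg_cong[where f=count_space]) (auto simp: PiE_def)
    also have "(\<integral>i. (\<Prod>j\<in>J. g j (X (i j) \<omega>)) \<partial>restrict_space (count_space ?U) (?S \<omega>)) =
        (\<integral>i. indicator (?S \<omega>) i *\<^sub>R (\<Prod>j\<in>J. g j (X (i j) \<omega>)) \<partial>count_space ?U)"
      by (rule integral_restrict_space) (auto simp: PiE_def)
    finally show ?thesis by simp
  qed
  have "(\<lambda>(\<omega>, i). indicator (?S \<omega>) i * (\<Prod>j\<in>J. g j (X (i j) \<omega>))) \<in> borel_measurable (M \<Otimes>\<^sub>M count_space ?U)"
  proof (subst measurable_pair_swap_iff, rule measurable_pair_measure_countable1[OF U])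
    fix i assume i: "i \<in> ?U"
    have 1: "(\<lambda>\<omega>. \<Prod>j\<in>J. g j (X (i j) \<omega>)) \<in> borel_measurable M"
      by (intro borel_measurable_prod measurable_compose[OF X_measurable g])
    have "{\<omega> \<in> space M. \<forall>j\<in>J. of_nat (i j) < emeasure (\<eta> \<omega>) (space L)} \<in> sets M"
      using J by (intro sets.sets_Collect_finite_All) auto
    then have 2: "(\<lambda>\<omega>. indicator {\<omega> \<in> space M. \<forall>j\<in>J. of_nat (i j) < emeasure (\<eta> \<omega>) (space L)} \<omega> * (if inj_on i J then 1 else 0 :: real)) \<in> borel_measurable M"
      by measurable
    have "indicator (?S \<omega>) i = indicator {\<omega> \<in> space M. \<forall>j\<in>J. of_nat (i j) < emeasure (\<eta> \<omega>) (space L)} \<omega> * (if inj_on i J then 1 else 0 :: real)"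
      if "\<omega> \<in> space M" for \<omega>
      using i that by (auto simp: indicator_def PiE_def Pi_def)
    with 2 have "(\<lambda>\<omega>. indicator (?S \<omega>) i :: real) \<in> borel_measurable M"
      by (subst measurable_cong[where g="\<lambda>\<omega>. indicator {\<omega> \<in> space M. \<forall>j\<in>J. of_nat (i j) < emeasure (\<eta> \<omega>) (space L)} \<omega> * (if inj_on i J then 1 else 0 :: real)"])
    with 1 show "(\<lambda>\<omega>. case (i, \<omega>) of (x, y) \<Rightarrow> case (y, x) of (\<omega>, i) \<Rightarrow> indicator (?S \<omega>) i * (\<Prod>j\<in>J. g j (X (i j) \<omega>))) \<in> borel_measurable M"
      by simp
  qed
  from U.borel_measurable_lebesgue_integral[OF this] eq show ?thesis
    by (subst measurable_cong[where g="\<lambda>\<omega>. \<integral>i. indicator (?S \<omega>) i * (\<Prod>j\<in>J. g j (X (i j) \<omega>)) \<partial>count_space ?U"])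
qed

lemma product_integral_measurable:
  assumes "\<And>i. i < n \<Longrightarrow> g i \<in> borel_measurable L"
  shows "(\<lambda>\<omega>. product_integral L (emeasure (\<eta> \<omega>) (space L)) (\<lambda>i. X i \<omega>) n g) \<in> borel_measurable M"
  unfolding product_integral_def
  using assms by (intro borel_measurable_sum borel_measurable_times borel_measurable_const factorial_measure_integral_measurable)
    (auto intro: finite_subset)

subsection \<open>The isometry\<close>

text \<open>Test the adjoint relation with the constant 1, whose differences vanish.\<close>

lemma compensated_integral_mean:
  assumes B: "B \<in> finite_sets L" and J: "finite J" "J \<noteq> {}" "\<And>j. j \<in> J \<Longrightarrow> factor_on L B (g j)"
  shows "(\<integral>\<omega>. compensated_integral L J g (\<eta> \<omega>) \<partial>M) = 0"
proof -
  obtain j where j: "j \<in> J" using J by blast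
  have one: "moments_finite B (\<lambda>_. 1)"
    by (rule moments_finite_square_integrable[OF B]) auto
  have ins: "insert j (J - {j}) = J" using j by auto
  show ?thesis
    using compensated_integral_adjoint(1)[OF B one, of "J - {j}" j g] J j
    by (simp add: ins insert_absorb diff_op_def)
qed

text \<open>Apply the adjoint relation to the functional \<open>compensated_integral L J g\<close>:
  the difference removes one index of \<open>J\<close> while one factor of \<open>h\<close> is
  consumed, so both orders decrease together. If the orders differ, in the end either a constant is
  differenced or an integral of positive order is averaged, and both give 0; if they agree, the
  pairings add up to a permanent.\<close>

lemma compensated_integral_isometry:
  assumes B: "B \<in> finite_sets L" and "finite J"
    and "\<And>j. j \<in> J \<Longrightarrow> factor_on L B (g j)" "\<And>i. i < n \<Longrightarrow> factor_on L B (h i)"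
  shows "(\<integral>\<omega>. compensated_integral L J g (\<eta> \<omega>) * compensated_integral L {..<n} h (\<eta> \<omega>) \<partial>M) =
    (if card J = n then injsum J (\<lambda>i j. \<integral>y. h i y * g j y \<partial>L) {..<n} else 0)"
  using assms(2-)
proof (induction n arbitrary: J)
  case 0
  then show ?case using compensated_integral_mean[OF B, of J g] by (cases "J = {}") (auto simp: prob_space)
next
  case (Suc n)
  have BL: "B \<in> sets L" using B by (rule finite_setsD)
  have h: "\<And>i. i \<in> insert n {..<n} \<Longrightarrow> factor_on L B (h i)" and hn: "factor_on L B (h n)" using Suc.prems by auto
  have hl: "\<And>i. i < n \<Longrightarrow> factor_on L B (h i)" using Suc.prems by auto
  have ins: "insert n {..<n} = {..<Suc n}" by auto
  let ?W = "compensated_integral L {..<n} h" and ?V = "\<lambda>J. compensated_integral L J g"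
  let ?a = "\<lambda>i j. \<integral>y. h i y * g j y \<partial>L"
  have W: "poly_bounded L B ?W" "?W \<in> borel_measurable (point_algebra L)"
    using hl by (auto intro!: poly_bounded_compensated_integral[OF BL] compensated_integral_measurable factor_on_measurable[of L B])
  have V: "poly_bounded L B (?V I)" "?V I \<in> borel_measurable (point_algebra L)" if "I \<subseteq> J" for I
    using that Suc.prems finite_subset[OF that]
    by (auto intro!: poly_bounded_compensated_integral[OF BL] compensated_integral_measurable factor_on_measurable[of L B])
  note [measurable] = W(2) V(2)
  have Vmf: "moments_finite B (?V I)" if "I \<subseteq> J" for I
    using V[OF that] by (intro moments_finite_square_integrable[OF B] poly_bounded_square_integrable[OF B])
  have prod: "factor_on L B (\<lambda>y. h n y * g j y)" if "j \<in> J" for j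
    using that Suc.prems hn by (intro factor_on_mult) auto
  have int: "integrable (L \<Otimes>\<^sub>M M) (\<lambda>p. (h n (fst p) * g j (fst p)) * (?V (J - {j}) (\<eta> (snd p)) * ?W (\<eta> (snd p))))" if "j \<in> J" for j
    using integrable_shift_product(2)[OF B Vmf W prod[OF that], of "J - {j}"] by auto
  have "(\<integral>\<omega>. ?V J (\<eta> \<omega>) * compensated_integral L {..<Suc n} h (\<eta> \<omega>) \<partial>M) =
      (\<integral>p. h n (fst p) * (diff_op (fst p) (?V J) (\<eta> (snd p)) * ?W (\<eta> (snd p))) \<partial>(L \<Otimes>\<^sub>M M))"
    using compensated_integral_adjoint(1)[OF B Vmf[OF subset_refl], of "{..<n}" n h] h by (simp add: ins)
  also have "\<dots> = (\<integral>p. (\<Sum>j\<in>J. (h n (fst p) * g j (fst p)) * (?V (J - {j}) (\<eta> (snd p)) * ?W (\<eta> (snd p)))) \<partial>(L \<Otimes>\<^sub>M M))"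
  proof (rule integral_cong_AE)
    show "(\<lambda>p. h n (fst p) * (diff_op (fst p) (?V J) (\<eta> (snd p)) * ?W (\<eta> (snd p)))) \<in> borel_measurable (L \<Otimes>\<^sub>M M)"
      using compensated_integral_adjoint(2)[OF B Vmf[OF subset_refl], of "{..<n}" n h] h by (intro borel_measurable_integrable) simp
    show "(\<lambda>p. \<Sum>j\<in>J. (h n (fst p) * g j (fst p)) * (?V (J - {j}) (\<eta> (snd p)) * ?W (\<eta> (snd p)))) \<in> borel_measurable (L \<Otimes>\<^sub>M M)"
      using int by (intro borel_measurable_sum) (rule borel_measurable_integrable)
    have "AE p in L \<Otimes>\<^sub>M M. emeasure (\<eta> (snd p)) B < \<infinity>"
    proof (rule LM.AE_pair_measure)
      show "{p \<in> space (L \<Otimes>\<^sub>M M). emeasure (\<eta> (snd p)) B < \<infinity>} \<in> sets (L \<Otimes>\<^sub>M M)"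
        using BL by measurable
      show "AE y in L. AE \<omega> in M. emeasure (\<eta> (snd (y, \<omega>))) B < \<infinity>"
        unfolding snd_conv by (rule AE_I2) (rule AE_eta_finite[OF B])
    qed
    then show "AE p in L \<Otimes>\<^sub>M M. h n (fst p) * (diff_op (fst p) (?V J) (\<eta> (snd p)) * ?W (\<eta> (snd p))) =
      (\<Sum>j\<in>J. (h n (fst p) * g j (fst p)) * (?V (J - {j}) (\<eta> (snd p)) * ?W (\<eta> (snd p))))"
      using AE_space
    proof eventually_elim
      case (elim p)
      then have p: "fst p \<in> space L" "snd p \<in> space M" by (auto simp: space_pair_measure)
      have "diff_op (fst p) (?V J) (\<eta> (snd p)) = (\<Sum>j\<in>J. g j (fst p) * ?V (J - {j}) (\<eta> (snd p)))"
        using compensated_integral_add_point[OF eta_labelled[OF p(2) BL elim(1)] p(1) Suc.prems(1,2)]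
        by (simp add: diff_op_def)
      then show ?case by (simp add: sum_distrib_left sum_distrib_right ac_simps)
    qed
  qed
  also have "\<dots> = (\<Sum>j\<in>J. \<integral>p. (h n (fst p) * g j (fst p)) * (?V (J - {j}) (\<eta> (snd p)) * ?W (\<eta> (snd p))) \<partial>(L \<Otimes>\<^sub>M M))"
    using int by (rule Bochner_Integration.integral_sum)
  also have "\<dots> = (\<Sum>j\<in>J. ?a n j * (\<integral>\<omega>. ?V (J - {j}) (\<eta> \<omega>) * ?W (\<eta> \<omega>) \<partial>M))"
    by (intro sum.cong refl) (use LM.integral_fst'[OF int] in simp)
  also have "\<dots> = (\<Sum>j\<in>J. ?a n j * (if card (J - {j}) = n then injsum (J - {j}) ?a {..<n} else 0))"
    using Suc.prems by (intro sum.cong refl arg_cong2[where f="(*)"] Suc.IH) auto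
  also have "\<dots> = (if card J = Suc n then injsum J ?a {..<Suc n} else 0)"
  proof (cases "J = {}")
    case False
    then have "card J > 0" using Suc.prems(1) by (simp add: card_gt_0_iff)
    \<comment> \<open>The condition on the order does not depend on the removed index, so it leaves
      the sum and \<open>injsum_insert_index\<close> collects the rest.\<close>
    then have "card (J - {j}) = n \<longleftrightarrow> card J = Suc n" if "j \<in> J" for j using Suc.prems(1) that by auto
    then show ?thesis
      using injsum_insert_index[OF Suc.prems(1), of "{..<n}" n ?a] by (simp add: ins)
  qed simp
  finally show ?case .
qed

end

lemma L2_closure_cong_AE:
  assumes "u \<in> L2_closure M V" "v \<in> borel_measurable M" "AE x in M. v x = u x"
  shows "v \<in> L2_closure M V"
proof -
  obtain h where h: "\<And>k. h k \<in> V" "L2_tendsto M h u" using assms(1) by (auto simp: L2_closure_def)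
  have "L2_tendsto M h v"
    by (rule L2_tendsto_cong_AE[OF h(2)]) (use h(2) assms in \<open>auto simp: L2_tendsto_def square_integrable_measurable\<close>)
  then show ?thesis using h(1) by (auto simp: L2_closure_def)
qed

lemma integrable_sum_list:
  fixes F :: "'i \<Rightarrow> 'b \<Rightarrow> real"
  assumes "\<And>g. g \<in> set gs \<Longrightarrow> integrable M (F g)"
  shows "integrable M (\<lambda>x. \<Sum>g\<leftarrow>gs. F g x)" "(\<integral>x. (\<Sum>g\<leftarrow>gs. F g x) \<partial>M) = (\<Sum>g\<leftarrow>gs. \<integral>x. F g x \<partial>M)"
proof -
  have "integrable M (\<lambda>x. \<Sum>g\<leftarrow>gs. F g x) \<and> (\<integral>x. (\<Sum>g\<leftarrow>gs. F g x) \<partial>M) = (\<Sum>g\<leftarrow>gs. \<integral>x. F g x \<partial>M)"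
    using assms by (induction gs) auto
  then show "integrable M (\<lambda>x. \<Sum>g\<leftarrow>gs. F g x)" "(\<integral>x. (\<Sum>g\<leftarrow>gs. F g x) \<partial>M) = (\<Sum>g\<leftarrow>gs. \<integral>x. F g x \<partial>M)"
    by auto
qed

lemma square_integrable_sum_list:
  "(\<And>g. g \<in> set gs \<Longrightarrow> square_integrable M (F g)) \<Longrightarrow> square_integrable M (\<lambda>x. \<Sum>g\<leftarrow>gs. F g x)"
  by (induction gs) (auto intro: square_integrable_add)

section \<open>Permutations of coordinates\<close>

context sigma_finite_measure
begin

interpretation PM: product_sigma_finite "\<lambda>_. M" ..

lemma permutes_measurable:
  assumes "\<pi> permutes {..<n}"
  shows "(\<lambda>y. y \<circ> \<pi>) \<in> power_measure M n \<rightarrow>\<^sub>M power_measure M n"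
proof (rule measurable_PiM_single')
  show "(\<lambda>y. (y \<circ> \<pi>) i) \<in> power_measure M n \<rightarrow>\<^sub>M M" if "i \<in> {..<n}" for i
    using measurable_component_singleton[of "\<pi> i" "{..<n}" "\<lambda>_. M"] permutes_in_image[OF assms, of i] that by simp
  show "(\<lambda>y i. (y \<circ> \<pi>) i) \<in> space (power_measure M n) \<rightarrow> {..<n} \<rightarrow>\<^sub>E space M"
    using permutes_in_image[OF assms] permutes_not_in[OF assms]
    by (auto simp: space_PiM PiE_def Pi_def extensional_def)
qed

text \<open>Rectangles suffice. Their preimages have the same sides in permuted order, and the
  product of the measures of the sides is unchanged.\<close>

lemma distr_permutes:
  assumes p: "\<pi> permutes {..<n}"
  shows "distr (power_measure M n) (power_measure M n) (\<lambda>y. y \<circ> \<pi>) = power_measure M n"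
proof (rule PM.PiM_eqI)
  fix A assume A: "\<And>i. i \<in> {..<n} \<Longrightarrow> A i \<in> sets M"
  have inv: "inv \<pi> permutes {..<n}" by (rule permutes_inv[OF p])
  have "emeasure (distr (power_measure M n) (power_measure M n) (\<lambda>y. y \<circ> \<pi>)) (Pi\<^sub>E {..<n} A) =
      emeasure (power_measure M n) ((\<lambda>y. y \<circ> \<pi>) -` Pi\<^sub>E {..<n} A \<inter> space (power_measure M n))"
    using A by (intro emeasure_distr permutes_measurable[OF p] sets_PiM_I_finite) auto
  also have "(\<lambda>y. y \<circ> \<pi>) -` Pi\<^sub>E {..<n} A \<inter> space (power_measure M n) = Pi\<^sub>E {..<n} (\<lambda>i. A (inv \<pi> i))" (is "?l = ?r")
  proof (intro set_eqI iffI)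
    fix y assume y: "y \<in> ?l"
    have "y i \<in> A (inv \<pi> i)" if "i < n" for i
    proof -
      have "inv \<pi> i < n" using permutes_in_image[OF inv, of i] that by simp
      then have "y (\<pi> (inv \<pi> i)) \<in> A (inv \<pi> i)" using y by (auto simp: PiE_def Pi_def)
      then show ?thesis by (simp add: permutes_inverses(1)[OF p])
    qed
    then show "y \<in> ?r" using y by (auto simp: space_PiM PiE_def Pi_def)
  next
    fix y assume y: "y \<in> ?r"
    have "y (\<pi> i) \<in> A i" if "i < n" for i
    proof -
      have "\<pi> i < n" using permutes_in_image[OF p, of i] that by simp
      then have "y (\<pi> i) \<in> A (inv \<pi> (\<pi> i))" using y by (auto simp: PiE_def Pi_def)
      then show ?thesis by (simp add: permutes_inverses(2)[OF p])
    qed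
    moreover have "y i \<in> space M" if "i < n" for i
      using y A[of "inv \<pi> i"] sets.sets_into_space[of _ M] permutes_in_image[OF inv, of i] that by (fastforce simp: PiE_def Pi_def)
    ultimately show "y \<in> ?l" using y permutes_not_in[OF p] by (auto simp: space_PiM PiE_def Pi_def extensional_def)
  qed
  also have "emeasure (power_measure M n) \<dots> = (\<Prod>i<n. emeasure M (A (inv \<pi> i)))"
    using A permutes_in_image[OF inv] by (intro PM.emeasure_PiM) auto
  also have "\<dots> = (\<Prod>i<n. emeasure M (A i))"
    using prod.permute[OF inv, of "\<lambda>i. emeasure M (A i)"] by (simp add: o_def)
  finally show "emeasure (distr (power_measure M n) (power_measure M n) (\<lambda>y. y \<circ> \<pi>)) (Pi\<^sub>E {..<n} A) = (\<Prod>i<n. emeasure M (A i))" .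
qed auto

lemma permutes_integral:
  fixes u :: "(nat \<Rightarrow> 'a) \<Rightarrow> real"
  assumes p: "\<pi> permutes {..<n}" and u: "u \<in> borel_measurable (power_measure M n)"
  shows "(\<integral>y. u (y \<circ> \<pi>) \<partial>power_measure M n) = (\<integral>y. u y \<partial>power_measure M n)"
  using integral_distr[OF permutes_measurable[OF p] u] by (simp add: distr_permutes[OF p])

lemma permutes_square_integrable:
  assumes p: "\<pi> permutes {..<n}" and u: "square_integrable (power_measure M n) u"
  shows "square_integrable (power_measure M n) (\<lambda>y. u (y \<circ> \<pi>))"
  using u square_integrable_distr[OF permutes_measurable[OF p], of u] by (simp add: distr_permutes[OF p])

lemma permutes_L2_norm:
  assumes p: "\<pi> permutes {..<n}" and u: "square_integrable (power_measure M n) u"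
  shows "L2_norm (power_measure M n) (\<lambda>y. u (y \<circ> \<pi>)) = L2_norm (power_measure M n) u"
  unfolding L2_norm_def using permutes_integral[OF p, of "\<lambda>y. (u y)\<^sup>2"] u
  by (simp add: square_integrable_measurable)

end

text \<open>This is \<open>n!\<close> times the symmetrization; keeping the factor absorbs the
  \<open>n!\<close> of the isometry. Symmetrising one argument of the scalar product is enough, as
  symmetrising the other then changes nothing.\<close>

definition sym_sum :: "nat \<Rightarrow> ((nat \<Rightarrow> 'a) \<Rightarrow> real) \<Rightarrow> (nat \<Rightarrow> 'a) \<Rightarrow> real" where
  "sym_sum n u y = (\<Sum>\<pi> | \<pi> permutes {..<n}. u (y \<circ> \<pi>))"

lemma (in sigma_finite_measure) sym_sum_square_integrable:
  assumes "square_integrable (power_measure M n) u"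
  shows "square_integrable (power_measure M n) (sym_sum n u)"
proof -
  have "square_integrable (power_measure M n) (\<lambda>y. \<Sum>\<pi> | \<pi> permutes {..<n}. u (y \<circ> \<pi>))"
    using assms by (intro square_integrable_sum permutes_square_integrable) auto
  then show ?thesis by (simp add: sym_sum_def[abs_def])
qed

text \<open>Every rearrangement of \<open>u\<close> has the norm of \<open>u\<close>, and there are
  \<open>n!\<close> of them.\<close>

lemma (in sigma_finite_measure) sym_sum_inner_bound:
  assumes u: "square_integrable (power_measure M n) u" and v: "square_integrable (power_measure M n) v"
  shows "\<bar>\<integral>y. sym_sum n u y * v y \<partial>power_measure M n\<bar> \<le> fact n * L2_norm (power_measure M n) u * L2_norm (power_measure M n) v"
proof -
  have "(\<integral>y. sym_sum n u y * v y \<partial>power_measure M n) = (\<Sum>\<pi> | \<pi> permutes {..<n}. \<integral>y. u (y \<circ> \<pi>) * v y \<partial>power_measure M n)"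
    unfolding sym_sum_def sum_distrib_right
    using u v by (intro Bochner_Integration.integral_sum integrable_mult_square permutes_square_integrable) auto
  also have "\<bar>\<dots>\<bar> \<le> (\<Sum>\<pi> | \<pi> permutes {..<n}. L2_norm (power_measure M n) u * L2_norm (power_measure M n) v)"
  proof (rule order_trans[OF sum_abs], rule sum_mono)
    fix \<pi> assume "\<pi> \<in> {\<pi>. \<pi> permutes {..<n}}"
    then have p: "\<pi> permutes {..<n}" by simp
    show "\<bar>\<integral>y. u (y \<circ> \<pi>) * v y \<partial>power_measure M n\<bar> \<le> L2_norm (power_measure M n) u * L2_norm (power_measure M n) v"
      using L2_Cauchy_Schwarz[OF permutes_square_integrable[OF p u] v] by (simp add: permutes_L2_norm[OF p u])
  qed
  also have "\<dots> = fact n * L2_norm (power_measure M n) u * L2_norm (power_measure M n) v"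
    by (simp add: card_permutations[OF card_lessThan])
  finally show ?thesis .
qed

section \<open>Functions of sum-product form\<close>

definition form_on :: "'a measure \<Rightarrow> 'a set \<Rightarrow> nat \<Rightarrow> (nat \<Rightarrow> 'a \<Rightarrow> real) list \<Rightarrow> bool" where
  "form_on L B n gs \<longleftrightarrow> (\<forall>g\<in>set gs. \<forall>i<n. factor_on L B (g i))"

lemma form_on_mono: "form_on L B n gs \<Longrightarrow> B \<subseteq> C \<Longrightarrow> form_on L C n gs"
  by (auto simp: form_on_def intro: factor_on_mono)

lemma form_on_imp: "form_on L B n gs \<Longrightarrow> B \<in> finite_sets L \<Longrightarrow> sum_product_form L n gs"
  by (auto simp: form_on_def sum_product_form_def admissible_factor_iff)

text \<open>Finitely many supports of finite intensity have a union of finite intensity, so a form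
  can be treated on one common set.\<close>

lemma sum_product_form_on:
  assumes "sum_product_form L n gs"
  obtains B where "B \<in> finite_sets L" "form_on L B n gs"
proof -
  have "\<exists>B\<in>finite_sets L. form_on L B n gs"
    using assms
  proof (induction gs)
    case Nil
    have "{} \<in> finite_sets L" by (simp add: finite_sets_def)
    then show ?case by (auto simp: form_on_def)
  next
    case (Cons g gs)
    then obtain B where B: "B \<in> finite_sets L" "form_on L B n gs" by (auto simp: sum_product_form_def)
    have "\<forall>i<n. \<exists>C\<in>finite_sets L. factor_on L C (g i)"
      using Cons.prems by (auto simp: sum_product_form_def admissible_factor_iff)
    then obtain C where C: "\<And>i. i < n \<Longrightarrow> C i \<in> finite_sets L" "\<And>i. i < n \<Longrightarrow> factor_on L (C i) (g i)" by metis
    let ?D = "B \<union> (\<Union>i\<in>{..<n}. C i)"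
    have "?D \<in> finite_sets L" using B C by (intro finite_sets_Un finite_sets_UN) auto
    moreover have "factor_on L ?D (g i)" if "i < n" for i
      by (rule factor_on_mono[OF C(2)[OF that]]) (use that in auto)
    ultimately show ?case using form_on_mono[OF B(2), of ?D] by (auto simp: form_on_def)
  qed
  then show ?thesis using that by blast
qed

lemma sum_product_append: "sum_product n (gs @ hs) y = sum_product n gs y + sum_product n hs y"
  by (simp add: sum_product_def)

text \<open>A multiple of a product form is again of product form, with the scalar put into one
  factor. For \<open>n = 0\<close> there is no factor to receive it and the tensor is always 1;
  hence the condition \<open>0 < n\<close> wherever forms are scaled.\<close>

definition scale_first :: "real \<Rightarrow> (nat \<Rightarrow> 'a \<Rightarrow> real) \<Rightarrow> nat \<Rightarrow> 'a \<Rightarrow> real" where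
  "scale_first c g = g(0 := \<lambda>y. c * g 0 y)"

lemma tensor_scale_first: "0 < n \<Longrightarrow> tensor {..<n} (scale_first c g) y = c * tensor {..<n} g y"
proof -
  assume "0 < n"
  then have *: "tensor {..<n} h y = h 0 (y 0) * (\<Prod>j\<in>{..<n} - {0}. h j (y j))" for h :: "nat \<Rightarrow> 'a \<Rightarrow> real"
    using prod.remove[of "{..<n}" 0 "\<lambda>j. h j (y j)"] by (simp add: tensor_def)
  show ?thesis unfolding * by (simp add: scale_first_def mult.assoc)
qed

lemma sum_product_scale: "0 < n \<Longrightarrow> sum_product n (map (scale_first c) gs) y = c * sum_product n gs y"
  by (induction gs) (simp_all add: sum_product_def tensor_scale_first distrib_left)

lemma form_on_append: "form_on L B n (gs @ hs) \<longleftrightarrow> form_on L B n gs \<and> form_on L B n hs"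
  by (auto simp: form_on_def)

lemma form_on_scale: "form_on L B n gs \<Longrightarrow> form_on L B n (map (scale_first c) gs)"
  by (auto simp: form_on_def scale_first_def intro: factor_on_scale)

definition sum_compensated :: "'a measure \<Rightarrow> nat \<Rightarrow> (nat \<Rightarrow> 'a \<Rightarrow> real) list \<Rightarrow> 'a measure \<Rightarrow> real" where
  "sum_compensated L n gs \<mu> = (\<Sum>g\<leftarrow>gs. compensated_integral L {..<n} g \<mu>)"

context poisson_points
begin

lemma tensor_square_integrable:
  assumes B: "B \<in> finite_sets L" and g: "\<And>i. i < n \<Longrightarrow> factor_on L B (g i)"
  shows "square_integrable (power_measure L n) (tensor {..<n} g)"
proof -
  have "integrable L (\<lambda>y. (g i y)\<^sup>2)" if "i < n" for i
    using factor_on_mult[OF g[OF that] g[OF that]] finite_setsD[OF B]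
    by (intro factor_on_integrable(1)[of L B]) (auto simp: power2_eq_square)
  then have "integrable (power_measure L n) (\<lambda>y. \<Prod>i<n. (g i (y i))\<^sup>2)"
    by (intro LP.product_integrable_prod) auto
  moreover have "tensor {..<n} g \<in> borel_measurable (power_measure L n)"
    using g by (intro tensor_measurable factor_on_measurable) auto
  ultimately show ?thesis by (simp add: square_integrable_def tensor_def prod_power_distrib)
qed

lemma sum_product_square_integrable:
  assumes "B \<in> finite_sets L" "form_on L B n gs"
  shows "square_integrable (power_measure L n) (sum_product n gs)"
  using assms square_integrable_sum_list[of gs "power_measure L n" "tensor {..<n}"]
  by (simp add: sum_product_def[abs_def] form_on_def tensor_square_integrable)

lemma compensated_integral_regular:
  assumes B: "B \<in> finite_sets L" and J: "finite J" "\<And>j. j \<in> J \<Longrightarrow> factor_on L B (g j)"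
  shows "compensated_integral L J g \<in> borel_measurable (point_algebra L)"
    "poly_bounded L B (compensated_integral L J g)"
    "square_integrable M (\<lambda>\<omega>. compensated_integral L J g (\<eta> \<omega>))"
proof -
  show 1: "compensated_integral L J g \<in> borel_measurable (point_algebra L)"
    using J by (intro compensated_integral_measurable factor_on_measurable[of L B]) auto
  show 2: "poly_bounded L B (compensated_integral L J g)"
    using J finite_setsD[OF B] by (intro poly_bounded_compensated_integral) auto
  show "square_integrable M (\<lambda>\<omega>. compensated_integral L J g (\<eta> \<omega>))"
    by (rule poly_bounded_square_integrable[OF B 2 1])
qed

lemma sum_compensated_square_integrable:
  assumes B: "B \<in> finite_sets L" and gs: "form_on L B n gs"
  shows "square_integrable M (\<lambda>\<omega>. sum_compensated L n gs (\<eta> \<omega>))"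
proof -
  have "square_integrable M (\<lambda>\<omega>. \<Sum>g\<leftarrow>gs. compensated_integral L {..<n} g (\<eta> \<omega>))"
    using gs by (intro square_integrable_sum_list compensated_integral_regular(3)[OF B]) (auto simp: form_on_def)
  then show ?thesis by (simp add: sum_compensated_def)
qed

lemma sum_product_integral_eq:
  assumes B: "B \<in> finite_sets L" and gs: "form_on L B n gs"
  shows "AE \<omega> in M. sum_product_integral L \<eta> X n gs \<omega> = sum_compensated L n gs (\<eta> \<omega>)"
  using AE_eta_finite[OF B] AE_space
proof eventually_elim
  case (elim \<omega>)
  show ?case unfolding sum_product_integral_def sum_compensated_def
    using gs by (intro arg_cong[where f=sum_list] map_cong refl product_integral_eq[OF elim(2) B elim(1)]) (auto simp: form_on_def)
qed

lemma sum_product_integral_square_integrable: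
  assumes B: "B \<in> finite_sets L" and gs: "form_on L B n gs"
  shows "square_integrable M (sum_product_integral L \<eta> X n gs)"
proof (rule square_integrable_cong_AE[OF sum_compensated_square_integrable[OF assms] _ sum_product_integral_eq[OF assms]])
  have "(\<lambda>\<omega>. \<Sum>g\<leftarrow>gs. product_integral L (emeasure (\<eta> \<omega>) (space L)) (\<lambda>i. X i \<omega>) n g) \<in> borel_measurable M"
    using gs
  proof (induction gs)
    case (Cons g gs)
    have "(\<lambda>\<omega>. product_integral L (emeasure (\<eta> \<omega>) (space L)) (\<lambda>i. X i \<omega>) n g) \<in> borel_measurable M"
      using Cons.prems by (intro product_integral_measurable factor_on_measurable[of L B]) (auto simp: form_on_def)
    moreover have "(\<lambda>\<omega>. \<Sum>g\<leftarrow>gs. product_integral L (emeasure (\<eta> \<omega>) (space L)) (\<lambda>i. X i \<omega>) n g) \<in> borel_measurable M"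
      using Cons by (auto simp: form_on_def)
    ultimately show ?case by simp
  qed simp
  then show "sum_product_integral L \<eta> X n gs \<in> borel_measurable M"
    by (simp add: sum_product_integral_def[abs_def])
qed

lemma sum_compensated_mean_diff:
  assumes B: "B \<in> finite_sets L" and f: "moments_finite B f" and gs: "form_on L B n gs"
  shows "(\<integral>\<omega>. f (\<eta> \<omega>) * sum_compensated L n gs (\<eta> \<omega>) \<partial>M) =
    (\<integral>y. sum_product n gs y * mean_diff M \<eta> n f y \<partial>power_measure L n)"
proof -
  have g: "factor_on L B (g i)" if "g \<in> set gs" "i < n" for g i using gs that by (simp add: form_on_def)
  have "(\<integral>\<omega>. f (\<eta> \<omega>) * sum_compensated L n gs (\<eta> \<omega>) \<partial>M) = (\<integral>\<omega>. (\<Sum>g\<leftarrow>gs. f (\<eta> \<omega>) * compensated_integral L {..<n} g (\<eta> \<omega>)) \<partial>M)"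
    by (simp add: sum_compensated_def sum_list_const_mult)
  also have "\<dots> = (\<Sum>g\<leftarrow>gs. \<integral>\<omega>. f (\<eta> \<omega>) * compensated_integral L {..<n} g (\<eta> \<omega>) \<partial>M)"
    using g by (intro integrable_sum_list integrable_product[OF B f] compensated_integral_regular[OF B]) auto
  also have "\<dots> = (\<Sum>g\<leftarrow>gs. \<integral>y. tensor {..<n} g y * mean_diff M \<eta> n f y \<partial>power_measure L n)"
    using g by (intro arg_cong[where f=sum_list] map_cong refl compensated_integral_mean_diff[OF B f]) auto
  also have "\<dots> = (\<integral>y. (\<Sum>g\<leftarrow>gs. tensor {..<n} g y * mean_diff M \<eta> n f y) \<partial>power_measure L n)"
    using g by (intro integrable_sum_list(2)[symmetric] tensor_mean_diff_integrable[OF B f]) auto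
  finally show ?thesis by (simp add: sum_product_def sum_list_mult_const)
qed

text \<open>The permanent of the matrix of integrals of \<open>h i * g j\<close> is, by Fubini for
  products, a sum of integrals of rearranged tensors.\<close>

lemma tensor_isometry:
  assumes B: "B \<in> finite_sets L" and g: "\<And>i. i < m \<Longrightarrow> factor_on L B (g i)" and h: "\<And>i. i < n \<Longrightarrow> factor_on L B (h i)"
  shows "(\<integral>\<omega>. compensated_integral L {..<m} g (\<eta> \<omega>) * compensated_integral L {..<n} h (\<eta> \<omega>) \<partial>M) =
    (if m = n then \<integral>y. sym_sum n (tensor {..<n} g) y * tensor {..<n} h y \<partial>power_measure L n else 0)"
proof (cases "m = n")
  case True
  have "(\<integral>\<omega>. compensated_integral L {..<m} g (\<eta> \<omega>) * compensated_integral L {..<n} h (\<eta> \<omega>) \<partial>M) =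
      (\<Sum>\<pi> | \<pi> permutes {..<n}. \<Prod>i<n. \<integral>y. h i y * g (\<pi> i) y \<partial>L)"
    using compensated_integral_isometry[OF B, of "{..<m}" g n h] g h True by (simp add: injsum_permutes)
  \<comment> \<open>Replacing each permutation by its inverse does not change the sum, but puts the
    permutation where it acts on the coordinates of \<open>y\<close>.\<close>
  also have "\<dots> = (\<Sum>\<pi> | \<pi> permutes {..<n}. \<Prod>i<n. \<integral>y. h i y * g (inv \<pi> i) y \<partial>L)"
    by (rule sum_permutations_inverse)
  also have "\<dots> = (\<Sum>\<pi> | \<pi> permutes {..<n}. \<integral>y. tensor {..<n} g (y \<circ> \<pi>) * tensor {..<n} h y \<partial>power_measure L n)"
  proof (rule sum.cong[OF refl])
    fix \<pi> assume "\<pi> \<in> {\<pi>. \<pi> permutes {..<n}}"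
    then have p: "\<pi> permutes {..<n}" and inv: "inv \<pi> permutes {..<n}" by (auto intro: permutes_inv)
    have "tensor {..<n} g (y \<circ> \<pi>) * tensor {..<n} h y = (\<Prod>i<n. h i (y i) * g (inv \<pi> i) (y i))" for y
    proof -
      have "(\<Prod>j<n. g j (y (\<pi> j))) = (\<Prod>i<n. g (inv \<pi> i) (y i))"
        using prod.permute[OF inv, of "\<lambda>j. g j (y (\<pi> j))"] by (simp add: o_def permutes_inverses(1)[OF p])
      then show ?thesis by (simp add: tensor_def prod.distrib mult.commute)
    qed
    moreover have "integrable L (\<lambda>y. h i y * g (inv \<pi> i) y)" if "i < n" for i
      using that h g permutes_in_image[OF inv, of i] True finite_setsD[OF B]
      by (intro factor_on_integrable(1)[of L B] factor_on_mult) auto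
    ultimately show "(\<Prod>i<n. \<integral>y. h i y * g (inv \<pi> i) y \<partial>L) = (\<integral>y. tensor {..<n} g (y \<circ> \<pi>) * tensor {..<n} h y \<partial>power_measure L n)"
      using LP.product_integral_prod[of "{..<n}" "\<lambda>i y. h i y * g (inv \<pi> i) y"] by simp
  qed
  also have "\<dots> = (\<integral>y. sym_sum n (tensor {..<n} g) y * tensor {..<n} h y \<partial>power_measure L n)"
    unfolding sym_sum_def sum_distrib_right
    using g h True
    by (intro Bochner_Integration.integral_sum[symmetric] integrable_mult_square L.permutes_square_integrable tensor_square_integrable[OF B]) auto
  finally show ?thesis using True by simp
next
  case False
  then show ?thesis using compensated_integral_isometry[OF B, of "{..<m}" g n h] g h by simp
qed

lemma sym_sum_sum_product: "sym_sum n (sum_product n gs) y = (\<Sum>g\<leftarrow>gs. sym_sum n (tensor {..<n} g) y)"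
  by (induction gs) (simp_all add: sym_sum_def sum_product_def sum.distrib)

lemma sum_compensated_isometry:
  assumes B: "B \<in> finite_sets L" and gs: "form_on L B m gs" and hs: "form_on L B n hs"
  shows "(\<integral>\<omega>. sum_compensated L m gs (\<eta> \<omega>) * sum_compensated L n hs (\<eta> \<omega>) \<partial>M) =
    (if m = n then \<integral>y. sym_sum n (sum_product n gs) y * sum_product n hs y \<partial>power_measure L n else 0)"
proof -
  let ?W = "\<lambda>m g \<omega>. compensated_integral L {..<m} g (\<eta> \<omega>)"
  have g: "factor_on L B (g i)" if "g \<in> set gs" "i < m" for g i using gs that by (simp add: form_on_def)
  have h: "factor_on L B (h i)" if "h \<in> set hs" "i < n" for h i using hs that by (simp add: form_on_def)
  have siW: "square_integrable M (?W m g)" if "g \<in> set gs" for g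
    using g[OF that] by (intro compensated_integral_regular[OF B]) auto
  have siW': "square_integrable M (?W n h)" if "h \<in> set hs" for h
    using h[OF that] by (intro compensated_integral_regular[OF B]) auto
  have siS: "square_integrable M (\<lambda>\<omega>. sum_compensated L n hs (\<eta> \<omega>))"
    by (rule sum_compensated_square_integrable[OF B hs])
  have "(\<integral>\<omega>. sum_compensated L m gs (\<eta> \<omega>) * sum_compensated L n hs (\<eta> \<omega>) \<partial>M) =
      (\<Sum>g\<leftarrow>gs. \<integral>\<omega>. ?W m g \<omega> * sum_compensated L n hs (\<eta> \<omega>) \<partial>M)"
    unfolding sum_compensated_def[of L m] sum_list_mult_const[symmetric]
    using siW siS by (intro integrable_sum_list integrable_mult_square) auto
  also have "\<dots> = (\<Sum>g\<leftarrow>gs. \<Sum>h\<leftarrow>hs. \<integral>\<omega>. ?W m g \<omega> * ?W n h \<omega> \<partial>M)"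
    unfolding sum_compensated_def[of L n] sum_list_const_mult[symmetric]
    using siW siW' by (intro arg_cong[where f=sum_list] map_cong refl integrable_sum_list integrable_mult_square) auto
  also have "\<dots> = (\<Sum>g\<leftarrow>gs. \<Sum>h\<leftarrow>hs. if m = n then \<integral>y. sym_sum n (tensor {..<n} g) y * tensor {..<n} h y \<partial>power_measure L n else 0)"
    using g h by (intro arg_cong[where f=sum_list] map_cong refl tensor_isometry[OF B]) auto
  also have "\<dots> = (if m = n then \<integral>y. sym_sum n (sum_product n gs) y * sum_product n hs y \<partial>power_measure L n else 0)"
  proof (cases "m = n")
    case True
    have si1: "square_integrable (power_measure L n) (sym_sum n (tensor {..<n} g))" if "g \<in> set gs" for g
      using g[OF that] True by (intro L.sym_sum_square_integrable tensor_square_integrable[OF B]) auto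
    have si2: "square_integrable (power_measure L n) (tensor {..<n} h)" if "h \<in> set hs" for h
      using h[OF that] by (intro tensor_square_integrable[OF B]) auto
    have si3: "square_integrable (power_measure L n) (sum_product n hs)"
      by (rule sum_product_square_integrable[OF B hs])
    have "(\<integral>y. sym_sum n (sum_product n gs) y * sum_product n hs y \<partial>power_measure L n) =
        (\<Sum>g\<leftarrow>gs. \<integral>y. sym_sum n (tensor {..<n} g) y * sum_product n hs y \<partial>power_measure L n)"
      unfolding sym_sum_sum_product sum_list_mult_const[symmetric]
      using si1 si3 by (intro integrable_sum_list integrable_mult_square) auto
    also have "\<dots> = (\<Sum>g\<leftarrow>gs. \<Sum>h\<leftarrow>hs. \<integral>y. sym_sum n (tensor {..<n} g) y * tensor {..<n} h y \<partial>power_measure L n)"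
      unfolding sum_product_def sum_list_const_mult[symmetric]
      using si1 si2 by (intro arg_cong[where f=sum_list] map_cong refl integrable_sum_list integrable_mult_square) auto
    finally show ?thesis using True by simp
  qed (simp add: sum_list_0)
  finally show ?thesis .
qed

end

lemma L2_closure_mono: "V \<subseteq> W \<Longrightarrow> L2_closure M V \<subseteq> L2_closure M W"
  unfolding L2_closure_def by blast

lemma square_integrable_indicator_mult:
  assumes "square_integrable M u" "A \<in> sets M"
  shows "square_integrable M (\<lambda>x. u x * indicator A x)"
  by (rule square_integrable_bound[OF assms(1)]) (use assms in \<open>auto simp: indicator_def square_integrable_measurable\<close>)

lemma square_integrable_density_indicator:
  assumes A: "A \<in> sets M"
  shows "square_integrable (density M (\<lambda>x. ennreal (indicator A x))) u \<longleftrightarrow>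
    u \<in> borel_measurable M \<and> square_integrable M (\<lambda>x. u x * indicator A x)"
proof -
  have eq: "indicator A x * (u x)\<^sup>2 = (u x * indicator A x)\<^sup>2" for x by (simp add: indicator_def)
  have "integrable (density M (\<lambda>x. ennreal (indicator A x))) (\<lambda>x. (u x)\<^sup>2) \<longleftrightarrow> integrable M (\<lambda>x. (u x * indicator A x)\<^sup>2)"
    if "u \<in> borel_measurable M"
    using that A by (subst integrable_density) (auto simp: eq)
  then show ?thesis using A by (auto simp: square_integrable_def)
qed

lemma L2_tendsto_density_indicator:
  assumes A: "A \<in> sets M" and u: "L2_tendsto (density M (\<lambda>x. ennreal (indicator A x))) u v"
  shows "L2_tendsto M (\<lambda>k x. u k x * indicator A x) (\<lambda>x. v x * indicator A x)"
proof -
  have m: "u k \<in> borel_measurable M" "v \<in> borel_measurable M" for k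
    using u by (auto simp: L2_tendsto_def square_integrable_density_indicator[OF A])
  have "(\<integral>x. (u k x - v x)\<^sup>2 \<partial>density M (\<lambda>x. ennreal (indicator A x))) = (\<integral>x. (u k x * indicator A x - v x * indicator A x)\<^sup>2 \<partial>M)" for k
    using m A by (subst integral_density) (auto intro!: Bochner_Integration.integral_cong simp: indicator_def)
  then show ?thesis using u by (simp add: L2_tendsto_def square_integrable_density_indicator[OF A])
qed

lemma sets_PiM_rectangles:
  assumes "finite I"
  shows "sets (Pi\<^sub>M I M) = sigma_sets (space (Pi\<^sub>M I M)) {Pi\<^sub>E I E | E. \<forall>i\<in>I. E i \<in> sets (M i)}"
proof
  show "sets (Pi\<^sub>M I M) \<subseteq> sigma_sets (space (Pi\<^sub>M I M)) {Pi\<^sub>E I E | E. \<forall>i\<in>I. E i \<in> sets (M i)}"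
    unfolding sets_PiM_finite space_PiM by (rule sigma_sets_mono') auto
  show "sigma_sets (space (Pi\<^sub>M I M)) {Pi\<^sub>E I E | E. \<forall>i\<in>I. E i \<in> sets (M i)} \<subseteq> sets (Pi\<^sub>M I M)"
    using assms by (intro sets.sigma_sets_subset) (auto intro: sets_PiM_I_finite)
qed

context poisson_points
begin

section \<open>Density of product forms in \<open>L^2\<close>\<close>

definition cube :: "'a set \<Rightarrow> nat \<Rightarrow> (nat \<Rightarrow> 'a) set" where
  "cube B n = Pi\<^sub>E {..<n} (\<lambda>_. B)"

lemma cube_sets [measurable]: "B \<in> sets L \<Longrightarrow> cube B n \<in> sets (power_measure L n)"
  unfolding cube_def by (intro sets_PiM_I_finite) auto

lemma cube_finite: "B \<in> finite_sets L \<Longrightarrow> emeasure (power_measure L n) (cube B n) < \<infinity>"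
  using finite_setsD[of B L] unfolding cube_def
  by (subst LP.emeasure_PiM) (auto simp: power_less_top_ennreal)

text \<open>A tuple has finitely many coordinates, so it lies in the cube over \<open>C k\<close>
  for all large \<open>k\<close>; one sequence of sets exhausts the product spaces of every
  order.\<close>

lemma exhausting:
  obtains C where "\<And>k. C k \<in> finite_sets L" "incseq C" "\<And>n y. y \<in> space (power_measure L n) \<Longrightarrow> \<forall>\<^sub>F k in sequentially. y \<in> cube (C k) n"
proof -
  obtain C where C: "range C \<subseteq> sets L" "(\<Union>i. C i) = space L" "\<And>i. emeasure L (C i) \<noteq> \<infinity>" "incseq C"
    using L.sigma_finite_incseq by metis
  have fin: "C k \<in> finite_sets L" for k using C by (auto simp: finite_sets_def top.not_eq_extremum)
  have ev: "\<forall>\<^sub>F k in sequentially. y \<in> cube (C k) n" if y: "y \<in> space (power_measure L n)" for n y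
  proof -
    have "\<forall>\<^sub>F k in sequentially. y i \<in> C k" if "i < n" for i
    proof -
      have "y i \<in> (\<Union>k. C k)" using y that C(2) by (auto simp: space_PiM)
      then obtain m where "y i \<in> C m" by blast
      then have "y i \<in> C k" if "k \<ge> m" for k using C(4) that by (auto simp: incseq_def)
      then show ?thesis by (auto simp: eventually_sequentially)
    qed
    then have "\<forall>\<^sub>F k in sequentially. \<forall>i\<in>{..<n}. y i \<in> C k" by (intro eventually_ball_finite) auto
    then show ?thesis by eventually_elim (use y in \<open>auto simp: cube_def space_PiM PiE_def\<close>)
  qed
  show ?thesis by (rule that[OF fin C(4) ev])
qed

abbreviation forms_on :: "'a set \<Rightarrow> nat \<Rightarrow> ((nat \<Rightarrow> 'a) \<Rightarrow> real) set" where
  "forms_on B n \<equiv> {sum_product n gs |gs. form_on L B n gs}"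

text \<open>Restricting to the cube makes the product measure finite, so that the induction
  principle applies with rectangles as generator. Intersecting the sides with \<open>B\<close> shows
  that the indicator of a rectangle, cut off to the cube, is itself a product form.\<close>

lemma forms_on_dense:
  assumes n: "n > 0" and B: "B \<in> finite_sets L" and u: "square_integrable (power_measure L n) u"
  shows "(\<lambda>y. u y * indicator (cube B n) y) \<in> L2_closure (power_measure L n) (forms_on B n)"
proof -
  let ?P = "power_measure L n" and ?A = "cube B n"
  let ?N = "density ?P (\<lambda>y. ennreal (indicator ?A y))"
  let ?G = "{Pi\<^sub>E {..<n} E | E. \<forall>i\<in>{..<n}. E i \<in> sets L}"
  have BL: "B \<in> sets L" by (rule finite_setsD[OF B])
  have A [measurable]: "?A \<in> sets ?P" by (rule cube_sets[OF BL])
  have "emeasure ?N (space ?P) = (\<integral>\<^sup>+y. ennreal (indicator ?A y) * indicator (space ?P) y \<partial>?P)"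
    by (rule emeasure_density) (use A in auto)
  also have "\<dots> = (\<integral>\<^sup>+y. indicator ?A y \<partial>?P)"
    by (intro nn_integral_cong) (auto simp: indicator_def)
  finally have "emeasure ?N (space ?N) = emeasure ?P ?A" by simp
  then interpret N: finite_measure ?N
    using cube_finite[OF B, of n] by (intro finite_measureI) auto
  let ?Q = "\<lambda>w. (\<lambda>y. w y * indicator ?A y) \<in> L2_closure ?P (forms_on B n)"
  have rect: "?Q (indicator R)" if RG: "R \<in> ?G" for R
  proof -
    obtain E where R: "R = Pi\<^sub>E {..<n} E" and E: "\<And>i. i < n \<Longrightarrow> E i \<in> sets L" using RG by auto
    let ?g = "\<lambda>i. indicator (E i \<inter> B) :: 'a \<Rightarrow> real"
    have fo: "form_on L B n [?g]" using E BL by (auto simp: form_on_def intro!: factor_on_indicator)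
    have "sum_product n [?g] \<in> L2_closure ?P (forms_on B n)"
      using fo by (intro L2_closure_incl sum_product_square_integrable[OF B]) auto
    then show ?thesis
    proof (rule L2_closure_cong_AE)
      have "R \<in> sets ?P" unfolding R using E by (intro sets_PiM_I_finite) auto
      then show "(\<lambda>y. indicator R y * indicator ?A y :: real) \<in> borel_measurable ?P"
        by (intro borel_measurable_times borel_measurable_indicator A)
      have "indicator R y * indicator ?A y = sum_product n [?g] y" if y: "y \<in> space ?P" for y
      proof (cases "\<forall>i<n. y i \<in> E i \<inter> B")
        case True
        then have "y \<in> R" "y \<in> ?A" using y by (auto simp: R cube_def space_PiM PiE_def)
        then show ?thesis using True by (simp add: sum_product_def tensor_def)
      next
        case False
        then obtain i where i: "i < n" "y i \<notin> E i \<inter> B" by blast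
        then have "tensor {..<n} ?g y = 0" unfolding tensor_def by (intro prod_zero bexI[of _ i]) auto
        moreover have "y \<notin> R \<or> y \<notin> ?A" using i by (auto simp: R cube_def)
        ultimately show ?thesis by (auto simp: sum_product_def)
      qed
      then show "AE y in ?P. indicator R y * indicator ?A y = sum_product n [?g] y" by auto
    qed
  qed
  have "?Q u"
  proof (rule N.L2_induct_generator[where G="?G" and P="?Q"])
    show "Int_stable ?G" using Int_stable_PiE[of "{..<n}" "{..<n}" "\<lambda>_. L"] by simp
    show "?G \<subseteq> Pow (space ?N)" using sets.sets_into_space[of _ L] by (fastforce simp: space_PiM PiE_def Pi_def)
    show "sets ?N = sigma_sets (space ?N) ?G"
      using sets_PiM_rectangles[of "{..<n}" "\<lambda>_. L"] by simp
    show "?Q (indicator R)" if "R \<in> ?G" for R using rect[OF that] .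
    have "space ?P \<in> ?G" by (auto simp: space_PiM)
    then show "?Q (indicator (space ?N))" using rect[of "space ?P"] by simp
    show "?Q (\<lambda>x. v x + w x)" if "?Q v" "?Q w" for v w
    proof -
      have "(\<lambda>y. v y * indicator ?A y + w y * indicator ?A y) \<in> L2_closure ?P (forms_on B n)"
      proof (rule L2_closure_add[OF _ that])
        fix a b assume "a \<in> forms_on B n" "b \<in> forms_on B n"
        then obtain gs hs where "a = sum_product n gs" "b = sum_product n hs" "form_on L B n gs" "form_on L B n hs" by blast
        then have "(\<lambda>x. a x + b x) = sum_product n (gs @ hs)" "form_on L B n (gs @ hs)"
          by (auto simp: sum_product_append form_on_append)
        then show "(\<lambda>x. a x + b x) \<in> forms_on B n" by blast
      qed
      then show ?thesis by (simp add: distrib_right)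
    qed
    show "?Q (\<lambda>x. c * v x)" if "?Q v" for v c
    proof -
      have "(\<lambda>y. c * (v y * indicator ?A y)) \<in> L2_closure ?P (forms_on B n)"
      proof (rule L2_closure_scale[OF _ that])
        fix a assume "a \<in> forms_on B n"
        then obtain gs where "a = sum_product n gs" "form_on L B n gs" by blast
        then have "(\<lambda>x. c * a x) = sum_product n (map (scale_first c) gs)" "form_on L B n (map (scale_first c) gs)"
          using n by (auto simp: sum_product_scale form_on_scale)
        then show "(\<lambda>x. c * a x) \<in> forms_on B n" by blast
      qed
      then show ?thesis by (simp add: mult.assoc)
    qed
    show "?Q v" if "\<And>k. ?Q (w k)" "L2_tendsto ?N w v" for v and w
      by (rule L2_closure_lim[OF that(1) L2_tendsto_density_indicator[OF A that(2)]])
    show "square_integrable ?N u"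
      unfolding square_integrable_density_indicator[OF A]
      using u square_integrable_indicator_mult[OF u A] by (simp add: square_integrable_measurable)
  qed
  then show ?thesis .
qed

text \<open>The cut-offs of \<open>u\<close> to an exhausting sequence of cubes converge in
  \<open>L^2\<close>, dominated by the absolute value of \<open>u\<close>.\<close>

lemma forms_dense:
  assumes n: "n > 0" and u: "square_integrable (power_measure L n) u"
  shows "u \<in> L2_closure (power_measure L n) {sum_product n gs |gs. sum_product_form L n gs}"
proof -
  obtain C where C: "\<And>k. C k \<in> finite_sets L" "\<And>n y. y \<in> space (power_measure L n) \<Longrightarrow> \<forall>\<^sub>F k in sequentially. y \<in> cube (C k) n"
    using exhausting by metis
  show ?thesis
  proof (rule L2_closure_lim)
    fix k
    have "forms_on (C k) n \<subseteq> {sum_product n gs |gs. sum_product_form L n gs}"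
      using form_on_imp[OF _ C(1)] by blast
    then show "(\<lambda>y. u y * indicator (cube (C k) n) y) \<in> L2_closure (power_measure L n) {sum_product n gs |gs. sum_product_form L n gs}"
      using forms_on_dense[OF n C(1) u, of k] L2_closure_mono by blast
  next
    show "L2_tendsto (power_measure L n) (\<lambda>k y. u y * indicator (cube (C k) n) y) u"
    proof (rule L2_tendsto_dominated[where w="\<lambda>y. \<bar>u y\<bar>"])
      show "(\<lambda>y. u y * indicator (cube (C k) n) y) \<in> borel_measurable (power_measure L n)" for k
        using square_integrable_measurable[OF u] finite_setsD(1)[OF C(1), of k] by measurable
      show "square_integrable (power_measure L n) (\<lambda>y. \<bar>u y\<bar>)"
        using u by (auto simp: square_integrable_def)
      show "AE y in power_measure L n. \<bar>u y * indicator (cube (C k) n) y\<bar> \<le> \<bar>u y\<bar>" for k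
        by (auto simp: indicator_def)
      show "AE y in power_measure L n. (\<lambda>k. u y * indicator (cube (C k) n) y) \<longlonglongrightarrow> u y"
      proof (rule AE_I2)
        fix y assume "y \<in> space (power_measure L n)"
        from C(2)[OF this] have "\<forall>\<^sub>F k in sequentially. u y * indicator (cube (C k) n) y = u y"
          by eventually_elim simp
        then show "(\<lambda>k. u y * indicator (cube (C k) n) y) \<longlonglongrightarrow> u y" by (rule tendsto_eventually)
      qed
    qed (use u in \<open>auto simp: square_integrable_measurable\<close>)
  qed
qed

text \<open>The difference \<open>u - v\<close> is a limit of forms orthogonal to it, hence
  orthogonal to itself.\<close>

lemma L2_eqI_forms:
  assumes n: "n > 0" and u: "square_integrable (power_measure L n) u" and v: "square_integrable (power_measure L n) v"
    and eq: "\<And>gs. sum_product_form L n gs \<Longrightarrow>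
      (\<integral>y. sum_product n gs y * u y \<partial>power_measure L n) = (\<integral>y. sum_product n gs y * v y \<partial>power_measure L n)"
  shows "AE y in power_measure L n. u y = v y"
proof -
  let ?P = "power_measure L n" and ?d = "\<lambda>y. u y - v y"
  have d: "square_integrable ?P ?d" using u v by (rule square_integrable_diff)
  obtain h where h: "\<And>k. h k \<in> {sum_product n gs |gs. sum_product_form L n gs}" "L2_tendsto ?P h ?d"
    using forms_dense[OF n d] by (auto simp: L2_closure_def)
  have "(\<integral>y. h k y * ?d y \<partial>?P) = 0" for k
  proof -
    have hs: "square_integrable ?P (h k)" using h(2) by (simp add: L2_tendsto_def)
    have "(\<integral>y. h k y * ?d y \<partial>?P) = (\<integral>y. h k y * u y \<partial>?P) - (\<integral>y. h k y * v y \<partial>?P)"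
      using integrable_mult_square[OF hs u] integrable_mult_square[OF hs v] by (simp add: right_diff_distrib)
    moreover obtain gs where "h k = sum_product n gs" "sum_product_form L n gs" using h(1)[of k] by blast
    ultimately show ?thesis using eq by simp
  qed
  with L2_tendsto_inner[OF h(2) d] have "(\<lambda>k::nat. 0) \<longlonglongrightarrow> (\<integral>y. ?d y * ?d y \<partial>?P)" by simp
  then have "(\<integral>y. ?d y * ?d y \<partial>?P) = 0" by (simp add: LIMSEQ_const_iff)
  then have "L2_norm ?P ?d = 0" by (simp add: L2_norm_def power2_eq_square)
  from L2_norm_eq_0_AE[OF d this] show ?thesis by eventually_elim simp
qed

subsection \<open>Existence and properties of the multiple integrals\<close>

text \<open>It makes the integral Lipschitz with constant \<open>sqrt (n!)\<close>. The square is
  expanded into four scalar products instead of treating the difference as one form, since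
  subtracting forms by means of \<open>scale_first\<close> is possible only in positive
  order.\<close>

lemma sum_compensated_norm:
  assumes B: "B \<in> finite_sets L" and gs: "form_on L B n gs" and hs: "form_on L B n hs"
  shows "(L2_norm M (\<lambda>\<omega>. sum_compensated L n gs (\<eta> \<omega>) - sum_compensated L n hs (\<eta> \<omega>)))\<^sup>2 \<le>
    fact n * (L2_norm (power_measure L n) (\<lambda>y. sum_product n gs y - sum_product n hs y))\<^sup>2"
proof -
  let ?P = "power_measure L n"
  let ?a = "sum_product n gs" and ?b = "sum_product n hs"
  let ?A = "\<lambda>\<omega>. sum_compensated L n gs (\<eta> \<omega>)" and ?B = "\<lambda>\<omega>. sum_compensated L n hs (\<eta> \<omega>)"
  have A: "square_integrable M ?A" and B': "square_integrable M ?B"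
    using sum_compensated_square_integrable[OF B] gs hs by auto
  have a: "square_integrable ?P ?a" and b: "square_integrable ?P ?b"
    using sum_product_square_integrable[OF B] gs hs by auto
  note Sa = L.sym_sum_square_integrable[OF a] and Sb = L.sym_sum_square_integrable[OF b]
  have S: "sym_sum n (\<lambda>y. ?a y - ?b y) y = sym_sum n ?a y - sym_sum n ?b y" for y
    by (simp add: sym_sum_def sum_subtractf)
  have "(L2_norm M (\<lambda>\<omega>. ?A \<omega> - ?B \<omega>))\<^sup>2 = (\<integral>\<omega>. ?A \<omega> * ?A \<omega> - ?A \<omega> * ?B \<omega> - (?B \<omega> * ?A \<omega> - ?B \<omega> * ?B \<omega>) \<partial>M)"
    unfolding L2_norm_square by (intro Bochner_Integration.integral_cong) (auto simp: power2_eq_square algebra_simps)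
  also have "\<dots> = (\<integral>\<omega>. ?A \<omega> * ?A \<omega> \<partial>M) - (\<integral>\<omega>. ?A \<omega> * ?B \<omega> \<partial>M) - ((\<integral>\<omega>. ?B \<omega> * ?A \<omega> \<partial>M) - (\<integral>\<omega>. ?B \<omega> * ?B \<omega> \<partial>M))"
    using integrable_mult_square[OF A A] integrable_mult_square[OF A B'] integrable_mult_square[OF B' A] integrable_mult_square[OF B' B']
    by (simp only: Bochner_Integration.integral_diff Bochner_Integration.integrable_diff)
  also have "\<dots> = (\<integral>y. sym_sum n ?a y * ?a y \<partial>?P) - (\<integral>y. sym_sum n ?a y * ?b y \<partial>?P) -
      ((\<integral>y. sym_sum n ?b y * ?a y \<partial>?P) - (\<integral>y. sym_sum n ?b y * ?b y \<partial>?P))"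
    using gs hs by (simp add: sum_compensated_isometry[OF B])
  also have "\<dots> = (\<integral>y. sym_sum n ?a y * ?a y - sym_sum n ?a y * ?b y - (sym_sum n ?b y * ?a y - sym_sum n ?b y * ?b y) \<partial>?P)"
    using integrable_mult_square[OF Sa a] integrable_mult_square[OF Sa b] integrable_mult_square[OF Sb a] integrable_mult_square[OF Sb b] by simp
  also have "\<dots> = (\<integral>y. sym_sum n (\<lambda>y. ?a y - ?b y) y * (?a y - ?b y) \<partial>?P)"
    by (intro Bochner_Integration.integral_cong) (auto simp: S algebra_simps)
  also have "\<dots> \<le> fact n * L2_norm ?P (\<lambda>y. ?a y - ?b y) * L2_norm ?P (\<lambda>y. ?a y - ?b y)"
    using L.sym_sum_inner_bound[OF square_integrable_diff[OF a b] square_integrable_diff[OF a b]] by linarith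
  finally show ?thesis by (simp add: power2_eq_square mult.assoc)
qed

lemma sum_product_integral_norm:
  assumes gs: "sum_product_form L n gs" and hs: "sum_product_form L n hs"
  shows "L2_norm M (\<lambda>\<omega>. sum_product_integral L \<eta> X n gs \<omega> - sum_product_integral L \<eta> X n hs \<omega>) \<le>
    sqrt (fact n) * L2_norm (power_measure L n) (\<lambda>y. sum_product n gs y - sum_product n hs y)"
proof -
  obtain B1 B2 where "B1 \<in> finite_sets L" "form_on L B1 n gs" "B2 \<in> finite_sets L" "form_on L B2 n hs"
    using sum_product_form_on gs hs by metis
  then have B: "B1 \<union> B2 \<in> finite_sets L" "form_on L (B1 \<union> B2) n gs" "form_on L (B1 \<union> B2) n hs"
    by (auto intro: finite_sets_Un form_on_mono)
  have "L2_norm M (\<lambda>\<omega>. sum_product_integral L \<eta> X n gs \<omega> - sum_product_integral L \<eta> X n hs \<omega>) =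
      L2_norm M (\<lambda>\<omega>. sum_compensated L n gs (\<eta> \<omega>) - sum_compensated L n hs (\<eta> \<omega>))"
  proof (rule L2_norm_cong_AE)
    show "AE \<omega> in M. sum_product_integral L \<eta> X n gs \<omega> - sum_product_integral L \<eta> X n hs \<omega> =
        sum_compensated L n gs (\<eta> \<omega>) - sum_compensated L n hs (\<eta> \<omega>)"
      using sum_product_integral_eq[OF B(1,2)] sum_product_integral_eq[OF B(1,3)] by eventually_elim simp
    show "(\<lambda>\<omega>. sum_product_integral L \<eta> X n gs \<omega> - sum_product_integral L \<eta> X n hs \<omega>) \<in> borel_measurable M"
      using sum_product_integral_square_integrable[OF B(1,2)] sum_product_integral_square_integrable[OF B(1,3)]
      by (auto simp: square_integrable_def)
    show "(\<lambda>\<omega>. sum_compensated L n gs (\<eta> \<omega>) - sum_compensated L n hs (\<eta> \<omega>)) \<in> borel_measurable M"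
      using sum_compensated_square_integrable[OF B(1,2)] sum_compensated_square_integrable[OF B(1,3)]
      by (auto simp: square_integrable_def)
  qed
  also have "\<dots> \<le> sqrt (fact n * (L2_norm (power_measure L n) (\<lambda>y. sum_product n gs y - sum_product n hs y))\<^sup>2)"
    using sum_compensated_norm[OF B] by (intro real_le_rsqrt)
  also have "\<dots> = sqrt (fact n) * L2_norm (power_measure L n) (\<lambda>y. sum_product n gs y - sum_product n hs y)"
    by (simp add: real_sqrt_mult)
  finally show ?thesis .
qed

text \<open>The integrals of an approximating sequence of forms are Cauchy by the Lipschitz bound,
  whose constant is compensated in the choice of \<open>N\<close>; completeness supplies the
  limit.\<close>

lemma wiener_ito_version_exists:
  assumes n: "n > 0" and g: "square_integrable (power_measure L n) g"
  shows "\<exists>Z. wiener_ito_version M L \<eta> X n g Z"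
proof -
  let ?P = "power_measure L n"
  obtain u where u: "\<And>k. u k \<in> {sum_product n gs |gs. sum_product_form L n gs}" "L2_tendsto ?P u g"
    using forms_dense[OF n g] by (auto simp: L2_closure_def)
  then have "\<forall>k. \<exists>gs. u k = sum_product n gs \<and> sum_product_form L n gs" by blast
  then obtain h where h: "\<And>k. u k = sum_product n (h k)" "\<And>k. sum_product_form L n (h k)" by metis
  have "u = (\<lambda>k. sum_product n (h k))" using h(1) by (rule ext)
  with u(2) have u': "L2_tendsto ?P (\<lambda>k. sum_product n (h k)) g" by (simp only:)
  have si: "square_integrable M (sum_product_integral L \<eta> X n (h k))" for k
    using sum_product_form_on[OF h(2)] sum_product_integral_square_integrable by metis
  have sh: "square_integrable ?P (sum_product n (h k))" for k using u' by (simp add: L2_tendsto_def)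
  obtain Z where "L2_tendsto M (\<lambda>k. sum_product_integral L \<eta> X n (h k)) Z"
  proof (rule L2_complete[OF si])
    fix e :: real assume e: "e > 0"
    let ?c = "sqrt (fact n) :: real"
    have c: "?c > 0" by simp
    have "(\<lambda>k. L2_norm ?P (\<lambda>x. sum_product n (h k) x - g x)) \<longlonglongrightarrow> 0" using u' by (simp add: L2_tendsto_iff)
    from LIMSEQ_D[OF this, of "e / (2 * ?c)"] e c
    obtain N where N: "\<And>k. k \<ge> N \<Longrightarrow> L2_norm ?P (\<lambda>x. sum_product n (h k) x - g x) < e / (2 * ?c)" by auto
    show "\<exists>N. \<forall>m\<ge>N. \<forall>l\<ge>N. L2_norm M (\<lambda>\<omega>. sum_product_integral L \<eta> X n (h m) \<omega> - sum_product_integral L \<eta> X n (h l) \<omega>) < e"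
    proof (intro exI[of _ N] allI impI)
      fix m l assume "m \<ge> N" "l \<ge> N"
      have "L2_norm ?P (\<lambda>y. sum_product n (h m) y - sum_product n (h l) y) \<le>
          L2_norm ?P (\<lambda>y. sum_product n (h m) y - g y) + L2_norm ?P (\<lambda>y. g y - sum_product n (h l) y)"
        by (rule L2_norm_triangle_diff[OF sh g sh])
      also have "\<dots> < e / (2 * ?c) + e / (2 * ?c)"
        using N[OF \<open>m \<ge> N\<close>] N[OF \<open>l \<ge> N\<close>] L2_norm_minus_commute[of ?P g "sum_product n (h l)"] by simp
      also have "\<dots> = e / ?c" by simp
      finally have "?c * L2_norm ?P (\<lambda>y. sum_product n (h m) y - sum_product n (h l) y) < e"
        using c by (simp add: field_simps)
      then show "L2_norm M (\<lambda>\<omega>. sum_product_integral L \<eta> X n (h m) \<omega> - sum_product_integral L \<eta> X n (h l) \<omega>) < e"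
        using sum_product_integral_norm[OF h(2)[of m] h(2)[of l]] by linarith
    qed
  qed
  then show ?thesis using h(2) u' unfolding wiener_ito_version_def by blast
qed

lemma sum_product_integral_mean_diff:
  assumes f: "f \<in> borel_measurable (point_algebra L)" "square_integrable M (\<lambda>\<omega>. f (\<eta> \<omega>))"
    and gs: "sum_product_form L n gs"
  shows "(\<integral>\<omega>. sum_product_integral L \<eta> X n gs \<omega> * f (\<eta> \<omega>) \<partial>M) =
    (\<integral>y. sum_product n gs y * mean_diff M \<eta> n f y \<partial>power_measure L n)"
proof -
  obtain B where B: "B \<in> finite_sets L" "form_on L B n gs" using sum_product_form_on[OF gs] .
  have "(\<integral>\<omega>. sum_product_integral L \<eta> X n gs \<omega> * f (\<eta> \<omega>) \<partial>M) = (\<integral>\<omega>. f (\<eta> \<omega>) * sum_compensated L n gs (\<eta> \<omega>) \<partial>M)"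
  proof (rule integral_cong_AE)
    show "AE \<omega> in M. sum_product_integral L \<eta> X n gs \<omega> * f (\<eta> \<omega>) = f (\<eta> \<omega>) * sum_compensated L n gs (\<eta> \<omega>)"
      using sum_product_integral_eq[OF B] by eventually_elim simp
  qed (use f(2) sum_product_integral_square_integrable[OF B] sum_compensated_square_integrable[OF B] in \<open>auto simp: square_integrable_def\<close>)
  also have "\<dots> = (\<integral>y. sum_product n gs y * mean_diff M \<eta> n f y \<partial>power_measure L n)"
    by (rule sum_compensated_mean_diff[OF B(1) moments_finite_square_integrable[OF B(1) f] B(2)])
  finally show ?thesis .
qed

text \<open>Both sides are continuous along the approximating forms: the left in
  \<open>L^2(M)\<close>, the right because \<open>T_n f\<close> is square integrable.\<close>

lemma wiener_ito_version_mean_diff: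
  assumes Z: "wiener_ito_version M L \<eta> X n g Z"
    and f: "f \<in> borel_measurable (point_algebra L)" "square_integrable M (\<lambda>\<omega>. f (\<eta> \<omega>))"
    and T: "square_integrable (power_measure L n) (mean_diff M \<eta> n f)"
  shows "(\<integral>\<omega>. Z \<omega> * f (\<eta> \<omega>) \<partial>M) = (\<integral>y. g y * mean_diff M \<eta> n f y \<partial>power_measure L n)"
proof -
  obtain h where h: "\<And>k. sum_product_form L n (h k)" "L2_tendsto (power_measure L n) (\<lambda>k. sum_product n (h k)) g"
      "L2_tendsto M (\<lambda>k. sum_product_integral L \<eta> X n (h k)) Z"
    using Z unfolding wiener_ito_version_def by blast
  show ?thesis
    using L2_tendsto_inner[OF h(3) f(2)] L2_tendsto_inner[OF h(2) T]
    unfolding sum_product_integral_mean_diff[OF f h(1)] by (rule LIMSEQ_unique)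
qed

lemma sum_product_integral_isometry:
  assumes gs: "sum_product_form L m gs" and hs: "sum_product_form L n hs"
  shows "(\<integral>\<omega>. sum_product_integral L \<eta> X m gs \<omega> * sum_product_integral L \<eta> X n hs \<omega> \<partial>M) =
    (if m = n then \<integral>y. sym_sum n (sum_product n gs) y * sum_product n hs y \<partial>power_measure L n else 0)"
proof -
  obtain B1 B2 where "B1 \<in> finite_sets L" "form_on L B1 m gs" "B2 \<in> finite_sets L" "form_on L B2 n hs"
    using sum_product_form_on gs hs by metis
  then have B: "B1 \<union> B2 \<in> finite_sets L" "form_on L (B1 \<union> B2) m gs" "form_on L (B1 \<union> B2) n hs"
    by (auto intro: finite_sets_Un form_on_mono)
  have "(\<integral>\<omega>. sum_product_integral L \<eta> X m gs \<omega> * sum_product_integral L \<eta> X n hs \<omega> \<partial>M) =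
      (\<integral>\<omega>. sum_compensated L m gs (\<eta> \<omega>) * sum_compensated L n hs (\<eta> \<omega>) \<partial>M)"
  proof (rule integral_cong_AE)
    show "AE \<omega> in M. sum_product_integral L \<eta> X m gs \<omega> * sum_product_integral L \<eta> X n hs \<omega> = sum_compensated L m gs (\<eta> \<omega>) * sum_compensated L n hs (\<eta> \<omega>)"
      using sum_product_integral_eq[OF B(1,2)] sum_product_integral_eq[OF B(1,3)] by eventually_elim simp
  qed (use sum_product_integral_square_integrable[OF B(1,2)] sum_compensated_square_integrable[OF B(1,2)]
      sum_product_integral_square_integrable[OF B(1,3)] sum_compensated_square_integrable[OF B(1,3)] in \<open>auto simp: square_integrable_def\<close>)
  with sum_compensated_isometry[OF B] show ?thesis by simp
qed

text \<open>Rearranging coordinates is an isometry, so symmetrising costs at most the factor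
  \<open>n!\<close> and preserves limits.\<close>

lemma sym_sum_tendsto:
  assumes u: "L2_tendsto (power_measure L n) u g" and v: "square_integrable (power_measure L n) v"
  shows "(\<lambda>k. \<integral>y. sym_sum n (u k) y * v y \<partial>power_measure L n) \<longlonglongrightarrow> (\<integral>y. sym_sum n g y * v y \<partial>power_measure L n)"
proof -
  let ?P = "power_measure L n"
  have si: "square_integrable ?P (u k)" "square_integrable ?P g" for k using u by (auto simp: L2_tendsto_def)
  have "norm ((\<integral>y. sym_sum n (u k) y * v y \<partial>?P) - (\<integral>y. sym_sum n g y * v y \<partial>?P)) \<le> L2_norm ?P (\<lambda>y. u k y - g y) * (fact n * L2_norm ?P v)" for k
  proof -
    have S: "sym_sum n (\<lambda>y. u k y - g y) y = sym_sum n (u k) y - sym_sum n g y" for y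
      by (simp add: sym_sum_def sum_subtractf)
    have "(\<integral>y. sym_sum n (u k) y * v y \<partial>?P) - (\<integral>y. sym_sum n g y * v y \<partial>?P) = (\<integral>y. sym_sum n (\<lambda>y. u k y - g y) y * v y \<partial>?P)"
      using integrable_mult_square[OF L.sym_sum_square_integrable[OF si(1)[of k]] v] integrable_mult_square[OF L.sym_sum_square_integrable[OF si(2)] v]
      by (simp add: S left_diff_distrib)
    then show ?thesis
      using L.sym_sum_inner_bound[OF square_integrable_diff[OF si(1)[of k] si(2)] v] by (simp add: ac_simps)
  qed
  moreover have "(\<lambda>k. L2_norm ?P (\<lambda>y. u k y - g y) * (fact n * L2_norm ?P v)) \<longlonglongrightarrow> 0"
    using u by (intro tendsto_mult_left_zero) (simp add: L2_tendsto_iff)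
  ultimately have "(\<lambda>k. (\<integral>y. sym_sum n (u k) y * v y \<partial>?P) - (\<integral>y. sym_sum n g y * v y \<partial>?P)) \<longlonglongrightarrow> 0"
    by (rule Lim_null_comparison[OF always_eventually[OF allI]])
  then show ?thesis by (simp add: LIM_zero_iff)
qed

text \<open>The isometry is extended to limits one argument at a time; here the second argument is
  still of sum-product form.\<close>

lemma wiener_ito_version_isometry_form:
  assumes Z: "wiener_ito_version M L \<eta> X m g Z" and hs: "sum_product_form L n hs"
  shows "(\<integral>\<omega>. Z \<omega> * sum_product_integral L \<eta> X n hs \<omega> \<partial>M) =
    (if m = n then \<integral>y. sym_sum n g y * sum_product n hs y \<partial>power_measure L n else 0)"
proof -
  obtain h where h: "\<And>k. sum_product_form L m (h k)" "L2_tendsto (power_measure L m) (\<lambda>k. sum_product m (h k)) g"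
      "L2_tendsto M (\<lambda>k. sum_product_integral L \<eta> X m (h k)) Z"
    using Z unfolding wiener_ito_version_def by blast
  obtain B where B: "B \<in> finite_sets L" "form_on L B n hs" using sum_product_form_on[OF hs] .
  note 1 = L2_tendsto_inner[OF h(3) sum_product_integral_square_integrable[OF B], unfolded sum_product_integral_isometry[OF h(1) hs]]
  show ?thesis
  proof (cases "m = n")
    case True
    then have "(\<lambda>k. \<integral>y. sym_sum n (sum_product n (h k)) y * sum_product n hs y \<partial>power_measure L n) \<longlonglongrightarrow> (\<integral>y. sym_sum n g y * sum_product n hs y \<partial>power_measure L n)"
      using h(2) by (intro sym_sum_tendsto sum_product_square_integrable[OF B]) simp
    from LIMSEQ_unique[OF _ this] 1 True show ?thesis by simp
  next
    case False
    then show ?thesis using 1 by (simp add: LIMSEQ_const_iff)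
  qed
qed

lemma wiener_ito_version_isometry:
  assumes Z: "wiener_ito_version M L \<eta> X m g Z" and Y: "wiener_ito_version M L \<eta> X n g' Y"
  shows "(\<integral>\<omega>. Z \<omega> * Y \<omega> \<partial>M) =
    (if m = n then \<integral>y. sym_sum n g y * g' y \<partial>power_measure L n else 0)"
proof -
  obtain h where h: "\<And>k. sum_product_form L n (h k)" "L2_tendsto (power_measure L n) (\<lambda>k. sum_product n (h k)) g'"
      "L2_tendsto M (\<lambda>k. sum_product_integral L \<eta> X n (h k)) Y"
    using Y unfolding wiener_ito_version_def by blast
  have Zs: "square_integrable M Z" and gs: "square_integrable (power_measure L m) g"
    using Z by (auto simp: wiener_ito_version_def L2_tendsto_def)
  have 1: "(\<lambda>k. \<integral>\<omega>. Z \<omega> * sum_product_integral L \<eta> X n (h k) \<omega> \<partial>M) \<longlonglongrightarrow> (\<integral>\<omega>. Z \<omega> * Y \<omega> \<partial>M)"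
    using L2_tendsto_inner[OF h(3) Zs] by (simp add: mult.commute)
  note 1 = 1[unfolded wiener_ito_version_isometry_form[OF Z h(1)]]
  show ?thesis
  proof (cases "m = n")
    case True
    then have "(\<lambda>k. \<integral>y. sym_sum n g y * sum_product n (h k) y \<partial>power_measure L n) \<longlonglongrightarrow> (\<integral>y. sym_sum n g y * g' y \<partial>power_measure L n)"
      using L2_tendsto_inner[OF h(2) L.sym_sum_square_integrable, of g] gs by (simp add: mult.commute)
    from LIMSEQ_unique[OF _ this] 1 True show ?thesis by simp
  next
    case False
    then show ?thesis using 1 by (simp add: LIMSEQ_const_iff)
  qed
qed

lemma wiener_ito_version_mean:
  assumes n: "n > 0" and Z: "wiener_ito_version M L \<eta> X n g Z"
  shows "(\<integral>\<omega>. Z \<omega> \<partial>M) = 0"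
proof -
  have form: "sum_product_form L 0 [g]" for g by (simp add: sum_product_form_def)
  have "{} \<in> finite_sets L" "form_on L {} 0 [g]" for g by (auto simp: finite_sets_def form_on_def)
  \<comment> \<open>A form of order 0 with a single summand is the empty product 1, so a mean
    becomes a scalar product with an integral of order 0.\<close>
  then have AE1: "AE \<omega> in M. sum_product_integral L \<eta> X 0 [\<lambda>_ _. 0] \<omega> = 1"
    using sum_product_integral_eq[of "{}" 0 "[\<lambda>_ _. 0]"] by (simp add: sum_compensated_def)
  have "(\<integral>\<omega>. Z \<omega> \<partial>M) = (\<integral>\<omega>. Z \<omega> * sum_product_integral L \<eta> X 0 [\<lambda>_ _. 0] \<omega> \<partial>M)"
  proof (rule integral_cong_AE)
    have "square_integrable M Z" using Z by (auto simp: wiener_ito_version_def L2_tendsto_def)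
    then show m: "Z \<in> borel_measurable M" by (rule square_integrable_measurable)
    show "(\<lambda>\<omega>. Z \<omega> * sum_product_integral L \<eta> X 0 [\<lambda>_ _. 0] \<omega>) \<in> borel_measurable M"
      using m sum_product_integral_square_integrable[OF \<open>{} \<in> finite_sets L\<close> \<open>form_on L {} 0 [\<lambda>_ _. 0]\<close>]
      by (auto simp: square_integrable_def)
    show "AE \<omega> in M. Z \<omega> = Z \<omega> * sum_product_integral L \<eta> X 0 [\<lambda>_ _. 0] \<omega>"
      using AE1 by eventually_elim simp
  qed
  also have "\<dots> = 0"
    using wiener_ito_version_isometry_form[OF Z form] n by simp
  finally show ?thesis .
qed

end

section \<open>Square integrability of the expected differences\<close>

lemma diff_ops_bounded:
  assumes "\<And>\<mu>. \<mu> \<in> point_measures L \<Longrightarrow> \<bar>f \<mu>\<bar> \<le> c" "\<mu> \<in> point_measures L"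
  shows "\<bar>diff_ops ys f \<mu>\<bar> \<le> 2 ^ length ys * c"
  using assms(2)
proof (induction ys arbitrary: \<mu>)
  case Nil
  then show ?case using assms(1) by simp
next
  case (Cons y ys)
  have "\<bar>diff_ops ys f (add_point \<mu> y)\<bar> \<le> 2 ^ length ys * c" "\<bar>diff_ops ys f \<mu>\<bar> \<le> 2 ^ length ys * c"
    by (rule Cons.IH[OF add_point_in_point_measures[OF Cons.prems]], rule Cons.IH[OF Cons.prems])
  then show ?case by (simp add: diff_op_def)
qed

lemma diff_ops_diff: "diff_ops ys (\<lambda>\<mu>. f \<mu> - h \<mu>) = (\<lambda>\<mu>. diff_ops ys f \<mu> - diff_ops ys h \<mu>)"
  by (induction ys) (auto simp: diff_op_def)

context poisson_points
begin

lemma mean_diff_bounded: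
  assumes f: "f \<in> borel_measurable (point_algebra L)" "\<And>\<mu>. \<mu> \<in> point_measures L \<Longrightarrow> \<bar>f \<mu>\<bar> \<le> c"
    and y: "y \<in> space (power_measure L n)"
  shows "\<bar>mean_diff M \<eta> n f y\<bar> \<le> 2 ^ n * c"
proof -
  have b: "\<bar>iter_diff n f y (\<eta> \<omega>)\<bar> \<le> 2 ^ n * c" if "\<omega> \<in> space M" for \<omega>
    using diff_ops_bounded[OF f(2) eta_point_measure[OF that], where ys="map y [0..<n]"] by (simp add: iter_diff_def)
  have m: "(\<lambda>\<omega>. iter_diff n f y (\<eta> \<omega>)) \<in> borel_measurable M"
    using measurable_compose[OF eta_measurable iter_diff_measurable[OF f(1) y]] .
  have i: "integrable M (\<lambda>\<omega>. iter_diff n f y (\<eta> \<omega>))"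
    using b m by (intro integrable_const_bound[of _ "2 ^ n * c"]) auto
  have "\<bar>mean_diff M \<eta> n f y\<bar> \<le> (\<integral>\<omega>. \<bar>iter_diff n f y (\<eta> \<omega>)\<bar> \<partial>M)"
    unfolding mean_diff_def by (rule integral_abs_bound)
  also have "\<dots> \<le> (\<integral>\<omega>. 2 ^ n * c \<partial>M)"
    using i b by (intro integral_mono) auto
  finally show ?thesis by (simp add: prob_space)
qed

text \<open>Duality: paired with a form \<open>h\<close> on \<open>B\<close>, \<open>T_n f\<close>
  gives \<open>E f(\<eta>) I_n(h)\<close>, which is at most the norm of \<open>f(\<eta>)\<close>
  times \<open>sqrt (n!)\<close> times the norm of \<open>h\<close>. Letting \<open>h\<close>
  approach the cut-off \<open>T_n f\<close> yields the bound. Boundedness of \<open>f\<close> makes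
  this cut-off square integrable beforehand, so the argument is not circular.\<close>

lemma mean_diff_cube_norm_bounded:
  assumes n: "n > 0" and B: "B \<in> finite_sets L"
    and f: "f \<in> borel_measurable (point_algebra L)" "\<And>\<mu>. \<mu> \<in> point_measures L \<Longrightarrow> \<bar>f \<mu>\<bar> \<le> c"
  shows "(\<integral>\<^sup>+y. ennreal ((mean_diff M \<eta> n f y * indicator (cube B n) y)\<^sup>2) \<partial>power_measure L n)
    \<le> ennreal (fact n * (L2_norm M (\<lambda>\<omega>. f (\<eta> \<omega>)))\<^sup>2)"
proof -
  let ?P = "power_measure L n" and ?T = "mean_diff M \<eta> n f"
  let ?u = "\<lambda>y. ?T y * indicator (cube B n) y"
  have BL: "B \<in> sets L" by (rule finite_setsD[OF B])
  have fs: "square_integrable M (\<lambda>\<omega>. f (\<eta> \<omega>))"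
    using f eta_point_measure by (intro square_integrable_bounded[of _ c]) auto
  note Tm = mean_diff_measurable[OF f(1), of n]
  have cube_si: "square_integrable ?P (\<lambda>y. 2 ^ n * c * indicator (cube B n) y)"
  proof -
    have "(\<lambda>y. (2 ^ n * c * indicator (cube B n) y)\<^sup>2) = (\<lambda>y. (2 ^ n * c)\<^sup>2 * indicator (cube B n) y)"
      by (auto simp: indicator_def)
    moreover have "integrable ?P (\<lambda>y. (2 ^ n * c)\<^sup>2 * indicator (cube B n) y)"
      using cube_finite[OF B, of n] cube_sets[OF BL, of n] by (intro integrable_mult_right integrable_real_indicator)
    ultimately show ?thesis using cube_sets[OF BL, of n] by (auto simp: square_integrable_def)
  qed
  have u: "square_integrable ?P ?u"
  proof (rule square_integrable_bound[OF cube_si])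
    show "?u \<in> borel_measurable ?P" using Tm cube_sets[OF BL, of n] by measurable
    show "AE y in ?P. \<bar>?u y\<bar> \<le> \<bar>2 ^ n * c * indicator (cube B n) y\<bar>"
    proof (rule AE_I2)
      fix y assume "y \<in> space ?P"
      from mean_diff_bounded[OF f this] show "\<bar>?u y\<bar> \<le> \<bar>2 ^ n * c * indicator (cube B n) y\<bar>"
        by (auto simp: indicator_def)
    qed
  qed
  have "(\<lambda>y. ?u y * indicator (cube B n) y) \<in> L2_closure ?P (forms_on B n)"
    by (rule forms_on_dense[OF n B u])
  then have "?u \<in> L2_closure ?P (forms_on B n)" by (simp add: indicator_inter_arith[symmetric] mult.assoc)
  then obtain h where h: "\<And>k. h k \<in> forms_on B n" "L2_tendsto ?P h ?u" by (auto simp: L2_closure_def)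
  have le: "(\<integral>y. h k y * ?u y \<partial>?P) \<le> L2_norm M (\<lambda>\<omega>. f (\<eta> \<omega>)) * (sqrt (fact n) * L2_norm ?P (h k))" for k
  proof -
    obtain gs where gs: "h k = sum_product n gs" "form_on L B n gs" using h(1)[of k] by blast
    have si: "square_integrable M (\<lambda>\<omega>. sum_compensated L n gs (\<eta> \<omega>))"
      by (rule sum_compensated_square_integrable[OF B gs(2)])
    \<comment> \<open>Forms on \<open>B\<close> vanish outside the cube, so the pairing does not
      notice the cut-off.\<close>
    have z: "sum_product n gs y = sum_product n gs y * indicator (cube B n) y" if y: "y \<in> space ?P" for y
    proof (cases "y \<in> cube B n")
      case False
      then obtain i where i: "i < n" "y i \<notin> B" using y by (auto simp: cube_def space_PiM PiE_def)
      have "tensor {..<n} g y = 0" if "g \<in> set gs" for g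
      proof -
        have "y i \<in> space L - B" using y i by (auto simp: space_PiM)
        then have "g i (y i) = 0" using gs(2) that i(1) by (auto simp: form_on_def factor_on_def)
        then show ?thesis unfolding tensor_def using i(1) by (intro prod_zero bexI[of _ i]) auto
      qed
      then have "sum_product n gs y = (\<Sum>g\<leftarrow>gs. 0)"
        unfolding sum_product_def by (intro arg_cong[where f=sum_list] map_cong) auto
      then show ?thesis by simp
    qed simp
    have "(\<integral>y. h k y * ?u y \<partial>?P) = (\<integral>y. sum_product n gs y * ?T y \<partial>?P)"
      unfolding gs(1) using z by (intro Bochner_Integration.integral_cong refl) (metis mult.assoc mult.commute)
    also have "\<dots> = (\<integral>\<omega>. f (\<eta> \<omega>) * sum_compensated L n gs (\<eta> \<omega>) \<partial>M)"
      by (rule sum_compensated_mean_diff[OF B moments_finite_square_integrable[OF B f(1) fs] gs(2), symmetric])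
    also have "\<dots> \<le> L2_norm M (\<lambda>\<omega>. f (\<eta> \<omega>)) * L2_norm M (\<lambda>\<omega>. sum_compensated L n gs (\<eta> \<omega>))"
      using L2_Cauchy_Schwarz[OF fs si] by linarith
    also have "\<dots> \<le> L2_norm M (\<lambda>\<omega>. f (\<eta> \<omega>)) * (sqrt (fact n) * L2_norm ?P (h k))"
    proof (rule mult_left_mono)
      have "form_on L B n []" by (simp add: form_on_def)
      from sum_compensated_norm[OF B gs(2) this]
      have "(L2_norm M (\<lambda>\<omega>. sum_compensated L n gs (\<eta> \<omega>)))\<^sup>2 \<le> fact n * (L2_norm ?P (h k))\<^sup>2"
        by (simp add: sum_compensated_def[of _ _ "[]"] sum_product_def[of _ "[]"] gs(1))
      then have "L2_norm M (\<lambda>\<omega>. sum_compensated L n gs (\<eta> \<omega>)) \<le> sqrt (fact n * (L2_norm ?P (h k))\<^sup>2)"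
        by (rule real_le_rsqrt)
      then show "L2_norm M (\<lambda>\<omega>. sum_compensated L n gs (\<eta> \<omega>)) \<le> sqrt (fact n) * L2_norm ?P (h k)"
        by (simp add: real_sqrt_mult)
    qed simp
    finally show ?thesis .
  qed
  have "(\<integral>y. ?u y * ?u y \<partial>?P) \<le> L2_norm M (\<lambda>\<omega>. f (\<eta> \<omega>)) * (sqrt (fact n) * L2_norm ?P ?u)"
  proof (rule LIMSEQ_le)
    show "(\<lambda>k. \<integral>y. h k y * ?u y \<partial>?P) \<longlonglongrightarrow> (\<integral>y. ?u y * ?u y \<partial>?P)" by (rule L2_tendsto_inner[OF h(2) u])
    show "(\<lambda>k. L2_norm M (\<lambda>\<omega>. f (\<eta> \<omega>)) * (sqrt (fact n) * L2_norm ?P (h k))) \<longlonglongrightarrow>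
        L2_norm M (\<lambda>\<omega>. f (\<eta> \<omega>)) * (sqrt (fact n) * L2_norm ?P ?u)"
      by (intro tendsto_intros L2_tendsto_norm h(2))
  qed (use le in blast)
  moreover have "(\<integral>y. ?u y * ?u y \<partial>?P) = (L2_norm ?P ?u)\<^sup>2"
    unfolding L2_norm_square by (simp only: power2_eq_square)
  ultimately have "(L2_norm ?P ?u)\<^sup>2 \<le> (L2_norm M (\<lambda>\<omega>. f (\<eta> \<omega>)) * sqrt (fact n)) * L2_norm ?P ?u"
    by (simp only: mult.assoc)
  \<comment> \<open>Cancels one factor of the norm when it is not 0; otherwise the inequality is
    trivial.\<close>
  then have "L2_norm ?P ?u \<le> L2_norm M (\<lambda>\<omega>. f (\<eta> \<omega>)) * sqrt (fact n)"
    using L2_norm_nonneg[of ?P ?u] by (cases "L2_norm ?P ?u = 0") (auto simp: power2_eq_square)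
  then have "(L2_norm ?P ?u)\<^sup>2 \<le> (L2_norm M (\<lambda>\<omega>. f (\<eta> \<omega>)) * sqrt (fact n))\<^sup>2"
    by (intro power_mono) auto
  also have "\<dots> = fact n * (L2_norm M (\<lambda>\<omega>. f (\<eta> \<omega>)))\<^sup>2" by (simp add: power_mult_distrib)
  finally have "ennreal (\<integral>y. (?u y)\<^sup>2 \<partial>?P) \<le> ennreal (fact n * (L2_norm M (\<lambda>\<omega>. f (\<eta> \<omega>)))\<^sup>2)"
    unfolding L2_norm_square[of ?P] by (rule ennreal_leI)
  then show ?thesis
    using u by (subst nn_integral_eq_integral) (auto simp: square_integrable_def)
qed

text \<open>The truncation acts on \<open>f\<close> as a function of all configurations, since
  differences evaluate it at \<open>\<eta> + \<delta>_y\<close> as well as at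
  \<open>\<eta>\<close>.\<close>

definition truncation :: "nat \<Rightarrow> ('a measure \<Rightarrow> real) \<Rightarrow> 'a measure \<Rightarrow> real" where
  "truncation k f \<mu> = max (- real k) (min (real k) (f \<mu>))"

lemma truncation_props:
  "\<bar>truncation k f \<mu>\<bar> \<le> real k" "\<bar>truncation k f \<mu>\<bar> \<le> \<bar>f \<mu>\<bar>" "\<bar>f \<mu> - truncation k f \<mu>\<bar> \<le> \<bar>f \<mu>\<bar>"
  "real k \<ge> \<bar>f \<mu>\<bar> \<Longrightarrow> truncation k f \<mu> = f \<mu>"
  unfolding truncation_def by auto

lemma truncation_measurable:
  "f \<in> borel_measurable (point_algebra L) \<Longrightarrow> truncation k f \<in> borel_measurable (point_algebra L)"
  unfolding truncation_def[abs_def] by (intro borel_measurable_max borel_measurable_min borel_measurable_const)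

lemma weighted_norm_truncation:
  assumes B: "B \<in> finite_sets L" and f: "moments_finite B f"
  shows "(\<lambda>k. weighted_norm B m (\<lambda>\<mu>. f \<mu> - truncation k f \<mu>)) \<longlonglongrightarrow> 0"
proof -
  have BL [measurable]: "B \<in> sets L" by (rule finite_setsD[OF B])
  have fm [measurable]: "f \<in> borel_measurable (point_algebra L)" using f by (simp add: moments_finite_def)
  have [measurable]: "truncation k f \<in> borel_measurable (point_algebra L)" for k by (rule truncation_measurable[OF fm])
  have "(\<lambda>k. \<integral>\<^sup>+\<omega>. ennreal (\<bar>f (\<eta> \<omega>) - truncation k f (\<eta> \<omega>)\<bar> * (1 + measure (\<eta> \<omega>) B) ^ m) \<partial>M) \<longlonglongrightarrow> (\<integral>\<^sup>+\<omega>. 0 \<partial>M)"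
  proof (rule nn_integral_dominated_convergence[where w="\<lambda>\<omega>. ennreal (\<bar>f (\<eta> \<omega>)\<bar> * (1 + measure (\<eta> \<omega>) B) ^ m)"])
    show "AE \<omega> in M. ennreal (\<bar>f (\<eta> \<omega>) - truncation k f (\<eta> \<omega>)\<bar> * (1 + measure (\<eta> \<omega>) B) ^ m) \<le> ennreal (\<bar>f (\<eta> \<omega>)\<bar> * (1 + measure (\<eta> \<omega>) B) ^ m)" for k
      by (intro AE_I2 ennreal_leI mult_right_mono truncation_props) auto
    show "(\<integral>\<^sup>+\<omega>. ennreal (\<bar>f (\<eta> \<omega>)\<bar> * (1 + measure (\<eta> \<omega>) B) ^ m) \<partial>M) < \<infinity>"
      using f by (simp add: moments_finite_def weighted_norm_def)
    show "AE \<omega> in M. (\<lambda>k. ennreal (\<bar>f (\<eta> \<omega>) - truncation k f (\<eta> \<omega>)\<bar> * (1 + measure (\<eta> \<omega>) B) ^ m)) \<longlonglongrightarrow> 0"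
    proof (rule AE_I2, rule tendsto_eventually)
      fix \<omega>
      obtain N :: nat where "\<bar>f (\<eta> \<omega>)\<bar> \<le> real N" using real_arch_simple by blast
      then have "truncation k f (\<eta> \<omega>) = f (\<eta> \<omega>)" if "k \<ge> N" for k using that by (intro truncation_props(4)) simp
      then show "\<forall>\<^sub>F k in sequentially. ennreal (\<bar>f (\<eta> \<omega>) - truncation k f (\<eta> \<omega>)\<bar> * (1 + measure (\<eta> \<omega>) B) ^ m) = 0"
        by (intro eventually_sequentiallyI[of N]) simp
    qed
  qed measurable
  then show ?thesis by (simp add: weighted_norm_def)
qed

text \<open>\<open>T_n\<close> is additive where both expectations exist, which is guaranteed only
  almost everywhere on the cube.\<close>

lemma mean_diff_diff_bound:
  assumes B: "B \<in> finite_sets L" and f: "moments_finite B f" and h: "moments_finite B h"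
  shows "AE y in power_measure L n. ennreal \<bar>(mean_diff M \<eta> n f y - mean_diff M \<eta> n h y) * indicator (cube B n) y\<bar> \<le>
    weighted_norm B 0 (iter_diff n (\<lambda>\<mu>. f \<mu> - h \<mu>) y) * (\<Prod>i<n. indicator B (y i))"
  using AE_integrable_iter_diff[OF B f, of n] AE_integrable_iter_diff[OF B h, of n] AE_space
proof eventually_elim
  case (elim y)
  show ?case
  proof (cases "y \<in> cube B n")
    case True
    then have "\<forall>i<n. y i \<in> B" by (auto simp: cube_def)
    then have i: "integrable M (\<lambda>\<omega>. iter_diff n f y (\<eta> \<omega>))" "integrable M (\<lambda>\<omega>. iter_diff n h y (\<eta> \<omega>))" and one: "(\<Prod>i<n. indicator B (y i)) = (1::ennreal)"
      using elim by auto
    have "mean_diff M \<eta> n f y - mean_diff M \<eta> n h y = (\<integral>\<omega>. iter_diff n (\<lambda>\<mu>. f \<mu> - h \<mu>) y (\<eta> \<omega>) \<partial>M)"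
      unfolding mean_diff_def using i by (simp add: iter_diff_def diff_ops_diff)
    moreover have "integrable M (\<lambda>\<omega>. iter_diff n (\<lambda>\<mu>. f \<mu> - h \<mu>) y (\<eta> \<omega>))"
      using i by (simp add: iter_diff_def diff_ops_diff)
    ultimately show ?thesis
      using integral_norm_bound_ennreal[of M "\<lambda>\<omega>. iter_diff n (\<lambda>\<mu>. f \<mu> - h \<mu>) y (\<eta> \<omega>)"] True one
      by (simp add: weighted_norm_0)
  qed simp
qed

text \<open>On the cube, \<open>T_n\<close> of the truncations converges to \<open>T_n f\<close> in
  \<open>L^1\<close>, because the weighted norms of the errors tend to 0; hence a subsequence
  converges almost everywhere. Fatou's lemma transfers the bound, which is uniform in the level
  because truncation does not increase the norm.\<close>

lemma mean_diff_cube_norm: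
  assumes n: "n > 0" and B: "B \<in> finite_sets L"
    and f: "f \<in> borel_measurable (point_algebra L)" "square_integrable M (\<lambda>\<omega>. f (\<eta> \<omega>))"
  shows "(\<integral>\<^sup>+y. ennreal ((mean_diff M \<eta> n f y * indicator (cube B n) y)\<^sup>2) \<partial>power_measure L n)
    \<le> ennreal (fact n * (L2_norm M (\<lambda>\<omega>. f (\<eta> \<omega>)))\<^sup>2)"
proof -
  let ?P = "power_measure L n" and ?K = "ennreal (fact n * (L2_norm M (\<lambda>\<omega>. f (\<eta> \<omega>)))\<^sup>2)"
  let ?T = "mean_diff M \<eta> n"
  have BL [measurable]: "B \<in> sets L" by (rule finite_setsD[OF B])
  note [measurable] = f(1) truncation_measurable[OF f(1)]
  have tm: "truncation k f \<in> borel_measurable (point_algebra L)" for k by measurable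
  have ts: "square_integrable M (\<lambda>\<omega>. truncation k f (\<eta> \<omega>))" for k
    by (rule square_integrable_bound[OF f(2)]) (use truncation_props in auto)
  have mf: "moments_finite B f" and mt: "moments_finite B (truncation k f)" for k
    using f ts tm by (auto intro: moments_finite_square_integrable[OF B])
  note [measurable] = mean_diff_measurable[OF f(1), of n] mean_diff_measurable[OF tm, of n]
  let ?d = "\<lambda>k y. (?T f y - ?T (truncation k f) y) * indicator (cube B n) y"
  have bound: "(\<integral>\<^sup>+y. ennreal \<bar>?d k y\<bar> \<partial>?P) \<le> (1 + emeasure L B) ^ n * weighted_norm B n (\<lambda>\<mu>. f \<mu> - truncation k f \<mu>)" for k
  proof -
    have "(\<integral>\<^sup>+y. ennreal \<bar>?d k y\<bar> \<partial>?P) \<le>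
        (\<integral>\<^sup>+y. weighted_norm B 0 (iter_diff n (\<lambda>\<mu>. f \<mu> - truncation k f \<mu>) y) * (\<Prod>i<n. indicator B (y i)) \<partial>?P)"
      by (rule nn_integral_mono_AE[OF mean_diff_diff_bound[OF B mf mt]])
    also have "\<dots> \<le> (1 + emeasure L B) ^ n * weighted_norm B (0 + n) (\<lambda>\<mu>. f \<mu> - truncation k f \<mu>)"
      by (rule weighted_norm_iter_diff[OF B]) measurable
    finally show ?thesis by simp
  qed
  have lim0: "(\<lambda>k. \<integral>\<^sup>+y. ennreal \<bar>?d k y\<bar> \<partial>?P) \<longlonglongrightarrow> 0"
  proof (rule tendsto_sandwich[OF _ _ tendsto_const])
    have "(\<lambda>k. (1 + emeasure L B) ^ n * weighted_norm B n (\<lambda>\<mu>. f \<mu> - truncation k f \<mu>)) \<longlonglongrightarrow> (1 + emeasure L B) ^ n * 0"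
      using finite_setsD(2)[OF B] by (intro tendsto_mult_ennreal tendsto_const weighted_norm_truncation[OF B mf])
        (auto simp: power_eq_top_ennreal)
    then show "(\<lambda>k. (1 + emeasure L B) ^ n * weighted_norm B n (\<lambda>\<mu>. f \<mu> - truncation k f \<mu>)) \<longlonglongrightarrow> 0" by simp
  qed (use bound in auto)
  have wfin: "weighted_norm B n (\<lambda>\<mu>. f \<mu> - truncation k f \<mu>) < \<infinity>" for k
  proof -
    have "moments_finite B (\<lambda>\<mu>. f \<mu> - truncation k f \<mu>)"
      using f(2) ts by (intro moments_finite_square_integrable[OF B] square_integrable_diff) auto
    then show ?thesis by (simp add: moments_finite_def)
  qed
  have fin: "(\<integral>\<^sup>+y. ennreal \<bar>?d k y\<bar> \<partial>?P) < \<infinity>" for k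
    using bound[of k] wfin[of k] finite_setsD(2)[OF B]
    by (auto simp: ennreal_mult_less_top power_less_top_ennreal intro: le_less_trans)
  have dm [measurable]: "?d k \<in> borel_measurable ?P" for k by measurable
  have int: "integrable ?P (?d k)" for k
    using fin by (intro integrableI_bounded) auto
  have "(\<lambda>k. \<integral>y. norm (?d k y) \<partial>?P) \<longlonglongrightarrow> 0"
  proof -
    have "(\<integral>y. norm (?d k y) \<partial>?P) = enn2real (\<integral>\<^sup>+y. ennreal \<bar>?d k y\<bar> \<partial>?P)" for k
      by (subst integral_eq_nn_integral) auto
    moreover have "(\<lambda>k. enn2real (\<integral>\<^sup>+y. ennreal \<bar>?d k y\<bar> \<partial>?P)) \<longlonglongrightarrow> 0"
      using lim0 by (intro tendsto_enn2real) simp_all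
    ultimately show ?thesis by simp
  qed
  from tendsto_L1_AE_subseq[OF int this]
  obtain r where r: "strict_mono r" "AE y in ?P. (\<lambda>k. ?d (r k) y) \<longlonglongrightarrow> 0" by auto
  have "(\<integral>\<^sup>+y. ennreal ((?T f y * indicator (cube B n) y)\<^sup>2) \<partial>?P) =
      (\<integral>\<^sup>+y. liminf (\<lambda>k. ennreal ((?T (truncation (r k) f) y * indicator (cube B n) y)\<^sup>2)) \<partial>?P)"
  proof (rule nn_integral_cong_AE, use r(2) in eventually_elim)
    case (elim y)
    have "(\<lambda>k. ?T f y * indicator (cube B n) y - ?d (r k) y) \<longlonglongrightarrow> ?T f y * indicator (cube B n) y - 0"
      by (intro tendsto_intros elim)
    then have "(\<lambda>k. ?T (truncation (r k) f) y * indicator (cube B n) y) \<longlonglongrightarrow> ?T f y * indicator (cube B n) y"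
      by (simp add: left_diff_distrib)
    then have "(\<lambda>k. ennreal ((?T (truncation (r k) f) y * indicator (cube B n) y)\<^sup>2)) \<longlonglongrightarrow> ennreal ((?T f y * indicator (cube B n) y)\<^sup>2)"
      by (intro tendsto_ennrealI tendsto_power)
    from lim_imp_Liminf[OF sequentially_bot this] show ?case by (rule sym)
  qed
  also have "\<dots> \<le> liminf (\<lambda>k. \<integral>\<^sup>+y. ennreal ((?T (truncation (r k) f) y * indicator (cube B n) y)\<^sup>2) \<partial>?P)"
    by (rule nn_integral_liminf) measurable
  also have "\<dots> \<le> ?K"
  proof (rule Liminf_le)
    have "(\<integral>\<^sup>+y. ennreal ((?T (truncation k f) y * indicator (cube B n) y)\<^sup>2) \<partial>?P) \<le> ?K" for k
    proof -
      have "(\<integral>\<^sup>+y. ennreal ((?T (truncation k f) y * indicator (cube B n) y)\<^sup>2) \<partial>?P) \<le>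
          ennreal (fact n * (L2_norm M (\<lambda>\<omega>. truncation k f (\<eta> \<omega>)))\<^sup>2)"
        by (rule mean_diff_cube_norm_bounded[OF n B tm truncation_props(1)])
      also have "\<dots> \<le> ?K"
      proof (intro ennreal_leI mult_left_mono)
        show "(L2_norm M (\<lambda>\<omega>. truncation k f (\<eta> \<omega>)))\<^sup>2 \<le> (L2_norm M (\<lambda>\<omega>. f (\<eta> \<omega>)))\<^sup>2"
          unfolding L2_norm_square using f(2) ts[of k]
          by (intro integral_mono) (auto simp: square_integrable_def abs_le_square_iff[symmetric] truncation_props)
      qed simp
      finally show ?thesis .
    qed
    then show "\<forall>\<^sub>F k in sequentially. (\<integral>\<^sup>+y. ennreal ((?T (truncation (r k) f) y * indicator (cube B n) y)\<^sup>2) \<partial>?P) \<le> ?K"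
      by simp
  qed simp
  finally show ?thesis .
qed

text \<open>The bound on a cube depends on \<open>f\<close> and \<open>n\<close> only, so Fatou's
  lemma along exhausting cubes gives it on the whole space. The expectation is defined on each cube
  outside a null set, and countably many cubes suffice.\<close>

theorem mean_diff_square_integrable:
  assumes n: "n > 0" and f: "f \<in> borel_measurable (point_algebra L)" "square_integrable M (\<lambda>\<omega>. f (\<eta> \<omega>))"
  shows "square_integrable (power_measure L n) (mean_diff M \<eta> n f)"
    "AE y in power_measure L n. integrable M (\<lambda>\<omega>. iter_diff n f y (\<eta> \<omega>))"
proof -
  let ?P = "power_measure L n" and ?T = "mean_diff M \<eta> n f"
  let ?K = "ennreal (fact n * (L2_norm M (\<lambda>\<omega>. f (\<eta> \<omega>)))\<^sup>2)"
  obtain C where C: "\<And>k. C k \<in> finite_sets L" "\<And>n y. y \<in> space (power_measure L n) \<Longrightarrow> \<forall>\<^sub>F k in sequentially. y \<in> cube (C k) n"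
    using exhausting by metis
  note [measurable] = mean_diff_measurable[OF f(1), of n] finite_setsD(1)[OF C(1)]
  have "(\<integral>\<^sup>+y. ennreal ((?T y)\<^sup>2) \<partial>?P) = (\<integral>\<^sup>+y. liminf (\<lambda>k. ennreal ((?T y * indicator (cube (C k) n) y)\<^sup>2)) \<partial>?P)"
  proof (rule nn_integral_cong)
    fix y assume "y \<in> space ?P"
    from C(2)[OF this] have "\<forall>\<^sub>F k in sequentially. ennreal ((?T y * indicator (cube (C k) n) y)\<^sup>2) = ennreal ((?T y)\<^sup>2)"
      by eventually_elim simp
    from lim_imp_Liminf[OF sequentially_bot tendsto_eventually[OF this]]
    show "ennreal ((?T y)\<^sup>2) = liminf (\<lambda>k. ennreal ((?T y * indicator (cube (C k) n) y)\<^sup>2))" by (rule sym)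
  qed
  also have "\<dots> \<le> liminf (\<lambda>k. \<integral>\<^sup>+y. ennreal ((?T y * indicator (cube (C k) n) y)\<^sup>2) \<partial>?P)"
    by (rule nn_integral_liminf) measurable
  also have "\<dots> \<le> ?K"
    using mean_diff_cube_norm[OF n C(1) f] by (intro Liminf_le) auto
  finally have "(\<integral>\<^sup>+y. ennreal ((?T y)\<^sup>2) \<partial>?P) < \<infinity>" by (auto intro: le_less_trans)
  then show "square_integrable ?P ?T" by (simp add: square_integrable_def integrableI_nonneg)
  have "AE y in ?P. \<forall>k. (\<forall>i<n. y i \<in> C k) \<longrightarrow> integrable M (\<lambda>\<omega>. iter_diff n f y (\<eta> \<omega>))"
    using AE_integrable_iter_diff[OF C(1) moments_finite_square_integrable[OF C(1) f]]
    by (subst AE_all_countable) blast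
  then show "AE y in ?P. integrable M (\<lambda>\<omega>. iter_diff n f y (\<eta> \<omega>))"
    using AE_space
  proof eventually_elim
    case (elim y)
    from C(2)[OF elim(2)] obtain k where "y \<in> cube (C k) n" by (auto simp: eventually_sequentially)
    then have "\<forall>i<n. y i \<in> C k" by (auto simp: cube_def)
    then show ?case using elim(1) by blast
  qed
qed

end

section \<open>Totality of the chaos\<close>

text \<open>For natural \<open>x\<close>, a partial sum of the inclusion-exclusion formula for the
  indicator of \<open>x = k\<close>. The generalised binomial coefficient makes it a polynomial in a
  real variable, hence applicable to an integral.\<close>

definition truncated_atom :: "nat \<Rightarrow> nat \<Rightarrow> real \<Rightarrow> real" where
  "truncated_atom n k x = (\<Sum>m\<in>{k..n}. (- 1) ^ (m - k) * real (m choose k) * (x gchoose m))"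

lemma truncated_atom_of_nat:
  assumes "N \<le> n"
  shows "truncated_atom n k (real N) = (if N = k then 1 else 0)"
proof -
  have "truncated_atom n k (real N) = (\<Sum>m\<in>{k..n}. (- 1) ^ (m - k) * real (m choose k) * real (N choose m))"
    by (simp add: truncated_atom_def binomial_gbinomial)
  also have "\<dots> = (\<Sum>m\<in>{k..N}. (- 1) ^ (m - k) * real (m choose k) * real (N choose m))"
    using assms by (intro sum.mono_neutral_right) (auto simp: not_le)
  also have "\<dots> = (if N = k then 1 else 0)"
  proof (cases "k \<le> N")
    case True
    have "(\<Sum>m\<in>{k..N}. (- 1) ^ (m - k) * real (m choose k) * real (N choose m)) =
        (\<Sum>m\<in>{k..N}. real (N choose k) * ((- 1) ^ (m - k) * real ((N - k) choose (m - k))))"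
    proof (rule sum.cong[OF refl])
      fix m assume "m \<in> {k..N}"
      \<comment> \<open>This exchange of binomial coefficients leaves an alternating sum over a row
        of Pascal's triangle, which is 0 unless the row has a single entry, that is, unless
        \<open>N = k\<close>.\<close>
      then have "real (N choose m) * real (m choose k) = real (N choose k) * real ((N - k) choose (m - k))"
        using choose_mult[of k m N] by (simp flip: of_nat_mult)
      then show "(- 1) ^ (m - k) * real (m choose k) * real (N choose m) = real (N choose k) * ((- 1) ^ (m - k) * real ((N - k) choose (m - k)))"
        by (simp add: ac_simps)
    qed
    also have "\<dots> = real (N choose k) * (\<Sum>j\<le>N - k. (- 1) ^ j * real ((N - k) choose j))"
      unfolding sum_distrib_left[symmetric]
      by (intro arg_cong2[where f="(*)"] refl sum.reindex_bij_witness[where i="\<lambda>j. j + k" and j="\<lambda>m. m - k"]) (use True in auto)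
    also have "(\<Sum>j\<le>N - k. (- 1) ^ j * real ((N - k) choose j)) = (if N = k then 1 else 0)"
      using choose_alternating_sum[of "N - k", where ?'a=real] True by auto
    finally show ?thesis by simp
  qed simp
  finally show ?thesis .
qed

text \<open>\<open>m choose k\<close> is at most \<open>2^m\<close>, and the sum of
  \<open>2^m\<close> times \<open>N choose m\<close> is \<open>(2 + 1)^N\<close>. The majorant does
  not depend on \<open>n\<close>, as dominated convergence requires.\<close>

lemma truncated_atom_bound: "\<bar>truncated_atom n k (real N)\<bar> \<le> 3 ^ N"
proof -
  have "\<bar>truncated_atom n k (real N)\<bar> = \<bar>\<Sum>m\<in>{k..n}. (- 1) ^ (m - k) * real (m choose k) * real (N choose m)\<bar>"
    by (simp add: truncated_atom_def binomial_gbinomial)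
  also have "\<dots> \<le> (\<Sum>m\<in>{k..n}. real (m choose k) * real (N choose m))"
    by (rule order_trans[OF sum_abs]) (simp add: abs_mult power_abs)
  also have "\<dots> \<le> (\<Sum>m\<in>{k..n}. 2 ^ m * real (N choose m))"
  proof (intro sum_mono mult_right_mono)
    show "real (m choose k) \<le> 2 ^ m" for m
      using binomial_le_pow2[of m k] by (metis of_nat_le_iff of_nat_numeral of_nat_power)
  qed simp
  also have "\<dots> \<le> (\<Sum>m\<in>{..N}. 2 ^ m * real (N choose m))"
  \<comment> \<open>The range is enlarged to contain both \<open>{k..n}\<close> and
    \<open>{..N}\<close>; the terms beyond \<open>N\<close> vanish.\<close>
  proof (rule sum_mono2[of "{..n + N}", THEN order_trans])
    show "(\<Sum>m\<in>{..n + N}. 2 ^ m * real (N choose m)) \<le> (\<Sum>m\<in>{..N}. 2 ^ m * real (N choose m))"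
      by (rule eq_refl, rule sum.mono_neutral_right) (auto simp: not_le)
  qed auto
  also have "\<dots> = 3 ^ N"
    using binomial_ring[of "2::real" 1 N] by (simp add: mult.commute)
  finally show ?thesis .
qed

lemma admissible_factor_mult:
  assumes "admissible_factor L u" "admissible_factor L v"
  shows "admissible_factor L (\<lambda>y. u y * v y)"
proof -
  obtain B C where "B \<in> finite_sets L" "C \<in> finite_sets L" "factor_on L B u" "factor_on L C v"
    using assms by (auto simp: admissible_factor_iff)
  then have "factor_on L (B \<union> C) (\<lambda>y. u y * v y)" "B \<union> C \<in> finite_sets L"
    by (auto intro: factor_on_mult factor_on_mono finite_sets_Un)
  then show ?thesis by (auto simp: admissible_factor_iff)
qed

lemma admissible_factor_scale: "admissible_factor L u \<Longrightarrow> admissible_factor L (\<lambda>y. c * u y)"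
  unfolding admissible_factor_iff using factor_on_scale by blast

lemma admissible_factors_common:
  assumes "finite J" "\<And>j. j \<in> J \<Longrightarrow> admissible_factor L (g j)"
  obtains B where "B \<in> finite_sets L" "\<And>j. j \<in> J \<Longrightarrow> factor_on L B (g j)"
proof -
  obtain C where C: "\<And>j. j \<in> J \<Longrightarrow> C j \<in> finite_sets L" "\<And>j. j \<in> J \<Longrightarrow> factor_on L (C j) (g j)"
    using assms(2) unfolding admissible_factor_iff by metis
  show ?thesis
  proof (rule that[of "\<Union>j\<in>J. C j"])
    show "(\<Union>j\<in>J. C j) \<in> finite_sets L" using C(1) assms(1) by (intro finite_sets_UN)
    show "factor_on L (\<Union>j\<in>J. C j) (g j)" if "j \<in> J" for j
      by (rule factor_on_mono[OF C(2)[OF that]]) (use that in auto)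
  qed
qed

text \<open>Linear combinations of factorial polynomials, with index lists and supports varying from
  term to term. The aim is closure under multiplication by counts, so that all polynomials in counts
  belong to it.\<close>

inductive factorial_span :: "'a measure \<Rightarrow> ('a measure \<Rightarrow> real) \<Rightarrow> bool" for L where
  poly: "distinct js \<Longrightarrow> (\<And>j. j \<in> set js \<Longrightarrow> admissible_factor L (g j)) \<Longrightarrow> factorial_span L (factorial_poly js g)"
| add: "factorial_span L F \<Longrightarrow> factorial_span L G \<Longrightarrow> factorial_span L (\<lambda>\<mu>. F \<mu> + G \<mu>)"
| scale: "factorial_span L F \<Longrightarrow> factorial_span L (\<lambda>\<mu>. c * F \<mu>)"

lemma factorial_span_one: "factorial_span L (\<lambda>\<mu>. 1)"
proof -
  have "factorial_poly [] (\<lambda>_ _. 0) = (\<lambda>\<mu> :: 'a measure. 1)" by auto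
  then show ?thesis using factorial_span.poly[of "[]" L "\<lambda>_ _. 0"] by simp
qed

lemma factorial_span_sum:
  "(\<And>i. i \<in> I \<Longrightarrow> factorial_span L (F i)) \<Longrightarrow> factorial_span L (\<lambda>\<mu>. \<Sum>i\<in>I. F i \<mu>)"
proof (induction I rule: infinite_finite_induct)
  case (insert i I)
  then show ?case by (auto intro: factorial_span.add)
qed (use factorial_span.scale[OF factorial_span_one, of L 0] in auto)

text \<open>The recursion of \<open>factorial_poly\<close> read backwards: an integral times a
  factorial polynomial is a factorial polynomial with one more index plus the collision
  terms.\<close>

lemma factorial_span_mult:
  assumes "factorial_span L F" and C: "C \<in> finite_sets L"
  shows "factorial_span L (\<lambda>\<mu>. (\<integral>y. indicator C y \<partial>\<mu>) * F \<mu>)"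
  using assms(1)
proof induction
  case (poly js g)
  \<comment> \<open>A fresh index carries the additional factor \<open>indicator C\<close> without
    disturbing \<open>g\<close>.\<close>
  obtain j where j: "j \<notin> set js" using ex_new_if_finite[OF infinite_UNIV_nat] by blast
  define g' where "g' = g(j := indicator C)"
  have "factor_on L C (indicator C)" using finite_setsD(1)[OF C] by (intro factor_on_indicator) auto
  then have ind: "admissible_factor L (indicator C)" using C by (auto simp: admissible_factor_iff)
  have g': "admissible_factor L (g' i)" if "i \<in> insert j (set js)" for i
    using poly.hyps ind that by (auto simp: g'_def)
  have "factorial_poly js g' \<mu> = factorial_poly js g \<mu>" for \<mu>
    using j by (intro factorial_poly_cong) (auto simp: g'_def)
  then have eq: "(\<integral>y. indicator C y \<partial>\<mu>) * factorial_poly js g \<mu> =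
      factorial_poly (j # js) g' \<mu> + (\<Sum>i\<in>set js. factorial_poly js (g'(i := \<lambda>y. g' j y * g' i y)) \<mu>)" for \<mu>
    by (simp add: g'_def)
  show ?case unfolding eq
    using g' poly.hyps(1) j
    by (intro factorial_span.add factorial_span.poly factorial_span_sum) (auto intro: admissible_factor_mult)
next
  case (add F G)
  then show ?case using factorial_span.add[OF add.IH] by (simp add: distrib_left)
next
  case (scale F c)
  then show ?case using factorial_span.scale[OF scale.IH, of c] by (simp add: mult.left_commute)
qed

text \<open>Up to \<open>m!\<close>, \<open>x gchoose m\<close> is a product of factors
  \<open>x - i\<close>, so multiplying by it iterates multiplications by a count and by
  scalars.\<close>

lemma factorial_span_gchoose:
  assumes F: "factorial_span L F" and C: "C \<in> finite_sets L"
  shows "factorial_span L (\<lambda>\<mu>. ((\<integral>y. indicator C y \<partial>\<mu>) gchoose m) * F \<mu>)"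
proof -
  have "factorial_span L (\<lambda>\<mu>. (\<Prod>i<m. (\<integral>y. indicator C y \<partial>\<mu>) - real i) * F \<mu>)" for m
  proof (induction m)
    case 0
    then show ?case using F by simp
  next
    case (Suc m)
    have "factorial_span L (\<lambda>\<mu>. (\<integral>y. indicator C y \<partial>\<mu>) * ((\<Prod>i<m. (\<integral>y. indicator C y \<partial>\<mu>) - real i) * F \<mu>) +
        (- real m) * ((\<Prod>i<m. (\<integral>y. indicator C y \<partial>\<mu>) - real i) * F \<mu>))"
      by (intro factorial_span.add factorial_span_mult[OF Suc C] factorial_span.scale[OF Suc])
    then show ?case by (simp add: algebra_simps)
  qed
  from factorial_span.scale[OF this[of m], of "1 / fact m"] show ?thesis
    by (simp add: gbinomial_prod_rev atLeast0LessThan)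
qed

lemma factorial_span_truncated_atom:
  assumes F: "factorial_span L F" and C: "C \<in> finite_sets L"
  shows "factorial_span L (\<lambda>\<mu>. truncated_atom n k (\<integral>y. indicator C y \<partial>\<mu>) * F \<mu>)"
proof -
  have "factorial_span L (\<lambda>\<mu>. \<Sum>m\<in>{k..n}. ((- 1) ^ (m - k) * real (m choose k)) * (((\<integral>y. indicator C y \<partial>\<mu>) gchoose m) * F \<mu>))"
    by (intro factorial_span_sum factorial_span.scale factorial_span_gchoose[OF F C])
  then show ?thesis by (simp add: truncated_atom_def sum_distrib_right mult.assoc)
qed

lemma factorial_span_prod:
  fixes S :: "('a set \<times> nat) set"
  assumes "finite S" "fst ` S \<subseteq> finite_sets L"
  shows "factorial_span L (\<lambda>\<mu>. \<Prod>p\<in>S. truncated_atom n (snd p) (\<integral>y. indicator (fst p) y \<partial>\<mu>))"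
  using assms
proof (induction S rule: finite_induct)
  case empty
  show ?case using factorial_span_one by simp
next
  case (insert p S)
  then show ?case using factorial_span_truncated_atom[of L _ "fst p" n "snd p"] by simp
qed

context poisson_points
begin

text \<open>The constant is kept apart from the orders \<open>n \<ge> 1\<close>, because forms of
  order 0 cannot be scaled by \<open>scale_first\<close>. One form for each order is no restriction:
  forms are lists and can be concatenated, and the empty list gives 0.\<close>

definition chaos_sums :: "('w \<Rightarrow> real) set" where
  "chaos_sums = {\<lambda>\<omega>. c + (\<Sum>n\<in>{1..<N}. sum_product_integral L \<eta> X n (gs n) \<omega>) | c N gs. \<forall>n. sum_product_form L n (gs n)}"

lemma chaos_sumsI:
  "(\<And>n. sum_product_form L n (gs n)) \<Longrightarrow> (\<lambda>\<omega>. c + (\<Sum>n\<in>{1..<N}. sum_product_integral L \<eta> X n (gs n) \<omega>)) \<in> chaos_sums"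
  unfolding chaos_sums_def by blast

lemma sum_product_integral_append:
  "sum_product_integral L \<eta> X n (gs @ hs) \<omega> = sum_product_integral L \<eta> X n gs \<omega> + sum_product_integral L \<eta> X n hs \<omega>"
  by (simp add: sum_product_integral_def)

lemma sum_product_integral_Nil [simp]: "sum_product_integral L \<eta> X n [] \<omega> = 0"
  by (simp add: sum_product_integral_def)

text \<open>The index 0 lies in exactly one of \<open>J\<close> and its complement, so each summand
  acquires the scalar exactly once.\<close>

lemma product_integral_scale:
  assumes "n > 0"
  shows "product_integral L \<kappa> x n (scale_first c g) = c * product_integral L \<kappa> x n g"
  unfolding product_integral_def sum_distrib_left
proof (rule sum.cong[OF refl])
  fix J assume J: "J \<in> Pow {..<n}"
  have t: "tensor I (scale_first c g) y = (if 0 \<in> I then c else 1) * tensor I g y" if "finite I" for I and y :: "nat \<Rightarrow> 'a"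
  proof (cases "0 \<in> I")
    case True
    then have *: "tensor I h y = h 0 (y 0) * (\<Prod>j\<in>I - {0}. h j (y j))" for h :: "nat \<Rightarrow> 'a \<Rightarrow> real"
      unfolding tensor_def using that by (subst prod.remove[of I 0]) auto
    show ?thesis unfolding * using True by (simp add: scale_first_def mult.assoc)
  next
    case False
    then show ?thesis unfolding tensor_def by (auto intro!: prod.cong simp: scale_first_def)
  qed
  have "finite J" "finite ({..<n} - J)" using J by (auto intro: finite_subset)
  then show "(- 1) ^ (n - card J) * (\<integral>y. tensor J (scale_first c g) y \<partial>factorial_measure L \<kappa> x J) *
      (\<integral>y. tensor ({..<n} - J) (scale_first c g) y \<partial>Pi\<^sub>M ({..<n} - J) (\<lambda>_. L)) =
      c * ((- 1) ^ (n - card J) * (\<integral>y. tensor J g y \<partial>factorial_measure L \<kappa> x J) *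
      (\<integral>y. tensor ({..<n} - J) g y \<partial>Pi\<^sub>M ({..<n} - J) (\<lambda>_. L)))"
    using assms by (cases "0 \<in> J") (auto simp: t)
qed

lemma sum_product_integral_scale:
  "n > 0 \<Longrightarrow> sum_product_integral L \<eta> X n (map (scale_first c) gs) \<omega> = c * sum_product_integral L \<eta> X n gs \<omega>"
  by (induction gs) (simp_all add: sum_product_integral_def product_integral_scale distrib_left)

lemma sum_product_form_append: "sum_product_form L n gs \<Longrightarrow> sum_product_form L n hs \<Longrightarrow> sum_product_form L n (gs @ hs)"
  by (auto simp: sum_product_form_def)

lemma sum_product_form_scale: "sum_product_form L n gs \<Longrightarrow> sum_product_form L n (map (scale_first c) gs)"
  by (auto simp: sum_product_form_def scale_first_def intro: admissible_factor_scale)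

lemma sum_product_form_Nil [simp]: "sum_product_form L n []"
  by (simp add: sum_product_form_def)

lemma chaos_sums_add:
  assumes "u \<in> chaos_sums" "v \<in> chaos_sums"
  shows "(\<lambda>\<omega>. u \<omega> + v \<omega>) \<in> chaos_sums"
proof -
  obtain c N gs where u: "u = (\<lambda>\<omega>. c + (\<Sum>n\<in>{1..<N}. sum_product_integral L \<eta> X n (gs n) \<omega>))" "\<And>n. sum_product_form L n (gs n)"
    using assms(1) unfolding chaos_sums_def by blast
  obtain d K hs where v: "v = (\<lambda>\<omega>. d + (\<Sum>n\<in>{1..<K}. sum_product_integral L \<eta> X n (hs n) \<omega>))" "\<And>n. sum_product_form L n (hs n)"
    using assms(2) unfolding chaos_sums_def by blast
  let ?g = "\<lambda>n. (if n < N then gs n else []) @ (if n < K then hs n else [])"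
  have "(\<Sum>n\<in>{1..<max N K}. sum_product_integral L \<eta> X n (?g n) \<omega>) =
      (\<Sum>n\<in>{1..<N}. sum_product_integral L \<eta> X n (gs n) \<omega>) + (\<Sum>n\<in>{1..<K}. sum_product_integral L \<eta> X n (hs n) \<omega>)" for \<omega>
  proof -
    have "(\<Sum>n\<in>{1..<max N K}. sum_product_integral L \<eta> X n (if n < R then fs n else []) \<omega>) = (\<Sum>n\<in>{1..<R}. sum_product_integral L \<eta> X n (fs n) \<omega>)"
      if "R \<le> max N K" for R fs
      using that by (intro sum.mono_neutral_cong_right) auto
    then show ?thesis by (simp add: sum_product_integral_append sum.distrib)
  qed
  then have "(\<lambda>\<omega>. u \<omega> + v \<omega>) = (\<lambda>\<omega>. (c + d) + (\<Sum>n\<in>{1..<max N K}. sum_product_integral L \<eta> X n (?g n) \<omega>))"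
    by (auto simp: u(1) v(1))
  also have "\<dots> \<in> chaos_sums" using u(2) v(2) by (intro chaos_sumsI sum_product_form_append) auto
  finally show ?thesis .
qed

lemma chaos_sums_scale:
  assumes "u \<in> chaos_sums"
  shows "(\<lambda>\<omega>. a * u \<omega>) \<in> chaos_sums"
proof -
  obtain c N gs where u: "u = (\<lambda>\<omega>. c + (\<Sum>n\<in>{1..<N}. sum_product_integral L \<eta> X n (gs n) \<omega>))" "\<And>n. sum_product_form L n (gs n)"
    using assms(1) unfolding chaos_sums_def by blast
  have "(\<lambda>\<omega>. a * u \<omega>) = (\<lambda>\<omega>. a * c + (\<Sum>n\<in>{1..<N}. sum_product_integral L \<eta> X n (map (scale_first a) (gs n)) \<omega>))"
    by (auto simp: u(1) distrib_left sum_distrib_left sum_product_integral_scale intro!: sum.cong)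
  also have "\<dots> \<in> chaos_sums" using u(2) by (intro chaos_sumsI sum_product_form_scale)
  finally show ?thesis .
qed

abbreviation chaos_closure :: "('w \<Rightarrow> real) set" where
  "chaos_closure \<equiv> L2_closure M chaos_sums"

lemma chaos_closure_add: "u \<in> chaos_closure \<Longrightarrow> v \<in> chaos_closure \<Longrightarrow> (\<lambda>\<omega>. u \<omega> + v \<omega>) \<in> chaos_closure"
  by (rule L2_closure_add[OF chaos_sums_add])

lemma chaos_closure_scale: "u \<in> chaos_closure \<Longrightarrow> (\<lambda>\<omega>. c * u \<omega>) \<in> chaos_closure"
  by (rule L2_closure_scale[OF chaos_sums_scale])

lemma chaos_closure_const: "(\<lambda>\<omega>. c) \<in> chaos_closure"
  using chaos_sumsI[of "\<lambda>_. []" c 0] by (intro L2_closure_incl) auto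

lemma chaos_closure_sum:
  "(\<And>i. i \<in> I \<Longrightarrow> u i \<in> chaos_closure) \<Longrightarrow> (\<lambda>\<omega>. \<Sum>i\<in>I. u i \<omega>) \<in> chaos_closure"
  by (induction I rule: infinite_finite_induct) (auto intro: chaos_closure_add chaos_closure_const)

lemma chaos_closure_sum_product_integral:
  assumes n: "n > 0" and gs: "sum_product_form L n gs"
  shows "sum_product_integral L \<eta> X n gs \<in> chaos_closure"
proof (rule L2_closure_incl)
  obtain B where "B \<in> finite_sets L" "form_on L B n gs" using sum_product_form_on[OF gs] .
  then show "square_integrable M (sum_product_integral L \<eta> X n gs)" by (rule sum_product_integral_square_integrable)
  have "sum_product_integral L \<eta> X n gs = (\<lambda>\<omega>. 0 + (\<Sum>m\<in>{1..<Suc n}. sum_product_integral L \<eta> X m (if m = n then gs else []) \<omega>))"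
  proof
    fix \<omega>
    have "(\<Sum>m\<in>{1..<Suc n}. sum_product_integral L \<eta> X m (if m = n then gs else []) \<omega>) = (\<Sum>m\<in>{n}. sum_product_integral L \<eta> X m gs \<omega>)"
      using n by (intro sum.mono_neutral_cong_right) auto
    then show "sum_product_integral L \<eta> X n gs \<omega> = 0 + (\<Sum>m\<in>{1..<Suc n}. sum_product_integral L \<eta> X m (if m = n then gs else []) \<omega>)" by simp
  qed
  also have "\<dots> \<in> chaos_sums" using gs by (intro chaos_sumsI) auto
  finally show "sum_product_integral L \<eta> X n gs \<in> chaos_sums" .
qed

lemma factorial_integral_eta_measurable:
  assumes "finite J" "\<And>j. j \<in> J \<Longrightarrow> factor_on L B (g j)"
  shows "(\<lambda>\<omega>. factorial_integral J g (\<eta> \<omega>)) \<in> borel_measurable M"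
  using assms by (intro measurable_compose[OF eta_measurable factorial_integral_measurable] factor_on_measurable[of L B]) auto

text \<open>In the compensated integral the full index set contributes the factorial integral
  itself, and all other summands have fewer indices. Solving for it gives an induction on the number
  of indices. The index set is renamed to \<open>{..<n}\<close>, where the integrals
  \<open>I_n\<close> are defined.\<close>

lemma chaos_closure_factorial_integral:
  assumes B: "B \<in> finite_sets L" and "finite J" "\<And>j. j \<in> J \<Longrightarrow> factor_on L B (g j)"
  shows "(\<lambda>\<omega>. factorial_integral J g (\<eta> \<omega>)) \<in> chaos_closure"
  using assms(2,3)
proof (induction "card J" arbitrary: J g rule: less_induct)
  case less
  define n where "n = card J"
  obtain e where e: "bij_betw e {..<n} J"
    using ex_bij_betw_nat_finite[OF less.prems(1)] by (auto simp: n_def atLeast0LessThan)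
  let ?g = "\<lambda>j. g (e j)"
  have g: "\<And>j. j < n \<Longrightarrow> factor_on L B (?g j)" using less.prems(2) e by (auto simp: bij_betw_def)
  let ?s = "\<lambda>I. (- 1 :: real) ^ card ({..<n} - I) * (\<Prod>j\<in>{..<n} - I. \<integral>y. ?g j y \<partial>L)"
  let ?W = "\<lambda>\<omega>. compensated_integral L {..<n} ?g (\<eta> \<omega>)"
  have W: "?W \<in> chaos_closure"
  proof (cases "n = 0")
    case True
    then show ?thesis using chaos_closure_const[of 1] by (simp add: lessThan_0)
  next
    case False
    have fo: "form_on L B n [?g]" using g by (simp add: form_on_def)
    show ?thesis
    proof (rule L2_closure_cong_AE)
      show "sum_product_integral L \<eta> X n [?g] \<in> chaos_closure"
        using False form_on_imp[OF fo B] by (intro chaos_closure_sum_product_integral) auto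
      show "?W \<in> borel_measurable M"
        using g compensated_integral_regular(3)[OF B, of "{..<n}" ?g] by (auto simp: square_integrable_def)
      show "AE \<omega> in M. ?W \<omega> = sum_product_integral L \<eta> X n [?g] \<omega>"
        using sum_product_integral_eq[OF B fo] by eventually_elim (simp add: sum_compensated_def)
    qed
  qed
  have "(\<lambda>\<omega>. ?W \<omega> + (\<Sum>I\<in>Pow {..<n} - {{..<n}}. (- ?s I) * factorial_integral I ?g (\<eta> \<omega>))) \<in> chaos_closure"
  proof (intro chaos_closure_add[OF W] chaos_closure_sum chaos_closure_scale)
    fix I assume I: "I \<in> Pow {..<n} - {{..<n}}"
    then have "I \<subset> {..<n}" by auto
    then have "card I < card J" using psubset_card_mono[of "{..<n}" I] by (simp add: n_def)
    then show "(\<lambda>\<omega>. factorial_integral I ?g (\<eta> \<omega>)) \<in> chaos_closure"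
      using I g by (intro less.hyps) (auto intro: finite_subset)
  qed
  then show ?case
  proof (rule L2_closure_cong_AE)
    show "(\<lambda>\<omega>. factorial_integral J g (\<eta> \<omega>)) \<in> borel_measurable M"
      by (rule factorial_integral_eta_measurable[OF less.prems])
    show "AE \<omega> in M. factorial_integral J g (\<eta> \<omega>) =
        ?W \<omega> + (\<Sum>I\<in>Pow {..<n} - {{..<n}}. (- ?s I) * factorial_integral I ?g (\<eta> \<omega>))"
      using AE_eta_finite[OF B] AE_space
    proof eventually_elim
      case (elim \<omega>)
      have "factorial_integral J g (\<eta> \<omega>) = factorial_integral (e ` {..<n}) g (\<eta> \<omega>)"
        using e by (simp add: bij_betw_def)
      also have "\<dots> = factorial_integral {..<n} ?g (\<eta> \<omega>)"
        using e g by (intro factorial_integral_reindex[OF eta_labelled[OF elim(2) finite_setsD(1)[OF B] elim(1)]]) (auto simp: bij_betw_def)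
      moreover have "?W \<omega> = factorial_integral {..<n} ?g (\<eta> \<omega>) + (\<Sum>I\<in>Pow {..<n} - {{..<n}}. ?s I * factorial_integral I ?g (\<eta> \<omega>))"
        unfolding compensated_integral_def by (subst sum.remove[of _ "{..<n}"]) (auto simp: ac_simps)
      ultimately show ?case by (simp add: sum_negf)
    qed
  qed
qed

lemma chaos_closure_factorial_span:
  assumes "factorial_span L F"
  shows "(\<lambda>\<omega>. F (\<eta> \<omega>)) \<in> chaos_closure"
  using assms
proof induction
  case (poly js g)
  obtain B where B: "B \<in> finite_sets L" "\<And>j. j \<in> set js \<Longrightarrow> factor_on L B (g j)"
    using admissible_factors_common[of "set js" L g] poly.hyps by blast
  show ?case
  proof (rule L2_closure_cong_AE[OF chaos_closure_factorial_integral[OF B(1) finite_set B(2)]])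
    show "(\<lambda>\<omega>. factorial_poly js g (\<eta> \<omega>)) \<in> borel_measurable M"
      using B(2) by (intro measurable_compose[OF eta_measurable factorial_poly_measurable] factor_on_measurable[of L B])
    show "AE \<omega> in M. factorial_poly js g (\<eta> \<omega>) = factorial_integral (set js) g (\<eta> \<omega>)"
      using AE_eta_finite[OF B(1)] AE_space
    proof eventually_elim
      case (elim \<omega>)
      note lab = eta_labelled[OF elim(2) finite_setsD(1)[OF B(1)] elim(1)]
      show ?case
        using factorial_poly_labelled[OF lab poly.hyps(1) B(2)] factorial_integral_labelled[OF lab finite_set B(2)] by simp
    qed
  qed
qed (auto intro: chaos_closure_add chaos_closure_scale)

text \<open>The product of the truncated atoms of the prescribed counts is eventually equal to the
  indicator of \<open>a\<close>, almost surely; the convergence is obvious and only a majorant has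
  to be found.\<close>

lemma chaos_closure_generator:
  assumes a: "a \<in> point_generator L"
  shows "(\<lambda>\<omega>. indicator a (\<eta> \<omega>)) \<in> chaos_closure"
proof -
  obtain S :: "('a set \<times> nat) set" where S:
    "a = {\<mu> \<in> point_measures L. \<forall>(C, k)\<in>S. emeasure \<mu> C = of_nat k}" "finite S" "fst ` S \<subseteq> finite_sets L"
    using a unfolding point_generator_def by blast
  define U where "U = (\<Union>p\<in>S. fst p)"
  have U: "U \<in> finite_sets L" unfolding U_def using S by (intro finite_sets_UN) auto
  have pS: "fst p \<in> finite_sets L" if "p \<in> S" for p using S(3) that by auto
  let ?F = "\<lambda>n \<omega>. \<Prod>p\<in>S. truncated_atom n (snd p) (\<integral>y. indicator (fst p) y \<partial>\<eta> \<omega>)"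
  have F: "?F n \<in> chaos_closure" for n
    using chaos_closure_factorial_span[OF factorial_span_prod[OF S(2,3), of n]] .
  have "AE \<omega> in M. \<exists>k::nat. emeasure (\<eta> \<omega>) (fst p) = of_nat k" if "p \<in> S" for p
    using poisson_AE[OF eta_poisson[OF finite_setsD(1)[OF pS[OF that]]] finite_setsD(2)[OF pS[OF that]]] .
  then have AE_S: "AE \<omega> in M. \<forall>p\<in>S. \<exists>k::nat. emeasure (\<eta> \<omega>) (fst p) = of_nat k"
    using S(2) by (intro AE_finite_allI) auto
  have val: "(\<integral>y. indicator (fst p) y \<partial>\<eta> \<omega>) = real k \<and> k \<le> measure (\<eta> \<omega>) U"
    if "\<omega> \<in> space M" "p \<in> S" "emeasure (\<eta> \<omega>) (fst p) = of_nat k" "emeasure (\<eta> \<omega>) U < \<infinity>" for \<omega> p k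
  proof -
    have "(\<integral>y. indicator (fst p) y \<partial>\<eta> \<omega>) = measure (\<eta> \<omega>) (fst p)"
      using finite_setsD(1)[OF pS[OF that(2)]] that(1) by (simp add: eta_sets)
    also have "\<dots> = real k" using that(3) by (simp add: measure_def)
    finally have 1: "(\<integral>y. indicator (fst p) y \<partial>\<eta> \<omega>) = real k" .
    have "measure (\<eta> \<omega>) (fst p) \<le> measure (\<eta> \<omega>) U"
      unfolding measure_def using that finite_setsD(1)[OF U]
      by (intro enn2real_mono emeasure_mono) (auto simp: U_def eta_sets)
    with that(3) 1 show ?thesis by (simp add: measure_def)
  qed
  have "L2_tendsto M ?F (\<lambda>\<omega>. indicator a (\<eta> \<omega>))"
  \<comment> \<open>Each prescribed count is at most \<open>\<eta>(U)\<close>, so each of the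
    \<open>card S\<close> factors is at most 3 to the power \<open>\<eta>(U)\<close>, whatever
    \<open>n\<close> is.\<close>
  proof (rule L2_tendsto_dominated[where w="\<lambda>\<omega>. (3 ^ card S) powr measure (\<eta> \<omega>) U"])
    show "?F n \<in> borel_measurable M" for n
      using L2_closure_square_integrable[OF F[of n]] by (rule square_integrable_measurable)
    have "a \<in> sets (point_algebra L)" using a by (simp add: L.sets_point_algebra)
    then show "(\<lambda>\<omega>. indicator a (\<eta> \<omega>)) \<in> borel_measurable M" by measurable
    show "square_integrable M (\<lambda>\<omega>. (3 ^ card S) powr measure (\<eta> \<omega>) U)"
      by (rule square_integrable_powr[OF U]) simp
    show "AE \<omega> in M. \<bar>?F n \<omega>\<bar> \<le> (3 ^ card S) powr measure (\<eta> \<omega>) U" for n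
      using AE_S AE_eta_finite[OF U] AE_space
    proof eventually_elim
      case (elim \<omega>)
      have "\<bar>truncated_atom n (snd p) (\<integral>y. indicator (fst p) y \<partial>\<eta> \<omega>)\<bar> \<le> 3 powr measure (\<eta> \<omega>) U" if p: "p \<in> S" for p
      proof -
        obtain k :: nat where k: "emeasure (\<eta> \<omega>) (fst p) = of_nat k" using elim(1) p by blast
        note v = val[OF elim(3) p k elim(2)]
        have "\<bar>truncated_atom n (snd p) (\<integral>y. indicator (fst p) y \<partial>\<eta> \<omega>)\<bar> \<le> 3 ^ k"
          using v truncated_atom_bound[of n "snd p" k] by simp
        also have "\<dots> = 3 powr real k" by (simp add: powr_realpow)
        also have "\<dots> \<le> 3 powr measure (\<eta> \<omega>) U" using v by (intro powr_mono) auto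
        finally show ?thesis .
      qed
      then have "\<bar>?F n \<omega>\<bar> \<le> (\<Prod>p\<in>S. 3 powr measure (\<eta> \<omega>) U)"
        unfolding abs_prod by (intro prod_mono) auto
      also have "\<dots> = (3 ^ card S) powr measure (\<eta> \<omega>) U"
        by (simp add: powr_power powr_powr mult.commute flip: powr_realpow)
      finally show ?case .
    qed
    show "AE \<omega> in M. (\<lambda>n. ?F n \<omega>) \<longlonglongrightarrow> indicator a (\<eta> \<omega>)"
      using AE_S AE_eta_finite[OF U] AE_space
    proof eventually_elim
      case (elim \<omega>)
      obtain k :: "('a set \<times> nat) \<Rightarrow> nat" where k: "\<And>p. p \<in> S \<Longrightarrow> emeasure (\<eta> \<omega>) (fst p) = of_nat (k p)" using elim(1) by metis
      obtain K :: nat where K: "measure (\<eta> \<omega>) U \<le> real K" using real_arch_simple by blast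
      \<comment> \<open>From \<open>K\<close> on, no count exceeds \<open>n\<close> and every
        truncated atom is exact.\<close>
      have "?F n \<omega> = indicator a (\<eta> \<omega>)" if n: "n \<ge> K" for n
      proof -
        have "truncated_atom n (snd p) (\<integral>y. indicator (fst p) y \<partial>\<eta> \<omega>) = (if k p = snd p then 1 else 0)" if p: "p \<in> S" for p
        proof -
          note v = val[OF elim(3) p k[OF p] elim(2)]
          then have "k p \<le> n" using K n by linarith
          then show ?thesis using v truncated_atom_of_nat[of "k p" n "snd p"] by simp
        qed
        then have "?F n \<omega> = (\<Prod>p\<in>S. if k p = snd p then 1 else 0)" by (intro prod.cong) auto
        also have "\<dots> = (if \<forall>p\<in>S. k p = snd p then 1 else 0)"
          using S(2) by (auto intro!: prod.neutral prod_zero)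
        also have "\<dots> = indicator a (\<eta> \<omega>)"
          using k eta_point_measure[OF elim(3)] unfolding S(1) case_prod_beta by (simp add: indicator_def)
        finally show ?thesis .
      qed
      then show ?case by (intro tendsto_eventually) (auto simp: eventually_sequentially)
    qed
  qed
  then show ?thesis by (rule L2_closure_lim[OF F])
qed

text \<open>The induction principle, applied to the law of \<open>\<eta>\<close>, reduces square
  integrable functions of \<open>\<eta>\<close> to indicators of generator events.\<close>

theorem chaos_dense:
  assumes f: "f \<in> borel_measurable (point_algebra L)" "square_integrable M (\<lambda>\<omega>. f (\<eta> \<omega>))"
  shows "(\<lambda>\<omega>. f (\<eta> \<omega>)) \<in> chaos_closure"
proof -
  let ?N = "distr M (point_algebra L) \<eta>"
  interpret N: prob_space ?N by (rule prob_space_distr) measurable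
  show ?thesis
  proof (rule N.L2_induct_generator[where G="point_generator L" and P="\<lambda>f. (\<lambda>\<omega>. f (\<eta> \<omega>)) \<in> chaos_closure"])
    show "Int_stable (point_generator L)" by (rule Int_stable_point_generator)
    show "point_generator L \<subseteq> Pow (space ?N)" using point_generator_Pow by simp
    show "sets ?N = sigma_sets (space ?N) (point_generator L)" by (simp add: L.sets_point_algebra)
    show "(\<lambda>\<omega>. indicator a (\<eta> \<omega>)) \<in> chaos_closure" if "a \<in> point_generator L" for a
      by (rule chaos_closure_generator[OF that])
    show "(\<lambda>\<omega>. indicator (space ?N) (\<eta> \<omega>)) \<in> chaos_closure"
      using chaos_closure_generator[OF point_measures_in_generator] by simp
    show "(\<lambda>\<omega>. v (\<eta> \<omega>)) \<in> chaos_closure" if "\<And>k. (\<lambda>\<omega>. u k (\<eta> \<omega>)) \<in> chaos_closure" "L2_tendsto ?N u v" for u v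
    proof (rule L2_closure_lim[OF that(1)])
      have [measurable]: "u k \<in> borel_measurable (point_algebra L)" "v \<in> borel_measurable (point_algebra L)" for k
        using that(2) by (auto simp: L2_tendsto_def square_integrable_distr)
      have "(\<integral>\<mu>. (u k \<mu> - v \<mu>)\<^sup>2 \<partial>?N) = (\<integral>\<omega>. (u k (\<eta> \<omega>) - v (\<eta> \<omega>))\<^sup>2 \<partial>M)" for k
        by (rule integral_distr) measurable
      then show "L2_tendsto M (\<lambda>k \<omega>. u k (\<eta> \<omega>)) (\<lambda>\<omega>. v (\<eta> \<omega>))"
        using that(2) by (simp add: L2_tendsto_def square_integrable_distr)
    qed
    show "square_integrable ?N f" using f by (simp add: square_integrable_distr)
  qed (auto intro: chaos_closure_add chaos_closure_scale)
qed

end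

section \<open>The chaos expansion\<close>

context poisson_points
begin

lemma wiener_ito_is_version:
  assumes "n > 0" "square_integrable (power_measure L n) g"
  shows "wiener_ito_version M L \<eta> X n g (wiener_ito M L \<eta> X n g)"
  using someI_ex[OF wiener_ito_version_exists[OF assms]] assms(1) by (simp add: wiener_ito_def)

lemma wiener_ito_0: "wiener_ito M L \<eta> X 0 g = (\<lambda>_. g (\<lambda>_. undefined))"
  by (simp add: wiener_ito_def)

lemma wiener_ito_version_square_integrable:
  "wiener_ito_version M L \<eta> X n g Z \<Longrightarrow> square_integrable M Z"
  "wiener_ito_version M L \<eta> X n g Z \<Longrightarrow> square_integrable (power_measure L n) g"
  by (auto simp: wiener_ito_version_def L2_tendsto_def)

lemma sum_product_integral_is_version:
  assumes "sum_product_form L n gs"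
  shows "wiener_ito_version M L \<eta> X n (sum_product n gs) (sum_product_integral L \<eta> X n gs)"
proof -
  obtain B where "B \<in> finite_sets L" "form_on L B n gs" using sum_product_form_on[OF assms] .
  then show ?thesis unfolding wiener_ito_version_def
    using assms sum_product_square_integrable sum_product_integral_square_integrable
    by (intro exI[of _ "\<lambda>_. gs"]) (auto intro: L2_tendsto_const)
qed

text \<open>\<open>T_n f\<close> is symmetric, so symmetrising only multiplies it by
  \<open>n!\<close>, which cancels the coefficient \<open>1 / n!\<close> of the expansion.\<close>

lemma sym_sum_mean_diff: "sym_sum n (mean_diff M \<eta> n f) y = fact n * mean_diff M \<eta> n f y"
proof -
  have "sym_sum n (mean_diff M \<eta> n f) y = (\<Sum>\<pi> | \<pi> permutes {..<n}. mean_diff M \<eta> n f y)"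
    unfolding sym_sum_def mean_diff_def by (intro sum.cong refl) (simp add: iter_diff_permutes)
  then show ?thesis by (simp add: card_permutations[OF card_lessThan])
qed

text \<open>By orthogonality only the order \<open>m\<close> survives. The order 0 is treated
  separately, being a constant instead of a chosen version; it drops out because \<open>Y\<close>
  has mean 0.\<close>

lemma partial_sum_inner:
  assumes g: "\<And>n. n > 0 \<Longrightarrow> square_integrable (power_measure L n) (g n)"
    and Y: "wiener_ito_version M L \<eta> X m h Y" and m: "0 < m" "m < N"
  shows "(\<integral>\<omega>. (\<Sum>n<N. 1 / fact n * wiener_ito M L \<eta> X n (g n) \<omega>) * Y \<omega> \<partial>M) =
    1 / fact m * (\<integral>y. sym_sum m (g m) y * h y \<partial>power_measure L m)"
proof -
  let ?I = "\<lambda>n. wiener_ito M L \<eta> X n (g n)"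
  have Ys: "square_integrable M Y" by (rule wiener_ito_version_square_integrable[OF Y])
  have Is: "square_integrable M (?I n)" for n
    using wiener_ito_is_version[OF _ g, of n] wiener_ito_version_square_integrable
    by (cases "n = 0") (auto simp: wiener_ito_0)
  have inner: "(\<integral>\<omega>. ?I n \<omega> * Y \<omega> \<partial>M) = (if n = m then \<integral>y. sym_sum m (g m) y * h y \<partial>power_measure L m else 0)" for n
  proof (cases "n = 0")
    case True
    then show ?thesis using wiener_ito_version_mean[OF m(1) Y] m by (simp add: wiener_ito_0)
  next
    case False
    then show ?thesis using wiener_ito_version_isometry[OF wiener_ito_is_version[OF _ g, of n] Y] by auto
  qed
  have "(\<integral>\<omega>. (\<Sum>n<N. 1 / fact n * ?I n \<omega>) * Y \<omega> \<partial>M) = (\<integral>\<omega>. (\<Sum>n<N. 1 / fact n * (?I n \<omega> * Y \<omega>)) \<partial>M)"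
    by (simp add: sum_distrib_right)
  also have "\<dots> = (\<Sum>n<N. 1 / fact n * (\<integral>\<omega>. ?I n \<omega> * Y \<omega> \<partial>M))"
    by (subst Bochner_Integration.integral_sum) (auto intro!: integrable_mult_square Is Ys simp: integrable_mult_square[OF Is Ys])
  also have "\<dots> = (\<Sum>n<N. if n = m then 1 / fact m * (\<integral>y. sym_sum m (g m) y * h y \<partial>power_measure L m) else 0)"
    by (intro sum.cong refl) (simp add: inner)
  also have "\<dots> = 1 / fact m * (\<integral>y. sym_sum m (g m) y * h y \<partial>power_measure L m)"
    using m by (simp add: sum.delta)
  finally show ?thesis .
qed

lemma partial_sum_square_integrable:
  assumes "\<And>n. n > 0 \<Longrightarrow> square_integrable (power_measure L n) (g n)"
  shows "square_integrable M (\<lambda>\<omega>. \<Sum>n<N. 1 / fact n * wiener_ito M L \<eta> X n (g n) \<omega>)"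
proof (intro square_integrable_sum square_integrable_scale)
  fix n
  show "square_integrable M (wiener_ito M L \<eta> X n (g n))"
    using wiener_ito_is_version[OF _ assms, of n] wiener_ito_version_square_integrable
    by (cases "n = 0") (auto simp: wiener_ito_0)
qed

lemma partial_sum_mean:
  assumes g: "\<And>n. n > 0 \<Longrightarrow> square_integrable (power_measure L n) (g n)" and N: "0 < N"
  shows "(\<integral>\<omega>. (\<Sum>n<N. 1 / fact n * wiener_ito M L \<eta> X n (g n) \<omega>) \<partial>M) = g 0 (\<lambda>_. undefined)"
proof -
  let ?I = "\<lambda>n. wiener_ito M L \<eta> X n (g n)"
  have Is: "square_integrable M (?I n)" for n
    using wiener_ito_is_version[OF _ g, of n] wiener_ito_version_square_integrable
    by (cases "n = 0") (auto simp: wiener_ito_0)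
  have Ii: "integrable M (?I n)" for n
    using integrable_mult_square[OF Is square_integrable_const[of 1]] by simp
  have mean: "(\<integral>\<omega>. ?I n \<omega> \<partial>M) = (if n = 0 then g 0 (\<lambda>_. undefined) else 0)" for n
    using wiener_ito_version_mean[OF _ wiener_ito_is_version[OF _ g], of n] by (auto simp: wiener_ito_0 prob_space)
  have "(\<integral>\<omega>. (\<Sum>n<N. 1 / fact n * ?I n \<omega>) \<partial>M) = (\<Sum>n<N. 1 / fact n * (\<integral>\<omega>. ?I n \<omega> \<partial>M))"
    by (subst Bochner_Integration.integral_sum) (auto simp: Ii)
  also have "\<dots> = (\<Sum>n<N. if n = 0 then g 0 (\<lambda>_. undefined) else 0)"
    by (intro sum.cong refl) (simp add: mean)
  finally show ?thesis using N by (simp add: sum.delta)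
qed

context
  fixes f :: "'a measure \<Rightarrow> real"
  assumes f: "f \<in> borel_measurable (point_algebra L)" "square_integrable M (\<lambda>\<omega>. f (\<eta> \<omega>))"
begin

lemma f_inner:
  assumes Y: "wiener_ito_version M L \<eta> X m h Y" and m: "0 < m"
  shows "(\<integral>\<omega>. f (\<eta> \<omega>) * Y \<omega> \<partial>M) = (\<integral>y. mean_diff M \<eta> m f y * h y \<partial>power_measure L m)"
  using wiener_ito_version_mean_diff[OF Y f mean_diff_square_integrable(1)[OF m f]] by (simp add: mult.commute)

lemma remainder_orthogonal:
  assumes N: "0 < N" and v: "v \<in> {\<lambda>\<omega>. c + (\<Sum>n\<in>{1..<N}. Y n \<omega>) | c Y. \<forall>n\<in>{1..<N}. \<exists>h. wiener_ito_version M L \<eta> X n h (Y n)}"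
  shows "(\<integral>\<omega>. (f (\<eta> \<omega>) - (\<Sum>n<N. 1 / fact n * wiener_ito M L \<eta> X n (mean_diff M \<eta> n f) \<omega>)) * v \<omega> \<partial>M) = 0"
proof -
  let ?S = "\<lambda>\<omega>. \<Sum>n<N. 1 / fact n * wiener_ito M L \<eta> X n (mean_diff M \<eta> n f) \<omega>"
  have T: "\<And>n. n > 0 \<Longrightarrow> square_integrable (power_measure L n) (mean_diff M \<eta> n f)"
    by (rule mean_diff_square_integrable(1)[OF _ f])
  have S: "square_integrable M ?S" by (rule partial_sum_square_integrable[OF T])
  have R: "square_integrable M (\<lambda>\<omega>. f (\<eta> \<omega>) - ?S \<omega>)" using f(2) S by (rule square_integrable_diff)
  obtain c Y where v: "v = (\<lambda>\<omega>. c + (\<Sum>n\<in>{1..<N}. Y n \<omega>))" and Y: "\<forall>n\<in>{1..<N}. \<exists>h. wiener_ito_version M L \<eta> X n h (Y n)"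
    using v by blast
  have Ys: "square_integrable M (Y n)" if "n \<in> {1..<N}" for n
    using Y that wiener_ito_version_square_integrable(1) by blast
  have zero: "(\<integral>\<omega>. (f (\<eta> \<omega>) - ?S \<omega>) * Y n \<omega> \<partial>M) = 0" if n: "n \<in> {1..<N}" for n
  proof -
    obtain h where h: "wiener_ito_version M L \<eta> X n h (Y n)" using Y n by blast
    have "(\<integral>\<omega>. (f (\<eta> \<omega>) - ?S \<omega>) * Y n \<omega> \<partial>M) = (\<integral>\<omega>. f (\<eta> \<omega>) * Y n \<omega> \<partial>M) - (\<integral>\<omega>. ?S \<omega> * Y n \<omega> \<partial>M)"
      unfolding left_diff_distrib
      by (intro Bochner_Integration.integral_diff integrable_mult_square[OF f(2) Ys[OF n]] integrable_mult_square[OF S Ys[OF n]])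
    also have "(\<integral>\<omega>. ?S \<omega> * Y n \<omega> \<partial>M) = 1 / fact n * (\<integral>y. sym_sum n (mean_diff M \<eta> n f) y * h y \<partial>power_measure L n)"
      using n by (intro partial_sum_inner[OF T h]) auto
    also have "\<dots> = (\<integral>y. mean_diff M \<eta> n f y * h y \<partial>power_measure L n)"
      by (simp add: sym_sum_mean_diff mult.assoc)
    finally show ?thesis using f_inner[OF h] n by simp
  qed
  have fi: "integrable M (\<lambda>\<omega>. f (\<eta> \<omega>))" and Si: "integrable M ?S"
    using integrable_mult_square[OF f(2) square_integrable_const[of 1]] integrable_mult_square[OF S square_integrable_const[of 1]] by auto
  have mean: "(\<integral>\<omega>. f (\<eta> \<omega>) - ?S \<omega> \<partial>M) = 0"
    using partial_sum_mean[OF T N] Bochner_Integration.integral_diff[OF fi Si] by (simp add: mean_diff_def)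
  have "(\<integral>\<omega>. (f (\<eta> \<omega>) - ?S \<omega>) * v \<omega> \<partial>M) = (\<integral>\<omega>. (f (\<eta> \<omega>) - ?S \<omega>) * c + (\<Sum>n\<in>{1..<N}. (f (\<eta> \<omega>) - ?S \<omega>) * Y n \<omega>) \<partial>M)"
    by (simp add: v distrib_left sum_distrib_left)
  also have "\<dots> = (\<integral>\<omega>. (f (\<eta> \<omega>) - ?S \<omega>) * c \<partial>M) + (\<Sum>n\<in>{1..<N}. \<integral>\<omega>. (f (\<eta> \<omega>) - ?S \<omega>) * Y n \<omega> \<partial>M)"
    using integrable_mult_square[OF R Ys] fi Si
    by (subst Bochner_Integration.integral_add)
       (auto intro!: Bochner_Integration.integral_sum Bochner_Integration.integrable_sum integrable_mult_left Bochner_Integration.integrable_diff)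
  also have "\<dots> = 0" using zero mean by simp
  finally show ?thesis .
qed

text \<open>Orthogonality of the remainder makes the partial sum at least as good an approximation
  of \<open>f(\<eta>)\<close> as any chaos sum with orders below \<open>N\<close>, and some chaos
  sum is closer than a given \<open>e\<close>.\<close>

theorem chaos_expansion: "has_chaos_expansion M L \<eta> X f (\<lambda>n. mean_diff M \<eta> n f)"
proof -
  let ?I = "\<lambda>n. wiener_ito M L \<eta> X n (mean_diff M \<eta> n f)"
  let ?S = "\<lambda>N \<omega>. \<Sum>n<N. 1 / fact n * ?I n \<omega>"
  have T: "\<And>n. n > 0 \<Longrightarrow> square_integrable (power_measure L n) (mean_diff M \<eta> n f)"
    by (rule mean_diff_square_integrable(1)[OF _ f])
  have S: "square_integrable M (?S N)" for N by (rule partial_sum_square_integrable[OF T])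
  have "(\<lambda>N. L2_norm M (\<lambda>\<omega>. ?S N \<omega> - f (\<eta> \<omega>))) \<longlonglongrightarrow> 0"
  proof (rule LIMSEQ_I)
    fix e :: real assume "e > 0"
    obtain h where h: "h \<in> chaos_sums" "square_integrable M h" "L2_norm M (\<lambda>\<omega>. h \<omega> - f (\<eta> \<omega>)) < e"
      using L2_closure_approx[OF chaos_dense[OF f] \<open>e > 0\<close>] .
    obtain c K gs where hs: "h = (\<lambda>\<omega>. c + (\<Sum>n\<in>{1..<K}. sum_product_integral L \<eta> X n (gs n) \<omega>))" "\<And>n. sum_product_form L n (gs n)"
      using h(1) unfolding chaos_sums_def by blast
    \<comment> \<open>Beyond \<open>K\<close> all orders of \<open>h\<close> are below
      \<open>N\<close>; the successor also ensures \<open>0 < N\<close>, which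
      \<open>remainder_orthogonal\<close> asks for.\<close>
    have small: "L2_norm M (\<lambda>\<omega>. ?S N \<omega> - f (\<eta> \<omega>)) < e" if N: "N \<ge> Suc K" for N
    proof -
      let ?R = "\<lambda>\<omega>. f (\<eta> \<omega>) - ?S N \<omega>" and ?D = "\<lambda>\<omega>. ?S N \<omega> - h \<omega>"
      have R: "square_integrable M ?R" and D: "square_integrable M ?D"
        using f(2) S h(2) by (auto intro: square_integrable_diff)
      let ?V = "{\<lambda>\<omega>. c + (\<Sum>n\<in>{1..<N}. Y n \<omega>) | c Y. \<forall>n\<in>{1..<N}. \<exists>h. wiener_ito_version M L \<eta> X n h (Y n)}"
      have "h \<in> ?V"
      proof -
        let ?g = "\<lambda>n. if n < K then gs n else []"
        have "(\<Sum>n\<in>{1..<K}. sum_product_integral L \<eta> X n (gs n) \<omega>) = (\<Sum>n\<in>{1..<N}. sum_product_integral L \<eta> X n (?g n) \<omega>)" for \<omega>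
          using N by (intro sum.mono_neutral_cong_left) auto
        then have "h = (\<lambda>\<omega>. c + (\<Sum>n\<in>{1..<N}. sum_product_integral L \<eta> X n (?g n) \<omega>))" by (simp add: hs(1))
        moreover have "\<exists>h. wiener_ito_version M L \<eta> X n h (sum_product_integral L \<eta> X n (?g n))" for n
          using sum_product_integral_is_version[of n "?g n"] hs(2) by auto
        ultimately show ?thesis
          unfolding mem_Collect_eq by (intro exI[of _ c] exI[of _ "\<lambda>n. sum_product_integral L \<eta> X n (?g n)"] conjI ballI)
      qed
      moreover have "?S N \<in> ?V"
      proof -
        \<comment> \<open>The scaled summand is a version of the integral of the scaled kernel;
          scaling the approximating forms is possible because \<open>n > 0\<close>.\<close>
        have "wiener_ito_version M L \<eta> X n (\<lambda>y. 1 / fact n * mean_diff M \<eta> n f y) (\<lambda>\<omega>. 1 / fact n * ?I n \<omega>)" if pos: "n > 0" for n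
        proof -
          obtain gs where gs: "\<And>k. sum_product_form L n (gs k)" "L2_tendsto (power_measure L n) (\<lambda>k. sum_product n (gs k)) (mean_diff M \<eta> n f)"
              "L2_tendsto M (\<lambda>k. sum_product_integral L \<eta> X n (gs k)) (?I n)"
            using wiener_ito_is_version[OF pos T[OF pos]] unfolding wiener_ito_version_def by blast
          have "sum_product n (map (scale_first (1 / fact n)) (gs k)) = (\<lambda>y. 1 / fact n * sum_product n (gs k) y)"
            "sum_product_integral L \<eta> X n (map (scale_first (1 / fact n)) (gs k)) = (\<lambda>\<omega>. 1 / fact n * sum_product_integral L \<eta> X n (gs k) \<omega>)" for k
            using pos by (auto simp: sum_product_scale sum_product_integral_scale)
          then show ?thesis unfolding wiener_ito_version_def
            using L2_tendsto_scale[OF gs(2), of "1 / fact n"] L2_tendsto_scale[OF gs(3), of "1 / fact n"] sum_product_form_scale[OF gs(1)]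
            by (intro exI[of _ "\<lambda>k. map (scale_first (1 / fact n)) (gs k)"]) simp
        qed
        then have "\<exists>h. wiener_ito_version M L \<eta> X n h (\<lambda>\<omega>. 1 / fact n * ?I n \<omega>)" if "n > 0" for n
          using that by blast
        then have "\<forall>n\<in>{1..<N}. \<exists>h. wiener_ito_version M L \<eta> X n h (\<lambda>\<omega>. 1 / fact n * ?I n \<omega>)"
          by simp
        moreover have "?S N = (\<lambda>\<omega>. ?I 0 undefined + (\<Sum>n\<in>{1..<N}. 1 / fact n * ?I n \<omega>))"
        proof
          fix \<omega>
          have "{..<N} = insert 0 {1..<N}" using N by auto
          then show "?S N \<omega> = ?I 0 undefined + (\<Sum>n\<in>{1..<N}. 1 / fact n * ?I n \<omega>)"
            by (simp add: wiener_ito_0)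
        qed
        ultimately show ?thesis
          unfolding mem_Collect_eq by (intro exI[of _ "?I 0 undefined"] exI[of _ "\<lambda>n \<omega>. 1 / fact n * ?I n \<omega>"] conjI)
      qed
      ultimately have "(\<integral>\<omega>. ?R \<omega> * ?S N \<omega> \<partial>M) = 0" "(\<integral>\<omega>. ?R \<omega> * h \<omega> \<partial>M) = 0"
        using remainder_orthogonal[of N] N by auto
      then have orth: "(\<integral>\<omega>. ?R \<omega> * ?D \<omega> \<partial>M) = 0"
        unfolding right_diff_distrib
        using Bochner_Integration.integral_diff[OF integrable_mult_square[OF R S[of N]] integrable_mult_square[OF R h(2)]] by simp
      \<comment> \<open>Pythagoras for the sum of the orthogonal functions \<open>?R\<close> and
        \<open>?D\<close>.\<close>
      have "(L2_norm M (\<lambda>\<omega>. f (\<eta> \<omega>) - h \<omega>))\<^sup>2 = (\<integral>\<omega>. (?R \<omega>)\<^sup>2 + (?D \<omega>)\<^sup>2 + 2 * (?R \<omega> * ?D \<omega>) \<partial>M)"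
        unfolding L2_norm_square by (intro Bochner_Integration.integral_cong refl) (simp add: power2_eq_square algebra_simps)
      also have "\<dots> = (L2_norm M ?R)\<^sup>2 + (L2_norm M ?D)\<^sup>2 + 2 * (\<integral>\<omega>. ?R \<omega> * ?D \<omega> \<partial>M)"
        unfolding L2_norm_square
        using square_integrable_integrable[OF R] square_integrable_integrable[OF D] integrable_mult_square[OF R D]
        by (subst Bochner_Integration.integral_add) (auto intro!: Bochner_Integration.integral_add)
      finally have "(L2_norm M ?R)\<^sup>2 \<le> (L2_norm M (\<lambda>\<omega>. f (\<eta> \<omega>) - h \<omega>))\<^sup>2" unfolding orth by simp
      then have "L2_norm M ?R \<le> L2_norm M (\<lambda>\<omega>. f (\<eta> \<omega>) - h \<omega>)" by (rule power2_le_imp_le) simp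
      then show ?thesis
        using h(3) L2_norm_minus_commute[of M "?S N" "\<lambda>\<omega>. f (\<eta> \<omega>)"] L2_norm_minus_commute[of M h "\<lambda>\<omega>. f (\<eta> \<omega>)"] by linarith
    qed
    show "\<exists>no. \<forall>N\<ge>no. norm (L2_norm M (\<lambda>\<omega>. ?S N \<omega> - f (\<eta> \<omega>)) - 0) < e"
      by (intro exI[of _ "Suc K"] allI impI) (use small in \<open>simp only: diff_zero real_norm_def abs_of_nonneg[OF L2_norm_nonneg]\<close>)
  qed
  then show ?thesis unfolding has_chaos_expansion_def L2_tendsto_iff using S f(2) by blast
qed

text \<open>Tested against a form of order \<open>n\<close>, the partial sums are constant from
  \<open>N = n + 1\<close> on, so their limit can be read off. Comparing with the duality for
  \<open>T_n f\<close>, for all forms, identifies the kernel.\<close>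

theorem chaos_expansion_unique:
  assumes g: "\<And>n. g n \<in> sym_L2 L n" and exp: "has_chaos_expansion M L \<eta> X f g"
  shows "g 0 (\<lambda>_. undefined) = (\<integral>\<omega>. f (\<eta> \<omega>) \<partial>M)"
    "n \<ge> 1 \<Longrightarrow> AE y in power_measure L n. g n y = mean_diff M \<eta> n f y"
proof -
  let ?S = "\<lambda>N \<omega>. \<Sum>n<N. 1 / fact n * wiener_ito M L \<eta> X n (g n) \<omega>"
  have gs: "square_integrable (power_measure L n) (g n)" for n using g[of n] by (simp add: sym_L2_def)
  have lim: "L2_tendsto M ?S (\<lambda>\<omega>. f (\<eta> \<omega>))" using exp by (simp add: has_chaos_expansion_def)
  have "(\<lambda>N. \<integral>\<omega>. ?S N \<omega> * 1 \<partial>M) \<longlonglongrightarrow> (\<integral>\<omega>. f (\<eta> \<omega>) * 1 \<partial>M)"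
    by (rule L2_tendsto_inner[OF lim]) simp
  moreover have "(\<lambda>N. \<integral>\<omega>. ?S N \<omega> * 1 \<partial>M) \<longlonglongrightarrow> g 0 (\<lambda>_. undefined)"
    using partial_sum_mean[OF gs] by (intro tendsto_eventually eventually_sequentiallyI[of 1]) simp
  ultimately show "g 0 (\<lambda>_. undefined) = (\<integral>\<omega>. f (\<eta> \<omega>) \<partial>M)"
    using LIMSEQ_unique by auto
  assume "n \<ge> 1"
  then have n: "n > 0" by simp
  \<comment> \<open>Symmetry is given almost everywhere for each permutation; there are finitely
    many permutations, so one null set suffices.\<close>
  have sym: "AE y in power_measure L n. sym_sum n (g n) y = fact n * g n y"
  proof -
    have "AE y in power_measure L n. \<forall>\<pi>\<in>{\<pi>. \<pi> permutes {..<n}}. g n (y \<circ> \<pi>) = g n y"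
      using g[of n] by (intro AE_finite_allI finite_permutations) (auto simp: sym_L2_def)
    then show ?thesis
      by eventually_elim (simp add: sym_sum_def card_permutations[OF card_lessThan])
  qed
  show "AE y in power_measure L n. g n y = mean_diff M \<eta> n f y"
  proof (rule L2_eqI_forms[OF n gs mean_diff_square_integrable(1)[OF n f]])
    fix hs assume hs: "sum_product_form L n hs"
    note Y = sum_product_integral_is_version[OF hs]
    note Ys = wiener_ito_version_square_integrable[OF Y]
    have "(\<lambda>N. \<integral>\<omega>. ?S N \<omega> * sum_product_integral L \<eta> X n hs \<omega> \<partial>M) \<longlonglongrightarrow> (\<integral>\<omega>. f (\<eta> \<omega>) * sum_product_integral L \<eta> X n hs \<omega> \<partial>M)"
      by (rule L2_tendsto_inner[OF lim Ys(1)])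
    moreover have "(\<lambda>N. \<integral>\<omega>. ?S N \<omega> * sum_product_integral L \<eta> X n hs \<omega> \<partial>M) \<longlonglongrightarrow>
        1 / fact n * (\<integral>y. sym_sum n (g n) y * sum_product n hs y \<partial>power_measure L n)"
      using partial_sum_inner[OF gs Y n] by (intro tendsto_eventually eventually_sequentiallyI[of "Suc n"]) simp
    ultimately have "(\<integral>\<omega>. f (\<eta> \<omega>) * sum_product_integral L \<eta> X n hs \<omega> \<partial>M) =
        1 / fact n * (\<integral>y. sym_sum n (g n) y * sum_product n hs y \<partial>power_measure L n)"
      by (rule LIMSEQ_unique)
    also have "(\<integral>y. sym_sum n (g n) y * sum_product n hs y \<partial>power_measure L n) = (\<integral>y. fact n * (g n y * sum_product n hs y) \<partial>power_measure L n)"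
    proof (rule integral_cong_AE)
      show "AE y in power_measure L n. sym_sum n (g n) y * sum_product n hs y = fact n * (g n y * sum_product n hs y)"
        using sym by eventually_elim simp
    qed (use L.sym_sum_square_integrable[OF gs[of n]] gs[of n] Ys(2) in \<open>auto simp: square_integrable_def\<close>)
    finally have "(\<integral>\<omega>. f (\<eta> \<omega>) * sum_product_integral L \<eta> X n hs \<omega> \<partial>M) = (\<integral>y. g n y * sum_product n hs y \<partial>power_measure L n)"
      by simp
    then show "(\<integral>y. sum_product n hs y * g n y \<partial>power_measure L n) = (\<integral>y. sum_product n hs y * mean_diff M \<eta> n f y \<partial>power_measure L n)"
      using f_inner[OF Y n] by (simp add: mult.commute)
  qed
qed

end

end

theorem theorem1p3:
  fixes M :: "'w measure" and L :: "'a measure"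
    and \<eta> :: "'w \<Rightarrow> 'a measure" and X :: "nat \<Rightarrow> 'w \<Rightarrow> 'a"
    and f :: "'a measure \<Rightarrow> real"
  assumes "prob_space M"
    and "sigma_finite_measure L"
    and "poisson_process M L \<eta>"
    and "\<And>i. X i \<in> M \<rightarrow>\<^sub>M L"
    and "\<And>\<omega>. \<omega> \<in> space M \<Longrightarrow> \<eta> \<omega> = point_sum L (emeasure (\<eta> \<omega>) (space L)) (\<lambda>i. X i \<omega>)"
    and "square_integrable (distr M (point_algebra L) \<eta>) f"
  shows "(\<forall>n\<ge>1. (AE y in power_measure L n. integrable M (\<lambda>\<omega>. iter_diff n f y (\<eta> \<omega>))) \<and>
            square_integrable (power_measure L n) (mean_diff M \<eta> n f))
       \<and> has_chaos_expansion M L \<eta> X f (\<lambda>n. mean_diff M \<eta> n f)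
       \<and> (\<forall>g. (\<forall>n. g n \<in> sym_L2 L n) \<and> has_chaos_expansion M L \<eta> X f g \<longrightarrow>
            g 0 (\<lambda>_. undefined) = (\<integral>\<omega>. f (\<eta> \<omega>) \<partial>M) \<and>
            (\<forall>n\<ge>1. AE y in power_measure L n. g n y = mean_diff M \<eta> n f y))"
proof -
  interpret M: prob_space M by fact
  interpret L: sigma_finite_measure L by fact
  interpret poisson_points M L \<eta> X
    by (unfold_locales) (use assms in auto)
  \<comment> \<open>Square integrability under the law of \<open>\<eta>\<close> is square
    integrability of \<open>f(\<eta>)\<close> under \<open>M\<close>, together with measurability of
    \<open>f\<close> on all configurations, which the difference operators rely on.\<close>
  have f: "f \<in> borel_measurable (point_algebra L)" "square_integrable M (\<lambda>\<omega>. f (\<eta> \<omega>))"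
    using assms(6) by (simp_all add: square_integrable_distr)
  show ?thesis
    using mean_diff_square_integrable[OF _ f] chaos_expansion[OF f] chaos_expansion_unique[OF f] by auto
qed

end
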